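(* Let $R$ be a commutative ring, $q$ a unit in $R$, and regard $\mathrm{Hec}(n)_{R,q}$ as a cellular algebra via a regular cell datum. Let $X$ be a Young permutation module for $\mathrm{Hec}(n)_{R,q}$ and put $\sigma=\zeta(X)$. If $\hat\sigma$ is co-saturated then $\mathrm{Ann}_{\mathrm{Hec}(n)_{R,q}}(X)$ is the cell ideal $\mathrm{Hec}(n)_{R,q}(\tau)$, where $\tau$ is the complement of $\hat\sigma$ in $\mathrm{Par}(n)$.
   Context: Hecke algebra: $\mathrm{Hec}(n)_{R,q}$ has generators $T_1,\dots,T_{n-1}$ with the braid relations and $(T_i-q)(T_i+1)=0$, and $R$-basis $T_w$, $w\in\mathrm{Sym}(n)$. Modules are left modules. It has the $R$-linear anti-automorphism ${}^*$ with $T_i^*=T_i$ and the automorphism ${}^\sharp$ with $T_i^\sharp=-T_i+(q-1)1$. $\mathrm{Par}(n)$ is the set of partitions of $n$ with the dominance order. For $\lambda\in\mathrm{Par}(n)$ put $x(\lambda)=\sum_{w\in\mathrm{Sym}(\lambda)}T_w$, with $\mathrm{Sym}(\lambda)$ the Young subgroup, and $M(\lambda)_{R,q}=\mathrm{Hec}(n)_{R,q}x(\lambda)$. A Young permutation module is a module $X=\bigoplus_\lambda M(\lambda)_{R,q}^{(d_\lambda)}$ ($d_\lambda$ copies of $M(\lambda)_{R,q}$); the $d_\lambda$ are determined by $X$ (take $R \ne 0$), and $\zeta(X)=\{\lambda:d_\lambda\ne0\}$. A partition $\mu$ is a coarsening of $\lambda$ if the multiset of parts of $\lambda$ can be partitioned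 into multisets whose sums are the parts of $\mu$; $\hat\sigma$ is the set of all coarsenings of elements of $\sigma$. A subset is co-saturated if it contains every $\lambda\in\mathrm{Par}(n)$ dominating one of its members, and saturated if it contains every $\lambda$ dominated by one of its members. Cell data (Graham–Lehrer): a cell datum $(\Lambda,N,C,{}^* )$ for an $R$-algebra $A$ consists of a finite poset $\Lambda$, finite sets $N(\lambda)$, an injective map $C:\coprod_\lambda N(\lambda)\times N(\lambda)\to A$, $(u,v)\mapsto C^\lambda_{u,v}$, whose image is an $R$-basis, and an $R$-linear involutory anti-automorphism ${}^*$ with $(C^\lambda_{u,v})^*=C^\lambda_{v,u}$, such that for $a\in A$, $aC^\lambda_{u,v}\equiv\sum_{u'}r_a(u',u)C^\lambda_{u',v}$ modulo the span of the $C^\mu_{u'',v''}$ with $\mu<\lambda$, where $r_a(u',u)\in R$ is independent of $v$. The cell module $W(\lambda)$ is $R$-free on symbols $C_u$, $u\in N(\lambda)$, with $aC_u=\sum_{u'}r_a(u',u)C_{u'}$. For $\tau\subseteq\Lambda$, $A(\tau)$ is the $R$-span of all $C^\lambda_{u,v}$ with $\lambda\in\tau$; if $\tau$ is saturated this is an ideal, the cell ideal of $\tau$. A cell datum yields by base change $R\to\bar R$ a cell datum for $\bar R\otimes_RA$. Regular cell data: let $J=\mathbb Z[x,x^{-1}]$. A cell datum for $\mathrm{Hec}(n)_{J,x}$ is regular if $\Lambda=\mathrm{Par}(n)$ with the dominance order and $W(\lambda)\cong\mathrm{Sp}(\lambda)_{J,x}$ for all $\lambda$. A cell datum for $\mathrm{Hec}(n)_{R,q}$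 is regular if it is obtained by base change ($x\mapsto q$) from a regular cell datum for $\mathrm{Hec}(n)_{J,x}$. Here the Specht module $\mathrm{Sp}(\lambda)$ is the dual $\mathrm{Hom}(\tilde W(\lambda),J)$ (with action $(a\alpha)(v)=\alpha(a^*v)$) of Murphy's cell module $\tilde W(\lambda)$: for standard $\lambda$-tableaux $s,t$ set $x_{st}=T_{d(s)}x(\lambda)T_{d(t)}^*$, where $d(s)\in\mathrm{Sym}(n)$ satisfies $s=d(s)\circ t^\lambda$ and $t^\lambda$ has entries $1,2,\dots,n$ in order along successive rows; the $x_{st}$ over all $\lambda$ form a basis, and $\tilde W(\lambda)$ is the span of the images of $x_{ut}$ ($t$ fixed, $u$ varying over standard $\lambda$-tableaux) modulo the span of the $x_{uv}$ with $u,v$ of shape strictly dominating $\lambda$. One regular cell datum is given by $N(\lambda)=$ the set of standard $\lambda'$-tableaux ($\lambda'$ the transpose partition), $C^\lambda_{s,t}=x_{st}^\sharp$. *)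

theory Defs
  imports
    "HOL-Library.Multiset"
    "HOL-Library.FuncSet"
    "HOL-Library.Poly_Mapping"
    "HOL-Combinatorics.Permutations"
    "HOL-Algebra.QuotRing"
    "HOL-Algebra.Module"
begin

section \<open>Algebras over a commutative ring and their left modules\<close>

text \<open>
  An algebra over a commutative ring given by a type \<open>'r :: comm_ring_1\<close> is a
  record of type \<open>('r, 'a) module\<close>, which has both the ring operations and the scalar
  multiplication.  A left module over such an algebra (or over any ring) with carrier type \<open>'a\<close>
  is a record of type \<open>('a, 'm) module\<close>, of which only \<open>carrier\<close>, \<open>zero\<close>, \<open>add\<close> and \<open>smult\<close>
  matter.  (The locale \<open>module\<close> of the library requires commutative scalars.)
\<close>

locale left_module = A: ring A + M: abelian_group M
  for A :: "('a, 'b) ring_scheme" and M :: "('a, 'm) module" +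
  assumes smult_closed:
      "\<lbrakk>a \<in> carrier A; x \<in> carrier M\<rbrakk> \<Longrightarrow> a \<odot>\<^bsub>M\<^esub> x \<in> carrier M"
    and smult_add_left:
      "\<lbrakk>a \<in> carrier A; b \<in> carrier A; x \<in> carrier M\<rbrakk>
        \<Longrightarrow> (a \<oplus>\<^bsub>A\<^esub> b) \<odot>\<^bsub>M\<^esub> x = (a \<odot>\<^bsub>M\<^esub> x) \<oplus>\<^bsub>M\<^esub> (b \<odot>\<^bsub>M\<^esub> x)"
    and smult_add_right:
      "\<lbrakk>a \<in> carrier A; x \<in> carrier M; y \<in> carrier M\<rbrakk>
        \<Longrightarrow> a \<odot>\<^bsub>M\<^esub> (x \<oplus>\<^bsub>M\<^esub> y) = (a \<odot>\<^bsub>M\<^esub> x) \<oplus>\<^bsub>M\<^esub> (a \<odot>\<^bsub>M\<^esub> y)"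
    and smult_mult:
      "\<lbrakk>a \<in> carrier A; b \<in> carrier A; x \<in> carrier M\<rbrakk>
        \<Longrightarrow> (a \<otimes>\<^bsub>A\<^esub> b) \<odot>\<^bsub>M\<^esub> x = a \<odot>\<^bsub>M\<^esub> (b \<odot>\<^bsub>M\<^esub> x)"
    and smult_one: "x \<in> carrier M \<Longrightarrow> \<one>\<^bsub>A\<^esub> \<odot>\<^bsub>M\<^esub> x = x"

definition mk_module ::
  "'m set \<Rightarrow> 'm \<Rightarrow> ('m \<Rightarrow> 'm \<Rightarrow> 'm) \<Rightarrow> ('a \<Rightarrow> 'm \<Rightarrow> 'm) \<Rightarrow> ('a, 'm) module" where
  "mk_module S z ad sm =
     \<lparr>carrier = S, mult = undefined, one = undefined, zero = z, add = ad, smult = sm\<rparr>"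

definition module_iso ::
  "('a, 'b) ring_scheme \<Rightarrow> ('a, 'm) module \<Rightarrow> ('a, 'k) module \<Rightarrow> bool" where
  "module_iso A M M' \<longleftrightarrow>
     (\<exists>f. bij_betw f (carrier M) (carrier M') \<and>
          (\<forall>x\<in>carrier M. \<forall>y\<in>carrier M. f (x \<oplus>\<^bsub>M\<^esub> y) = f x \<oplus>\<^bsub>M'\<^esub> f y) \<and>
          (\<forall>a\<in>carrier A. \<forall>x\<in>carrier M. f (a \<odot>\<^bsub>M\<^esub> x) = a \<odot>\<^bsub>M'\<^esub> f x))"

definition annihilator :: "('a, 'b) ring_scheme \<Rightarrow> ('a, 'm) module \<Rightarrow> 'a set" where
  "annihilator A M = {a \<in> carrier A. \<forall>x\<in>carrier M. a \<odot>\<^bsub>M\<^esub> x = \<zero>\<^bsub>M\<^esub>}"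

definition left_ideal_module :: "('a, 'b) ring_scheme \<Rightarrow> 'a \<Rightarrow> ('a, 'a) module" where
  "left_ideal_module A x =
     mk_module ((\<lambda>a. a \<otimes>\<^bsub>A\<^esub> x) ` carrier A) \<zero>\<^bsub>A\<^esub> (add A) (mult A)"

definition direct_sum_module :: "'i set \<Rightarrow> ('i \<Rightarrow> ('a, 'm) module) \<Rightarrow> ('a, 'i \<Rightarrow> 'm) module" where
  "direct_sum_module I M = mk_module
     {f \<in> (\<Pi>\<^sub>E i\<in>I. carrier (M i)). finite {i \<in> I. f i \<noteq> \<zero>\<^bsub>M i\<^esub>}}
     (\<lambda>i\<in>I. \<zero>\<^bsub>M i\<^esub>)
     (\<lambda>f g. \<lambda>i\<in>I. f i \<oplus>\<^bsub>M i\<^esub> g i)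
     (\<lambda>a f. \<lambda>i\<in>I. a \<odot>\<^bsub>M i\<^esub> f i)"

definition lin_span :: "('r::comm_ring_1, 'a) module \<Rightarrow> 'a set \<Rightarrow> 'a set" where
  "lin_span A S = {(\<Oplus>\<^bsub>A\<^esub> b\<in>F. c b \<odot>\<^bsub>A\<^esub> b) | F c. finite F \<and> F \<subseteq> S}"

definition is_basis :: "('r::comm_ring_1, 'a) module \<Rightarrow> 'a set \<Rightarrow> bool" where
  "is_basis A S \<longleftrightarrow> S \<subseteq> carrier A \<and> lin_span A S = carrier A \<and>
     (\<forall>F c. finite F \<and> F \<subseteq> S \<and> (\<Oplus>\<^bsub>A\<^esub> b\<in>F. c b \<odot>\<^bsub>A\<^esub> b) = \<zero>\<^bsub>A\<^esub> \<longrightarrow> (\<forall>b\<in>F. c b = 0))"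

definition is_linear_endo :: "('r::comm_ring_1, 'a) module \<Rightarrow> ('a \<Rightarrow> 'a) \<Rightarrow> bool" where
  "is_linear_endo A f \<longleftrightarrow> f \<in> carrier A \<rightarrow> carrier A \<and>
     (\<forall>a\<in>carrier A. \<forall>b\<in>carrier A. f (a \<oplus>\<^bsub>A\<^esub> b) = f a \<oplus>\<^bsub>A\<^esub> f b) \<and>
     (\<forall>r. \<forall>a\<in>carrier A. f (r \<odot>\<^bsub>A\<^esub> a) = r \<odot>\<^bsub>A\<^esub> f a)"

definition is_involutory_antiaut :: "('r::comm_ring_1, 'a) module \<Rightarrow> ('a \<Rightarrow> 'a) \<Rightarrow> bool" where
  "is_involutory_antiaut A st \<longleftrightarrow> is_linear_endo A st \<and> st \<one>\<^bsub>A\<^esub> = \<one>\<^bsub>A\<^esub> \<and>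
     (\<forall>a\<in>carrier A. \<forall>b\<in>carrier A. st (a \<otimes>\<^bsub>A\<^esub> b) = st b \<otimes>\<^bsub>A\<^esub> st a) \<and>
     (\<forall>a\<in>carrier A. st (st a) = a)"

text \<open>
  The linear dual of a left module, made into a left module through an anti-automorphism \<open>st\<close>.
  A scalar \<open>r\<close> acts on a left module over an algebra \<open>A\<close> as the element \<open>r \<odot> \<one>\<close> of \<open>A\<close>.
\<close>

definition dual_module ::
  "('r::comm_ring_1, 'a) module \<Rightarrow> ('a \<Rightarrow> 'a) \<Rightarrow> ('a, 'm) module \<Rightarrow> ('a, 'm \<Rightarrow> 'r) module" where
  "dual_module A st M = mk_module
     {\<alpha> \<in> extensional (carrier M).
        (\<forall>x\<in>carrier M. \<forall>y\<in>carrier M. \<alpha> (x \<oplus>\<^bsub>M\<^esub> y) = \<alpha> x + \<alpha> y) \<and>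
        (\<forall>r. \<forall>x\<in>carrier M. \<alpha> ((r \<odot>\<^bsub>A\<^esub> \<one>\<^bsub>A\<^esub>) \<odot>\<^bsub>M\<^esub> x) = r * \<alpha> x)}
     (\<lambda>v\<in>carrier M. 0)
     (\<lambda>\<alpha> \<beta>. \<lambda>v\<in>carrier M. \<alpha> v + \<beta> v)
     (\<lambda>a \<alpha>. \<lambda>v\<in>carrier M. \<alpha> (st a \<odot>\<^bsub>M\<^esub> v))"


section \<open>Cell data\<close>

definition cell_span ::
  "('r::comm_ring_1, 'a) module \<Rightarrow> ('l \<Rightarrow> 'i set) \<Rightarrow> ('l \<Rightarrow> 'i \<Rightarrow> 'i \<Rightarrow> 'a) \<Rightarrow> 'l set \<Rightarrow> 'a set" where
  "cell_span A N C \<tau> = lin_span A {C l u v | l u v. l \<in> \<tau> \<and> u \<in> N l \<and> v \<in> N l}"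

definition is_cell_action ::
  "('r::comm_ring_1, 'a) module \<Rightarrow> 'l set \<Rightarrow> ('l \<Rightarrow> 'l \<Rightarrow> bool) \<Rightarrow> ('l \<Rightarrow> 'i set) \<Rightarrow>
   ('l \<Rightarrow> 'i \<Rightarrow> 'i \<Rightarrow> 'a) \<Rightarrow> 'l \<Rightarrow> 'a \<Rightarrow> ('i \<Rightarrow> 'i \<Rightarrow> 'r) \<Rightarrow> bool" where
  "is_cell_action A \<Lambda> leq N C l a r \<longleftrightarrow>
     (\<forall>u\<in>N l. \<forall>v\<in>N l.
        (a \<otimes>\<^bsub>A\<^esub> C l u v) \<ominus>\<^bsub>A\<^esub> (\<Oplus>\<^bsub>A\<^esub> u'\<in>N l. r u' u \<odot>\<^bsub>A\<^esub> C l u' v)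
          \<in> cell_span A N C {m \<in> \<Lambda>. leq m l \<and> m \<noteq> l})"

definition cell_datum ::
  "('r::comm_ring_1, 'a) module \<Rightarrow> 'l set \<Rightarrow> ('l \<Rightarrow> 'l \<Rightarrow> bool) \<Rightarrow> ('l \<Rightarrow> 'i set) \<Rightarrow>
   ('l \<Rightarrow> 'i \<Rightarrow> 'i \<Rightarrow> 'a) \<Rightarrow> ('a \<Rightarrow> 'a) \<Rightarrow> bool" where
  "cell_datum A \<Lambda> leq N C st \<longleftrightarrow>
     finite \<Lambda> \<and> reflp_on \<Lambda> leq \<and> transp_on \<Lambda> leq \<and> antisymp_on \<Lambda> leq \<and>
     (\<forall>l\<in>\<Lambda>. finite (N l)) \<and>
     inj_on (\<lambda>(l, u, v). C l u v) (SIGMA l:\<Lambda>. N l \<times> N l) \<and>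
     is_basis A ((\<lambda>(l, u, v). C l u v) ` (SIGMA l:\<Lambda>. N l \<times> N l)) \<and>
     is_involutory_antiaut A st \<and>
     (\<forall>l\<in>\<Lambda>. \<forall>u\<in>N l. \<forall>v\<in>N l. st (C l u v) = C l v u) \<and>
     (\<forall>a\<in>carrier A. \<forall>l\<in>\<Lambda>. \<exists>r. is_cell_action A \<Lambda> leq N C l a r)"

text \<open>
  For a cell datum, \<open>r u' u\<close> is uniquely determined for \<open>u\<close>, \<open>u'\<close> in \<open>N l\<close>, so that the choice
  below is immaterial.  The element of the cell module with coefficient \<open>f u\<close> at the basis symbol
  \<open>C\<^sub>u\<close> is the function \<open>f\<close>, extensional on \<open>N l\<close>.
\<close>

definition cell_module ::
  "('r::comm_ring_1, 'a) module \<Rightarrow> 'l set \<Rightarrow> ('l \<Rightarrow> 'l \<Rightarrow> bool) \<Rightarrow> ('l \<Rightarrow> 'i set) \<Rightarrow>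
   ('l \<Rightarrow> 'i \<Rightarrow> 'i \<Rightarrow> 'a) \<Rightarrow> 'l \<Rightarrow> ('a, 'i \<Rightarrow> 'r) module" where
  "cell_module A \<Lambda> leq N C l = mk_module
     (extensional (N l))
     (\<lambda>u\<in>N l. 0)
     (\<lambda>f g. \<lambda>u\<in>N l. f u + g u)
     (\<lambda>a f. \<lambda>u'\<in>N l. \<Sum>u\<in>N l. (SOME r. is_cell_action A \<Lambda> leq N C l a r) u' u * f u)"


section \<open>Partitions and tableaux\<close>

text \<open>A partition is the list of its parts in decreasing order.\<close>

definition Par :: "nat \<Rightarrow> nat list set" where
  "Par n = {la. sorted_wrt (\<ge>) la \<and> (\<forall>p\<in>set la. 0 < p) \<and> sum_list la = n}"

definition dominated_by :: "nat list \<Rightarrow> nat list \<Rightarrow> bool" where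
  "dominated_by la mu \<longleftrightarrow> (\<forall>k. sum_list (take k la) \<le> sum_list (take k mu))"

definition co_saturated :: "nat \<Rightarrow> nat list set \<Rightarrow> bool" where
  "co_saturated n \<sigma> \<longleftrightarrow> (\<forall>la\<in>\<sigma>. \<forall>mu\<in>Par n. dominated_by la mu \<longrightarrow> mu \<in> \<sigma>)"

definition is_coarsening :: "nat list \<Rightarrow> nat list \<Rightarrow> bool" where
  "is_coarsening mu la \<longleftrightarrow>
     (\<exists>P :: nat multiset multiset. sum_mset P = mset la \<and> image_mset sum_mset P = mset mu)"

definition coarsenings :: "nat \<Rightarrow> nat list set \<Rightarrow> nat list set" where
  "coarsenings n \<sigma> = {mu \<in> Par n. \<exists>la\<in>\<sigma>. is_coarsening mu la}"

text \<open>
  Boxes are numbered from 0.  A tableau is a filling of the boxes, extensional on the set of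
  boxes; \<open>initial_tableau la\<close> has the entries 1, 2, 3, ... in order along successive rows.
\<close>

definition boxes :: "nat list \<Rightarrow> (nat \<times> nat) set" where
  "boxes la = {(i, j). i < length la \<and> j < la ! i}"

definition initial_tableau :: "nat list \<Rightarrow> nat \<times> nat \<Rightarrow> nat" where
  "initial_tableau la = (\<lambda>(i, j)\<in>boxes la. sum_list (take i la) + j + 1)"

definition standard_tableaux :: "nat list \<Rightarrow> (nat \<times> nat \<Rightarrow> nat) set" where
  "standard_tableaux la = {t \<in> extensional (boxes la).
     bij_betw t (boxes la) {1..sum_list la} \<and>
     (\<forall>i j k. (i, j) \<in> boxes la \<and> (i, k) \<in> boxes la \<and> j < k \<longrightarrow> t (i, j) < t (i, k)) \<and>
     (\<forall>i j k. (i, k) \<in> boxes la \<and> (j, k) \<in> boxes la \<and> i < j \<longrightarrow> t (i, k) < t (j, k))}"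

definition tableau_perm :: "nat list \<Rightarrow> (nat \<times> nat \<Rightarrow> nat) \<Rightarrow> nat \<Rightarrow> nat" where
  "tableau_perm la s = (THE w. w permutes {1..sum_list la} \<and>
     (\<forall>b\<in>boxes la. s b = w (initial_tableau la b)))"

definition young_subgroup :: "nat list \<Rightarrow> (nat \<Rightarrow> nat) set" where
  "young_subgroup la = {w. w permutes {1..sum_list la} \<and>
     (\<forall>i<length la. let row = {sum_list (take i la) + 1..sum_list (take (Suc i) la)}
                     in w ` row \<subseteq> row)}"


section \<open>The Hecke algebra\<close>

text \<open>
  The free algebra on generators \<open>g\<^sub>i\<close>, \<open>1 \<le> i < n\<close>, is the algebra of the free monoid of words
  in the letters \<open>1, ..., n - 1\<close>.  Words form an additive monoid under concatenation, because the
  product on \<open>_ \<Rightarrow>\<^sub>0 _\<close> is convolution with respect to addition of exponents.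
\<close>

datatype fword = Word (letters: "nat list")

instantiation fword :: monoid_add
begin

definition zero_fword :: fword where "0 = Word []"

definition plus_fword :: "fword \<Rightarrow> fword \<Rightarrow> fword" where
  "u + v = Word (letters u @ letters v)"

instance
  by standard (simp_all add: zero_fword_def plus_fword_def)

end

type_synonym 'r hecke = "(fword \<Rightarrow>\<^sub>0 'r) set"

definition free_alg :: "nat \<Rightarrow> (fword \<Rightarrow>\<^sub>0 'r::comm_ring_1) ring" where
  "free_alg n = \<lparr>carrier = {f. \<forall>w\<in>Poly_Mapping.keys f. set (letters w) \<subseteq> {1..<n}},
                 mult = (*), one = 1, zero = 0, add = (+)\<rparr>"

definition free_gen :: "nat \<Rightarrow> (fword \<Rightarrow>\<^sub>0 'r::comm_ring_1)" where
  "free_gen i = Poly_Mapping.single (Word [i]) 1"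

definition free_const :: "'r::comm_ring_1 \<Rightarrow> (fword \<Rightarrow>\<^sub>0 'r)" where
  "free_const r = Poly_Mapping.single 0 r"

definition hecke_relators :: "nat \<Rightarrow> 'r::comm_ring_1 \<Rightarrow> (fword \<Rightarrow>\<^sub>0 'r) set" where
  "hecke_relators n q =
     {(free_gen i - free_const q) * (free_gen i + 1) | i. i \<in> {1..<n}} \<union>
     {free_gen i * free_gen (Suc i) * free_gen i - free_gen (Suc i) * free_gen i * free_gen (Suc i)
        | i. i \<in> {1..<n} \<and> Suc i \<in> {1..<n}} \<union>
     {free_gen i * free_gen j - free_gen j * free_gen i
        | i j. i \<in> {1..<n} \<and> j \<in> {1..<n} \<and> Suc i < j}"

definition hecke_ideal :: "nat \<Rightarrow> 'r::comm_ring_1 \<Rightarrow> (fword \<Rightarrow>\<^sub>0 'r) set" where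
  "hecke_ideal n q = Idl\<^bsub>free_alg n\<^esub> (hecke_relators n q)"

definition hecke_class :: "nat \<Rightarrow> 'r::comm_ring_1 \<Rightarrow> (fword \<Rightarrow>\<^sub>0 'r) \<Rightarrow> 'r hecke" where
  "hecke_class n q f = hecke_ideal n q +>\<^bsub>free_alg n\<^esub> f"

definition Hec :: "nat \<Rightarrow> 'r::comm_ring_1 \<Rightarrow> ('r, 'r hecke) module" where
  "Hec n q = (let Q = free_alg n Quot hecke_ideal n q in
     \<lparr>carrier = carrier Q, mult = mult Q, one = one Q, zero = zero Q, add = add Q,
      smult = (\<lambda>r a. hecke_class n q (free_const r) \<otimes>\<^bsub>Q\<^esub> a)\<rparr>)"

definition simple_product :: "nat list \<Rightarrow> nat \<Rightarrow> nat" where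
  "simple_product is = foldr (\<lambda>i w. transpose i (Suc i) \<circ> w) is id"

definition reduced_word :: "nat \<Rightarrow> (nat \<Rightarrow> nat) \<Rightarrow> nat list" where
  "reduced_word n w = (ARG_MIN length is. set is \<subseteq> {1..<n} \<and> simple_product is = w)"

text \<open>\<open>T\<^sub>w\<close> does not depend on the reduced word chosen for \<open>w\<close>, by the braid relations.\<close>

definition hecke_T :: "nat \<Rightarrow> 'r::comm_ring_1 \<Rightarrow> (nat \<Rightarrow> nat) \<Rightarrow> 'r hecke" where
  "hecke_T n q w = hecke_class n q (Poly_Mapping.single (Word (reduced_word n w)) 1)"

text \<open>
  The anti-automorphism with \<open>T\<^sub>i\<^sup>* = T\<^sub>i\<close> is induced by the reversal of words, which maps
  the ideal of relations onto itself and hence cosets onto cosets.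
\<close>

definition hecke_star :: "'r::comm_ring_1 hecke \<Rightarrow> 'r hecke" where
  "hecke_star a = Poly_Mapping.map_key (\<lambda>w. Word (rev (letters w))) ` a"

text \<open>
  The map of Hecke algebras induced by a ring homomorphism \<open>\<phi>\<close> of the coefficients, where \<open>q\<close> is
  the image under \<open>\<phi>\<close> of the parameter of the source.
\<close>

definition hecke_map ::
  "nat \<Rightarrow> 's::comm_ring_1 \<Rightarrow> ('r::comm_ring_1 \<Rightarrow> 's) \<Rightarrow> 'r hecke \<Rightarrow> 's hecke" where
  "hecke_map n q \<phi> a = (\<Union>f\<in>a. hecke_class n q (Poly_Mapping.map \<phi> f))"

definition young_sum :: "nat \<Rightarrow> 'r::comm_ring_1 \<Rightarrow> nat list \<Rightarrow> 'r hecke" where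
  "young_sum n q la = (\<Oplus>\<^bsub>Hec n q\<^esub> w\<in>young_subgroup la. hecke_T n q w)"

definition perm_module ::
  "nat \<Rightarrow> 'r::comm_ring_1 \<Rightarrow> nat list \<Rightarrow> ('r hecke, 'r hecke) module" where
  "perm_module n q la = left_ideal_module (Hec n q) (young_sum n q la)"

text \<open>
  \<open>X\<close> is isomorphic to the direct sum of \<open>d la\<close> copies of \<open>M(la)\<close>, for \<open>la\<close> in \<open>Par n\<close>.
\<close>

definition young_permutation_module ::
  "nat \<Rightarrow> 'r::comm_ring_1 \<Rightarrow> (nat list \<Rightarrow> nat) \<Rightarrow> ('r hecke, 'm) module \<Rightarrow> bool" where
  "young_permutation_module n q d X \<longleftrightarrow> left_module (Hec n q) X \<and>
     module_iso (Hec n q) X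
       (direct_sum_module (SIGMA la:Par n. {..<d la}) (\<lambda>(la, k). perm_module n q la))"

definition zeta :: "nat \<Rightarrow> (nat list \<Rightarrow> nat) \<Rightarrow> nat list set" where
  "zeta n d = {la \<in> Par n. d la \<noteq> 0}"


section \<open>Specht modules\<close>

definition murphy ::
  "nat \<Rightarrow> 'r::comm_ring_1 \<Rightarrow> nat list \<Rightarrow> (nat \<times> nat \<Rightarrow> nat) \<Rightarrow> (nat \<times> nat \<Rightarrow> nat) \<Rightarrow> 'r hecke"
where
  "murphy n q la s t =
     hecke_T n q (tableau_perm la s) \<otimes>\<^bsub>Hec n q\<^esub> young_sum n q la
       \<otimes>\<^bsub>Hec n q\<^esub> hecke_star (hecke_T n q (tableau_perm la t))"

definition murphy_above :: "nat \<Rightarrow> 'r::comm_ring_1 \<Rightarrow> nat list \<Rightarrow> 'r hecke set" where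
  "murphy_above n q la = lin_span (Hec n q)
     {murphy n q mu u v | mu u v. mu \<in> Par n \<and> dominated_by la mu \<and> mu \<noteq> la \<and>
        u \<in> standard_tableaux mu \<and> v \<in> standard_tableaux mu}"

text \<open>
  The fixed second tableau is taken to be \<open>initial_tableau la\<close>.
\<close>

definition murphy_cell_module ::
  "nat \<Rightarrow> 'r::comm_ring_1 \<Rightarrow> nat list \<Rightarrow> ('r hecke, 'r hecke set) module" where
  "murphy_cell_module n q la = (let A = Hec n q; B = murphy_above n q la in mk_module
     ((\<lambda>y. B +>\<^bsub>A\<^esub> y) `
        lin_span A {murphy n q la u (initial_tableau la) | u. u \<in> standard_tableaux la})
     B
     (set_add A)
     (\<lambda>a V. \<Union>y\<in>V. B +>\<^bsub>A\<^esub> (a \<otimes>\<^bsub>A\<^esub> y)))"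

definition specht_module ::
  "nat \<Rightarrow> 'r::comm_ring_1 \<Rightarrow> nat list \<Rightarrow> ('r hecke, 'r hecke set \<Rightarrow> 'r) module" where
  "specht_module n q la = dual_module (Hec n q) hecke_star (murphy_cell_module n q la)"


section \<open>Regular cell data\<close>

text \<open>
  The ring of Laurent polynomials over the integers is the group ring of the integers; the
  variable is the group element 1.
\<close>

type_synonym laurent = "int \<Rightarrow>\<^sub>0 int"

definition laurent_x :: laurent where
  "laurent_x = Poly_Mapping.single 1 1"

text \<open>For a unit \<open>q\<close> this is the unique ring homomorphism that maps \<open>laurent_x\<close> to \<open>q\<close>.\<close>

definition unit_power :: "'r::comm_ring_1 \<Rightarrow> int \<Rightarrow> 'r" where
  "unit_power q k = (if 0 \<le> k then q ^ nat k else (THE r. q * r = 1) ^ nat (- k))"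

definition laurent_eval :: "'r::comm_ring_1 \<Rightarrow> laurent \<Rightarrow> 'r" where
  "laurent_eval q f =
     (\<Sum>k\<in>Poly_Mapping.keys f. of_int (Poly_Mapping.lookup f k) * unit_power q k)"

definition regular_cell_datum_generic ::
  "nat \<Rightarrow> (nat list \<Rightarrow> 'i set) \<Rightarrow> (nat list \<Rightarrow> 'i \<Rightarrow> 'i \<Rightarrow> laurent hecke) \<Rightarrow>
   (laurent hecke \<Rightarrow> laurent hecke) \<Rightarrow> bool" where
  "regular_cell_datum_generic n N C st \<longleftrightarrow>
     cell_datum (Hec n laurent_x) (Par n) dominated_by N C st \<and>
     (\<forall>la\<in>Par n. module_iso (Hec n laurent_x)
        (cell_module (Hec n laurent_x) (Par n) dominated_by N C la)
        (specht_module n laurent_x la))"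

text \<open>
  The base-changed involution is pinned down by linearity and its values on the image of the
  generic Hecke algebra, which spans.
\<close>

definition regular_cell_datum ::
  "nat \<Rightarrow> 'r::comm_ring_1 \<Rightarrow> (nat list \<Rightarrow> 'i set) \<Rightarrow> (nat list \<Rightarrow> 'i \<Rightarrow> 'i \<Rightarrow> 'r hecke) \<Rightarrow>
   ('r hecke \<Rightarrow> 'r hecke) \<Rightarrow> bool" where
  "regular_cell_datum n q N C st \<longleftrightarrow>
     (\<exists>C' st'. regular_cell_datum_generic n N C' st' \<and>
        (\<forall>la\<in>Par n. \<forall>u\<in>N la. \<forall>v\<in>N la.
           C la u v = hecke_map n q (laurent_eval q) (C' la u v)) \<and>
        is_linear_endo (Hec n q) st \<and>
        (\<forall>a\<in>carrier (Hec n laurent_x).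
           st (hecke_map n q (laurent_eval q) a) = hecke_map n q (laurent_eval q) (st' a)))"

end

theory Submission
  imports Defs "HOL-Library.Function_Algebras" "Jordan_Normal_Form.Determinant"
begin

text \<open>
  The Hecke algebra acts on functions of words by interchanging neighbouring places, and an element
  is determined by its effect on the word \<open>1 2 \<dots> n\<close>. It thus becomes an algebra \<open>H\<close> of operators
  with the trace form \<open>tr\<close> (the coefficient of 1) and the involution \<open>*\<close>. For a set \<open>S\<close> of
  partitions let \<open>I(S)\<close> be the two-sided ideal generated by the \<open>x(\<mu>)\<close> with \<open>\<mu> \<in> S\<close>. If \<open>\<mu>\<close> is a
  coarsening of \<open>\<lambda>\<close> then \<open>x(\<mu>) \<in> H x(\<lambda>) H\<close>, so that the annihilator of \<open>X\<close> is the left annihilator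
  of \<open>I = I(S)\<close>, where \<open>S\<close> is the set of coarsenings of \<open>\<zeta>(X)\<close>. As \<open>S\<close> is closed under passing to
  dominating partitions, straightening shows that \<open>I\<close> is spanned by the elements of Murphy's basis
  with shape in \<open>S\<close>.

  Over the Laurent polynomials \<open>a a\<^sup>* = 0\<close> forces \<open>a = 0\<close>, because squares have positive leading
  coefficients; in particular self-adjoint nilpotent elements vanish. Let \<open>A\<close> be the cell ideal of
  the complement of \<open>S\<close>. Since the cell modules are dual to Murphy's, \<open>c c\<^sup>*\<close> lowers every layer of
  \<open>A\<close> when \<open>c \<in> A \<inter> I\<close>, so it is nilpotent and \<open>c = 0\<close>; hence \<open>A I = 0\<close>. A similar argument for
  the left annihilator of \<open>I\<close> and the right annihilator of \<open>A\<close> shows that the latter is contained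
  in \<open>I\<close>, which therefore contains the elements with index in \<open>S\<close> of the basis \<open>D\<close> dual to the cell
  basis. Both facts survive base change. The first says that \<open>A\<close> annihilates \<open>I\<close>. By the second,
  an element \<open>a\<close> with \<open>a I = 0\<close> has coefficients \<open>tr (a D) = 0\<close> at the indices in \<open>S\<close> and so lies
  in \<open>A\<close>.
\<close>

section \<open>The action on functions of words\<close>

text \<open>Positivity fails over \<open>R\<close>: for \<open>n = 2\<close> and
  \<open>q = - 1\<close> the element 1 + T_1 is self-adjoint with square zero. So annihilators are
  computed over the Laurent polynomials only. As annihilators do not commute with base change, what
  is carried over are identities between explicit elements: vanishing products, a spanning family,
  and the values of the trace form on a pair of dual families. The trace form is perfect over every
  ring in which \<open>q\<close> is a unit, since up to \<open>*\<close> its Gram matrix in the T_w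
  is diagonal with powers of \<open>q\<close>.

  The involution of the cell datum is arbitrary. It serves to make cell ideals two-sided, while
  positivity concerns \<open>*\<close>; the two are never compared. The datum meets Murphy's basis
  only through the isomorphisms of cell modules, which tell when an element acts by zero on a layer.

  Linear independence of Murphy's elements is not shown directly. Straightening gives a spanning
  family; counting pairs of standard tableaux bounds its size by n!, and determinants over a
  commutative ring turn it into a basis. Similarly, that T_w is independent of the reduced word is
  read off from the action.\<close>

text \<open>
  A word is a function \<open>c :: nat \<Rightarrow> nat\<close> with letter \<open>c r\<close> at the place \<open>r\<close>. The Hecke algebra acts
  on functions of words by interchanging neighbouring places.
\<close>

type_synonym 'r vec = "(nat \<Rightarrow> nat) \<Rightarrow> 'r"

definition vsc :: "'r::comm_ring_1 \<Rightarrow> 'r vec \<Rightarrow> 'r vec" where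
  "vsc r u = (\<lambda>c. r * u c)"

lemma vsc_apply [simp]: "vsc r u c = r * u c"
  by (simp add: vsc_def)

definition vlin :: "('r::comm_ring_1 vec \<Rightarrow> 'r vec) \<Rightarrow> bool" where
  "vlin f \<longleftrightarrow> (\<forall>u v. f (u + v) = f u + f v) \<and> (\<forall>r u. f (vsc r u) = vsc r (f u))"

text \<open>Operators form a type rather than a set of functions, so that they become an instance of
  \<open>ring_1\<close> and the library's theory of spans and subspaces applies to them.\<close>

typedef (overloaded) ('r::comm_ring_1) endo = "{f :: 'r vec \<Rightarrow> 'r vec. vlin f}"
  morphisms app Endo
  by (rule exI[of _ "\<lambda>u. u"]) (simp add: vlin_def)

notation app (infixr "\<triangleright>" 72)

setup_lifting type_definition_endo

lemma vlin_app: "vlin (app a)"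
  using app by blast

lemma app_add: "a \<triangleright> (u + v) = a \<triangleright> u + a \<triangleright> v"
  and app_vsc: "a \<triangleright> vsc r u = vsc r (a \<triangleright> u)"
  using vlin_app[of a] by (auto simp: vlin_def)

lemma endo_eqI: "(\<And>u. a \<triangleright> u = b \<triangleright> u) \<Longrightarrow> a = b"
  by (metis app_inject ext)

instantiation endo :: (comm_ring_1) ring_1
begin

lift_definition zero_endo :: "'a endo" is "\<lambda>u. 0"
  by (auto simp: vlin_def fun_eq_iff)

lift_definition one_endo :: "'a endo" is "\<lambda>u. u"
  by (auto simp: vlin_def)

lift_definition plus_endo :: "'a endo \<Rightarrow> 'a endo \<Rightarrow> 'a endo" is "\<lambda>f g u. f u + g u"
  by (auto simp: vlin_def fun_eq_iff algebra_simps)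

lift_definition minus_endo :: "'a endo \<Rightarrow> 'a endo \<Rightarrow> 'a endo" is "\<lambda>f g u. f u - g u"
  by (auto simp: vlin_def fun_eq_iff algebra_simps)

lift_definition uminus_endo :: "'a endo \<Rightarrow> 'a endo" is "\<lambda>f u. - f u"
  by (auto simp: vlin_def fun_eq_iff algebra_simps)

lift_definition times_endo :: "'a endo \<Rightarrow> 'a endo \<Rightarrow> 'a endo" is "\<lambda>f g u. f (g u)"
  by (auto simp: vlin_def)

instance
proof
  show "(0::'a endo) \<noteq> 1"
  proof
    assume "(0::'a endo) = 1"
    then have "(0::'a endo) \<triangleright> (\<lambda>c. 1) = 1 \<triangleright> (\<lambda>c. 1)" by simp
    then show False by transfer (simp add: fun_eq_iff)
  qed
qed (transfer; auto simp: vlin_def fun_eq_iff algebra_simps)+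

end

lemma zero_app [simp]: "0 \<triangleright> u = 0"
  and one_app [simp]: "1 \<triangleright> u = u"
  and plus_app [simp]: "(a + b) \<triangleright> u = a \<triangleright> u + b \<triangleright> u"
  and minus_app [simp]: "(a - b) \<triangleright> u = a \<triangleright> u - b \<triangleright> u"
  and times_app [simp]: "(a * b) \<triangleright> u = a \<triangleright> b \<triangleright> u"
  by (transfer, simp)+

lift_definition smul :: "'r::comm_ring_1 \<Rightarrow> 'r endo \<Rightarrow> 'r endo" is "\<lambda>r f u. vsc r (f u)"
  by (auto simp: vlin_def fun_eq_iff algebra_simps)

lemma smul_app [simp]: "smul r a \<triangleright> u = vsc r (a \<triangleright> u)"
  by transfer simp

global_interpretation endo: Modules.module smul
  defines endo_span = endo.span and endo_subspace = endo.subspace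
  by unfold_locales (auto intro!: endo_eqI simp: fun_eq_iff algebra_simps)

lemma smul_mult_left [simp]: "smul r a * b = smul r (a * b)"
  and smul_mult_right [simp]: "a * smul r b = smul r (a * b)"
  by (auto intro!: endo_eqI simp: app_vsc)

lemma sum_app: "(\<Sum>i\<in>A. f i) \<triangleright> u = (\<Sum>i\<in>A. f i \<triangleright> u)"
  by (induction A rule: infinite_finite_induct) auto

lemma app_zero [simp]: "a \<triangleright> 0 = 0"
  using app_vsc[of a 0 0] by (simp add: vsc_def zero_fun_def)

lemma sum_fun_apply: "(\<Sum>i\<in>A. u i) c = (\<Sum>i\<in>A. (u i c :: 'r::comm_monoid_add))"
  by (induction A rule: infinite_finite_induct) auto

abbreviation adj :: "nat \<Rightarrow> nat \<Rightarrow> nat" where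
  "adj i \<equiv> Transposition.transpose i (Suc i)"

text \<open>The q-analogue of place permutations on tensor space. With s the interchange of the
  places i and i + 1, the basis vector at a word c goes to the one at c s if c ascends there, to q
  times that plus q - 1 times itself if c descends, and to its multiple by q if the letters agree.
  On the permutations of \<open>{1..n}\<close> this is the left regular representation.\<close>

lift_definition T :: "'r::comm_ring_1 \<Rightarrow> nat \<Rightarrow> 'r endo" is
  "\<lambda>q i u c. if c i < c (Suc i) then q * u (c \<circ> adj i)
     else if c i = c (Suc i) then q * u c else u (c \<circ> adj i) + (q - 1) * u c"
  by (auto simp: vlin_def fun_eq_iff algebra_simps)

lemma T_app: "(T q i \<triangleright> u) c = (if c i < c (Suc i) then q * u (c \<circ> adj i)
     else if c i = c (Suc i) then q * u c else u (c \<circ> adj i) + (q - 1) * u c)"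
  by transfer simp

lemma comp_adj_eq: "c i = c (Suc i) \<Longrightarrow> c \<circ> adj i = c"
  by (auto simp: fun_eq_iff transpose_def)

lemma comp_adj_adj [simp]: "c \<circ> adj i \<circ> adj i = c"
  by (simp add: comp_assoc)

lemma comp_adj_apply [simp]: "(c \<circ> adj i) i = c (Suc i)" "(c \<circ> adj i) (Suc i) = c i"
  by simp_all

lemma T_quadratic: "T q i * T q i = smul (q - 1) (T q i) + smul q 1"
  by (rule endo_eqI, rule ext)
    (simp add: T_app comp_adj_eq algebra_simps del: o_apply)

lemma T_relation: "(T q i - smul q 1) * (T q i + 1) = 0"
  by (simp add: algebra_simps T_quadratic endo.scale_left_diff_distrib)

lemma T_app_upd1:
  "(T q i \<triangleright> u) (c(i := x, Suc i := y)) =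
    (if x < y then q * u (c(i := y, Suc i := x))
     else if x = y then q * u (c(i := x, Suc i := y))
     else u (c(i := y, Suc i := x)) + (q - 1) * u (c(i := x, Suc i := y)))"
proof -
  have "c(i := x, Suc i := y) \<circ> adj i = c(i := y, Suc i := x)"
    by (auto simp: fun_eq_iff transpose_def)
  then show ?thesis by (simp add: T_app)
qed

lemma T_braid: "T q i * T q (Suc i) * T q i = T q (Suc i) * T q i * T q (Suc i)"
proof (rule endo_eqI, rule ext)
  fix u :: "'a vec" and c
  \<comment> \<open>Only the letters at three neighbouring places are moved; with the others fixed,
    the relation becomes a finite comparison by the relative order of the three letters.\<close>
  define w where "w x y z = c(i := x, Suc i := y, Suc (Suc i) := z)" for x y z :: nat
  have w1: "(T q i \<triangleright> v) (w x y z) =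
    (if x < y then q * v (w y x z) else if x = y then q * v (w x y z)
     else v (w y x z) + (q - 1) * v (w x y z))" for v :: "'a vec" and x y z :: nat
  proof -
    have "w a b z = (c(Suc (Suc i) := z))(i := a, Suc i := b)" for a b
      by (auto simp: w_def fun_eq_iff)
    then show ?thesis by (simp only: T_app_upd1)
  qed
  have w2: "(T q (Suc i) \<triangleright> v) (w x y z) =
    (if y < z then q * v (w x z y) else if y = z then q * v (w x y z)
     else v (w x z y) + (q - 1) * v (w x y z))" for v :: "'a vec" and x y z :: nat
    unfolding w_def by (rule T_app_upd1)
  have "((T q i * T q (Suc i) * T q i) \<triangleright> u) (w x y z)
      = ((T q (Suc i) * T q i * T q (Suc i)) \<triangleright> u) (w x y z)" for x y z :: nat
    unfolding times_app w1 w2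
    by (cases x y rule: linorder_cases; cases y z rule: linorder_cases;
        cases x z rule: linorder_cases; simp add: algebra_simps)
  moreover have "c = w (c i) (c (Suc i)) (c (Suc (Suc i)))"
    by (auto simp: w_def)
  ultimately show "((T q i * T q (Suc i) * T q i) \<triangleright> u) c
      = ((T q (Suc i) * T q i * T q (Suc i)) \<triangleright> u) c" by metis
qed

lemma T_commute:
  assumes "Suc i < j"
  shows "T q i * T q j = T q j * T q i"
proof (rule endo_eqI, rule ext)
  fix u :: "'a vec" and c
  define w where "w x y z t = c(i := x, Suc i := y, j := z, Suc j := t)" for x y z t :: nat
  have w1: "(T q i \<triangleright> v) (w x y z t) =
    (if x < y then q * v (w y x z t) else if x = y then q * v (w x y z t)
     else v (w y x z t) + (q - 1) * v (w x y z t))" for v :: "'a vec" and x y z t :: nat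
  proof -
    have "w a b z t = (c(j := z, Suc j := t))(i := a, Suc i := b)" for a b
      using assms by (auto simp: w_def fun_eq_iff)
    then show ?thesis by (simp only: T_app_upd1)
  qed
  have w2: "(T q j \<triangleright> v) (w x y z t) =
    (if z < t then q * v (w x y t z) else if z = t then q * v (w x y z t)
     else v (w x y t z) + (q - 1) * v (w x y z t))" for v :: "'a vec" and x y z t :: nat
    unfolding w_def by (rule T_app_upd1)
  have "((T q i * T q j) \<triangleright> u) (w x y z t) = ((T q j * T q i) \<triangleright> u) (w x y z t)" for x y z t :: nat
    unfolding times_app w1 w2 by (simp add: algebra_simps)
  moreover have "c = w (c i) (c (Suc i)) (c j) (c (Suc j))"
    by (auto simp: w_def)
  ultimately show "((T q i * T q j) \<triangleright> u) c = ((T q j * T q i) \<triangleright> u) c" by metis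
qed

definition Tl :: "'r::comm_ring_1 \<Rightarrow> nat list \<Rightarrow> 'r endo" where
  "Tl q l = prod_list (map (T q) l)"

lemma Tl_simps [simp]: "Tl q [] = 1" "Tl q (i # l) = T q i * Tl q l"
  "Tl q (l @ l') = Tl q l * Tl q l'"
  by (simp_all add: Tl_def)

definition act :: "'r::comm_ring_1 \<Rightarrow> (fword \<Rightarrow>\<^sub>0 'r) \<Rightarrow> 'r endo" where
  "act q f = (\<Sum>w\<in>Poly_Mapping.keys f. smul (Poly_Mapping.lookup f w) (Tl q (letters w)))"

lemma act_superset:
  assumes "finite S" "Poly_Mapping.keys f \<subseteq> S"
  shows "act q f = (\<Sum>w\<in>S. smul (Poly_Mapping.lookup f w) (Tl q (letters w)))"
  unfolding act_def using assms
  by (intro sum.mono_neutral_left) (auto simp: in_keys_iff)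

lemma act_add: "act q (f + g) = act q f + act q g"
proof -
  let ?S = "Poly_Mapping.keys f \<union> Poly_Mapping.keys g"
  have "Poly_Mapping.keys (f + g) \<subseteq> ?S" by (rule keys_add)
  then show ?thesis
    by (simp add: act_superset[of ?S] lookup_add endo.scale_left_distrib sum.distrib)
qed

lemma act_zero [simp]: "act q 0 = 0"
  by (simp add: act_def)

lemma act_uminus: "act q (- f) = - act q f"
  using act_add[of q f "- f"] by (simp add: eq_neg_iff_add_eq_0 add.commute)

lemma act_diff: "act q (f - g) = act q f - act q g"
  using act_add[of q f "- g"] by (simp add: act_uminus)

lemma act_single: "act q (Poly_Mapping.single w r) = smul r (Tl q (letters w))"
  by (cases "r = 0") (simp_all add: act_def)

lemma act_one [simp]: "act q 1 = 1"
  by (simp add: act_single zero_fword_def flip: single_one)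

lemma act_sum: "act q (\<Sum>i\<in>A. f i) = (\<Sum>i\<in>A. act q (f i))"
  by (induction A rule: infinite_finite_induct) (auto simp: act_add)

lemma poly_mapping_sum_single:
  "f = (\<Sum>w\<in>Poly_Mapping.keys f. Poly_Mapping.single w (Poly_Mapping.lookup f w))"
proof (rule poly_mapping_eqI)
  fix k
  have "(\<Sum>w\<in>Poly_Mapping.keys f. Poly_Mapping.lookup f w when w = k)
      = (\<Sum>w\<in>Poly_Mapping.keys f. if w = k then Poly_Mapping.lookup f w else 0)"
    by (simp add: when_def)
  also have "\<dots> = Poly_Mapping.lookup f k"
    by (auto simp: in_keys_iff)
  finally show "Poly_Mapping.lookup f k = Poly_Mapping.lookup
      (\<Sum>w\<in>Poly_Mapping.keys f. Poly_Mapping.single w (Poly_Mapping.lookup f w)) k"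
    by (simp add: lookup_sum lookup_single)
qed

lemma act_mult: "act q (f * g) = act q f * act q g"
proof -
  have "f * g = (\<Sum>v\<in>Poly_Mapping.keys f. \<Sum>w\<in>Poly_Mapping.keys g.
      Poly_Mapping.single (v + w) (Poly_Mapping.lookup f v * Poly_Mapping.lookup g w))"
    by (subst poly_mapping_sum_single[of f], subst poly_mapping_sum_single[of g])
      (simp add: sum_product mult_single)
  moreover have "letters (v + w) = letters v @ letters w" for v w
    by (simp add: plus_fword_def)
  ultimately have "act q (f * g) = (\<Sum>v\<in>Poly_Mapping.keys f. \<Sum>w\<in>Poly_Mapping.keys g.
      smul (Poly_Mapping.lookup f v * Poly_Mapping.lookup g w) (Tl q (letters v) * Tl q (letters w)))"
    by (simp only: act_sum act_single Tl_simps)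
  then show ?thesis
    by (simp add: act_def sum_product mult.commute)
qed

lemma act_free_gen [simp]: "act q (free_gen i) = T q i"
  and act_free_const [simp]: "act q (free_const r) = smul r 1"
  by (simp_all add: free_gen_def free_const_def act_single zero_fword_def)

lemma act_relator: "g \<in> hecke_relators n q \<Longrightarrow> act q g = 0"
  using T_relation[of q] T_braid[of q] T_commute[of _ _ q]
  by (auto simp: hecke_relators_def act_diff act_mult act_add)

declare upt_Suc [simp del]

section \<open>The free algebra and the Hecke ideal\<close>

lemma free_alg_sel [simp]:
  "mult (free_alg n) = (*)" "one (free_alg n) = 1" "zero (free_alg n) = 0" "add (free_alg n) = (+)"
  by (simp_all add: free_alg_def)

lemma carrier_free_alg:
  "f \<in> carrier (free_alg n) \<longleftrightarrow> (\<forall>w\<in>Poly_Mapping.keys f. set (letters w) \<subseteq> {1..<n})"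
  by (simp add: free_alg_def)

lemma free_alg_zero: "0 \<in> carrier (free_alg n)"
  and free_alg_one: "1 \<in> carrier (free_alg n)"
  by (simp_all add: carrier_free_alg zero_fword_def)

lemma free_alg_add:
  "f \<in> carrier (free_alg n) \<Longrightarrow> g \<in> carrier (free_alg n) \<Longrightarrow> f + g \<in> carrier (free_alg n)"
  unfolding carrier_free_alg by (meson Un_iff keys_add subsetD)

lemma free_alg_uminus: "f \<in> carrier (free_alg n) \<Longrightarrow> - f \<in> carrier (free_alg n)"
  by (simp add: carrier_free_alg in_keys_iff)

lemma free_alg_diff:
  "f \<in> carrier (free_alg n) \<Longrightarrow> g \<in> carrier (free_alg n) \<Longrightarrow> f - g \<in> carrier (free_alg n)"
  using free_alg_add[of f n "- g"] free_alg_uminus by auto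

lemma free_alg_mult:
  assumes "f \<in> carrier (free_alg n)" "g \<in> carrier (free_alg n)"
  shows "f * g \<in> carrier (free_alg n)"
  unfolding carrier_free_alg
proof
  fix w assume "w \<in> Poly_Mapping.keys (f * g)"
  then obtain a b where "w = a + b" "a \<in> Poly_Mapping.keys f" "b \<in> Poly_Mapping.keys g"
    using keys_mult[of f g] by blast
  then show "set (letters w) \<subseteq> {1..<n}"
    using assms by (auto simp: carrier_free_alg plus_fword_def)
qed

lemma free_alg_single: "set (letters w) \<subseteq> {1..<n} \<Longrightarrow> Poly_Mapping.single w r \<in> carrier (free_alg n)"
  by (auto simp: carrier_free_alg)

lemma free_alg_const: "free_const r \<in> carrier (free_alg n)"
  by (simp add: free_const_def free_alg_single zero_fword_def)

lemma ring_free_alg: "ring (free_alg n :: (fword \<Rightarrow>\<^sub>0 'r::comm_ring_1) ring)"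
proof (rule ringI)
  show "abelian_group (free_alg n :: (fword \<Rightarrow>\<^sub>0 'r) ring)"
  proof (rule abelian_groupI)
    fix x :: "fword \<Rightarrow>\<^sub>0 'r" assume "x \<in> carrier (free_alg n)"
    then show "\<exists>y\<in>carrier (free_alg n). y \<oplus>\<^bsub>free_alg n\<^esub> x = \<zero>\<^bsub>free_alg n\<^esub>"
      by (intro bexI[of _ "- x"]) (auto simp: free_alg_uminus)
  qed (auto simp: free_alg_add free_alg_zero algebra_simps)
  show "Group.monoid (free_alg n :: (fword \<Rightarrow>\<^sub>0 'r) ring)"
    by unfold_locales (auto simp: free_alg_mult free_alg_one algebra_simps)
qed (auto simp: algebra_simps)

abbreviation mon :: "nat list \<Rightarrow> (fword \<Rightarrow>\<^sub>0 'r::comm_ring_1)" where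
  "mon l \<equiv> Poly_Mapping.single (Word l) 1"

lemma mon_append: "mon (l @ l') = mon l * mon l'"
  by (simp add: mult_single plus_fword_def)

lemma mon_Nil [simp]: "mon [] = 1"
  by (simp flip: single_one add: zero_fword_def)

lemma free_gen_mon: "free_gen i = mon [i]"
  by (simp add: free_gen_def)

lemma mon_carrier: "set l \<subseteq> {1..<n} \<Longrightarrow> mon l \<in> carrier (free_alg n)"
  by (simp add: free_alg_single)

lemma free_const_mult: "free_const (r * s) = free_const r * free_const s"
  by (simp add: free_const_def mult_single)

lemma free_const_add: "free_const (r + s) = free_const r + free_const s"
  by (simp add: free_const_def single_add)

lemma free_const_zero [simp]: "free_const 0 = 0"
  and free_const_one [simp]: "free_const 1 = 1"
  by (simp_all add: free_const_def)

lemma free_const_uminus: "free_const (- r) = - free_const r"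
  by (simp add: free_const_def single_uminus)

lemma free_const_commute: "f * free_const r = free_const r * f"
  by (subst (1 2) poly_mapping_sum_single[of f])
    (simp add: sum_distrib_left sum_distrib_right free_const_def mult_single mult.commute)

lemma relators_carrier: "hecke_relators n q \<subseteq> carrier (free_alg n)"
proof -
  have "i \<in> {1..<n} \<Longrightarrow> free_gen i \<in> carrier (free_alg n)" for i
    by (simp add: free_gen_mon mon_carrier)
  then show ?thesis
    unfolding hecke_relators_def
    by (auto intro!: free_alg_mult free_alg_diff free_alg_add free_alg_const free_alg_one)
qed

lemma ideal_hecke: "ideal (hecke_ideal n q) (free_alg n)"
  unfolding hecke_ideal_def by (rule ring.genideal_ideal[OF ring_free_alg relators_carrier])

lemma hecke_ideal_carrier: "f \<in> hecke_ideal n q \<Longrightarrow> f \<in> carrier (free_alg n)"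
  using ideal_hecke[of n q] by (meson ideal.Icarr)

lemma hecke_ideal_mult_left:
  "f \<in> hecke_ideal n q \<Longrightarrow> g \<in> carrier (free_alg n) \<Longrightarrow> g * f \<in> hecke_ideal n q"
  using ideal.I_l_closed[OF ideal_hecke, of f n q g] by simp

lemma hecke_ideal_mult_right:
  "f \<in> hecke_ideal n q \<Longrightarrow> g \<in> carrier (free_alg n) \<Longrightarrow> f * g \<in> hecke_ideal n q"
  using ideal.I_r_closed[OF ideal_hecke, of f n q g] by simp

lemma hecke_ideal_zero: "0 \<in> hecke_ideal n q"
  using additive_subgroup.zero_closed[OF ideal.axioms(1)[OF ideal_hecke[of n q]]] by simp

lemma hecke_ideal_add:
  "f \<in> hecke_ideal n q \<Longrightarrow> g \<in> hecke_ideal n q \<Longrightarrow> f + g \<in> hecke_ideal n q"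
  using additive_subgroup.a_closed[OF ideal.axioms(1)[OF ideal_hecke[of n q]], of f g] by simp

lemma hecke_ideal_uminus: "f \<in> hecke_ideal n q \<Longrightarrow> - f \<in> hecke_ideal n q"
  using hecke_ideal_mult_left[OF _ free_alg_const[of "- 1"], of f n q]
  by (simp add: free_const_uminus)

lemma hecke_ideal_diff:
  "f \<in> hecke_ideal n q \<Longrightarrow> g \<in> hecke_ideal n q \<Longrightarrow> f - g \<in> hecke_ideal n q"
  using hecke_ideal_add[of f n q "- g"] hecke_ideal_uminus by auto

lemma relator_in_ideal: "f \<in> hecke_relators n q \<Longrightarrow> f \<in> hecke_ideal n q"
  unfolding hecke_ideal_def using ring.genideal_self[OF ring_free_alg relators_carrier] by blast

lemma act_hecke_ideal: "f \<in> hecke_ideal n q \<Longrightarrow> act q f = 0"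
proof -
  let ?K = "{f \<in> carrier (free_alg n). act q f = 0}"
  have "ideal ?K (free_alg n)"
  proof (rule idealI[OF ring_free_alg])
    show "subgroup ?K (add_monoid (free_alg n))"
    proof -
      have inv: "inv\<^bsub>add_monoid (free_alg n)\<^esub> x = - x" if "x \<in> carrier (free_alg n)" for x :: "fword \<Rightarrow>\<^sub>0 'a"
        by (rule group.inv_equality[OF abelian_group.a_group[OF ring.is_abelian_group[OF ring_free_alg[of n]]]])
          (use that free_alg_uminus in auto)
      show ?thesis
        by (rule group.subgroupI[OF abelian_group.a_group[OF ring.is_abelian_group[OF ring_free_alg[of n]]]])
          (auto simp: inv[simplified] act_uminus act_add free_alg_add free_alg_uminus intro: free_alg_zero)
    qed
  qed (auto simp: act_mult free_alg_mult)
  moreover have "hecke_relators n q \<subseteq> ?K"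
    using relators_carrier[of n q] act_relator[of _ n q] by auto
  ultimately have "hecke_ideal n q \<subseteq> ?K"
    unfolding hecke_ideal_def by (rule ring.genideal_minimal[OF ring_free_alg])
  then show "f \<in> hecke_ideal n q \<Longrightarrow> act q f = 0" by blast
qed

section \<open>Normal forms\<close>

abbreviation down :: "nat \<Rightarrow> nat \<Rightarrow> nat list" where
  "down n k \<equiv> rev [k..<Suc n]"

text \<open>Sym(n + 1) is the disjoint union of the cosets Sym(n) s_n ... s_k for k = 1, ..., n + 1,
  where k = n + 1 gives the empty word \<open>down n k\<close>. Iterating this yields one word for
  each permutation.\<close>

primrec normal_words :: "nat \<Rightarrow> nat list set" where
  "normal_words 0 = {[]}"
| "normal_words (Suc n) = (\<lambda>(m, k). m @ down n k) ` (normal_words n \<times> {1..Suc n})"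

lemma normal_words_SucI:
  "m \<in> normal_words n \<Longrightarrow> 1 \<le> k \<Longrightarrow> k \<le> Suc n \<Longrightarrow> m @ down n k \<in> normal_words (Suc n)"
  by (auto intro!: image_eqI[where x = "(m, k)"])

lemma normal_words_SucE:
  assumes "m \<in> normal_words (Suc n)"
  obtains m' k where "m = m' @ down n k" "m' \<in> normal_words n" "1 \<le> k" "k \<le> Suc n"
  using assms by auto

lemma Nil_normal_words: "[] \<in> normal_words n"
proof (induction n)
  case (Suc n)
  then show ?case using normal_words_SucI[of "[]" n "Suc n"] by simp
qed simp

lemma finite_normal_words: "finite (normal_words n)"
  by (induction n) auto

lemma normal_words_letters: "m \<in> normal_words n \<Longrightarrow> set m \<subseteq> {1..<n}"
  by (induction n arbitrary: m) fastforce+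

context
  fixes N :: nat and q :: "'r::comm_ring_1"
begin

definition cg :: "(fword \<Rightarrow>\<^sub>0 'r) \<Rightarrow> (fword \<Rightarrow>\<^sub>0 'r) \<Rightarrow> bool" where
  "cg f g \<longleftrightarrow> f - g \<in> hecke_ideal N q"

lemma cg_refl: "cg f f"
  by (simp add: cg_def hecke_ideal_zero)

lemma cg_trans [trans]: "cg f g \<Longrightarrow> cg g h \<Longrightarrow> cg f h"
  unfolding cg_def using hecke_ideal_add[of "f - g" N q "g - h"] by simp

lemma cg_sym: "cg f g \<Longrightarrow> cg g f"
  unfolding cg_def using hecke_ideal_uminus[of "f - g" N q] by simp

lemma cg_mult: 
  assumes "cg f g" "h \<in> carrier (free_alg N)" "k \<in> carrier (free_alg N)"
  shows "cg (h * f * k) (h * g * k)"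
  using hecke_ideal_mult_right[OF hecke_ideal_mult_left[OF assms(1)[unfolded cg_def] assms(2)] assms(3)]
  by (simp add: cg_def algebra_simps)

lemma cg_mon: 
  assumes "cg (mon l) (mon l')" "set a \<subseteq> {1..<N}" "set b \<subseteq> {1..<N}"
  shows "cg (mon (a @ l @ b)) (mon (a @ l' @ b))"
  using cg_mult[OF assms(1) mon_carrier mon_carrier, OF assms(2,3)]
  by (simp add: mon_append[of a] mon_append[of _ b] mult.assoc)

lemma cg_braid:
  assumes "i \<in> {1..<N}" "Suc i \<in> {1..<N}"
  shows "cg (mon [Suc i, i, Suc i]) (mon [i, Suc i, i])"
proof -
  have "free_gen i * free_gen (Suc i) * free_gen i - free_gen (Suc i) * free_gen i * free_gen (Suc i)
      \<in> hecke_ideal N q"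
    using assms by (intro relator_in_ideal) (auto simp: hecke_relators_def)
  then have "cg (mon [i, Suc i, i]) (mon [Suc i, i, Suc i])"
    by (simp add: cg_def free_gen_mon flip: mon_append)
  then show ?thesis by (rule cg_sym)
qed

lemma cg_commute:
  assumes "i \<in> {1..<N}" "j \<in> {1..<N}" "Suc i < j \<or> Suc j < i"
  shows "cg (mon [i, j]) (mon [j, i])"
proof -
  have *: "cg (mon [i, j]) (mon [j, i])" if "i \<in> {1..<N}" "j \<in> {1..<N}" "Suc i < j" for i j
  proof -
    have "free_gen i * free_gen j - free_gen j * free_gen i \<in> hecke_ideal N q"
      using that by (intro relator_in_ideal) (unfold hecke_relators_def, blast)
    then show ?thesis by (simp add: cg_def free_gen_mon flip: mon_append)
  qed
  show ?thesis using assms *[of i j] *[of j i] cg_sym by blast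
qed

lemma cg_quadratic:
  assumes "i \<in> {1..<N}"
  shows "cg (mon [i, i]) (free_const (q - 1) * mon [i] + free_const q)"
proof -
  have "(free_gen i - free_const q) * (free_gen i + 1) \<in> hecke_ideal N q"
    using assms by (intro relator_in_ideal) (auto simp: hecke_relators_def)
  moreover have "(free_gen i - free_const q) * (free_gen i + 1)
      = mon [i, i] - (free_const (q - 1) * mon [i] + free_const q)"
    using free_const_add[of q "- 1"]
    by (simp add: free_gen_mon distrib_left distrib_right left_diff_distrib free_const_uminus
        flip: mon_append)
  ultimately show ?thesis by (simp add: cg_def)
qed

lemma cg_slide:
  assumes "set l \<subseteq> {1..<N}" "j \<in> {1..<N}" "\<And>i. i \<in> set l \<Longrightarrow> Suc i < j \<or> Suc j < i"
  shows "cg (mon (l @ [j])) (mon (j # l))"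
  using assms
proof (induction l)
  case (Cons i l)
  have "cg (mon ([i] @ (l @ [j]) @ [])) (mon ([i] @ (j # l) @ []))"
    by (rule cg_mon[OF Cons.IH]) (use Cons.prems in auto)
  also have "cg (mon ([i] @ (j # l) @ [])) (mon ([] @ [j, i] @ l))"
    using cg_mon[OF cg_commute[of i j], of "[]" l] Cons.prems by auto
  finally show ?case by simp
qed (simp add: cg_refl)

text \<open>The ambient rank \<open>N\<close> stays fixed while \<open>n\<close> runs through the
  smaller ranks of the induction, so that all congruences are modulo one and the same ideal.\<close>

definition nspan :: "nat \<Rightarrow> (fword \<Rightarrow>\<^sub>0 'r) set" where
  "nspan n = {f. \<exists>c. cg f (\<Sum>m\<in>normal_words n. free_const (c m) * mon m)}"

lemma nspan_cg: "cg f g \<Longrightarrow> g \<in> nspan n \<Longrightarrow> f \<in> nspan n"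
  unfolding nspan_def using cg_trans by blast

lemma nspan_zero: "0 \<in> nspan n"
  unfolding nspan_def by (auto intro!: exI[of _ "\<lambda>_. 0"] simp: cg_refl)

lemma nspan_add: "f \<in> nspan n \<Longrightarrow> g \<in> nspan n \<Longrightarrow> f + g \<in> nspan n"
proof -
  assume "f \<in> nspan n" "g \<in> nspan n"
  then obtain c d where
    "f - (\<Sum>m\<in>normal_words n. free_const (c m) * mon m) \<in> hecke_ideal N q"
    "g - (\<Sum>m\<in>normal_words n. free_const (d m) * mon m) \<in> hecke_ideal N q"
    by (auto simp: nspan_def cg_def)
  from hecke_ideal_add[OF this]
  have "cg (f + g) (\<Sum>m\<in>normal_words n. free_const (c m + d m) * mon m)"
    by (simp add: cg_def free_const_add sum.distrib algebra_simps)
  then show ?thesis unfolding nspan_def by (rule_tac CollectI, rule_tac exI)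
qed

lemma nspan_const: "f \<in> nspan n \<Longrightarrow> free_const r * f \<in> nspan n"
proof -
  assume "f \<in> nspan n"
  then obtain c where "cg f (\<Sum>m\<in>normal_words n. free_const (c m) * mon m)"
    by (auto simp: nspan_def)
  from cg_mult[OF this free_alg_const[of r] free_alg_one]
  have "cg (free_const r * f) (\<Sum>m\<in>normal_words n. free_const (r * c m) * mon m)"
    by (simp add: free_const_mult sum_distrib_left mult.assoc)
  then show ?thesis unfolding nspan_def by (rule_tac CollectI, rule_tac exI)
qed

lemma nspan_sum: "(\<And>i. i \<in> A \<Longrightarrow> f i \<in> nspan n) \<Longrightarrow> sum f A \<in> nspan n"
  by (induction A rule: infinite_finite_induct) (auto simp: nspan_zero nspan_add)

lemma nspan_mon: "m \<in> normal_words n \<Longrightarrow> mon m \<in> nspan n"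
proof -
  assume m: "m \<in> normal_words n"
  have "(\<Sum>x\<in>normal_words n. free_const (if x = m then 1 else 0) * mon x) = (mon m :: fword \<Rightarrow>\<^sub>0 'r)"
    using m finite_normal_words[of n] by (simp add: if_distrib[of free_const] if_distrib[of "\<lambda>x. x * _"] cong: if_cong)
  then have "cg (mon m) (\<Sum>x\<in>normal_words n. free_const (if x = m then 1 else 0) * mon x)"
    by (simp add: cg_refl)
  then show ?thesis unfolding nspan_def by (rule_tac CollectI, rule_tac exI)
qed

lemma nspan_mult_mon:
  assumes "f \<in> nspan n" "set l \<subseteq> {1..<N}" "\<And>m. m \<in> normal_words n \<Longrightarrow> mon (m @ l) \<in> nspan k"
  shows "f * mon l \<in> nspan k"
proof -
  obtain c where "cg f (\<Sum>m\<in>normal_words n. free_const (c m) * mon m)"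
    using assms(1) by (auto simp: nspan_def)
  from cg_mult[OF this free_alg_one mon_carrier[OF assms(2)]]
  have "cg (f * mon l) (\<Sum>m\<in>normal_words n. free_const (c m) * mon (m @ l))"
    by (simp add: sum_distrib_right mon_append mult.assoc)
  moreover have "(\<Sum>m\<in>normal_words n. free_const (c m) * mon (m @ l)) \<in> nspan k"
    by (intro nspan_sum nspan_const assms(3))
  ultimately show ?thesis by (rule nspan_cg)
qed

text \<open>The new letter j meets the run n, n - 1, ..., k from the right. If j < k - 1 it commutes
  with the run, if j = k - 1 it prolongs it, if j = k the quadratic relation applies, and if j > k
  the braid relation lets it through as j - 1.\<close>

lemma normal_words_step:
  assumes "n \<le> N" "m \<in> normal_words n" "1 \<le> j" "j < n"
  shows "mon (m @ [j]) \<in> nspan n"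
  using assms
proof (induction n arbitrary: m j)
  case (Suc n)
  from Suc.prems(2) obtain m' k where m: "m = m' @ down n k" and m': "m' \<in> normal_words n"
    and k: "1 \<le> k" "k \<le> Suc n"
    by (rule normal_words_SucE)
  have let': "set m' \<subseteq> {1..<N}" using normal_words_letters[OF m'] Suc.prems(1) by fastforce
  have letd: "set (down n i) \<subseteq> {1..<N}" if "1 \<le> i" for i using that Suc.prems(1) by auto
  \<comment> \<open>A letter below n that has reached the left of the run is absorbed by the normal
    form of smaller rank.\<close>
  have ext: "mon (m' @ [i] @ down n k) \<in> nspan (Suc n)" if "1 \<le> i" "i < n" for i
  proof -
    have "mon (m' @ [i]) * mon (down n k) \<in> nspan (Suc n)"
    proof (rule nspan_mult_mon)
      show "mon (m' @ [i]) \<in> nspan n" by (rule Suc.IH) (use Suc.prems m' that in auto)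
      show "set (down n k) \<subseteq> {1..<N}" by (rule letd[OF k(1)])
      fix x assume "x \<in> normal_words n"
      then show "mon (x @ down n k) \<in> nspan (Suc n)"
        using k by (intro nspan_mon normal_words_SucI)
    qed
    then show ?thesis by (simp only: mon_append append_assoc mult.assoc)
  qed
  consider "Suc j < k" | "Suc j = k" | "j = k" | "k < j" by linarith
  then show ?case
  proof cases
    case 1
    have "cg (mon (m' @ (down n k @ [j]) @ [])) (mon (m' @ (j # down n k) @ []))"
      by (rule cg_mon[OF cg_slide]) (use letd[OF k(1)] 1 Suc.prems let' in auto)
    then show ?thesis using ext[of j] 1 k Suc.prems(3) nspan_cg m by simp
  next
    case 2
    then have "down n k @ [j] = down n j" using k by (simp add: upt_rec[of j])
    then have "m @ [j] = m' @ down n j" using m by simp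
    moreover have "m' @ down n j \<in> normal_words (Suc n)"
      using m' Suc.prems by (intro normal_words_SucI) auto
    ultimately show ?thesis by (simp only: nspan_mon)
  next
    case 3
    have d: "down n k = down n (Suc k) @ [k]"
      using 3 Suc.prems by (simp add: upt_rec[of k])
    have "m @ [j] = (m' @ down n (Suc k)) @ [k, k] @ []" using 3 d m by simp
    moreover have "cg (mon (m' @ down n (Suc k)) * mon [k, k] * mon [])
        (mon (m' @ down n (Suc k)) * (free_const (q - 1) * mon [k] + free_const q) * mon [])"
      by (rule cg_mult[OF cg_quadratic mon_carrier mon_carrier])
        (use 3 Suc.prems let' letd[of "Suc k"] in auto)
    moreover have "mon (m' @ down n (Suc k)) * (free_const (q - 1) * mon [k] + free_const q) * mon []
        = free_const (q - 1) * mon m + free_const q * mon (m' @ down n (Suc k))"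
    proof -
      have "mon (m' @ down n (Suc k)) * (free_const (q - 1) * mon [k])
          = free_const (q - 1) * (mon (m' @ down n (Suc k)) * mon [k])"
        by (simp only: mult.assoc[symmetric] free_const_commute)
      also have "mon (m' @ down n (Suc k)) * mon [k] = mon m"
        by (simp only: mon_append[symmetric] m d append_assoc)
      finally show ?thesis
        by (simp add: distrib_left free_const_commute)
    qed
    ultimately have "cg (mon (m @ [j]))
        (free_const (q - 1) * mon m + free_const q * mon (m' @ down n (Suc k)))"
      by (simp only: mon_append mult.assoc)
    moreover have "m' @ down n (Suc k) \<in> normal_words (Suc n)"
      using m' 3 Suc.prems by (intro normal_words_SucI) auto
    ultimately show ?thesis
      using nspan_cg nspan_add nspan_const nspan_mon Suc.prems(2) by blast
  next
    case 4
    then obtain i where i: "j = Suc i" "k \<le> i" "i < n" using Suc.prems by (cases j) auto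
    define a where "a = rev [Suc (Suc i)..<Suc n]"
    define b where "b = rev [k..<i]"
    have d: "down n k = a @ [Suc i, i] @ b"
    proof -
      have "[k..<Suc n] = [k..<i] @ i # Suc i # [Suc (Suc i)..<Suc n]"
        using i upt_add_eq_append[of k i "Suc n - i"] upt_conv_Cons[of i "Suc n"]
          upt_conv_Cons[of "Suc i" "Suc n"] by simp
      then show ?thesis by (simp add: a_def b_def)
    qed
    have la: "set a \<subseteq> {1..<N}" and lb: "set b \<subseteq> {1..<N}"
      using Suc.prems k i by (auto simp: a_def b_def)
    have ii: "i \<in> {1..<N}" "Suc i \<in> {1..<N}" using i k Suc.prems by auto
    have "cg (mon ((m' @ a @ [Suc i, i]) @ (b @ [Suc i]) @ []))
        (mon ((m' @ a @ [Suc i, i]) @ (Suc i # b) @ []))"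
      by (rule cg_mon[OF cg_slide]) (use lb la let' ii in \<open>auto simp: b_def\<close>)
    also have "cg (mon ((m' @ a @ [Suc i, i]) @ (Suc i # b) @ []))
        (mon ((m' @ a) @ [i, Suc i, i] @ b))"
      using cg_mon[OF cg_braid[OF ii], of "m' @ a" b] la lb let' by simp
    also have "cg (mon ((m' @ a) @ [i, Suc i, i] @ b)) (mon (m' @ (i # a) @ ([Suc i, i] @ b)))"
      using cg_mon[OF cg_slide[of a i], of m' "[Suc i, i] @ b"] la lb let' ii by (auto simp: a_def)
    finally have "cg (mon (m @ [j])) (mon (m' @ [i] @ down n k))"
      by (simp add: m d i(1))
    then show ?thesis using ext[of i] i k nspan_cg by fastforce
  qed
qed simp

lemma mon_nspan: "set l \<subseteq> {1..<N} \<Longrightarrow> mon l \<in> nspan N"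
proof (induction l rule: rev_induct)
  case Nil
  show ?case by (rule nspan_mon[OF Nil_normal_words])
next
  case (snoc j l)
  have "mon l * mon [j] \<in> nspan N"
    by (rule nspan_mult_mon[OF snoc.IH _ normal_words_step]) (use snoc.prems in auto)
  then show ?case by (simp only: mon_append)
qed

lemma carrier_nspan:
  assumes "f \<in> carrier (free_alg N)"
  shows "f \<in> nspan N"
proof -
  have 1: "Poly_Mapping.single w r = free_const r * mon (letters w)" for w and r :: 'r
    by (cases w) (simp add: free_const_def mult_single zero_fword_def plus_fword_def)
  have "(\<Sum>w\<in>Poly_Mapping.keys f. free_const (Poly_Mapping.lookup f w) * mon (letters w)) \<in> nspan N"
    by (intro nspan_sum nspan_const mon_nspan) (use assms in \<open>auto simp: carrier_free_alg\<close>)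
  then show ?thesis
    by (simp only: 1[symmetric] poly_mapping_sum_single[symmetric])
qed

end

section \<open>Basis vectors, and the faithfulness of the action\<close>

definition de :: "(nat \<Rightarrow> nat) \<Rightarrow> 'r::comm_ring_1 vec" where
  "de c = (\<lambda>d. if d = c then 1 else 0)"

lemma T_de_asc:
  assumes "c i < c (Suc i)"
  shows "T q i \<triangleright> de c = de (c \<circ> adj i)"
proof (rule ext)
  fix d
  have 1: "d \<circ> adj i = c \<longleftrightarrow> d = c \<circ> adj i" by (metis comp_adj_adj)
  have "(c \<circ> adj i) i = c (Suc i)" "(c \<circ> adj i) (Suc i) = c i" by simp_all
  moreover have "c \<circ> adj i \<noteq> c" using assms by (metis comp_adj_apply(1) less_irrefl)
  ultimately show "(T q i \<triangleright> de c) d = de (c \<circ> adj i) d"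
    using assms unfolding T_app de_def 1 by (auto simp del: o_apply)
qed

lemma simple_product_simps [simp]:
  "simple_product [] = id" "simple_product (i # l) = adj i \<circ> simple_product l"
  by (simp_all add: simple_product_def)

lemma simple_product_append [simp]: "simple_product (l @ l') = simple_product l \<circ> simple_product l'"
  by (induction l) (simp_all add: comp_assoc)

lemma simple_product_rev: "simple_product l \<circ> simple_product (rev l) = id"
proof (induction l)
  case (Cons a l)
  have "simple_product (a # l) \<circ> simple_product (rev (a # l))
      = adj a \<circ> (simple_product l \<circ> simple_product (rev l)) \<circ> adj a" by (simp add: comp_assoc)
  also have "\<dots> = id" by (simp only: Cons.IH comp_id transpose_comp_involutory)
  finally show ?case .
qed simp

lemma simple_product_rev': "simple_product (rev l) \<circ> simple_product l = id"
  using simple_product_rev[of "rev l"] by simp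

lemma simple_product_permutes: "set l \<subseteq> {1..<n} \<Longrightarrow> simple_product l permutes {1..n}"
proof (induction l)
  case (Cons a l)
  have "adj a permutes {1..n}" by (rule permutes_swap_id) (use Cons.prems in auto)
  then show ?case using Cons permutes_compose[of "simple_product l" "{1..n}" "adj a"]
    by (simp del: o_apply)
qed (simp add: permutes_id)

lemma simple_product_upt:
  "k \<le> Suc n \<Longrightarrow> simple_product [k..<Suc n]
    = (\<lambda>j. if k \<le> j \<and> j \<le> n then Suc j else if j = Suc n then k else j)"
proof (induction n)
  case 0
  then consider "k = 0" | "k = Suc 0" by linarith
  then show ?case
    by cases (auto simp: fun_eq_iff transpose_def upt_Suc)
next
  case (Suc n)
  show ?case
  proof (cases "k = Suc (Suc n)")
    case True
    then show ?thesis by (auto simp: fun_eq_iff)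
  next
    case False
    then have k: "k \<le> Suc n" using Suc.prems by simp
    then have "simple_product [k..<Suc (Suc n)] = simple_product [k..<Suc n] \<circ> adj (Suc n)"
      by (subst upt_Suc) simp
    also have "\<dots> = (\<lambda>j. if k \<le> j \<and> j \<le> Suc n then Suc j else if j = Suc (Suc n) then k else j)"
      unfolding Suc.IH[OF k] by (rule ext) (use k in \<open>auto simp: transpose_def\<close>)
    finally show ?thesis .
  qed
qed

lemma Tl_down_de:
  "1 \<le> k \<Longrightarrow> k \<le> Suc n \<Longrightarrow> strict_mono_on {1..Suc n} c \<Longrightarrow>
    Tl q (down n k) \<triangleright> de c = de (c \<circ> simple_product [k..<Suc n])"
proof (induction n)
  case 0
  then show ?case by simp
next
  case (Suc n)
  show ?case
  proof (cases "k = Suc (Suc n)")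
    case True
    then show ?thesis by simp
  next
    case False
    then have k: "k \<le> Suc n" using Suc.prems by simp
    let ?c = "c \<circ> simple_product [k..<Suc n]"
    have "strict_mono_on {1..Suc n} c"
      using Suc.prems(3) by (rule monotone_on_subset) auto
    then have IH: "Tl q (down n k) \<triangleright> de c = de ?c"
      using Suc.IH Suc.prems k by blast
    have "c k < c (Suc (Suc n))"
      by (rule strict_mono_onD[OF Suc.prems(3)]) (use k Suc.prems in auto)
    then have asc: "?c (Suc n) < ?c (Suc (Suc n))"
      using k by (simp add: simple_product_upt)
    have "Tl q (down (Suc n) k) \<triangleright> de c = T q (Suc n) \<triangleright> de ?c"
      using k IH by (subst upt_Suc) simp
    also have "\<dots> = de (?c \<circ> adj (Suc n))" using asc by (rule T_de_asc)
    also have "?c \<circ> adj (Suc n) = c \<circ> simple_product [k..<Suc (Suc n)]"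
      using k by (subst upt_Suc[of k "Suc n"]) (simp add: comp_assoc)
    finally show ?thesis .
  qed
qed

text \<open>On an increasing word every letter of a normal word meets an ascent, the case in which
  \<open>T\<close> merely interchanges two places. Distinct normal words are thus separated without
  any appeal to lengths.\<close>

lemma Tl_normal_de:
  "m \<in> normal_words n \<Longrightarrow> strict_mono_on {1..n} c \<Longrightarrow>
    Tl q m \<triangleright> de c = de (c \<circ> simple_product (rev m))"
proof (induction n arbitrary: m c)
  case (Suc n)
  from Suc.prems(1) obtain m' k where m: "m = m' @ down n k" and m': "m' \<in> normal_words n"
    and k: "1 \<le> k" "k \<le> Suc n"
    by (rule normal_words_SucE)
  let ?c = "c \<circ> simple_product [k..<Suc n]"
  have "strict_mono_on {1..n} ?c"
    using k strict_mono_onD[OF Suc.prems(2)]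
    by (auto intro!: strict_mono_onI simp: simple_product_upt)
  then have "Tl q m' \<triangleright> de ?c = de (?c \<circ> simple_product (rev m'))"
    by (rule Suc.IH[OF m'])
  then show ?case
    using Tl_down_de[OF k Suc.prems(2), of q] m by (simp add: comp_assoc[symmetric] del: upt_Suc o_apply)
qed simp

text \<open>The factor from the smaller rank fixes \<open>Suc n\<close>, so the image of
  \<open>Suc n\<close> is the index k of the last run; cancelling this run leaves the smaller
  rank.\<close>

lemma simple_product_normal_inj: "inj_on (\<lambda>m. simple_product (rev m)) (normal_words n)"
proof (induction n)
  case (Suc n)
  show ?case
  proof (rule inj_onI)
    fix x y assume x: "x \<in> normal_words (Suc n)" and y: "y \<in> normal_words (Suc n)"
      and eq: "simple_product (rev x) = simple_product (rev y)"
    from x obtain a k where a: "x = a @ down n k" "a \<in> normal_words n" "1 \<le> k" "k \<le> Suc n"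
      by (rule normal_words_SucE)
    from y obtain b l where b: "y = b @ down n l" "b \<in> normal_words n" "1 \<le> l" "l \<le> Suc n"
      by (rule normal_words_SucE)
    have fixn: "simple_product (rev m) (Suc n) = Suc n" if "m \<in> normal_words n" for m
    proof -
      have "simple_product (rev m) permutes {1..n}"
        using normal_words_letters[OF that] by (intro simple_product_permutes) auto
      then show ?thesis by (rule permutes_not_in) simp
    qed
    have "simple_product (rev x) (Suc n) = k" "simple_product (rev y) (Suc n) = l"
      using a b fixn by (simp_all add: simple_product_upt)
    then have kl: "k = l" using eq by simp
    have "simple_product (down n k) \<circ> simple_product (rev x) = simple_product (down n k) \<circ> simple_product (rev y)"
      using eq by simp
    then have "simple_product (rev a) = simple_product (rev b)"
      using a b kl simple_product_rev'[of "[k..<Suc n]"]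
      by (simp add: comp_assoc[symmetric])
    then show "x = y" using Suc.IH a b kl by (auto dest: inj_onD)
  qed
qed simp

text \<open>The normal words send \<open>de id\<close> to distinct basis vectors.\<close>

lemma act_faithful:
  assumes "f \<in> carrier (free_alg n)" "act q f \<triangleright> de id = 0"
  shows "f \<in> hecke_ideal n q"
proof -
  obtain c where c: "cg n q f (\<Sum>m\<in>normal_words n. free_const (c m) * mon m)"
    using carrier_nspan[OF assms(1), of q] by (auto simp: nspan_def)
  have "act q f = act q (\<Sum>m\<in>normal_words n. free_const (c m) * mon m)"
    using act_hecke_ideal[OF c[unfolded cg_def]] by (simp add: act_diff)
  also have "\<dots> = (\<Sum>m\<in>normal_words n. smul (c m) (Tl q m))"
    by (simp add: act_sum act_mult act_single)
  finally have "0 = (\<Sum>m\<in>normal_words n. vsc (c m) (Tl q m \<triangleright> de id))"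
    using assms(2) by (simp add: sum_app)
  also have "\<dots> = (\<Sum>m\<in>normal_words n. vsc (c m) (de (simple_product (rev m))))"
    by (intro sum.cong refl) (simp add: Tl_normal_de[where n = n] strict_mono_on_def)
  finally have sum0: "(\<Sum>m\<in>normal_words n. vsc (c m) (de (simple_product (rev m)))) = 0" by simp
  have "c x = 0" if x: "x \<in> normal_words n" for x
  proof -
    have "0 = (\<Sum>m\<in>normal_words n. vsc (c m) (de (simple_product (rev m)))) (simple_product (rev x))"
      using sum0 by simp
    also have "\<dots> = (\<Sum>m\<in>normal_words n. if m = x then c m else 0)"
      unfolding sum_fun_apply
      by (intro sum.cong refl) (use inj_onD[OF simple_product_normal_inj[of n]] x in \<open>auto simp: de_def\<close>)
    also have "\<dots> = c x" using x finite_normal_words by simp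
    finally show ?thesis by simp
  qed
  then have "(\<Sum>m\<in>normal_words n. free_const (c m) * mon m) = 0" by simp
  then show ?thesis using c by (simp add: cg_def)
qed

lemma hecke_ideal_iff:
  "f \<in> hecke_ideal n q \<longleftrightarrow> f \<in> carrier (free_alg n) \<and> act q f \<triangleright> de id = 0"
  by (auto simp: act_hecke_ideal hecke_ideal_carrier intro: act_faithful)

declare One_nat_def [simp del]

section \<open>Reduced words\<close>

abbreviation pinv :: "(nat \<Rightarrow> nat) \<Rightarrow> nat \<Rightarrow> nat" where
  "pinv w \<equiv> inv_into UNIV w"

text \<open>The relation is arbitrary, since the same count serves for the inversions of one word
  (\<open>ninv\<close>) and for the exponents attached to a pair of words
  (\<open>twist\<close>).\<close>

definition pair_count :: "nat \<Rightarrow> ('a \<Rightarrow> 'a \<Rightarrow> bool) \<Rightarrow> (nat \<Rightarrow> 'a) \<Rightarrow> nat" where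
  "pair_count n R d = card {(a, b). a \<in> {1..n} \<and> b \<in> {1..n} \<and> a < b \<and> R (d a) (d b)}"

lemma adj_in: "i \<in> {1..<n} \<Longrightarrow> adj i a \<in> {1..n} \<longleftrightarrow> a \<in> {1..n}"
  by (auto simp: transpose_def)

lemma adj_less: "a < b \<Longrightarrow> \<not> (a = i \<and> b = Suc i) \<Longrightarrow> adj i a < adj i b"
  by (auto simp: transpose_def)

text \<open>The interchange permutes all pairs of places in order, except that it reverses the pair
  (i, i + 1). Terms stand on both sides in order to avoid subtraction of natural numbers.\<close>

lemma pair_count_adj:
  assumes i: "i \<in> {1..<n}"
  shows "pair_count n R (d \<circ> adj i) + (if R (d i) (d (Suc i)) then 1 else 0)
    = pair_count n R d + (if R (d (Suc i)) (d i) then 1 else 0)"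
proof -
  define X where "X d = {(a, b). a \<in> {1..n} \<and> b \<in> {1..n} \<and> a < b \<and> R (d a) (d b)
    \<and> \<not> (a = i \<and> b = Suc i)}" for d
  have fin: "finite (X d)" for d
    by (rule finite_subset[of _ "{1..n} \<times> {1..n}"]) (auto simp: X_def)
  have pc: "pair_count n R d = card (X d) + (if R (d i) (d (Suc i)) then 1 else 0)" for d
  proof -
    have "{(a, b). a \<in> {1..n} \<and> b \<in> {1..n} \<and> a < b \<and> R (d a) (d b)}
        = X d \<union> (if R (d i) (d (Suc i)) then {(i, Suc i)} else {})"
      using i by (auto simp: X_def)
    moreover have "X d \<inter> (if R (d i) (d (Suc i)) then {(i, Suc i)} else {}) = {}"
      by (auto simp: X_def)
    ultimately show ?thesis
      unfolding pair_count_def using fin[of d] by (simp add: card_Un_disjoint)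
  qed
  have "bij_betw (\<lambda>(a, b). (adj i a, adj i b)) (X (d \<circ> adj i)) (X d)"
  proof (rule bij_betw_byWitness[where f' = "\<lambda>(a, b). (adj i a, adj i b)"])
    have *: "(adj i a, adj i b) \<in> X e" if "(a, b) \<in> X (e \<circ> adj i)" for a b e
      using that adj_in[OF i] adj_less[of a b i] adj_less[of "adj i a" "adj i b" i]
      by (auto simp: X_def transpose_eq_iff)
    show "(\<lambda>(a, b). (adj i a, adj i b)) ` X (d \<circ> adj i) \<subseteq> X d" using * by auto
    show "(\<lambda>(a, b). (adj i a, adj i b)) ` X d \<subseteq> X (d \<circ> adj i)"
      using *[of _ _ "d \<circ> adj i"] by (auto simp del: o_apply)
  qed auto
  then have "card (X (d \<circ> adj i)) = card (X d)" by (rule bij_betw_same_card)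
  then show ?thesis using pc[of d] pc[of "d \<circ> adj i"] by simp
qed

abbreviation ninv :: "nat \<Rightarrow> (nat \<Rightarrow> nat) \<Rightarrow> nat" where
  "ninv n c \<equiv> pair_count n (\<lambda>x y. y < x) c"

lemma ninv_asc: "i \<in> {1..<n} \<Longrightarrow> c i < c (Suc i) \<Longrightarrow> ninv n (c \<circ> adj i) = Suc (ninv n c)"
  and ninv_desc: "i \<in> {1..<n} \<Longrightarrow> c (Suc i) < c i \<Longrightarrow> ninv n c = Suc (ninv n (c \<circ> adj i))"
  using pair_count_adj[of i n "\<lambda>x y. y < x" c] by auto

lemma ninv_id [simp]: "ninv n id = 0"
proof -
  have "{(a, b). a \<in> {1..n} \<and> b \<in> {1..n} \<and> a < b \<and> id b < id a} = ({} :: (nat \<times> nat) set)" by auto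
  then show ?thesis by (simp only: pair_count_def card.empty)
qed

lemma ninv_step: "i \<in> {1..<n} \<Longrightarrow> ninv n (c \<circ> adj i) \<le> Suc (ninv n c)"
  using pair_count_adj[of i n "\<lambda>x y. y < x" c] by (simp split: if_splits)

lemma mono_on_Suc:
  assumes "\<And>i. i \<in> {1..<n} \<Longrightarrow> (c i :: nat) \<le> c (Suc i)"
  shows "mono_on {1..n} c"
proof (rule mono_onI)
  fix r s assume "r \<in> {1..n}" "s \<in> {1..n}" "r \<le> s"
  then have "1 \<le> r" "s \<le> n" by auto
  with \<open>r \<le> s\<close> show "c r \<le> c s"
  proof (induction s rule: dec_induct)
    case (step s)
    then show ?case using assms[of s] by simp
  qed simp
qed

lemma mono_on_perm_id:
  fixes w :: "nat \<Rightarrow> nat"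
  assumes w: "w permutes {1..n}" and m: "mono_on {1..n} w"
  shows "w = id"
proof -
  have w_in: "w k \<in> {1..n}" if "k \<in> {1..n}" for k using permutes_in_image[OF w] that by blast
  have inj: "inj w" using w by (rule permutes_inj)
  have lt: "w a < w b" if "a \<in> {1..n}" "b \<in> {1..n}" "a < b" for a b
  proof -
    have "w a \<le> w b" by (rule mono_onD[OF m]) (use that in auto)
    moreover have "w a \<noteq> w b" using injD[OF inj, of a b] that by auto
    ultimately show ?thesis by simp
  qed
  have ge: "k \<in> {1..n} \<Longrightarrow> k \<le> w k" for k
  proof (induction k)
    case (Suc k)
    then show ?case
    proof (cases "k = 0")
      case True
      then show ?thesis using w_in[of "Suc k"] Suc.prems by simp
    next
      case False
      then show ?thesis using Suc lt[of k "Suc k"] by fastforce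
    qed
  qed simp
  have le: "k \<in> {1..n} \<Longrightarrow> w k \<le> k" for k
  proof (induction "n - k" arbitrary: k)
    case 0
    then show ?case using w_in[of k] by simp
  next
    case (Suc d)
    have k: "Suc k \<in> {1..n}" using Suc.hyps(2) by auto
    then have "w (Suc k) \<le> Suc k" using Suc.hyps by auto
    then show ?case using lt[OF Suc.prems k] by simp
  qed
  show ?thesis
  proof
    fix k
    show "w k = id k"
      using ge[of k] le[of k] permutes_not_in[OF w, of k] by (cases "k \<in> {1..n}") auto
  qed
qed

abbreviation perms :: "nat \<Rightarrow> (nat \<Rightarrow> nat) set" where
  "perms n \<equiv> {w. w permutes {1..n}}"

lemma finite_perms: "finite (perms n)"
  by (simp add: finite_permutations)

lemma adj_permutes: "i \<in> {1..<n} \<Longrightarrow> adj i permutes {1..n}"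
  by (rule permutes_swap_id) auto

lemma comp_adj_permutes: "i \<in> {1..<n} \<Longrightarrow> c \<circ> adj i permutes {1..n} \<longleftrightarrow> c permutes {1..n}"
  using permutes_compose[OF adj_permutes, of i n c] permutes_compose[OF adj_permutes, of i n "c \<circ> adj i"]
  by (auto simp del: o_apply)

lemma ex_reduced:
  "w permutes {1..n} \<Longrightarrow> \<exists>l. set l \<subseteq> {1..<n} \<and> simple_product l = w \<and> length l = ninv n w"
proof (induction "ninv n w" arbitrary: w rule: less_induct)
  case less
  show ?case
  proof (cases "mono_on {1..n} w")
    case True
    then have "w = id" using mono_on_perm_id less.prems by blast
    moreover have "ninv n id = 0" by simp
    ultimately show ?thesis by (intro exI[of _ "[]"]) simp
  next
    case False
    then obtain i where i: "i \<in> {1..<n}" "w (Suc i) < w i" using mono_on_Suc[of n w] by force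
    have lt: "ninv n w = Suc (ninv n (w \<circ> adj i))" by (rule ninv_desc) fact+
    moreover have "w \<circ> adj i permutes {1..n}" using less.prems comp_adj_permutes i by blast
    ultimately obtain l where l: "set l \<subseteq> {1..<n}" "simple_product l = w \<circ> adj i"
      "length l = ninv n (w \<circ> adj i)" using less.hyps[of "w \<circ> adj i"] by auto
    then have "simple_product (l @ [i]) = w" by (simp del: o_apply)
    then show ?thesis using l i lt by (intro exI[of _ "l @ [i]"]) simp
  qed
qed

lemma ninv_simple_product: "set l \<subseteq> {1..<n} \<Longrightarrow> ninv n (simple_product l) \<le> length l"
proof (induction l rule: rev_induct)
  case Nil
  then show ?case by (simp del: id_apply)
next
  case (snoc i l)
  then show ?case using ninv_step[of i n "simple_product l"] by (simp del: o_apply)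
qed

lemma reduced_word:
  assumes "w permutes {1..n}"
  shows "set (reduced_word n w) \<subseteq> {1..<n}" "simple_product (reduced_word n w) = w"
    "length (reduced_word n w) = ninv n w"
proof -
  let ?Q = "\<lambda>l. set l \<subseteq> {1..<n} \<and> simple_product l = w"
  obtain l where l: "?Q l" "length l = ninv n w" using ex_reduced[OF assms] by blast
  have 1: "?Q (reduced_word n w) \<and> (\<forall>y. ?Q y \<longrightarrow> length (reduced_word n w) \<le> length y)"
    unfolding reduced_word_def by (rule arg_min_nat_lemma[of ?Q, OF l(1)])
  then show "set (reduced_word n w) \<subseteq> {1..<n}" "simple_product (reduced_word n w) = w" by auto
  show "length (reduced_word n w) = ninv n w"
    using 1 l ninv_simple_product[of "reduced_word n w" n] by (metis le_antisym)
qed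

text \<open>What the vectors \<open>de c\<close> have in common with the coset indicators
  \<open>chi n \<pi> c\<close>; results on T_w are proved once for both.\<close>

definition asc_family :: "nat \<Rightarrow> 'r::comm_ring_1 \<Rightarrow> ((nat \<Rightarrow> nat) \<Rightarrow> 'r vec) \<Rightarrow> bool" where
  "asc_family n q F \<longleftrightarrow>
    (\<forall>i\<in>{1..<n}. \<forall>c. c i < c (Suc i) \<longrightarrow> T q i \<triangleright> F c = F (c \<circ> adj i))"

lemma asc_family_de: "asc_family n q de"
  by (simp add: asc_family_def T_de_asc del: o_apply)

text \<open>Read from the right, a reduced word interchanges at each step two letters whose original
  places form an inversion of its product. The assumption on \<open>c\<close> says exactly that
  these are ascents of \<open>c\<close>.\<close>

lemma Tl_asc_family:
  assumes F: "asc_family n q F"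
  shows "set l \<subseteq> {1..<n} \<Longrightarrow> length l = ninv n (simple_product l) \<Longrightarrow>
    (\<And>a b. a \<in> {1..n} \<Longrightarrow> b \<in> {1..n} \<Longrightarrow> a < b \<Longrightarrow> simple_product l b < simple_product l a \<Longrightarrow> c a < c b) \<Longrightarrow>
    Tl q l \<triangleright> F c = F (c \<circ> simple_product (rev l))"
proof (induction l arbitrary: c rule: rev_induct)
  case (snoc i l)
  define d where "d = simple_product l"
  have i: "i \<in> {1..<n}" and l: "set l \<subseteq> {1..<n}" using snoc.prems by auto
  have sp: "simple_product (l @ [i]) = d \<circ> adj i" by (simp add: d_def)
  have len: "Suc (length l) = ninv n (d \<circ> adj i)"
    using snoc.prems(2) by (simp add: sp del: o_apply simple_product_append)
  have "ninv n d \<le> length l" unfolding d_def by (rule ninv_simple_product[OF l])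
  then have red: "length l = ninv n d" using ninv_step[OF i, of d] len by linarith
  \<comment> \<open>If this failed, the last letter would not add an inversion, and the word would
    not be reduced.\<close>
  have "d i < d (Suc i)"
  proof (rule ccontr)
    assume "\<not> d i < d (Suc i)"
    then have "ninv n (d \<circ> adj i) \<le> ninv n d"
      using pair_count_adj[OF i, of "\<lambda>x y. y < x" d] by (simp split: if_splits)
    then show False using len red by simp
  qed
  note asc = this
  have "c i < c (Suc i)"
    by (rule snoc.prems(3)) (use i asc in \<open>auto simp: sp simp del: simple_product_append\<close>)
  then have "Tl q (l @ [i]) \<triangleright> F c = Tl q l \<triangleright> F (c \<circ> adj i)"
    using F i by (simp add: asc_family_def del: o_apply)
  also have "\<dots> = F (c \<circ> adj i \<circ> simple_product (rev l))"
  proof (rule snoc.IH[OF l])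
    show "length l = ninv n (simple_product l)" using red d_def by simp
    fix a b assume ab: "a \<in> {1..n}" "b \<in> {1..n}" "a < b" "simple_product l b < simple_product l a"
    have "adj i a < adj i b"
      using adj_less[OF ab(3), of i] ab(4) asc d_def by fastforce
    moreover have "adj i a \<in> {1..n}" "adj i b \<in> {1..n}"
      using ab adj_in[OF i, of a] adj_in[OF i, of b] by blast+
    moreover have "simple_product (l @ [i]) (adj i b) < simple_product (l @ [i]) (adj i a)"
      using ab(4) unfolding sp d_def by simp
    ultimately have "c (adj i a) < c (adj i b)"
      by (metis snoc.prems(3))
    then show "(c \<circ> adj i) a < (c \<circ> adj i) b" by simp
  qed
  finally show ?case by (simp add: comp_assoc del: o_apply)
qed simp

definition Tw :: "nat \<Rightarrow> 'r::comm_ring_1 \<Rightarrow> (nat \<Rightarrow> nat) \<Rightarrow> 'r endo" where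
  "Tw n q w = Tl q (reduced_word n w)"

lemma simple_product_rev_inv: "simple_product (rev l) = pinv (simple_product l)"
  by (rule inv_unique_comp[symmetric]) (rule simple_product_rev simple_product_rev')+

lemma Tw_asc_family:
  assumes "asc_family n q F" "w permutes {1..n}"
    "\<And>a b. a \<in> {1..n} \<Longrightarrow> b \<in> {1..n} \<Longrightarrow> a < b \<Longrightarrow> w b < w a \<Longrightarrow> c a < c b"
  shows "Tw n q w \<triangleright> F c = F (c \<circ> pinv w)"
  using Tl_asc_family[OF assms(1), of "reduced_word n w" c] reduced_word[OF assms(2)] assms(3)
  by (simp add: Tw_def simple_product_rev_inv del: o_apply)

text \<open>Together with \<open>Hk_eqI\<close> this shows that T_w is independent of the reduced
  word chosen. The inverse occurs because places, not letters, are permuted.\<close>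

lemma Tw_de_id: "w permutes {1..n} \<Longrightarrow> Tw n q w \<triangleright> de id = de (pinv w)"
  using Tw_asc_family[OF asc_family_de, of w n id q] by simp

lemma ninv_inv: 
  assumes "w permutes {1..n}"
  shows "ninv n (pinv w) = ninv n w"
proof -
  have w: "w a \<in> {1..n} \<longleftrightarrow> a \<in> {1..n}" "pinv w a \<in> {1..n} \<longleftrightarrow> a \<in> {1..n}" for a
    using permutes_in_image[OF assms] permutes_in_image[OF permutes_inv[OF assms]] by blast+
  have "bij_betw (\<lambda>(a, b). (w b, w a))
    {(a, b). a \<in> {1..n} \<and> b \<in> {1..n} \<and> a < b \<and> w b < w a}
    {(a, b). a \<in> {1..n} \<and> b \<in> {1..n} \<and> a < b \<and> pinv w b < pinv w a}"
    by (rule bij_betw_byWitness[where f' = "\<lambda>(a, b). (pinv w b, pinv w a)"])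
      (use w in \<open>auto simp: permutes_inverses[OF assms]\<close>)
  then show ?thesis
    unfolding pair_count_def using bij_betw_same_card by fastforce
qed

section \<open>The image of the Hecke algebra\<close>

definition Hk :: "nat \<Rightarrow> 'r::comm_ring_1 \<Rightarrow> 'r endo set" where
  "Hk n q = act q ` carrier (free_alg n)"

lemma Hk_I: "f \<in> carrier (free_alg n) \<Longrightarrow> act q f \<in> Hk n q"
  by (simp add: Hk_def)

lemma Hk_E: "a \<in> Hk n q \<Longrightarrow> (\<And>f. f \<in> carrier (free_alg n) \<Longrightarrow> a = act q f \<Longrightarrow> thesis) \<Longrightarrow> thesis"
  by (auto simp: Hk_def)

lemma Hk_zero [simp]: "0 \<in> Hk n q"
  using Hk_I[OF free_alg_zero, of q n] by simp

lemma Hk_one [simp]: "1 \<in> Hk n q"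
  using Hk_I[OF free_alg_one, of q n] by simp

lemma Hk_add: "a \<in> Hk n q \<Longrightarrow> b \<in> Hk n q \<Longrightarrow> a + b \<in> Hk n q"
  by (auto simp: Hk_def act_add[symmetric] intro!: imageI free_alg_add)

lemma Hk_diff: "a \<in> Hk n q \<Longrightarrow> b \<in> Hk n q \<Longrightarrow> a - b \<in> Hk n q"
  by (auto simp: Hk_def act_diff[symmetric] intro!: imageI free_alg_diff)

lemma Hk_mult: "a \<in> Hk n q \<Longrightarrow> b \<in> Hk n q \<Longrightarrow> a * b \<in> Hk n q"
  by (auto simp: Hk_def act_mult[symmetric] intro!: imageI free_alg_mult)

lemma Hk_smul: "a \<in> Hk n q \<Longrightarrow> smul r a \<in> Hk n q"
  using Hk_mult[OF Hk_I[OF free_alg_const], of a n q r] by simp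

lemma Hk_sum: "(\<And>i. i \<in> A \<Longrightarrow> f i \<in> Hk n q) \<Longrightarrow> sum f A \<in> Hk n q"
  by (induction A rule: infinite_finite_induct) (auto simp: Hk_add)

lemma Hk_subspace: "endo_subspace (Hk n q)"
  by (simp add: endo.subspace_def Hk_add Hk_smul)

lemma Hk_Tl: "set l \<subseteq> {1..<n} \<Longrightarrow> Tl q l \<in> Hk n q"
  using Hk_I[OF mon_carrier, of l n q] by (simp add: act_single)

lemma Hk_T: "i \<in> {1..<n} \<Longrightarrow> T q i \<in> Hk n q"
  using Hk_Tl[of "[i]" n q] by simp

lemma Hk_Tw: "w permutes {1..n} \<Longrightarrow> Tw n q w \<in> Hk n q"
  by (simp add: Tw_def Hk_Tl reduced_word)

lemma Hk_eqI: 
  assumes "a \<in> Hk n q" "b \<in> Hk n q" "a \<triangleright> de id = b \<triangleright> de id"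
  shows "a = b"
proof -
  obtain f where f: "f \<in> carrier (free_alg n)" "a - b = act q f"
    using Hk_diff[OF assms(1,2)] Hk_E by blast
  then have "act q f \<triangleright> de id = 0" using assms(3) by (metis minus_app diff_self)
  then have "a - b = 0" using f act_faithful act_hecke_ideal by metis
  then show ?thesis by simp
qed

lemma Hk_induct [consumes 1, case_names Tl add smul]:
  assumes "a \<in> Hk n q"
    "\<And>l. set l \<subseteq> {1..<n} \<Longrightarrow> Q (Tl q l)"
    "\<And>a b. a \<in> Hk n q \<Longrightarrow> b \<in> Hk n q \<Longrightarrow> Q a \<Longrightarrow> Q b \<Longrightarrow> Q (a + b)"
    "\<And>r a. a \<in> Hk n q \<Longrightarrow> Q a \<Longrightarrow> Q (smul r a)"
  shows "Q a"
proof -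
  obtain f where f: "f \<in> carrier (free_alg n)" "a = act q f" using assms(1) Hk_E by blast
  have "(\<Sum>w\<in>K. smul (Poly_Mapping.lookup f w) (Tl q (letters w))) \<in> Hk n q \<and>
      Q (\<Sum>w\<in>K. smul (Poly_Mapping.lookup f w) (Tl q (letters w)))"
    if "finite K" "K \<subseteq> Poly_Mapping.keys f" for K
    using that
  proof (induction K)
    case empty
    then show ?case using assms(4)[of "Tl q []" 0] assms(2)[of "[]"] by simp
  next
    case (insert w K)
    then have w: "set (letters w) \<subseteq> {1..<n}" using f(1) by (auto simp: carrier_free_alg)
    have "smul (Poly_Mapping.lookup f w) (Tl q (letters w)) \<in> Hk n q"
      "Q (smul (Poly_Mapping.lookup f w) (Tl q (letters w)))"
      using assms(2)[OF w] assms(4) Hk_Tl[OF w] Hk_smul by blast+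
    then show ?case using insert assms(3) by (auto simp: Hk_add)
  qed
  then show ?thesis using f by (simp add: act_def)
qed

section \<open>Elements of the algebra as functions of permutations\<close>

definition supp :: "nat \<Rightarrow> 'r::comm_ring_1 vec \<Rightarrow> bool" where
  "supp n u \<longleftrightarrow> (\<forall>c. \<not> c permutes {1..n} \<longrightarrow> u c = 0)"

lemma supp_de: "c permutes {1..n} \<Longrightarrow> supp n (de c)"
  by (auto simp: supp_def de_def)

lemma supp_Hk: "a \<in> Hk n q \<Longrightarrow> supp n u \<Longrightarrow> supp n (a \<triangleright> u)"
proof (induction rule: Hk_induct)
  case (Tl l)
  then show ?case
  proof (induction l)
    case (Cons i l)
    then show ?case by (auto simp: supp_def T_app comp_adj_permutes simp del: o_apply)
  qed simp
qed (auto simp: supp_def)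

text \<open>The inverse of evaluation at \<open>de id\<close>: on the functions supported on
  permutations it returns the element with these coordinates, see \<open>el_app\<close> and
  \<open>el_eq\<close>.\<close>

definition el :: "nat \<Rightarrow> 'r::comm_ring_1 \<Rightarrow> 'r vec \<Rightarrow> 'r endo" where
  "el n q u = (\<Sum>c\<in>perms n. smul (u c) (Tw n q (pinv c)))"

lemma el_Hk: "el n q u \<in> Hk n q"
  unfolding el_def by (intro Hk_sum Hk_smul Hk_Tw) (auto intro: permutes_inv)

lemma el_app:
  assumes "supp n u"
  shows "el n q u \<triangleright> de id = u"
proof (rule ext)
  fix d
  have "(el n q u \<triangleright> de id) d = (\<Sum>c\<in>perms n. if c = d then u c else 0)"
    unfolding el_def sum_app sum_fun_apply
  proof (intro sum.cong refl)
    fix c assume "c \<in> perms n"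
    then have "Tw n q (pinv c) \<triangleright> de id = de c"
      by (simp add: Tw_de_id permutes_inv permutes_inv_inv)
    then show "(smul (u c) (Tw n q (pinv c)) \<triangleright> de id) d = (if c = d then u c else 0)"
      by (auto simp: de_def[of c])
  qed
  also have "\<dots> = u d"
    using assms finite_perms[of n] by (auto simp: supp_def)
  finally show "(el n q u \<triangleright> de id) d = u d" .
qed

lemma el_eq: "a \<in> Hk n q \<Longrightarrow> el n q (a \<triangleright> de id) = a"
  by (rule Hk_eqI[of _ n q]) (auto simp: el_Hk el_app supp_Hk supp_de permutes_id)

lemma Hk_span_Tw: "Hk n q = endo_span (Tw n q ` perms n)"
proof
  show "Hk n q \<subseteq> endo_span (Tw n q ` perms n)"
  proof
    fix a assume "a \<in> Hk n q"
    then have "a = el n q (a \<triangleright> de id)" by (simp add: el_eq)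
    also have "\<dots> \<in> endo_span (Tw n q ` perms n)"
      unfolding el_def by (intro endo.span_sum endo.span_scale endo.span_base imageI)
        (auto intro: permutes_inv)
    finally show "a \<in> endo_span (Tw n q ` perms n)" .
  qed
  show "endo_span (Tw n q ` perms n) \<subseteq> Hk n q"
    by (rule endo.span_minimal[OF _ Hk_subspace]) (auto intro: Hk_Tw)
qed

text \<open>An ascent of c gives T_i the entry 1 from c to the interchanged word and the entry q
  back; the weight \<open>q ^ ninv n c\<close> compensates this and makes T_i self-adjoint.\<close>

definition bf :: "nat \<Rightarrow> 'r::comm_ring_1 \<Rightarrow> 'r vec \<Rightarrow> 'r vec \<Rightarrow> 'r" where
  "bf n q u v = (\<Sum>c\<in>perms n. q ^ ninv n c * u c * v c)"

lemma bf_sym: "bf n q u v = bf n q v u"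
  by (simp add: bf_def mult_ac)

lemma bf_add_left: "bf n q (u + u') v = bf n q u v + bf n q u' v"
  and bf_vsc_left: "bf n q (vsc r u) v = r * bf n q u v"
  by (simp_all add: bf_def algebra_simps sum.distrib sum_distrib_left)

lemma bf_add_right: "bf n q u (v + v') = bf n q u v + bf n q u v'"
  and bf_vsc_right: "bf n q u (vsc r v) = r * bf n q u v"
  using bf_add_left bf_vsc_left bf_sym by metis+

lemma bf_de_left: "c permutes {1..n} \<Longrightarrow> bf n q (de c) v = q ^ ninv n c * v c"
proof -
  assume "c permutes {1..n}"
  have "bf n q (de c) v = (\<Sum>d\<in>perms n. if d = c then q ^ ninv n d * v d else 0)"
    unfolding bf_def by (intro sum.cong) (auto simp: de_def)
  then show ?thesis using \<open>c permutes {1..n}\<close> finite_perms[of n] by simp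
qed

lemma bf_T:
  assumes i: "i \<in> {1..<n}"
  shows "bf n q (T q i \<triangleright> u) v = bf n q u (T q i \<triangleright> v)"
proof -
  \<comment> \<open>\<open>D\<close> is the difference of the two summands. It changes sign when the
    places i and i + 1 are interchanged, so the ascents cancel against the descents.\<close>
  define D where "D c = q ^ ninv n c * ((T q i \<triangleright> u) c * v c - u c * (T q i \<triangleright> v) c)" for c
  let ?A = "{c \<in> perms n. c i < c (Suc i)}" and ?B = "{c \<in> perms n. c (Suc i) < c i}"
  have neq: "c i \<noteq> c (Suc i)" if "c permutes {1..n}" for c
    using permutes_inj[OF that] by (metis injD n_not_Suc_n)
  have AB: "perms n = ?A \<union> ?B"
  proof (rule Set.set_eqI)
    fix c show "c \<in> perms n \<longleftrightarrow> c \<in> ?A \<union> ?B" using neq[of c] by auto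
  qed
  have D: "D (c \<circ> adj i) = - D c" if "c \<in> ?A" for c
  proof -
    from that have c: "c i < c (Suc i)" by simp
    have n: "ninv n (c \<circ> adj i) = Suc (ninv n c)" by (rule ninv_asc[where c = c]) fact+
    have "(c \<circ> adj i) i = c (Suc i)" "(c \<circ> adj i) (Suc i) = c i" by simp_all
    then show ?thesis
      using c unfolding D_def n T_app comp_adj_adj
      by (simp add: algebra_simps del: o_apply)
  qed
  have "bij_betw (\<lambda>c. c \<circ> adj i) ?A ?B"
    by (rule bij_betw_byWitness[where f' = "\<lambda>c. c \<circ> adj i"])
      (auto simp: comp_adj_permutes[OF i] simp del: o_apply simp add: comp_adj_apply)
  then have "sum D ?B = (\<Sum>c\<in>?A. D (c \<circ> adj i))"
    by (simp add: sum.reindex_bij_betw[symmetric] del: o_apply)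
  also have "\<dots> = - sum D ?A" using D by (simp add: sum_negf del: o_apply)
  finally have "sum D ?A + sum D ?B = 0" by simp
  moreover have "sum D (perms n) = sum D ?A + sum D ?B"
    by (subst AB, rule sum.union_disjoint) (use finite_perms[of n] in auto)
  ultimately have "sum D (perms n) = 0" by simp
  then show ?thesis
    by (simp add: D_def bf_def algebra_simps sum_subtractf)
qed

lemma bf_Tl: "set l \<subseteq> {1..<n} \<Longrightarrow> bf n q (Tl q l \<triangleright> u) v = bf n q u (Tl q (rev l) \<triangleright> v)"
  by (induction l arbitrary: u v) (simp_all add: bf_T)

lemma ex_adjoint:
  "a \<in> Hk n q \<Longrightarrow> \<exists>b\<in>Hk n q. \<forall>u v. bf n q (a \<triangleright> u) v = bf n q u (b \<triangleright> v)"
proof (induction rule: Hk_induct)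
  case (Tl l)
  then show ?case by (intro bexI[of _ "Tl q (rev l)"]) (auto simp: bf_Tl Hk_Tl)
next
  case (add a b)
  then obtain a' b' where "a' \<in> Hk n q" "\<forall>u v. bf n q (a \<triangleright> u) v = bf n q u (a' \<triangleright> v)"
    "b' \<in> Hk n q" "\<forall>u v. bf n q (b \<triangleright> u) v = bf n q u (b' \<triangleright> v)" by auto
  then show ?case
    by (intro bexI[of _ "a' + b'"]) (simp_all add: Hk_add bf_add_left bf_add_right del: plus_fun_apply)
next
  case (smul r a)
  then obtain a' where "a' \<in> Hk n q" "\<forall>u v. bf n q (a \<triangleright> u) v = bf n q u (a' \<triangleright> v)" by auto
  then show ?case
    by (intro bexI[of _ "smul r a'"]) (simp_all add: Hk_smul bf_vsc_left bf_vsc_right del: vsc_apply)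
qed

section \<open>The involution and the trace form for an invertible parameter\<close>

locale hecke_unit =
  fixes n :: nat and q :: "'r::comm_ring_1"
  assumes unit: "q dvd 1"
begin

abbreviation "H \<equiv> Hk n q"
abbreviation "P \<equiv> perms n"
abbreviation "W \<equiv> Tw n q"

lemma q_power_cancel: "q ^ k * x = q ^ k * y \<Longrightarrow> x = y"
proof -
  assume *: "q ^ k * x = q ^ k * y"
  obtain p where "q * p = 1" using unit by (metis dvd_def)
  then have "p ^ k * q ^ k = 1" by (metis mult.commute power_mult_distrib power_one)
  then show ?thesis using * by (metis mult.assoc mult_1)
qed

lemma bf_nondeg:
  assumes "supp n u" "supp n v" "\<And>w. w permutes {1..n} \<Longrightarrow> bf n q (de w) u = bf n q (de w) v"
  shows "u = v"
proof
  fix c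
  show "u c = v c"
  proof (cases "c permutes {1..n}")
    case True
    then show ?thesis using assms(3)[of c] q_power_cancel by (simp add: bf_de_left)
  qed (use assms(1,2) in \<open>simp add: supp_def\<close>)
qed

text \<open>Taken as the adjoint for \<open>bf\<close> rather than by reversing words: uniqueness is
  then nondegeneracy of the form, and the product rule is formal. That reversal of words gives the
  same map is shown in \<open>star_Tl\<close>.\<close>

definition star :: "'r endo \<Rightarrow> 'r endo" where
  "star a = (SOME b. b \<in> H \<and> (\<forall>u v. bf n q (a \<triangleright> u) v = bf n q u (b \<triangleright> v)))"

lemma star_Hk: "a \<in> H \<Longrightarrow> star a \<in> H"
  and star_bf: "a \<in> H \<Longrightarrow> bf n q (a \<triangleright> u) v = bf n q u (star a \<triangleright> v)"
proof -
  assume "a \<in> H"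
  from someI_ex[OF ex_adjoint[unfolded Bex_def, OF this]]
  show "star a \<in> H" "bf n q (a \<triangleright> u) v = bf n q u (star a \<triangleright> v)"
    unfolding star_def by blast+
qed

lemma star_eqI:
  assumes "a \<in> H" "b \<in> H" "\<And>u v. bf n q (a \<triangleright> u) v = bf n q u (b \<triangleright> v)"
  shows "star a = b"
proof (rule Hk_eqI[OF star_Hk])
  show "star a \<triangleright> de id = b \<triangleright> de id"
    by (rule bf_nondeg[OF supp_Hk[OF star_Hk] supp_Hk])
      (use assms in \<open>simp_all add: supp_de star_bf[symmetric] permutes_id\<close>)
qed fact+

lemma star_add: "a \<in> H \<Longrightarrow> b \<in> H \<Longrightarrow> star (a + b) = star a + star b"
  by (rule star_eqI) (simp_all add: Hk_add star_Hk bf_add_left bf_add_right star_bf)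

lemma star_smul: "a \<in> H \<Longrightarrow> star (smul r a) = smul r (star a)"
  by (rule star_eqI) (simp_all add: Hk_smul star_Hk bf_vsc_left bf_vsc_right star_bf)

lemma star_mult: "a \<in> H \<Longrightarrow> b \<in> H \<Longrightarrow> star (a * b) = star b * star a"
  by (rule star_eqI) (simp_all add: Hk_mult star_Hk star_bf)

lemma star_star: "a \<in> H \<Longrightarrow> star (star a) = a"
  by (rule star_eqI) (simp_all add: star_Hk, metis star_bf bf_sym)

lemma star_zero [simp]: "star 0 = 0"
  by (rule star_eqI) (simp_all add: bf_def)

lemma star_one [simp]: "star 1 = 1"
  by (rule star_eqI) simp_all

lemma star_sum: "(\<And>i. i \<in> A \<Longrightarrow> f i \<in> H) \<Longrightarrow> star (sum f A) = (\<Sum>i\<in>A. star (f i))"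
  by (induction A rule: infinite_finite_induct) (auto simp: star_add Hk_sum)

lemma star_Tl: "set l \<subseteq> {1..<n} \<Longrightarrow> star (Tl q l) = Tl q (rev l)"
  by (rule star_eqI) (simp_all add: Hk_Tl bf_Tl)

lemma star_T: "i \<in> {1..<n} \<Longrightarrow> star (T q i) = T q i"
  using star_Tl[of "[i]"] by simp

lemma star_W:
  assumes "w permutes {1..n}"
  shows "star (W w) = W (pinv w)"
proof (rule Hk_eqI[OF star_Hk[OF Hk_Tw[OF assms]] Hk_Tw[OF permutes_inv[OF assms]]])
  let ?l = "rev (reduced_word n w)"
  note rw = reduced_word[OF assms]
  have "Tl q ?l \<triangleright> de id = de (id \<circ> simple_product (rev ?l))"
    by (rule Tl_asc_family[OF asc_family_de])
      (use rw assms in \<open>auto simp: simple_product_rev_inv ninv_inv\<close>)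
  then show "star (W w) \<triangleright> de id = W (pinv w) \<triangleright> de id"
    using rw assms by (simp add: Tw_def[of n q w] star_Tl Tw_de_id permutes_inv permutes_inv_inv)
qed

lemma star_coeff:
  assumes "a \<in> H" "c permutes {1..n}"
  shows "(star a \<triangleright> de id) c = (a \<triangleright> de id) (pinv c)"
proof -
  let ?u = "a \<triangleright> de id"
  have "star a = star (el n q ?u)" using assms by (simp add: el_eq)
  also have "\<dots> = (\<Sum>c\<in>P. smul (?u c) (W c))"
    unfolding el_def
    by (subst star_sum) (auto intro!: sum.cong simp: Hk_smul Hk_Tw star_smul star_W permutes_inv permutes_inv_inv)
  finally have "(star a \<triangleright> de id) c = (\<Sum>d\<in>P. ?u d * de (pinv d) c)"
    by (simp add: sum_app sum_fun_apply Tw_de_id)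
  also have "\<dots> = (\<Sum>d\<in>P. if d = pinv c then ?u d else 0)"
    using assms(2) by (intro sum.cong) (auto simp: de_def permutes_inv_inv)
  also have "\<dots> = ?u (pinv c)"
    using assms(2) finite_perms[of n] by (simp add: permutes_inv)
  finally show ?thesis .
qed

definition tr :: "'r endo \<Rightarrow> 'r" where
  "tr a = (a \<triangleright> de id) id"

lemma tr_bf: "tr a = bf n q (de id) (a \<triangleright> de id)"
proof -
  show ?thesis by (simp only: bf_de_left[OF permutes_id] ninv_id tr_def power_0 mult_1)
qed

lemma tr_star: "a \<in> H \<Longrightarrow> tr (star a) = tr a"
  using star_coeff[of a id] by (simp add: tr_def permutes_id)

lemma tr_mult: "a \<in> H \<Longrightarrow> tr (a * b) = bf n q (star a \<triangleright> de id) (b \<triangleright> de id)"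
  using star_bf[OF star_Hk, of a "de id" "b \<triangleright> de id"] by (simp add: tr_bf star_star)

lemma tr_zero [simp]: "tr 0 = 0"
  and tr_add: "tr (a + b) = tr a + tr b"
  and tr_smul: "tr (smul r a) = r * tr a"
  by (simp_all add: tr_def)

lemma tr_sum: "tr (sum f A) = (\<Sum>i\<in>A. tr (f i))"
  by (induction A rule: infinite_finite_induct) (auto simp: tr_add)

lemma tr_nondeg_right:
  assumes "y \<in> H" "\<And>h. h \<in> H \<Longrightarrow> tr (h * y) = 0"
  shows "y = 0"
proof (rule Hk_eqI[OF assms(1) Hk_zero])
  show "y \<triangleright> de id = 0 \<triangleright> de id"
  proof (rule bf_nondeg[OF supp_Hk[OF assms(1)] supp_Hk[OF Hk_zero]])
    fix w assume w: "w permutes {1..n}"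
    then have "tr (W w * y) = 0" using assms(2) Hk_Tw by blast
    then show "bf n q (de w) (y \<triangleright> de id) = bf n q (de w) (0 \<triangleright> de id)"
      using w by (simp add: tr_mult Hk_Tw star_W Tw_de_id permutes_inv permutes_inv_inv bf_def)
  qed (simp_all add: supp_de permutes_id)
qed

lemma tr_nondeg_left:
  assumes "y \<in> H" "\<And>h. h \<in> H \<Longrightarrow> tr (y * h) = 0"
  shows "y = 0"
proof -
  have "star y = 0"
  proof (rule tr_nondeg_right[OF star_Hk[OF assms(1)]])
    fix h assume h: "h \<in> H"
    have "tr (h * star y) = tr (star (y * star h))"
      using h assms by (simp add: star_mult star_Hk star_star)
    also have "\<dots> = 0" using h assms by (simp add: tr_star Hk_mult star_Hk)
    finally show "tr (h * star y) = 0" .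
  qed
  then show ?thesis using star_star[OF assms(1)] by simp
qed

text \<open>The form \<open>bf\<close> is diagonal in the vectors \<open>de c\<close> with
  invertible entries, so every linear functional is represented, over any ring of
  coefficients.\<close>

lemma functional_tr_left:
  assumes add: "\<And>a b. a \<in> H \<Longrightarrow> b \<in> H \<Longrightarrow> \<phi> (a + b) = \<phi> a + \<phi> b"
    and smul: "\<And>r a. a \<in> H \<Longrightarrow> \<phi> (smul r a) = r * \<phi> a"
  shows "\<exists>b\<in>H. \<forall>y\<in>H. \<phi> y = tr (b * y)"
proof -
  have zero: "\<phi> 0 = 0" using smul[of 0 0] by simp
  have sum: "\<phi> (sum f A) = (\<Sum>i\<in>A. \<phi> (f i))" if "\<And>i. i \<in> A \<Longrightarrow> f i \<in> H" for f and A :: "(nat \<Rightarrow> nat) set"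
    using that by (induction A rule: infinite_finite_induct) (auto simp: zero add Hk_sum)
  obtain p where p: "q * p = 1" using unit by (metis dvd_def)
  then have pq: "q ^ k * (p ^ k * x) = x" for k x
    by (metis mult.assoc mult_1 power_mult_distrib power_one)
  have pq2: "q ^ k * (x * p ^ k) = x" for k x
    using pq[of k x] by (simp add: mult.commute)
  \<comment> \<open>Division of the value of the functional at the basis element by the diagonal
    entry \<open>q ^ ninv n c\<close>; here p is the inverse of q.\<close>
  define v where "v c = (if c \<in> P then p ^ ninv n c * \<phi> (W (pinv c)) else 0)" for c
  have v: "supp n v" by (simp add: supp_def v_def)
  have "\<phi> y = tr (star (el n q v) * y)" if y: "y \<in> H" for y
  proof -
    have "tr (star (el n q v) * y) = bf n q v (y \<triangleright> de id)"
      using y v by (simp add: tr_mult el_Hk star_Hk star_star el_app)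
    also have "\<dots> = (\<Sum>c\<in>P. (y \<triangleright> de id) c * \<phi> (W (pinv c)))"
      unfolding bf_def by (intro sum.cong) (auto simp: v_def pq2 mult.commute)
    also have "\<dots> = \<phi> (el n q (y \<triangleright> de id))"
      unfolding el_def by (subst sum) (auto intro!: sum.cong simp: smul Hk_smul Hk_Tw permutes_inv)
    finally show ?thesis using y by (simp add: el_eq)
  qed
  then show ?thesis using star_Hk[OF el_Hk] by blast
qed

lemma functional_tr_right:
  assumes add: "\<And>a b. a \<in> H \<Longrightarrow> b \<in> H \<Longrightarrow> \<phi> (a + b) = \<phi> a + \<phi> b"
    and smul: "\<And>r a. a \<in> H \<Longrightarrow> \<phi> (smul r a) = r * \<phi> a"
  shows "\<exists>b\<in>H. \<forall>y\<in>H. \<phi> y = tr (y * b)"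
proof -
  obtain b where b: "b \<in> H" "\<And>y. y \<in> H \<Longrightarrow> \<phi> (star y) = tr (b * y)"
    using functional_tr_left[of "\<lambda>y. \<phi> (star y)"] assms by (auto simp: star_add star_smul star_Hk)
  have "\<phi> y = tr (y * star b)" if "y \<in> H" for y
  proof -
    have "\<phi> y = tr (b * star y)" using b(2)[of "star y"] that by (simp add: star_Hk star_star)
    also have "\<dots> = tr (star (b * star y))" using b that by (simp add: tr_star Hk_mult star_Hk)
    finally show ?thesis using b that by (simp add: star_mult star_star star_Hk)
  qed
  then show ?thesis using b star_Hk by blast
qed

end

section \<open>Young sums\<close>

definition stab :: "nat \<Rightarrow> (nat \<Rightarrow> nat) \<Rightarrow> (nat \<Rightarrow> nat) set" where
  "stab n \<pi> = {u. u permutes {1..n} \<and> \<pi> \<circ> u = \<pi>}"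

text \<open>For the row word of a partition this is \<open>x(\<lambda>)\<close>.\<close>

definition ys :: "nat \<Rightarrow> 'r::comm_ring_1 \<Rightarrow> (nat \<Rightarrow> nat) \<Rightarrow> 'r endo" where
  "ys n q \<pi> = (\<Sum>u\<in>stab n \<pi>. Tw n q u)"

definition words :: "nat \<Rightarrow> (nat \<Rightarrow> nat) \<Rightarrow> (nat \<Rightarrow> nat) set" where
  "words n \<pi> = (\<lambda>p. \<pi> \<circ> p) ` perms n"

text \<open>The indicator of a coset of \<open>stab n \<pi>\<close>, hence the image of the basis
  vector at \<open>c\<close> when functions of words are pulled back along \<pi>
  (\<open>pull_de\<close>). These vectors are the word model of the left ideal generated by the
  Young sum.\<close>

definition chi :: "nat \<Rightarrow> (nat \<Rightarrow> nat) \<Rightarrow> (nat \<Rightarrow> nat) \<Rightarrow> 'r::comm_ring_1 vec" where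
  "chi n \<pi> c = (\<lambda>p. if p permutes {1..n} \<and> \<pi> \<circ> p = c then 1 else 0)"

lemma finite_stab: "finite (stab n \<pi>)"
  using finite_perms[of n] by (rule finite_subset[rotated]) (auto simp: stab_def)

lemma stab_permutes: "u \<in> stab n \<pi> \<Longrightarrow> u permutes {1..n}"
  by (simp add: stab_def)

lemma finite_words: "finite (words n \<pi>)"
  by (simp add: words_def finite_perms)

lemma words_self: "\<pi> \<in> words n \<pi>"
  unfolding words_def using permutes_id[of "{1..n}"] by (intro image_eqI[of _ _ id]) auto

lemma words_comp: "c \<in> words n \<pi> \<Longrightarrow> p permutes {1..n} \<Longrightarrow> c \<circ> p \<in> words n \<pi>"
  by (auto simp: words_def comp_assoc permutes_compose intro!: image_eqI[where x = "_ \<circ> p"])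

lemma words_adj: "i \<in> {1..<n} \<Longrightarrow> c \<in> words n \<pi> \<Longrightarrow> c \<circ> adj i \<in> words n \<pi>"
  using words_comp adj_permutes by blast

lemma pinv_comp: "p permutes {1..n} \<Longrightarrow> p \<circ> pinv p = id" "p permutes {1..n} \<Longrightarrow> pinv p \<circ> p = id"
  by (rule permutes_inv_o(1), assumption, rule permutes_inv_o(2), assumption)

lemma comp_pinv_cancel:
  assumes "u permutes {1..n}"
  shows "f \<circ> u \<circ> pinv u = f" "f \<circ> pinv u \<circ> u = f" "pinv u \<circ> (u \<circ> g) = g" "u \<circ> (pinv u \<circ> g) = g"
  using pinv_comp[OF assms] by (metis comp_assoc comp_id id_comp)+

lemma stab_pinv: "u \<in> stab n \<pi> \<Longrightarrow> pinv u \<in> stab n \<pi>"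
proof -
  assume u: "u \<in> stab n \<pi>"
  then have up: "u permutes {1..n}" "\<pi> \<circ> u = \<pi>" by (auto simp: stab_def)
  have "\<pi> \<circ> pinv u = \<pi>" using comp_pinv_cancel(1)[OF up(1), of \<pi>] by (simp only: up(2))
  then show ?thesis using u by (simp add: stab_def permutes_inv)
qed

lemma mono_words_unique:
  assumes \<pi>: "mono_on {1..n} (\<pi> :: nat \<Rightarrow> nat)" and p: "p permutes {1..n}"
    and m: "mono_on {1..n} (\<pi> \<circ> p)"
  shows "\<pi> \<circ> p = \<pi>"
proof -
  have s: "sorted (map f [1..<Suc n])" if "mono_on {1..n} f" for f :: "nat \<Rightarrow> nat"
    unfolding sorted_iff_nth_mono using mono_onD[OF that] by (auto simp: nth_append)
  have "mset (map (\<pi> \<circ> p) [1..<Suc n]) = image_mset \<pi> (image_mset p (mset_set {1..n}))"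
    by (simp add: atLeastLessThanSuc_atLeastAtMost multiset.map_comp)
  also have "image_mset p (mset_set {1..n}) = mset_set {1..n}"
    using image_mset_mset_set[OF permutes_inj_on[OF p], of "{1..n}"] permutes_image[OF p] by simp
  also have "image_mset \<pi> (mset_set {1..n}) = mset (map \<pi> [1..<Suc n])"
    by (simp add: atLeastLessThanSuc_atLeastAtMost)
  finally have "map (\<pi> \<circ> p) [1..<Suc n] = map \<pi> [1..<Suc n]"
    using properties_for_sort[OF _ s[OF m]] properties_for_sort[OF _ s[OF \<pi>]] by metis
  then have eq: "(\<pi> \<circ> p) r = \<pi> r" if "r \<in> {1..n}" for r
    using that by (auto simp: map_eq_conv)
  show ?thesis
  proof
    fix r show "(\<pi> \<circ> p) r = \<pi> r"
      using eq[of r] permutes_not_in[OF p, of r] by (cases "r \<in> {1..n}") auto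
  qed
qed

lemma level_strict:
  assumes \<pi>: "mono_on {1..n} (\<pi> :: nat \<Rightarrow> nat)"
    and asc: "\<And>i. i \<in> {1..<n} \<Longrightarrow> \<pi> i = \<pi> (Suc i) \<Longrightarrow> (p :: nat \<Rightarrow> nat) i < p (Suc i)"
    and a: "1 \<le> a"
  shows "Suc (a + k) \<le> n \<Longrightarrow> \<pi> a = \<pi> (Suc (a + k)) \<Longrightarrow> p a < p (Suc (a + k))"
proof (induction k)
  case 0
  then show ?case using asc[of a] a by simp
next
  case (Suc k)
  have "\<pi> a \<le> \<pi> (Suc (a + k))" "\<pi> (Suc (a + k)) \<le> \<pi> (Suc (Suc (a + k)))"
    using mono_onD[OF \<pi>, of a "Suc (a + k)"] mono_onD[OF \<pi>, of "Suc (a + k)" "Suc (Suc (a + k))"] a Suc.prems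
    by auto
  then have eq: "\<pi> a = \<pi> (Suc (a + k))" "\<pi> (Suc (a + k)) = \<pi> (Suc (Suc (a + k)))"
    using Suc.prems by auto
  then have "p a < p (Suc (a + k))" using Suc by simp
  also have "\<dots> < p (Suc (Suc (a + k)))" by (rule asc) (use eq a Suc.prems in auto)
  finally show ?case by simp
qed

lemma chi_comp_adj: "i \<in> {1..<n} \<Longrightarrow> chi n \<pi> c (p \<circ> adj i) = chi n \<pi> (c \<circ> adj i) p"
proof -
  assume i: "i \<in> {1..<n}"
  have "\<pi> \<circ> (p \<circ> adj i) = c \<longleftrightarrow> \<pi> \<circ> p = c \<circ> adj i"
    by (metis comp_adj_adj comp_assoc)
  then show ?thesis using comp_adj_permutes[OF i] by (simp add: chi_def del: o_apply)
qed

lemma chi_order: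
  assumes \<pi>: "mono_on {1..n} \<pi>" and i: "i \<in> {1..<n}" and chi: "chi n \<pi> c p \<noteq> (0::'r::comm_ring_1)"
  shows "p i < p (Suc i) \<Longrightarrow> c i \<le> c (Suc i)" "p (Suc i) < p i \<Longrightarrow> c (Suc i) \<le> c i"
proof -
  have p: "p permutes {1..n}" and c: "c = \<pi> \<circ> p" using chi by (auto simp: chi_def split: if_splits)
  have in_n: "p i \<in> {1..n}" "p (Suc i) \<in> {1..n}"
    using permutes_in_image[OF p] i by (metis atLeastLessThan_iff atLeastAtMost_iff less_imp_le_nat)
      (use permutes_in_image[OF p, of "Suc i"] i in auto)
  show "p i < p (Suc i) \<Longrightarrow> c i \<le> c (Suc i)" "p (Suc i) < p i \<Longrightarrow> c (Suc i) \<le> c i"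
    using mono_onD[OF \<pi> in_n] mono_onD[OF \<pi> in_n(2) in_n(1)] by (simp_all add: c)
qed

lemma T_chi_asc:
  assumes \<pi>: "mono_on {1..n} \<pi>" and i: "i \<in> {1..<n}" and c: "c i < c (Suc i)"
  shows "T q i \<triangleright> chi n \<pi> c = chi n \<pi> (c \<circ> adj i)"
proof
  fix p
  note o1 = chi_order[OF \<pi> i, of c p, where 'r = 'a] and o2 = chi_order[OF \<pi> i, of "c \<circ> adj i" p, where 'r = 'a]
  have s: "(c \<circ> adj i) i = c (Suc i)" "(c \<circ> adj i) (Suc i) = c i" by simp_all
  have eq: "chi n \<pi> d p = (0::'a)" if "p i = p (Suc i)" for d
  proof -
    have "\<not> p permutes {1..n}" using that by (metis permutes_inj injD n_not_Suc_n)
    then show ?thesis by (simp add: chi_def)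
  qed
  show "(T q i \<triangleright> chi n \<pi> c) p = chi n \<pi> (c \<circ> adj i) p"
  proof (cases "p i" "p (Suc i)" rule: linorder_cases)
    case less
    then have "chi n \<pi> (c \<circ> adj i) p = (0::'a)" using o2(1) c unfolding s by linarith
    then show ?thesis using less by (simp add: T_app chi_comp_adj[OF i] del: o_apply)
  next
    case equal
    then show ?thesis by (simp add: T_app eq del: o_apply)
  next
    case greater
    then have "chi n \<pi> c p = (0::'a)" using o1(2) c by linarith
    then show ?thesis using greater by (simp add: T_app chi_comp_adj[OF i] del: o_apply)
  qed
qed

lemma T_chi_eq:
  assumes i: "i \<in> {1..<n}" and c: "c i = c (Suc i)"
  shows "T q i \<triangleright> chi n \<pi> c = vsc q (chi n \<pi> c)"
  by (rule ext) (simp add: T_app chi_comp_adj[OF i] comp_adj_eq[of c, OF c] algebra_simps del: o_apply)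

context hecke_unit
begin

abbreviation "Y \<equiv> ys n q"

lemma Y_Hk: "Y \<pi> \<in> H"
  unfolding ys_def by (intro Hk_sum Hk_Tw) (simp add: stab_def)

lemma Y_app: "Y \<pi> \<triangleright> de id = chi n \<pi> \<pi>"
proof
  fix p
  have "(Y \<pi> \<triangleright> de id) p = (\<Sum>u\<in>stab n \<pi>. de (pinv u) p)"
    unfolding ys_def sum_app sum_fun_apply by (intro sum.cong refl) (simp add: stab_def Tw_de_id)
  also have "\<dots> = (\<Sum>u\<in>stab n \<pi>. if u = pinv p \<and> p permutes {1..n} then 1 else 0)"
    by (intro sum.cong refl)
      (auto simp: de_def stab_def permutes_inv permutes_inv_inv)
  also have "\<dots> = chi n \<pi> \<pi> p"
  proof (cases "p permutes {1..n}")
    case True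
    have "pinv p \<in> stab n \<pi> \<longleftrightarrow> p \<in> stab n \<pi>"
      using stab_pinv[of p n \<pi>] stab_pinv[of "pinv p" n \<pi>] permutes_inv_inv[OF True] by auto
    then show ?thesis using True finite_stab[of n \<pi>] by (auto simp: chi_def stab_def)
  qed (simp add: chi_def)
  finally show "(Y \<pi> \<triangleright> de id) p = chi n \<pi> \<pi> p" .
qed

lemma star_Y: "star (Y \<pi>) = Y \<pi>"
proof -
  have "star (Y \<pi>) = (\<Sum>u\<in>stab n \<pi>. W (pinv u))"
    unfolding ys_def by (subst star_sum) (auto simp: stab_def Hk_Tw star_W intro!: sum.cong)
  also have "\<dots> = Y \<pi>"
    unfolding ys_def
    by (rule sum.reindex_bij_witness[of _ pinv pinv])
      (auto simp: stab_pinv dest: stab_permutes permutes_inv_inv)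
  finally show ?thesis .
qed

lemma T_Y: "i \<in> {1..<n} \<Longrightarrow> \<pi> i = \<pi> (Suc i) \<Longrightarrow> T q i * Y \<pi> = smul q (Y \<pi>)"
  by (rule Hk_eqI[of _ n q]) (simp_all add: Hk_mult Hk_T Y_Hk Hk_smul Y_app T_chi_eq del: vsc_apply)

lemma Y_T: "i \<in> {1..<n} \<Longrightarrow> \<pi> i = \<pi> (Suc i) \<Longrightarrow> Y \<pi> * T q i = smul q (Y \<pi>)"
  using arg_cong[OF T_Y[of i \<pi>], of star] by (simp add: star_mult star_smul star_Y star_T Hk_T Y_Hk)

text \<open>Removing descents sorts \<open>c\<close> into \<pi>, the only weakly increasing word of
  its content; each interchange is undone by a generator by \<open>T_chi_asc\<close>.\<close>

lemma chi_word:
  assumes \<pi>: "mono_on {1..n} \<pi>"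
  shows "c \<in> words n \<pi> \<Longrightarrow> \<exists>h\<in>H. (h * Y \<pi>) \<triangleright> de id = chi n \<pi> c"
proof (induction "ninv n c" arbitrary: c rule: less_induct)
  case less
  show ?case
  proof (cases "mono_on {1..n} c")
    case True
    then have "c = \<pi>" using less.prems mono_words_unique[OF \<pi>] by (auto simp: words_def)
    then show ?thesis by (intro bexI[of _ 1]) (simp_all add: Y_app)
  next
    case False
    then obtain i where i: "i \<in> {1..<n}" "c (Suc i) < c i" using mono_on_Suc[of n c] by force
    have "ninv n c = Suc (ninv n (c \<circ> adj i))" by (rule ninv_desc) fact+
    then obtain h where h: "h \<in> H" "(h * Y \<pi>) \<triangleright> de id = chi n \<pi> (c \<circ> adj i)"
      using less.hyps[of "c \<circ> adj i"] words_adj[OF i(1) less.prems] by auto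
    have "T q i \<triangleright> chi n \<pi> (c \<circ> adj i) = chi n \<pi> (c \<circ> adj i \<circ> adj i)"
      by (rule T_chi_asc[OF \<pi> i(1)]) (use i in simp)
    then show ?thesis
      using h i by (intro bexI[of _ "T q i * h"]) (simp_all add: Hk_mult Hk_T del: o_apply)
  qed
qed

text \<open>The stabilizer is generated by the interchanges it contains: at a descent of
  \<open>u\<close>, the monotonicity of \<pi> and \<pi> u = \<pi> force \<pi> to agree at the two
  places.\<close>

lemma stab_invariant:
  assumes \<pi>: "mono_on {1..n} \<pi>"
    and y: "\<And>i c. i \<in> {1..<n} \<Longrightarrow> \<pi> i = \<pi> (Suc i) \<Longrightarrow> c permutes {1..n} \<Longrightarrow> y (c \<circ> adj i) = y c"
    and c: "c permutes {1..n}"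
  shows "u \<in> stab n \<pi> \<Longrightarrow> y (c \<circ> u) = y c"
proof (induction "ninv n u" arbitrary: u rule: less_induct)
  case less
  then have u: "u permutes {1..n}" "\<pi> \<circ> u = \<pi>" by (auto simp: stab_def)
  show ?case
  proof (cases "mono_on {1..n} u")
    case True
    then show ?thesis using mono_on_perm_id[OF u(1)] by simp
  next
    case False
    then obtain i where i: "i \<in> {1..<n}" "u (Suc i) < u i" using mono_on_Suc[of n u] by force
    have in_n: "u i \<in> {1..n}" "u (Suc i) \<in> {1..n}"
      using permutes_in_image[OF u(1), of i] permutes_in_image[OF u(1), of "Suc i"] i by auto
    have "\<pi> (u (Suc i)) \<le> \<pi> (u i)" using mono_onD[OF \<pi> in_n(2,1)] i by simp
    moreover have "\<pi> i \<le> \<pi> (Suc i)" using mono_onD[OF \<pi>, of i "Suc i"] i by simp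
    ultimately have eq: "\<pi> i = \<pi> (Suc i)" using fun_cong[OF u(2), of i] fun_cong[OF u(2), of "Suc i"] by simp
    have s: "u \<circ> adj i \<in> stab n \<pi>"
      using u i comp_adj_permutes[OF i(1)] comp_adj_eq[of \<pi> i, OF eq]
      by (simp add: stab_def comp_assoc[symmetric] del: o_apply)
    have "ninv n u = Suc (ninv n (u \<circ> adj i))" by (rule ninv_desc) fact+
    then have "y (c \<circ> (u \<circ> adj i)) = y c" using less.hyps[OF _ s] by simp
    moreover have "y (c \<circ> (u \<circ> adj i) \<circ> adj i) = y (c \<circ> (u \<circ> adj i))"
      by (rule y[OF i(1) eq]) (use s c in \<open>auto simp: stab_def intro: permutes_compose\<close>)
    moreover have "c \<circ> (u \<circ> adj i) \<circ> adj i = c \<circ> u"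
      by (simp add: comp_assoc)
    ultimately show ?thesis by (simp del: o_apply)
  qed
qed

text \<open>The eigenvalue condition makes the coefficients of \<open>z\<close> constant on the
  cosets of \<open>stab n \<pi>\<close>. So \<open>z\<close> is a combination of the coset
  indicators, each of which comes from a left multiple of \<open>Y \<pi>\<close>.\<close>

lemma right_invariant:
  assumes \<pi>: "mono_on {1..n} \<pi>" and z: "z \<in> H"
    and inv: "\<And>i. i \<in> {1..<n} \<Longrightarrow> \<pi> i = \<pi> (Suc i) \<Longrightarrow> z * T q i = smul q z"
  shows "\<exists>h\<in>H. z = h * Y \<pi>"
proof -
  define y where "y = z \<triangleright> de id"
  define y' where "y' = star z \<triangleright> de id"
  have y': "y' (c \<circ> adj i) = y' c"
    if i: "i \<in> {1..<n}" "\<pi> i = \<pi> (Suc i)" and c: "c permutes {1..n}" for i c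
  proof -
    have "T q i * star z = smul q (star z)"
      using arg_cong[OF inv[OF i], of star] z i by (simp add: star_mult star_smul star_T Hk_T)
    then have Ty: "T q i \<triangleright> y' = vsc q y'"
      unfolding y'_def by (metis times_app smul_app)
    \<comment> \<open>At an ascent the eigenvalue equation compares q times the two coefficients,
      and q cancels.\<close>
    have asc: "y' (d \<circ> adj i) = y' d" if "d i < d (Suc i)" for d
      using fun_cong[OF Ty, of d] that q_power_cancel[of 1] by (simp add: T_app del: o_apply)
    have "c i \<noteq> c (Suc i)" using permutes_inj[OF c] by (metis injD n_not_Suc_n)
    then consider "c i < c (Suc i)" | "c (Suc i) < c i" by linarith
    then show ?thesis
      using asc[of c] asc[of "c \<circ> adj i"] by cases (simp_all del: o_apply add: comp_adj_apply)
  qed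
  have y_eq: "y c = y' (pinv c)" if "c permutes {1..n}" for c
    using star_coeff[OF star_Hk[OF z] that] z by (simp add: y_def y'_def star_star)
  have y_cong: "y c1 = y c2" if c: "c1 permutes {1..n}" "c2 permutes {1..n}" "\<pi> \<circ> c1 = \<pi> \<circ> c2" for c1 c2
  proof -
    let ?u = "c2 \<circ> pinv c1"
    have "\<pi> \<circ> ?u = \<pi> \<circ> c1 \<circ> pinv c1" by (simp only: c(3) comp_assoc)
    also have "\<dots> = \<pi>" by (rule comp_pinv_cancel(1)[OF c(1)])
    finally have "?u \<in> stab n \<pi>"
      using permutes_compose[OF permutes_inv[OF c(1)] c(2)] by (simp add: stab_def del: o_apply)
    from stab_invariant[OF \<pi> y' permutes_inv[OF c(2)] this]
    have "y' (pinv c2 \<circ> (c2 \<circ> pinv c1)) = y' (pinv c2)" by blast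
    moreover have "pinv c2 \<circ> (c2 \<circ> pinv c1) = pinv c1"
      by (rule comp_pinv_cancel(3)[OF c(2)])
    ultimately show ?thesis using y_eq c by (simp del: o_apply)
  qed
  \<comment> \<open>An arbitrary representative of the coset belonging to a word; by
    \<open>y_cong\<close> the coefficient does not depend on it.\<close>
  define r where "r c = (SOME p. p permutes {1..n} \<and> \<pi> \<circ> p = c)" for c
  have r: "r c permutes {1..n}" "\<pi> \<circ> r c = c" if "c \<in> words n \<pi>" for c
  proof -
    have "\<exists>p. p permutes {1..n} \<and> \<pi> \<circ> p = c" using that by (auto simp: words_def)
    from someI_ex[OF this] show "r c permutes {1..n}" "\<pi> \<circ> r c = c" by (simp_all add: r_def)
  qed
  obtain h where h: "\<And>c. c \<in> words n \<pi> \<Longrightarrow> h c \<in> H"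
    "\<And>c. c \<in> words n \<pi> \<Longrightarrow> (h c * Y \<pi>) \<triangleright> de id = chi n \<pi> c"
    using chi_word[OF \<pi>] by metis
  have "z = (\<Sum>c\<in>words n \<pi>. smul (y (r c)) (h c)) * Y \<pi>"
  proof (rule Hk_eqI[OF z])
    show "(\<Sum>c\<in>words n \<pi>. smul (y (r c)) (h c)) * Y \<pi> \<in> H"
      by (intro Hk_mult Hk_sum Hk_smul h Y_Hk)
    show "z \<triangleright> de id = ((\<Sum>c\<in>words n \<pi>. smul (y (r c)) (h c)) * Y \<pi>) \<triangleright> de id"
    proof
      fix p
      have "(((\<Sum>c\<in>words n \<pi>. smul (y (r c)) (h c)) * Y \<pi>) \<triangleright> de id) p
          = (\<Sum>c\<in>words n \<pi>. y (r c) * ((h c * Y \<pi>) \<triangleright> de id) p)"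
        by (simp add: sum_distrib_right sum_app sum_fun_apply)
      also have "\<dots> = (\<Sum>c\<in>words n \<pi>. y (r c) * chi n \<pi> c p)"
        using h by (intro sum.cong) auto
      also have "\<dots> = y p"
      proof (cases "p permutes {1..n}")
        case True
        then have p: "\<pi> \<circ> p \<in> words n \<pi>" by (auto simp: words_def)
        have "(\<Sum>c\<in>words n \<pi>. y (r c) * chi n \<pi> c p)
            = (\<Sum>c\<in>words n \<pi>. if c = \<pi> \<circ> p then y (r c) else 0)"
          using True by (intro sum.cong refl) (auto simp: chi_def)
        also have "\<dots> = y (r (\<pi> \<circ> p))" using p finite_words[of n \<pi>] by (simp del: o_apply)
        also have "\<dots> = y p" using r[OF p] True by (intro y_cong)
        finally show ?thesis .
      next
        case False
        then show ?thesis
          using supp_Hk[OF z supp_de[OF permutes_id]] by (simp add: chi_def supp_def y_def)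
      qed
      finally show "(z \<triangleright> de id) p = (((\<Sum>c\<in>words n \<pi>. smul (y (r c)) (h c)) * Y \<pi>) \<triangleright> de id) p"
        by (simp add: y_def)
    qed
  qed
  then show ?thesis using h by (blast intro: Hk_sum Hk_smul)
qed

lemma left_invariant:
  assumes \<pi>: "mono_on {1..n} \<pi>" and z: "z \<in> H"
    and inv: "\<And>i. i \<in> {1..<n} \<Longrightarrow> \<pi> i = \<pi> (Suc i) \<Longrightarrow> T q i * z = smul q z"
  shows "\<exists>h\<in>H. z = Y \<pi> * h"
proof -
  have "star z * T q i = smul q (star z)" if "i \<in> {1..<n}" "\<pi> i = \<pi> (Suc i)" for i
    using arg_cong[OF inv[OF that], of star] that z by (simp add: star_mult star_smul star_T Hk_T)
  then obtain h where h: "h \<in> H" "star z = h * Y \<pi>"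
    using right_invariant[OF \<pi> star_Hk[OF z]] by blast
  then have "z = Y \<pi> * star h"
    using star_star[OF z] by (simp add: star_mult Y_Hk star_Y)
  then show ?thesis using h star_Hk by blast
qed

lemma T_invertible: "i \<in> {1..<n} \<Longrightarrow> \<exists>h\<in>H. T q i * h = 1"
proof -
  assume i: "i \<in> {1..<n}"
  obtain p where p: "q * p = 1" using unit by (metis dvd_def)
  have "T q i * smul p (T q i - smul (q - 1) 1) = smul p (T q i * T q i - smul (q - 1) (T q i))"
    by (simp add: right_diff_distrib)
  also have "\<dots> = 1" using p by (simp add: T_quadratic mult.commute)
  finally show ?thesis using i by (blast intro: Hk_smul Hk_diff Hk_T Hk_one)
qed

lemma W_invertible: "w permutes {1..n} \<Longrightarrow> \<exists>h\<in>H. W w * h = 1"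
proof -
  have "set l \<subseteq> {1..<n} \<Longrightarrow> \<exists>h\<in>H. Tl q l * h = 1" for l
  proof (induction l)
    case Nil
    then show ?case by (intro bexI[of _ 1]) simp_all
  next
    case (Cons i l)
    then obtain h h' where "h \<in> H" "Tl q l * h = 1" "h' \<in> H" "T q i * h' = 1"
      using T_invertible[of i] by auto
    note h = this
    have "Tl q (i # l) * (h * h') = T q i * (Tl q l * h) * h'"
      by (simp add: mult.assoc)
    then show ?case using h by (intro bexI[of _ "h * h'"]) (simp_all add: Hk_mult)
  qed
  then show "w permutes {1..n} \<Longrightarrow> \<exists>h\<in>H. W w * h = 1"
    unfolding Tw_def using reduced_word by blast
qed

text \<open>Two Young subgroups whose blocks have the same sizes in another order are conjugate by a
  representative of minimal length. Along it lengths add, so that its T intertwines the two Young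
  sums, and it is invertible.\<close>

lemma Y_conjugate:
  assumes \<pi>: "mono_on {1..n} \<pi>" and \<kappa>: "mono_on {1..n} \<kappa>" and \<kappa>': "\<kappa>' \<in> words n \<kappa>"
    and lev: "\<And>r s. r \<in> {1..n} \<Longrightarrow> s \<in> {1..n} \<Longrightarrow> \<kappa>' r = \<kappa>' s \<longleftrightarrow> \<pi> r = \<pi> s"
  shows "\<exists>h\<in>H. \<exists>h'\<in>H. Y \<pi> = h * Y \<kappa> * h'"
proof -
  have "\<exists>p. p permutes {1..n} \<and> \<kappa> \<circ> p = \<kappa>'" using \<kappa>' by (auto simp: words_def)
  \<comment> \<open>Minimality of the number of inversions makes p increasing on each level of
    \<pi>, as \<open>Tw_asc_family\<close> demands.\<close>
  from ex_has_least_nat[of "\<lambda>p. p permutes {1..n} \<and> \<kappa> \<circ> p = \<kappa>'" _ "ninv n", OF someI_ex[OF this]]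
  obtain p where p: "p permutes {1..n}" "\<kappa> \<circ> p = \<kappa>'"
    and min: "\<And>p'. p' permutes {1..n} \<Longrightarrow> \<kappa> \<circ> p' = \<kappa>' \<Longrightarrow> ninv n p \<le> ninv n p'" by blast
  have asc: "p i < p (Suc i)" if i: "i \<in> {1..<n}" "\<pi> i = \<pi> (Suc i)" for i
  proof (rule ccontr)
    assume "\<not> p i < p (Suc i)"
    moreover have "p i \<noteq> p (Suc i)" using permutes_inj[OF p(1)] by (metis injD n_not_Suc_n)
    ultimately have "ninv n p = Suc (ninv n (p \<circ> adj i))" using ninv_desc[OF i(1)] by simp
    moreover have "\<kappa>' i = \<kappa>' (Suc i)" using lev[of i "Suc i"] i by auto
    then have "\<kappa> \<circ> (p \<circ> adj i) = \<kappa>'"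
      using p comp_adj_eq[of \<kappa>' i] by (simp add: comp_assoc[symmetric] del: o_apply)
    ultimately show False
      using min[of "p \<circ> adj i"] comp_adj_permutes[OF i(1)] p by (simp del: o_apply)
  qed
  have Wp: "W u \<triangleright> de p = de (p \<circ> pinv u)" if u: "u \<in> stab n \<pi>" for u
  proof (rule Tw_asc_family[OF asc_family_de])
    show up: "u permutes {1..n}" using u by (simp add: stab_def)
    fix a b assume ab: "a \<in> {1..n}" "b \<in> {1..n}" "a < b" "u b < u a"
    have pu: "\<pi> (u r) = \<pi> r" for r using u by (auto simp: stab_def fun_eq_iff)
    have "u a \<in> {1..n}" "u b \<in> {1..n}" using ab permutes_in_image[OF up] by blast+
    then have "\<pi> (u b) \<le> \<pi> (u a)" using mono_onD[OF \<pi>] ab(4) less_imp_le_nat by blast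
    then have "\<pi> b \<le> \<pi> a" by (simp only: pu)
    moreover have "\<pi> a \<le> \<pi> b" using mono_onD[OF \<pi>, of a b] ab by simp
    moreover obtain k where "b = Suc (a + k)" using ab(3) less_imp_Suc_add by blast
    ultimately show "p a < p b" using level_strict[where p = p and a = a and k = k, OF \<pi> asc] ab by simp
  qed
  have YW: "(Y \<pi> * W (pinv p)) \<triangleright> de id = chi n \<kappa> \<kappa>'"
  proof
    fix d
    have "((Y \<pi> * W (pinv p)) \<triangleright> de id) d = (\<Sum>u\<in>stab n \<pi>. (W u \<triangleright> de p) d)"
      using p by (simp add: ys_def sum_app sum_fun_apply Tw_de_id permutes_inv permutes_inv_inv)
    also have "\<dots> = (\<Sum>u\<in>stab n \<pi>. de (p \<circ> pinv u) d)"
      by (intro sum.cong refl) (simp only: Wp)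
    also have "\<dots> = (\<Sum>u\<in>stab n \<pi>. if u = pinv d \<circ> p \<and> d permutes {1..n} then 1 else 0)"
    proof (intro sum.cong refl)
      fix u assume "u \<in> stab n \<pi>"
      then have u: "u permutes {1..n}" by (simp add: stab_def)
      have "d = p \<circ> pinv u \<longleftrightarrow> u = pinv d \<circ> p \<and> d permutes {1..n}"
      proof
        assume d: "d = p \<circ> pinv u"
        then have dp: "d permutes {1..n}" using permutes_compose[OF permutes_inv[OF u] p(1)] by simp
        have "d \<circ> u = p" unfolding d by (rule comp_pinv_cancel(2)[OF u])
        then show "u = pinv d \<circ> p \<and> d permutes {1..n}"
          using dp comp_pinv_cancel(3)[OF dp, of u] by (simp only: simp_thms)
      next
        assume d: "u = pinv d \<circ> p \<and> d permutes {1..n}"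
        then have "d \<circ> u = p"
          using comp_pinv_cancel(4)[of d n p] by (simp only: simp_thms)
        then show "d = p \<circ> pinv u" using comp_pinv_cancel(1)[OF u, of d] by (simp only:)
      qed
      then show "de (p \<circ> pinv u) d = (if u = pinv d \<circ> p \<and> d permutes {1..n} then 1 else (0::'r))"
        by (simp add: de_def)
    qed
    also have "\<dots> = chi n \<kappa> \<kappa>' d"
    proof (cases "d permutes {1..n}")
      case True
      let ?u = "pinv d \<circ> p"
      have up: "?u permutes {1..n}" using permutes_compose[OF p(1) permutes_inv[OF True]] .
      have du: "d \<circ> ?u = p" by (rule comp_pinv_cancel(4)[OF True])
      have "\<pi> \<circ> ?u = \<pi> \<longleftrightarrow> \<kappa>' \<circ> ?u = \<kappa>'"
      proof -
        have out: "?u r = r" if "r \<notin> {1..n}" for r using permutes_not_in[OF up that] .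
        have "\<pi> (?u r) = \<pi> r \<longleftrightarrow> \<kappa>' (?u r) = \<kappa>' r" for r
          using out[of r] permutes_in_image[OF up, of r] lev[of "?u r" r] by (cases "r \<in> {1..n}") auto
        then show ?thesis by (simp add: fun_eq_iff)
      qed
      also have "\<dots> \<longleftrightarrow> \<kappa> \<circ> d = \<kappa>'"
      proof
        assume *: "\<kappa>' \<circ> ?u = \<kappa>'"
        have "\<kappa> \<circ> d \<circ> ?u = \<kappa>'" using du p(2) by (metis comp_assoc)
        then have "\<kappa> \<circ> d \<circ> ?u = \<kappa>' \<circ> ?u" using * by simp
        then have "\<kappa> \<circ> d \<circ> ?u \<circ> pinv ?u = \<kappa>' \<circ> ?u \<circ> pinv ?u" by simp
        then show "\<kappa> \<circ> d = \<kappa>'" by (simp only: comp_pinv_cancel(1)[OF up])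
      next
        assume "\<kappa> \<circ> d = \<kappa>'"
        then show "\<kappa>' \<circ> ?u = \<kappa>'" using du p(2) by (metis comp_assoc)
      qed
      finally have "?u \<in> stab n \<pi> \<longleftrightarrow> \<kappa> \<circ> d = \<kappa>'" using up by (simp add: stab_def del: o_apply)
      then show ?thesis using True finite_stab[of n \<pi>] by (simp add: chi_def del: o_apply)
    qed (simp add: chi_def)
    finally show "((Y \<pi> * W (pinv p)) \<triangleright> de id) d = chi n \<kappa> \<kappa>' d" .
  qed
  obtain h where h: "h \<in> H" "(h * Y \<kappa>) \<triangleright> de id = chi n \<kappa> \<kappa>'"
    using chi_word[OF \<kappa> \<kappa>'] by blast
  have eq: "Y \<pi> * W (pinv p) = h * Y \<kappa>"
    by (rule Hk_eqI[of _ n q]) (use h YW p in \<open>auto simp: Hk_mult Y_Hk Hk_Tw permutes_inv simp del: times_app\<close>)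
  obtain g where g: "g \<in> H" "W (pinv p) * g = 1"
    using W_invertible[OF permutes_inv[OF p(1)]] by blast
  have "Y \<pi> = Y \<pi> * (W (pinv p) * g)" using g by simp
  also have "\<dots> = h * Y \<kappa> * g" using eq by (simp only: mult.assoc[symmetric])
  finally show ?thesis using h g by blast
qed

end

section \<open>Words of given content\<close>

definition part :: "nat list \<Rightarrow> nat \<Rightarrow> nat" where
  "part la l = (if l < length la then la ! l else 0)"

lemma sum_list_take_part: "sum_list (take k la) = (\<Sum>l<k. part la l)"
proof (induction k)
  case (Suc k)
  show ?case
  proof (cases "k < length la")
    case True
    then show ?thesis using Suc by (simp add: take_Suc_conv_app_nth part_def)
  qed (use Suc in \<open>simp add: part_def\<close>)
qed simp

lemma sum_list_part: "sum_list la = (\<Sum>l<length la. part la l)"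
  using sum_list_take_part[of "length la" la] by simp

lemma Par_part_antimono: "la \<in> Par n \<Longrightarrow> l \<le> k \<Longrightarrow> part la k \<le> part la l"
  unfolding Par_def part_def by (auto simp: sorted_wrt_iff_nth_less le_eq_less_or_eq)

lemma dominated_by_part: "dominated_by la mu \<longleftrightarrow> (\<forall>k. (\<Sum>l<k. part la l) \<le> (\<Sum>l<k. part mu l))"
  by (simp add: dominated_by_def sum_list_take_part)

text \<open>The row word of the initial tableau, with rows counted from 0. The value 0 outside of
  \<open>{1..n}\<close> is a convention shared with \<open>lwords\<close>.\<close>

definition row :: "nat list \<Rightarrow> nat \<Rightarrow> nat" where
  "row la r = (if 1 \<le> r \<and> r \<le> sum_list la then LEAST l. r \<le> (\<Sum>j\<le>l. part la j) else 0)"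

lemma row_bounds:
  assumes "r \<in> {1..sum_list la}"
  shows "row la r < length la" "(\<Sum>j<row la r. part la j) < r" "r \<le> (\<Sum>j\<le>row la r. part la j)"
proof -
  have "la \<noteq> []" using assms by auto
  then have "r \<le> (\<Sum>j\<le>length la - 1. part la j)"
    using assms lessThan_Suc_atMost[of "length la - 1"] by (simp add: sum_list_part)
  note ex = this
  have row: "row la r = (LEAST l. r \<le> (\<Sum>j\<le>l. part la j))" using assms by (simp add: row_def)
  show le: "r \<le> (\<Sum>j\<le>row la r. part la j)" unfolding row using ex by (rule LeastI)
  have "row la r \<le> length la - 1" unfolding row using ex by (rule Least_le)
  then show "row la r < length la" using \<open>la \<noteq> []\<close> by (cases la) auto
  show "(\<Sum>j<row la r. part la j) < r"
  proof (cases "row la r")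
    case 0
    then show ?thesis using assms by simp
  next
    case (Suc k)
    then have "\<not> r \<le> (\<Sum>j\<le>k. part la j)" unfolding row by (intro not_less_Least) simp
    then show ?thesis using Suc by (simp add: lessThan_Suc_atMost)
  qed
qed

lemma row_eq_iff:
  assumes "r \<in> {1..sum_list la}"
  shows "row la r = l \<longleftrightarrow> (\<Sum>j<l. part la j) < r \<and> r \<le> (\<Sum>j\<le>l. part la j)"
proof
  assume l: "(\<Sum>j<l. part la j) < r \<and> r \<le> (\<Sum>j\<le>l. part la j)"
  have mono: "(\<Sum>j\<le>a. part la j) \<le> (\<Sum>j<b. part la j)" if "a < b" for a b
    using that by (intro sum_mono2) auto
  note b = row_bounds[OF assms]
  show "row la r = l"
    using mono[of l "row la r"] mono[of "row la r" l] b l by (metis leD le_trans linorder_neqE_nat)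
qed (use row_bounds[OF assms] in auto)

lemma row_mono: "mono_on {1..sum_list la} (row la)"
proof (rule mono_onI)
  fix r s assume rs: "r \<in> {1..sum_list la}" "s \<in> {1..sum_list la}" "r \<le> s"
  then have "r \<le> (\<Sum>j\<le>row la s. part la j)" using row_bounds(3)[OF rs(2)] by simp
  then show "row la r \<le> row la s" using rs by (auto simp: row_def intro: Least_le)
qed

lemma row_outside: "r \<notin> {1..sum_list la} \<Longrightarrow> row la r = 0"
  by (auto simp: row_def)

definition cntw :: "nat \<Rightarrow> (nat \<Rightarrow> nat) \<Rightarrow> nat \<Rightarrow> nat" where
  "cntw n c l = card {r \<in> {1..n}. c r = l}"

lemma cntw_count: "cntw n c l = count (image_mset c (mset_set {1..n})) l"
proof -
  have "{r \<in> {1..n}. c r = l} = {x. x \<in> {1..n} \<and> l = c x}" by auto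
  then show ?thesis
    by (simp add: cntw_def count_image_mset_eq_card_vimage)
qed

lemma cntw_row: "cntw (sum_list la) (row la) l = part la l"
proof -
  have "(\<Sum>j\<le>l. part la j) \<le> sum_list la"
  proof (cases "l < length la")
    case True
    then show ?thesis unfolding sum_list_part by (intro sum_mono2) auto
  next
    case False
    have "(\<Sum>j\<le>l. part la j) = (\<Sum>j<length la. part la j)"
      by (rule sum.mono_neutral_right) (use False in \<open>auto simp: part_def\<close>)
    then show ?thesis by (simp add: sum_list_part)
  qed
  then have "{r \<in> {1..sum_list la}. row la r = l} = {(\<Sum>j<l. part la j)<..(\<Sum>j\<le>l. part la j)}"
  proof (intro Set.set_eqI)
    fix r show "r \<in> {r \<in> {1..sum_list la}. row la r = l} \<longleftrightarrow>
        r \<in> {(\<Sum>j<l. part la j)<..(\<Sum>j\<le>l. part la j)}"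
      using row_eq_iff[of r la l] \<open>(\<Sum>j\<le>l. part la j) \<le> sum_list la\<close>
      by (cases "r \<in> {1..sum_list la}") auto
  qed
  then show ?thesis by (simp add: cntw_def lessThan_Suc_atMost[symmetric])
qed

lemma words_iff_cntw:
  "c \<in> words n \<pi> \<longleftrightarrow> (\<forall>r. r \<notin> {1..n} \<longrightarrow> c r = \<pi> r) \<and> (\<forall>l. cntw n c l = cntw n \<pi> l)"
proof
  assume "c \<in> words n \<pi>"
  then obtain p where p: "p permutes {1..n}" "c = \<pi> \<circ> p" by (auto simp: words_def)
  have "image_mset c (mset_set {1..n}) = image_mset \<pi> (image_mset p (mset_set {1..n}))"
    using p by (simp add: multiset.map_comp)
  also have "\<dots> = image_mset \<pi> (mset_set {1..n})"
    using image_mset_mset_set[OF permutes_inj_on[OF p(1)], of "{1..n}"] permutes_image[OF p(1)] by simp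
  finally show "(\<forall>r. r \<notin> {1..n} \<longrightarrow> c r = \<pi> r) \<and> (\<forall>l. cntw n c l = cntw n \<pi> l)"
    using p permutes_not_in[OF p(1)] by (simp add: cntw_count)
next
  assume c: "(\<forall>r. r \<notin> {1..n} \<longrightarrow> c r = \<pi> r) \<and> (\<forall>l. cntw n c l = cntw n \<pi> l)"
  then have "image_mset c (mset_set {1..n}) = image_mset \<pi> (mset_set {1..n})"
    by (intro multiset_eqI) (simp add: cntw_count)
  then obtain p where p: "p permutes {1..n}" "\<forall>r\<in>{1..n}. c r = \<pi> (p r)"
    by (rule image_mset_eq_implies_permutes[rotated]) simp_all
  have "c = \<pi> \<circ> p"
  proof
    fix r show "c r = (\<pi> \<circ> p) r"
      using p c permutes_not_in[OF p(1), of r] by (cases "r \<in> {1..n}") auto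
  qed
  then show "c \<in> words n \<pi>" using p by (auto simp: words_def)
qed

lemma antimono_sum_le:
  fixes f :: "nat \<Rightarrow> nat"
  assumes f: "\<And>l k. l \<le> k \<Longrightarrow> f k \<le> f l" and "finite K"
  shows "(\<Sum>k\<in>K. f k) \<le> (\<Sum>k<card K. f k)"
  using \<open>finite K\<close>
proof (induction K rule: finite_linorder_max_induct)
  case (insert b A)
  then have "A \<subseteq> {..<b}" by auto
  then have "card A \<le> b" using card_mono[of "{..<b}" A] by simp
  then have "f b \<le> f (card A)" by (rule f)
  moreover have "b \<notin> A" using insert by auto
  ultimately show ?case using insert by simp
qed simp

text \<open>The letters are renamed by decreasing frequency. The bound in the last clause, any set
  of letters against the largest parts, is what later proves dominance.\<close>

lemma word_shape:
  fixes \<pi> :: "nat \<Rightarrow> nat"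
  obtains mu \<kappa> where "mu \<in> Par n" "\<kappa> \<in> words n (row mu)"
    "\<And>r s. r \<in> {1..n} \<Longrightarrow> s \<in> {1..n} \<Longrightarrow> \<kappa> r = \<kappa> s \<longleftrightarrow> \<pi> r = \<pi> s"
    "\<And>A. finite A \<Longrightarrow> (\<Sum>l\<in>A. cntw n \<pi> l) \<le> (\<Sum>k<card A. part mu k)"
proof -
  define L where "L = \<pi> ` {1..n}"
  have "finite L" by (simp add: L_def)
  \<comment> \<open>The letters that occur, from the most to the least frequent.\<close>
  define ls where "ls = rev (sort_key (cntw n \<pi>) (sorted_list_of_set L))"
  have ls: "distinct ls" "set ls = L" using \<open>finite L\<close> by (simp_all add: ls_def)
  define mu where "mu = map (cntw n \<pi>) ls"
  have part: "part mu k = (if k < length ls then cntw n \<pi> (ls ! k) else 0)" for k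
    by (simp add: part_def mu_def)
  have sum: "sum_list mu = n"
  proof -
    have "sum_list mu = (\<Sum>l\<in>L. cntw n \<pi> l)"
      unfolding mu_def using ls by (simp add: sum_list_distinct_conv_sum_set)
    also have "\<dots> = card (\<Union>l\<in>L. {r \<in> {1..n}. \<pi> r = l})"
      unfolding cntw_def using \<open>finite L\<close> by (intro card_UN_disjoint[symmetric]) auto
    also have "(\<Union>l\<in>L. {r \<in> {1..n}. \<pi> r = l}) = {1..n}" by (auto simp: L_def)
    finally show ?thesis by simp
  qed
  have mu: "mu \<in> Par n"
  proof -
    have "sorted (rev mu)"
      by (simp add: mu_def ls_def rev_map)
    then have "sorted_wrt (\<ge>) mu" by (simp add: sorted_wrt_rev)
    moreover have "0 < p" if pm: "p \<in> set mu" for p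
    proof -
      obtain r where "r \<in> {1..n}" "p = cntw n \<pi> (\<pi> r)" using pm ls by (auto simp: mu_def L_def)
      then show ?thesis by (auto simp: cntw_def card_gt_0_iff)
    qed
    ultimately show ?thesis using sum by (simp add: Par_def)
  qed
  define idx where "idx l = (THE k. k < length ls \<and> ls ! k = l)" for l
  have idx: "idx l < length ls" "ls ! idx l = l" if l: "l \<in> L" for l
  proof -
    obtain k where "k < length ls \<and> ls ! k = l" using l ls(2) by (metis in_set_conv_nth)
    then have "idx l < length ls \<and> ls ! idx l = l"
      unfolding idx_def by (rule theI) (use \<open>k < length ls \<and> ls ! k = l\<close> ls(1) in \<open>auto simp: nth_eq_iff_index_eq\<close>)
    then show "idx l < length ls" "ls ! idx l = l" by auto
  qed
  define \<kappa> where "\<kappa> r = (if r \<in> {1..n} then idx (\<pi> r) else 0)" for r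
  have lev: "\<kappa> r = \<kappa> s \<longleftrightarrow> \<pi> r = \<pi> s" if "r \<in> {1..n}" "s \<in> {1..n}" for r s
  proof -
    have "\<pi> r \<in> L" "\<pi> s \<in> L" using that by (auto simp: L_def)
    then show ?thesis using that idx by (metis \<kappa>_def)
  qed
  have "\<kappa> \<in> words n (row mu)"
    unfolding words_iff_cntw
  proof (intro conjI allI impI)
    fix r assume "r \<notin> {1..n}"
    then show "\<kappa> r = row mu r" using row_outside[of r mu] sum by (auto simp: \<kappa>_def)
  next
    fix k
    have "cntw n \<kappa> k = part mu k"
    proof (cases "k < length ls")
      case True
      have "{r \<in> {1..n}. \<kappa> r = k} = {r \<in> {1..n}. \<pi> r = ls ! k}"
      proof -
        have "idx (\<pi> r) = k \<longleftrightarrow> \<pi> r = ls ! k" if "r \<in> {1..n}" for r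
        proof -
          have "\<pi> r \<in> L" using that by (simp add: L_def)
          then show ?thesis using idx[of "\<pi> r"] True ls(1) by (metis nth_eq_iff_index_eq)
        qed
        then show ?thesis by (auto simp: \<kappa>_def)
      qed
      then show ?thesis using True by (simp add: part cntw_def)
    next
      case False
      have "{r \<in> {1..n}. \<kappa> r = k} = {}"
        using idx(1) False by (fastforce simp: \<kappa>_def L_def)
      then show ?thesis using False by (simp add: part cntw_def)
    qed
    then show "cntw n \<kappa> k = cntw n (row mu) k" using cntw_row[of mu k] sum by simp
  qed
  moreover have "(\<Sum>l\<in>A. cntw n \<pi> l) \<le> (\<Sum>k<card A. part mu k)" if A: "finite A" for A
  proof -
    let ?B = "A \<inter> L"
    have "cntw n \<pi> l = 0" if "l \<notin> L" for l using that by (auto simp: cntw_def L_def)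
    then have "(\<Sum>l\<in>A. cntw n \<pi> l) = (\<Sum>l\<in>?B. cntw n \<pi> l)"
      using A by (intro sum.mono_neutral_right) auto
    also have "\<dots> = (\<Sum>l\<in>?B. part mu (idx l))"
      using idx by (intro sum.cong) (auto simp: part)
    also have "\<dots> = (\<Sum>k\<in>idx ` ?B. part mu k)"
    proof -
      have "inj_on idx ?B" using idx by (intro inj_onI) (metis IntD2)
      then show ?thesis by (simp add: sum.reindex)
    qed
    also have "\<dots> \<le> (\<Sum>k<card (idx ` ?B). part mu k)"
      by (rule antimono_sum_le) (use A Par_part_antimono[OF mu] in auto)
    also have "card (idx ` ?B) \<le> card A"
      by (rule order_trans[OF card_image_le card_mono]) (use A in auto)
    then have "(\<Sum>k<card (idx ` ?B). part mu k) \<le> (\<Sum>k<card A. part mu k)"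
      by (intro sum_mono2) auto
    finally show ?thesis .
  qed
  ultimately show thesis using that mu lev by blast
qed

text \<open>Embeds the functions of words of the content of \<pi> into the functions of
  permutations. For weakly increasing \<pi> it is a homomorphism (\<open>T_pull\<close>), so
  computations with words become computations in the algebra.\<close>

definition pull :: "nat \<Rightarrow> (nat \<Rightarrow> nat) \<Rightarrow> 'r::comm_ring_1 vec \<Rightarrow> 'r vec" where
  "pull n \<pi> \<phi> = (\<lambda>p. if p permutes {1..n} then \<phi> (\<pi> \<circ> p) else 0)"

lemma supp_pull: "supp n (pull n \<pi> \<phi>)"
  by (simp add: supp_def pull_def)

lemma pull_add: "pull n \<pi> (\<phi> + \<psi>) = pull n \<pi> \<phi> + pull n \<pi> \<psi>"
  and pull_vsc: "pull n \<pi> (vsc r \<phi>) = vsc r (pull n \<pi> \<phi>)"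
  and pull_zero: "pull n \<pi> 0 = 0"
  by (auto simp: pull_def fun_eq_iff)

lemma pull_de: "pull n \<pi> (de c) = chi n \<pi> c"
  by (auto simp: pull_def chi_def de_def fun_eq_iff)

lemma pull_expand: "pull n \<pi> \<phi> = (\<Sum>c\<in>words n \<pi>. vsc (\<phi> c) (chi n \<pi> c))"
proof
  fix p
  show "pull n \<pi> \<phi> p = (\<Sum>c\<in>words n \<pi>. vsc (\<phi> c) (chi n \<pi> c)) p"
  proof (cases "p permutes {1..n}")
    case True
    then have "(\<Sum>c\<in>words n \<pi>. vsc (\<phi> c) (chi n \<pi> c)) p = (\<Sum>c\<in>words n \<pi>. if c = \<pi> \<circ> p then \<phi> c else 0)"
      unfolding sum_fun_apply by (intro sum.cong refl) (auto simp: chi_def)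
    moreover have "\<pi> \<circ> p \<in> words n \<pi>" using True by (auto simp: words_def)
    ultimately show ?thesis using True finite_words[of n \<pi>] by (simp add: pull_def del: o_apply)
  qed (simp add: pull_def sum_fun_apply chi_def)
qed

text \<open>An ascent or descent of p may be flattened to an equality by \<pi> but never reversed.
  In the flattened case the value at p equals the one at the interchanged place, and all branches of
  \<open>T\<close> give the factor q.\<close>

lemma T_pull:
  assumes \<pi>: "mono_on {1..n} \<pi>" and i: "i \<in> {1..<n}"
  shows "T q i \<triangleright> pull n \<pi> \<phi> = pull n \<pi> (T q i \<triangleright> \<phi>)"
proof
  fix p
  show "(T q i \<triangleright> pull n \<pi> \<phi>) p = pull n \<pi> (T q i \<triangleright> \<phi>) p"
  proof (cases "p permutes {1..n}")
    case True
    have in_n: "p i \<in> {1..n}" "p (Suc i) \<in> {1..n}"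
      using permutes_in_image[OF True, of i] permutes_in_image[OF True, of "Suc i"] i by auto
    have ne: "p i \<noteq> p (Suc i)" using permutes_inj[OF True] by (metis injD n_not_Suc_n)
    have s: "(\<pi> \<circ> p) i = \<pi> (p i)" "(\<pi> \<circ> p) (Suc i) = \<pi> (p (Suc i))" by simp_all
    have pa: "pull n \<pi> \<phi> (p \<circ> adj i) = \<phi> (\<pi> \<circ> p \<circ> adj i)" "pull n \<pi> \<phi> p = \<phi> (\<pi> \<circ> p)"
      using True comp_adj_permutes[OF i] by (simp_all add: pull_def comp_assoc del: o_apply)
    have rhs: "pull n \<pi> (T q i \<triangleright> \<phi>) p = (T q i \<triangleright> \<phi>) (\<pi> \<circ> p)" using True by (simp add: pull_def)
    have eq: "\<phi> (\<pi> \<circ> p \<circ> adj i) = \<phi> (\<pi> \<circ> p)" if "\<pi> (p i) = \<pi> (p (Suc i))"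
      using comp_adj_eq[of "\<pi> \<circ> p" i] that by simp
    have m: "p i < p (Suc i) \<Longrightarrow> \<pi> (p i) \<le> \<pi> (p (Suc i))" "p (Suc i) < p i \<Longrightarrow> \<pi> (p (Suc i)) \<le> \<pi> (p i)"
      using mono_onD[OF \<pi> in_n] mono_onD[OF \<pi> in_n(2,1)] by simp_all
    show ?thesis
      unfolding rhs T_app pa s using ne m eq
      by (cases "\<pi> (p i)" "\<pi> (p (Suc i))" rule: linorder_cases;
          cases "p i" "p (Suc i)" rule: linorder_cases) (simp_all add: algebra_simps del: o_apply)
  next
    case False
    then show ?thesis
      using comp_adj_permutes[OF i, of p] by (simp add: pull_def T_app del: o_apply)
  qed
qed

lemma Hk_pull:
  assumes \<pi>: "mono_on {1..n} \<pi>"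
  shows "a \<in> Hk n q \<Longrightarrow> a \<triangleright> pull n \<pi> \<phi> = pull n \<pi> (a \<triangleright> \<phi>)"
proof (induction rule: Hk_induct)
  case (Tl l)
  then show ?case by (induction l) (simp_all add: T_pull[OF \<pi>])
qed (simp_all add: pull_add pull_vsc del: plus_fun_apply vsc_apply)

section \<open>Weighted sums of words\<close>

definition matched :: "nat \<Rightarrow> (nat \<Rightarrow> nat \<Rightarrow> bool) \<Rightarrow> (nat \<Rightarrow> nat) set \<Rightarrow> (nat \<Rightarrow> nat) \<Rightarrow> (nat \<Rightarrow> nat) set" where
  "matched n m S \<pi> = {c \<in> S. \<forall>r\<in>{1..n}. m (\<pi> r) (c r)}"

text \<open>Counts the places a < b at which c has equal letters while \<pi> decreases.\<close>

abbreviation twist :: "nat \<Rightarrow> (nat \<Rightarrow> nat) \<Rightarrow> (nat \<Rightarrow> nat) \<Rightarrow> nat" where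
  "twist n \<pi> c \<equiv> pair_count n (\<lambda>(x, y) (x', y'). x' < x \<and> y = y') (\<lambda>r. (\<pi> r, c r))"

text \<open>The q-analogue of the sum of all words in \<open>S\<close> that fit the pattern \<pi>.
  The powers of q are chosen so that the generators act on these sums as on the basis vectors at
  \<pi>, at ascents and at equal letters; they play the role of images of basis vectors under a
  homomorphism of permutation modules.\<close>

definition wsum :: "nat \<Rightarrow> 'r::comm_ring_1 \<Rightarrow> (nat \<Rightarrow> nat \<Rightarrow> bool) \<Rightarrow> (nat \<Rightarrow> nat) set \<Rightarrow> (nat \<Rightarrow> nat) \<Rightarrow> 'r vec" where
  "wsum n q m S \<pi> = (\<lambda>c. if c \<in> matched n m S \<pi> then q ^ twist n \<pi> c else 0)"

lemma twist_adj:
  assumes i: "i \<in> {1..<n}"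
  shows "twist n (\<pi> \<circ> adj i) (c \<circ> adj i) + (if \<pi> (Suc i) < \<pi> i \<and> c i = c (Suc i) then 1 else 0)
    = twist n \<pi> c + (if \<pi> i < \<pi> (Suc i) \<and> c i = c (Suc i) then 1 else 0)"
proof -
  have "(\<lambda>r. ((\<pi> \<circ> adj i) r, (c \<circ> adj i) r)) = (\<lambda>r. (\<pi> r, c r)) \<circ> adj i" by auto
  then show ?thesis
    using pair_count_adj[OF i, of "\<lambda>(x, y) (x', y'). x' < x \<and> y = y'" "\<lambda>r. (\<pi> r, c r)"]
    by (auto simp del: o_apply split: if_splits)
qed

text \<open>By \<open>m_mono\<close> a fitting word cannot descend where its pattern ascends. This
  is what makes the term with factor q - 1 disappear in \<open>T_wsum_asc\<close>.\<close>

locale word_match =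
  fixes n :: nat and m :: "nat \<Rightarrow> nat \<Rightarrow> bool" and S :: "(nat \<Rightarrow> nat) set"
  assumes m_mono: "m x y \<Longrightarrow> m x' y' \<Longrightarrow> x < x' \<Longrightarrow> y \<le> y'"
    and S_adj: "i \<in> {1..<n} \<Longrightarrow> c \<in> S \<Longrightarrow> c \<circ> adj i \<in> S"
begin

lemma matched_adj:
  assumes i: "i \<in> {1..<n}"
  shows "c \<circ> adj i \<in> matched n m S (\<pi> \<circ> adj i) \<longleftrightarrow> c \<in> matched n m S \<pi>"
proof -
  have *: "d \<circ> adj i \<in> matched n m S (\<rho> \<circ> adj i)" if "d \<in> matched n m S \<rho>" for d \<rho>
    using that S_adj[OF i, of d] adj_in[OF i] by (auto simp: matched_def simp del: atLeastAtMost_iff)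
  show ?thesis using *[of c \<pi>] *[of "c \<circ> adj i" "\<pi> \<circ> adj i"] by (auto simp del: o_apply)
qed

lemma matched_order:
  assumes i: "i \<in> {1..<n}" and c: "c \<in> matched n m S \<pi>"
  shows "\<pi> i < \<pi> (Suc i) \<Longrightarrow> c i \<le> c (Suc i)" "\<pi> (Suc i) < \<pi> i \<Longrightarrow> c (Suc i) \<le> c i"
proof -
  have "m (\<pi> i) (c i)" "m (\<pi> (Suc i)) (c (Suc i))"
    using i c by (auto simp: matched_def)
  then show "\<pi> i < \<pi> (Suc i) \<Longrightarrow> c i \<le> c (Suc i)" "\<pi> (Suc i) < \<pi> i \<Longrightarrow> c (Suc i) \<le> c i"
    using m_mono by blast+
qed

lemma T_wsum_asc:
  assumes i: "i \<in> {1..<n}" and asc: "\<pi> i < \<pi> (Suc i)"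
  shows "T q i \<triangleright> wsum n q m S \<pi> = wsum n q m S (\<pi> \<circ> adj i)"
proof
  fix c :: "nat \<Rightarrow> nat"
  have s: "(c \<circ> adj i) i = c (Suc i)" "(c \<circ> adj i) (Suc i) = c i"
    "(\<pi> \<circ> adj i) i = \<pi> (Suc i)" "(\<pi> \<circ> adj i) (Suc i) = \<pi> i" by simp_all
  have mm: "c \<in> matched n m S (\<pi> \<circ> adj i) \<longleftrightarrow> c \<circ> adj i \<in> matched n m S \<pi>"
    using matched_adj[OF i, of "c \<circ> adj i" \<pi>] by (simp del: o_apply)
  note tw = twist_adj[OF i, of \<pi> "c \<circ> adj i", unfolded s comp_adj_adj]
  show "(T q i \<triangleright> wsum n q m S \<pi>) c = wsum n q m S (\<pi> \<circ> adj i) c"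
  proof (cases "c i" "c (Suc i)" rule: linorder_cases)
    case less
    then have "c \<circ> adj i \<notin> matched n m S \<pi>"
      using matched_order(1)[OF i, of "c \<circ> adj i" \<pi>] asc s by fastforce
    then show ?thesis using less mm by (simp add: T_app wsum_def del: o_apply)
  next
    case equal
    then have c: "c \<circ> adj i = c" by (rule comp_adj_eq)
    then show ?thesis using equal mm tw asc by (simp add: T_app wsum_def power_add mult.commute del: o_apply)
  next
    case greater
    then have "c \<notin> matched n m S \<pi>"
      using matched_order(1)[OF i, of c \<pi>] asc by fastforce
    then show ?thesis using greater mm tw asc by (simp add: T_app wsum_def del: o_apply)
  qed
qed

lemma T_wsum_eq:
  assumes i: "i \<in> {1..<n}" and eq: "\<pi> i = \<pi> (Suc i)"
  shows "T q i \<triangleright> wsum n q m S \<pi> = vsc q (wsum n q m S \<pi>)"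
proof
  fix c :: "nat \<Rightarrow> nat"
  have \<pi>: "\<pi> \<circ> adj i = \<pi>" using eq by (rule comp_adj_eq)
  have mm: "c \<circ> adj i \<in> matched n m S \<pi> \<longleftrightarrow> c \<in> matched n m S \<pi>"
    using matched_adj[OF i, of c \<pi>] \<pi> by (simp del: o_apply)
  have tw: "twist n \<pi> (c \<circ> adj i) = twist n \<pi> c"
    using twist_adj[OF i, of \<pi> c] \<pi> eq by (simp del: o_apply)
  show "(T q i \<triangleright> wsum n q m S \<pi>) c = vsc q (wsum n q m S \<pi>) c"
    by (simp add: T_app wsum_def mm tw algebra_simps del: o_apply)
qed

end

section \<open>Straightening\<close>

definition above :: "nat \<Rightarrow> nat list \<Rightarrow> nat list set" where
  "above n la = {mu \<in> Par n. dominated_by la mu \<and> mu \<noteq> la}"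

text \<open>
  Standard tableaux correspond to lattice words: the letter at the place \<open>r\<close> is the row that
  contains the entry \<open>r\<close>.
\<close>

definition lat :: "nat \<Rightarrow> (nat \<Rightarrow> nat) \<Rightarrow> bool" where
  "lat n c \<longleftrightarrow> (\<forall>m\<le>n. \<forall>l. cntw m c (Suc l) \<le> cntw m c l)"

definition latw :: "nat \<Rightarrow> nat list \<Rightarrow> (nat \<Rightarrow> nat) set" where
  "latw n la = {c \<in> words n (row la). lat n c}"

context hecke_unit
begin

definition yideal :: "nat list set \<Rightarrow> 'r endo set" where
  "yideal S = endo_span {h * Y (row mu) * h' | h h' mu. mu \<in> S \<and> h \<in> H \<and> h' \<in> H}"

lemma yideal_gen: "mu \<in> S \<Longrightarrow> h \<in> H \<Longrightarrow> h' \<in> H \<Longrightarrow> h * Y (row mu) * h' \<in> yideal S"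
  unfolding yideal_def by (rule endo.span_base) blast

lemma yideal_Hk: "z \<in> yideal S \<Longrightarrow> z \<in> H"
proof -
  have "yideal S \<subseteq> H"
    unfolding yideal_def by (rule endo.span_minimal[OF _ Hk_subspace]) (auto intro!: Hk_mult Y_Hk)
  then show "z \<in> yideal S \<Longrightarrow> z \<in> H" by blast
qed

lemma yideal_subspace: "endo_subspace (yideal S)"
  unfolding yideal_def by (rule endo.subspace_span)

lemmas yideal_zero = endo.subspace_0[OF yideal_subspace]
lemmas yideal_add = endo.subspace_add[OF yideal_subspace]
lemmas yideal_diff = endo.subspace_diff[OF yideal_subspace]
lemmas yideal_smul = endo.subspace_scale[OF yideal_subspace]
lemmas yideal_sum = endo.subspace_sum[OF yideal_subspace]

lemma yideal_mono: "S \<subseteq> S' \<Longrightarrow> yideal S \<subseteq> yideal S'"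
  unfolding yideal_def by (rule endo.span_mono) blast

lemma yideal_left:
  assumes h: "h \<in> H" and z: "z \<in> yideal S"
  shows "h * z \<in> yideal S"
proof -
  have "yideal S \<subseteq> {z. h * z \<in> yideal S}"
  proof (subst yideal_def, rule endo.span_minimal)
    show "{h * Y (row mu) * h' |h h' mu. mu \<in> S \<and> h \<in> H \<and> h' \<in> H} \<subseteq> {z. h * z \<in> yideal S}"
      using h yideal_gen[of _ S] Hk_mult[OF h] by (auto simp flip: mult.assoc)
    show "endo_subspace {z. h * z \<in> yideal S}"
      by (auto simp: endo.subspace_def yideal_zero yideal_add yideal_smul distrib_left)
  qed
  then show ?thesis using z by blast
qed

lemma star_yideal:
  assumes z: "z \<in> yideal S"
  shows "star z \<in> yideal S"
proof -
  have "yideal S \<subseteq> {z \<in> H. star z \<in> yideal S}"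
  proof (subst yideal_def, rule endo.span_minimal)
    show "{h * Y (row mu) * h' |h h' mu. mu \<in> S \<and> h \<in> H \<and> h' \<in> H} \<subseteq> {z \<in> H. star z \<in> yideal S}"
    proof clarify
      fix h h' mu assume *: "mu \<in> S" "h \<in> H" "h' \<in> H"
      then have "star (h * Y (row mu) * h') = star h' * Y (row mu) * star h"
        by (simp add: star_mult star_Y Hk_mult Y_Hk mult.assoc)
      then show "h * Y (row mu) * h' \<in> H \<and> star (h * Y (row mu) * h') \<in> yideal S"
        using * by (simp add: yideal_gen star_Hk Hk_mult Y_Hk)
    qed
    show "endo_subspace {z \<in> H. star z \<in> yideal S}"
      by (auto simp: endo.subspace_def yideal_zero yideal_add yideal_smul Hk_add Hk_smul star_add star_smul)
  qed
  then show ?thesis using z by blast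
qed

lemma yideal_right:
  assumes "h \<in> H" "z \<in> yideal S"
  shows "z * h \<in> yideal S"
proof -
  have "star (star h * star z) \<in> yideal S"
    by (intro star_yideal yideal_left star_Hk assms)
  then show ?thesis
    using assms(1) yideal_Hk[OF assms(2)] by (simp add: star_mult star_star star_Hk)
qed

end

lemma sum_list_Par: "la \<in> Par n \<Longrightarrow> sum_list la = n"
  by (simp add: Par_def)

text \<open>
  In a pattern the letter \<open>3 l\<close> stands for a fixed letter \<open>l\<close>, and \<open>3 i + 1\<close> for a free choice
  between \<open>i\<close> and \<open>i + 1\<close>.
\<close>

definition fits :: "nat \<Rightarrow> nat \<Rightarrow> nat \<Rightarrow> bool" where
  "fits i x l \<longleftrightarrow> (if x = 3 * i + 1 then l = i \<or> l = Suc i else x = 3 * l)"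

locale straighten = hecke_unit n q for n and q :: "'r::comm_ring_1" +
  fixes la :: "nat list"
  assumes la: "la \<in> Par n"
begin

abbreviation "S0 \<equiv> words n (row la)"

lemma row_la: "mono_on {1..n} (row la)" "cntw n (row la) l = part la l" "r \<notin> {1..n} \<Longrightarrow> row la r = 0"
  using row_mono[of la] cntw_row[of la l] row_outside[of r la] sum_list_Par[OF la] by simp_all

lemma S0_cntw: "c \<in> S0 \<Longrightarrow> cntw n c l = part la l"
  using row_la by (simp add: words_iff_cntw)

text \<open>The functions of words of content \<open>la\<close> that vanish in the cell module of \<open>la\<close>.\<close>

definition higher :: "'r vec \<Rightarrow> bool" where
  "higher \<phi> \<longleftrightarrow> (\<exists>z\<in>yideal (above n la). z \<triangleright> de id = pull n (row la) \<phi>)"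

lemma higher_zero: "higher 0"
  unfolding higher_def by (rule bexI[of _ 0]) (simp_all add: pull_zero yideal_zero del: zero_fun_apply)

lemma higher_add: "higher \<phi> \<Longrightarrow> higher \<psi> \<Longrightarrow> higher (\<phi> + \<psi>)"
  unfolding higher_def using yideal_add pull_add plus_app by metis

lemma higher_vsc: "higher \<phi> \<Longrightarrow> higher (vsc r \<phi>)"
  unfolding higher_def using yideal_smul pull_vsc smul_app by metis

lemma higher_diff: "higher \<phi> \<Longrightarrow> higher \<psi> \<Longrightarrow> higher (\<phi> - \<psi>)"
proof -
  assume "higher \<phi>" "higher \<psi>"
  then have "higher (\<phi> + vsc (- 1) \<psi>)" by (intro higher_add higher_vsc)
  moreover have "\<phi> + vsc (- 1) \<psi> = \<phi> - \<psi>" by (auto simp: fun_eq_iff)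
  ultimately show ?thesis by simp
qed

lemma higher_sum: "(\<And>i. i \<in> A \<Longrightarrow> higher (f i)) \<Longrightarrow> higher (sum f A)"
  by (induction A rule: infinite_finite_induct) (auto simp: higher_zero intro: higher_add)

lemma higher_T:
  assumes "higher \<phi>" "i \<in> {1..<n}"
  shows "higher (T q i \<triangleright> \<phi>)"
proof -
  obtain z where z: "z \<in> yideal (above n la)" "z \<triangleright> de id = pull n (row la) \<phi>"
    using assms by (auto simp: higher_def)
  then have "T q i * z \<in> yideal (above n la)" using Hk_T[OF assms(2)] by (intro yideal_left)
  moreover have "(T q i * z) \<triangleright> de id = pull n (row la) (T q i \<triangleright> \<phi>)"
    using z by (simp add: T_pull[OF row_la(1) assms(2)])
  ultimately show ?thesis unfolding higher_def by blast
qed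

text \<open>A function invariant under the Young subgroup of \<pi> lies in the right ideal generated
  by \<open>Y \<pi>\<close>, by \<open>left_invariant\<close>. Up to conjugation this Young sum
  belongs to the partition \<open>mu\<close>, which is strictly larger than
  \<open>la\<close>.\<close>

lemma higher_invariant:
  fixes \<pi> :: "nat \<Rightarrow> nat"
  assumes \<pi>: "mono_on {1..n} \<pi>" and mu: "mu \<in> above n la" and \<kappa>: "\<kappa> \<in> words n (row mu)"
    and lev: "\<And>r s. r \<in> {1..n} \<Longrightarrow> s \<in> {1..n} \<Longrightarrow> \<kappa> r = \<kappa> s \<longleftrightarrow> \<pi> r = \<pi> s"
    and inv: "\<And>i. i \<in> {1..<n} \<Longrightarrow> \<pi> i = \<pi> (Suc i) \<Longrightarrow> T q i \<triangleright> \<phi> = vsc q \<phi>"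
  shows "higher \<phi>"
proof -
  define z where "z = el n q (pull n (row la) \<phi>)"
  have z: "z \<in> H" "z \<triangleright> de id = pull n (row la) \<phi>"
    unfolding z_def by (simp_all add: el_Hk el_app supp_pull)
  have "\<exists>h\<in>H. z = Y \<pi> * h"
  proof (rule left_invariant[OF \<pi> z(1)])
    fix i assume i: "i \<in> {1..<n}" "\<pi> i = \<pi> (Suc i)"
    show "T q i * z = smul q z"
    proof (rule Hk_eqI[of _ n q])
      show "(T q i * z) \<triangleright> de id = smul q z \<triangleright> de id"
        using z inv[OF i] by (simp add: T_pull[OF row_la(1) i(1)] pull_vsc del: vsc_apply)
    qed (intro Hk_mult Hk_smul Hk_T z i)+
  qed
  then obtain h where h: "h \<in> H" "z = Y \<pi> * h" by blast
  have mu': "mono_on {1..n} (row mu)"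
    using row_mono[of mu] mu sum_list_Par[of mu n] by (simp add: above_def)
  obtain g g' where g: "g \<in> H" "g' \<in> H" "Y \<pi> = g * Y (row mu) * g'"
    using Y_conjugate[OF \<pi> mu' \<kappa> lev] by blast
  then have "z = g * Y (row mu) * (g' * h)" using h by (simp add: mult.assoc)
  then have "z \<in> yideal (above n la)" using mu g h by (simp add: yideal_gen Hk_mult)
  then show ?thesis using z(2) unfolding higher_def by blast
qed

lemma word_match_fits: "word_match n (fits i) S0"
proof
  show "y \<le> y'" if "fits i x y" "fits i x' y'" "x < x'" for x y x' y'
    using that by (auto simp: fits_def split: if_splits)
qed (rule words_adj)

abbreviation "\<Phi> i \<equiv> wsum n q (fits i) S0"

lemma cntw_adj: "j \<in> {1..<n} \<Longrightarrow> cntw n (\<pi> \<circ> adj j) l = cntw n \<pi> l"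
  using words_adj[OF _ words_self, of j n \<pi>] unfolding words_iff_cntw by blast

lemma matched_cntw:
  assumes c: "c \<in> matched n (fits i) S0 \<pi>"
  shows "l \<noteq> i \<Longrightarrow> l \<noteq> Suc i \<Longrightarrow> cntw n \<pi> (3 * l) = part la l"
    "cntw n \<pi> (3 * i) + cntw n \<pi> (3 * i + 1) + cntw n \<pi> (3 * Suc i) = part la i + part la (Suc i)"
proof -
  have f: "fits i (\<pi> r) (c r)" if "r \<in> {1..n}" for r using c that by (simp add: matched_def)
  have S: "c \<in> S0" using c by (simp add: matched_def)
  show "cntw n \<pi> (3 * l) = part la l" if l: "l \<noteq> i" "l \<noteq> Suc i"
  proof -
    have "\<pi> r = 3 * l \<longleftrightarrow> c r = l" if "r \<in> {1..n}" for r
      using f[OF that] l unfolding fits_def by (auto split: if_splits)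
    then have "{r \<in> {1..n}. \<pi> r = 3 * l} = {r \<in> {1..n}. c r = l}" by blast
    then show ?thesis using S0_cntw[OF S, of l] by (simp add: cntw_def)
  qed
  let ?A = "\<lambda>f l. {r \<in> {1..n}. f r = l}"
  have eq: "?A \<pi> (3 * i) \<union> ?A \<pi> (3 * i + 1) \<union> ?A \<pi> (3 * Suc i) = ?A c i \<union> ?A c (Suc i)"
  proof -
    have "\<pi> r = 3 * i \<or> \<pi> r = 3 * i + 1 \<or> \<pi> r = 3 * Suc i \<longleftrightarrow> c r = i \<or> c r = Suc i"
      if "r \<in> {1..n}" for r
      using f[OF that] unfolding fits_def by (auto split: if_splits)
    then show ?thesis by blast
  qed
  have "card (?A \<pi> (3 * i) \<union> ?A \<pi> (3 * i + 1) \<union> ?A \<pi> (3 * Suc i))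
      = cntw n \<pi> (3 * i) + cntw n \<pi> (3 * i + 1) + cntw n \<pi> (3 * Suc i)"
    unfolding cntw_def by (subst card_Un_disjoint; (subst card_Un_disjoint)?) auto
  moreover have "card (?A c i \<union> ?A c (Suc i)) = cntw n c i + cntw n c (Suc i)"
    unfolding cntw_def by (subst card_Un_disjoint) auto
  ultimately show "cntw n \<pi> (3 * i) + cntw n \<pi> (3 * i + 1) + cntw n \<pi> (3 * Suc i) = part la i + part la (Suc i)"
    using S0_cntw[OF S, of i] S0_cntw[OF S, of "Suc i"] unfolding eq by linarith
qed

text \<open>With no letter i fixed and fewer than \<lambda>_(i+1) letters i + 1 fixed, more than
  \<lambda>_i places are free. The content of the pattern, sorted, therefore strictly dominates
  \<open>la\<close>, and the sum is invariant under the Young subgroup of the pattern.\<close>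

lemma garnir_base:
  assumes \<pi>: "mono_on {1..n} \<pi>" and u: "cntw n \<pi> (3 * i) = 0" and v: "cntw n \<pi> (3 * Suc i) < part la (Suc i)"
  shows "higher (\<Phi> i \<pi>)"
proof (cases "matched n (fits i) S0 \<pi> = {}")
  case True
  then have "\<Phi> i \<pi> = 0" by (auto simp: wsum_def fun_eq_iff)
  then show ?thesis by (simp add: higher_zero)
next
  case False
  then obtain c where c: "c \<in> matched n (fits i) S0 \<pi>" by blast
  note cnt = matched_cntw[OF c]
  obtain mu \<kappa> where mu: "mu \<in> Par n" and \<kappa>: "\<kappa> \<in> words n (row mu)"
    and lev: "\<And>r s. r \<in> {1..n} \<Longrightarrow> s \<in> {1..n} \<Longrightarrow> \<kappa> r = \<kappa> s \<longleftrightarrow> \<pi> r = \<pi> s"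
    and le: "\<And>A. finite A \<Longrightarrow> (\<Sum>l\<in>A. cntw n \<pi> l) \<le> (\<Sum>k<card A. part mu k)"
    by (rule word_shape[of n \<pi>]) blast
  have inj: "inj_on (\<lambda>l::nat. 3 * l) A" for A by (auto simp: inj_on_def)
  have small: "(\<Sum>l<k. part la l) \<le> (\<Sum>l<k. part mu l)" if "k \<le> i" for k
  proof -
    have "(\<Sum>l<k. part la l) = (\<Sum>l\<in>(\<lambda>l. 3 * l) ` {..<k}. cntw n \<pi> l)"
      unfolding sum.reindex[OF inj] using cnt(1) that by (intro sum.cong) auto
    also have "\<dots> \<le> (\<Sum>l<k. part mu l)"
      using le[of "(\<lambda>l. 3 * l) ` {..<k}"] card_image[OF inj, of "{..<k}"] by simp
    finally show ?thesis .
  qed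
  \<comment> \<open>The k letters used are those of the rows below k, with the letter for row i
    replaced by the free letter.\<close>
  have big: "cntw n \<pi> (3 * i + 1) + (\<Sum>l\<in>{..<k} - {i}. cntw n \<pi> (3 * l)) \<le> (\<Sum>l<k. part mu l)"
    if "i < k" for k
  proof -
    let ?A = "(\<lambda>l. 3 * l) ` ({..<k} - {i})"
    have ni: "3 * i + 1 \<notin> ?A" by auto
    have "card (insert (3 * i + 1) ?A) = k"
      using ni card_image[OF inj, of "{..<k} - {i}"] that by simp
    moreover have "(\<Sum>l\<in>insert (3 * i + 1) ?A. cntw n \<pi> l)
        = cntw n \<pi> (3 * i + 1) + (\<Sum>l\<in>{..<k} - {i}. cntw n \<pi> (3 * l))"
      using ni by (simp add: sum.reindex[OF inj])
    ultimately show ?thesis using le[of "insert (3 * i + 1) ?A"] by simp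
  qed
  have strict: "(\<Sum>l<Suc i. part la l) < (\<Sum>l<Suc i. part mu l)"
  proof -
    have "{..<Suc i} - {i} = {..<i}" by auto
    then have "(\<Sum>l\<in>{..<Suc i} - {i}. cntw n \<pi> (3 * l)) = (\<Sum>l<i. part la l)"
      using cnt(1) by (intro sum.cong) auto
    then show ?thesis using big[of "Suc i"] cnt(2) u v by simp
  qed
  have large: "(\<Sum>l<k. part la l) \<le> (\<Sum>l<k. part mu l)" if k: "Suc i < k" for k
  proof -
    have d: "{..<k} = insert i (insert (Suc i) ({..<k} - {i, Suc i}))"
      "{..<k} - {i} = insert (Suc i) ({..<k} - {i, Suc i})" using k by auto
    have "(\<Sum>l\<in>{..<k} - {i, Suc i}. cntw n \<pi> (3 * l)) = (\<Sum>l\<in>{..<k} - {i, Suc i}. part la l)"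
      using cnt(1) by (intro sum.cong) auto
    then have "(\<Sum>l\<in>{..<k} - {i}. cntw n \<pi> (3 * l)) = cntw n \<pi> (3 * Suc i) + (\<Sum>l\<in>{..<k} - {i, Suc i}. part la l)"
      unfolding d(2) by simp
    moreover have "(\<Sum>l<k. part la l) = part la i + (part la (Suc i) + (\<Sum>l\<in>{..<k} - {i, Suc i}. part la l))"
      by (subst d(1)) simp
    ultimately show ?thesis using big[of k] cnt(2) u k by simp
  qed
  have "dominated_by la mu"
    unfolding dominated_by_part using small large strict
    by (metis less_imp_le_nat linorder_neqE_nat not_less_eq not_le)
  moreover have "mu \<noteq> la" using strict by auto
  ultimately have "mu \<in> above n la" using mu by (simp add: above_def)
  then show ?thesis
    by (rule higher_invariant[OF \<pi> _ \<kappa> lev word_match.T_wsum_eq[OF word_match_fits]])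
qed

text \<open>Freeing all fixed letters i gives a pattern covered by \<open>garnir_base\<close>. Its
  sum splits according to the set K of freed places that receive i + 1. The part for empty K is the
  wanted one; every other K leaves fewer letters i fixed and keeps the total of fixed letters i and
  i + 1.\<close>

lemma garnir_step:
  assumes \<pi>: "mono_on {1..n} \<pi>" and uv: "cntw n \<pi> (3 * i) + cntw n \<pi> (3 * Suc i) < part la (Suc i)"
    and IH: "\<And>\<rho>. cntw n \<rho> (3 * i) < cntw n \<pi> (3 * i) \<Longrightarrow>
      cntw n \<rho> (3 * i) + cntw n \<rho> (3 * Suc i) < part la (Suc i) \<Longrightarrow> higher (\<Phi> i \<rho>)"
    and u: "cntw n \<pi> (3 * i) \<noteq> 0"
  shows "higher (\<Phi> i \<pi>)"
proof -
  obtain p where "q * p = 1" using unit by (metis dvd_def)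
  then have pq: "p ^ k * q ^ k = 1" for k by (metis mult.commute power_mult_distrib power_one)
  define X where "X = {r \<in> {1..n}. \<pi> r = 3 * i}"
  have X: "finite X" "card X = cntw n \<pi> (3 * i)" by (simp_all add: X_def cntw_def)
  define \<pi>' where "\<pi>' r = (if r \<in> X then 3 * i + 1 else \<pi> r)" for r
  define \<rho> where "\<rho> K r = (if r \<in> K then 3 * Suc i else \<pi> r)" for K r
  \<comment> \<open>The twist of the pattern for K: every place of K precedes every free place that
    carries i + 1, and there are \<lambda>_(i+1) minus the fixed letters i + 1 minus |K| such free
    places.\<close>
  define e where "e K = card K * (part la (Suc i) - cntw n \<pi> (3 * Suc i) - card K)" for K :: "nat set"
  have \<pi>'_mono: "mono_on {1..n} \<pi>'"
  proof (rule mono_onI)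
    fix r s assume rs: "r \<in> {1..n}" "s \<in> {1..n}" "r \<le> s"
    then have "\<pi> r \<le> \<pi> s" by (rule mono_onD[OF \<pi>])
    then show "\<pi>' r \<le> \<pi>' s" using rs by (auto simp: \<pi>'_def X_def)
  qed
  have \<pi>'_cnt: "cntw n \<pi>' (3 * i) = 0" "cntw n \<pi>' (3 * Suc i) = cntw n \<pi> (3 * Suc i)"
  proof -
    have "{r \<in> {1..n}. \<pi>' r = 3 * i} = {}" by (auto simp: \<pi>'_def X_def)
    then show "cntw n \<pi>' (3 * i) = 0" by (simp only: cntw_def card.empty)
    have "{r \<in> {1..n}. \<pi>' r = 3 * Suc i} = {r \<in> {1..n}. \<pi> r = 3 * Suc i}"
      by (auto simp: \<pi>'_def X_def)
    then show "cntw n \<pi>' (3 * Suc i) = cntw n \<pi> (3 * Suc i)" by (simp only: cntw_def)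
  qed
  have \<rho>_cnt: "cntw n (\<rho> K) (3 * i) = cntw n \<pi> (3 * i) - card K"
    "cntw n (\<rho> K) (3 * Suc i) = cntw n \<pi> (3 * Suc i) + card K" if K: "K \<subseteq> X" for K
  proof -
    have fK: "finite K" using K X(1) finite_subset by blast
    have "{r \<in> {1..n}. \<rho> K r = 3 * i} = X - K" using K by (auto simp: \<rho>_def X_def)
    then show "cntw n (\<rho> K) (3 * i) = cntw n \<pi> (3 * i) - card K"
      using card_Diff_subset[OF fK K] X by (simp add: cntw_def)
    have "{r \<in> {1..n}. \<rho> K r = 3 * Suc i} = {r \<in> {1..n}. \<pi> r = 3 * Suc i} \<union> K"
      using K by (auto simp: \<rho>_def X_def)
    moreover have "{r \<in> {1..n}. \<pi> r = 3 * Suc i} \<inter> K = {}" using K by (auto simp: X_def)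
    ultimately show "cntw n (\<rho> K) (3 * Suc i) = cntw n \<pi> (3 * Suc i) + card K"
      using fK by (simp add: cntw_def card_Un_disjoint)
  qed
  have m\<rho>: "c \<in> matched n (fits i) S0 (\<rho> K) \<longleftrightarrow>
      c \<in> matched n (fits i) S0 \<pi>' \<and> K = {r \<in> X. c r = Suc i}" if K: "K \<subseteq> X" for K c
  proof -
    have "fits i (\<rho> K r) (c r) \<longleftrightarrow> fits i (\<pi>' r) (c r) \<and> (r \<in> X \<longrightarrow> (r \<in> K \<longleftrightarrow> c r = Suc i))"
      if "r \<in> {1..n}" for r
      using K by (auto simp: fits_def \<rho>_def \<pi>'_def X_def that)
    then show ?thesis using K by (auto simp: matched_def X_def)
  qed
  have tw': "twist n \<pi>' c = 0" for c
  proof -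
    have "{(a, b). a \<in> {1..n} \<and> b \<in> {1..n} \<and> a < b \<and> (\<lambda>(x, y) (x', y'). x' < x \<and> y = y') (\<pi>' a, c a) (\<pi>' b, c b)} = {}"
      using mono_onD[OF \<pi>'_mono] by (fastforce simp: not_less[symmetric])
    then show ?thesis unfolding pair_count_def by (simp only: card.empty)
  qed
  have tw\<rho>: "twist n (\<rho> K) c = e K" if K: "K \<subseteq> X" and c: "c \<in> matched n (fits i) S0 (\<rho> K)" for K c
  proof -
    have c': "c \<in> matched n (fits i) S0 \<pi>'" and Kc: "K = {r \<in> X. c r = Suc i}"
      using m\<rho>[OF K] c by auto
    have f: "fits i (\<pi>' r) (c r)" if "r \<in> {1..n}" for r using c' that by (simp add: matched_def)
    define Y1 where "Y1 = {r \<in> {1..n}. \<pi> r = 3 * i + 1 \<and> c r = Suc i}"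
    have "{(a, b). a \<in> {1..n} \<and> b \<in> {1..n} \<and> a < b \<and> (\<lambda>(x, y) (x', y'). x' < x \<and> y = y') (\<rho> K a, c a) (\<rho> K b, c b)}
        = K \<times> Y1" (is "?L = _")
    proof (rule Set.set_eqI, unfold split_paired_all)
      fix a b
      show "(a, b) \<in> ?L \<longleftrightarrow> (a, b) \<in> K \<times> Y1"
      proof
        assume "(a, b) \<in> ?L"
        then have ab: "a \<in> {1..n}" "b \<in> {1..n}" "a < b" "\<rho> K b < \<rho> K a" "c a = c b" by auto
        then have "\<pi> a \<le> \<pi> b" using mono_onD[OF \<pi>] by simp
        then have aK: "a \<in> K" using ab K by (auto simp: \<rho>_def X_def split: if_splits)
        then have "\<rho> K a = 3 * Suc i" "c a = Suc i" using Kc by (auto simp: \<rho>_def)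
        then have b: "\<rho> K b < 3 * Suc i" "c b = Suc i" "b \<notin> K" using ab by (auto simp: \<rho>_def)
        then have "b \<notin> X" using Kc by auto
        then have "\<pi>' b = \<pi> b" "\<rho> K b = \<pi> b" using b by (auto simp: \<pi>'_def \<rho>_def)
        then have "\<pi> b = 3 * i + 1"
          using f[OF ab(2)] b by (auto simp: fits_def split: if_splits)
        then show "(a, b) \<in> K \<times> Y1" using aK ab b by (auto simp: Y1_def)
      next
        assume "(a, b) \<in> K \<times> Y1"
        then have a: "a \<in> X" "c a = Suc i" "a \<in> K" and b: "b \<in> {1..n}" "\<pi> b = 3 * i + 1" "c b = Suc i"
          using Kc by (auto simp: Y1_def)
        have "a < b"
        proof (rule ccontr)
          assume "\<not> a < b"
          then have "\<pi> b \<le> \<pi> a" using mono_onD[OF \<pi>, of b a] a b by (auto simp: X_def)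
          then show False using a b by (auto simp: X_def)
        qed
        moreover have "\<rho> K a = 3 * Suc i" "\<rho> K b = 3 * i + 1"
          using a b K by (auto simp: \<rho>_def X_def)
        ultimately show "(a, b) \<in> ?L" using a b by (auto simp: X_def)
      qed
    qed
    then have "twist n (\<rho> K) c = card K * card Y1"
      unfolding pair_count_def by (simp only: card_cartesian_product)
    moreover have "part la (Suc i) = card K + card Y1 + cntw n \<pi> (3 * Suc i)"
    proof -
      have "{r \<in> {1..n}. c r = Suc i} = K \<union> Y1 \<union> {r \<in> {1..n}. \<pi> r = 3 * Suc i}"
      proof (intro Set.set_eqI iffI)
        fix r assume "r \<in> {r \<in> {1..n}. c r = Suc i}"
        then show "r \<in> K \<union> Y1 \<union> {r \<in> {1..n}. \<pi> r = 3 * Suc i}"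
          using f[of r] Kc by (auto simp: fits_def \<pi>'_def Y1_def X_def split: if_splits)
      next
        fix r assume "r \<in> K \<union> Y1 \<union> {r \<in> {1..n}. \<pi> r = 3 * Suc i}"
        then show "r \<in> {r \<in> {1..n}. c r = Suc i}"
          using f[of r] Kc by (auto simp: fits_def \<pi>'_def Y1_def X_def split: if_splits)
      qed
      moreover have "card (K \<union> Y1 \<union> {r \<in> {1..n}. \<pi> r = 3 * Suc i})
          = card K + card Y1 + cntw n \<pi> (3 * Suc i)"
      proof -
        have "finite K" using K X(1) finite_subset by blast
        moreover have "K \<inter> Y1 = {}" "(K \<union> Y1) \<inter> {r \<in> {1..n}. \<pi> r = 3 * Suc i} = {}"
          using K by (auto simp: Y1_def X_def)
        moreover have "finite Y1" by (simp add: Y1_def)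
        ultimately show ?thesis by (simp add: cntw_def card_Un_disjoint)
      qed
      ultimately show ?thesis using S0_cntw[of c "Suc i"] c by (simp add: matched_def cntw_def)
    qed
    ultimately show ?thesis by (simp add: e_def)
  qed
  \<comment> \<open>The freed pattern is weakly increasing and has twist 0, so the summand for K
    only needs its own power of q removed; p is the inverse of q.\<close>
  have sum: "\<Phi> i \<pi>' = (\<Sum>K\<in>Pow X. vsc (p ^ e K) (\<Phi> i (\<rho> K)))"
  proof
    fix c
    have "(\<Sum>K\<in>Pow X. vsc (p ^ e K) (\<Phi> i (\<rho> K))) c
        = (\<Sum>K\<in>Pow X. if K = {r \<in> X. c r = Suc i} then if c \<in> matched n (fits i) S0 \<pi>' then 1 else 0 else 0)"
      unfolding sum_fun_apply
      by (intro sum.cong refl) (use tw\<rho> pq in \<open>auto simp: wsum_def m\<rho>\<close>)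
    also have "\<dots> = (if c \<in> matched n (fits i) S0 \<pi>' then 1 else 0)"
      using X(1) by (subst sum.delta) auto
    finally show "\<Phi> i \<pi>' c = (\<Sum>K\<in>Pow X. vsc (p ^ e K) (\<Phi> i (\<rho> K))) c"
      by (simp add: wsum_def tw')
  qed
  have "\<rho> {} = \<pi>" by (simp add: \<rho>_def fun_eq_iff)
  then have "\<Phi> i \<pi> = vsc (p ^ e {}) (\<Phi> i (\<rho> {}))"
    by (simp add: e_def vsc_def)
  then have eq: "\<Phi> i \<pi> = \<Phi> i \<pi>' - (\<Sum>K\<in>Pow X - {{}}. vsc (p ^ e K) (\<Phi> i (\<rho> K)))"
    unfolding sum using X(1) by (simp add: sum.remove[of "Pow X" "{}"])
  have "higher (\<Phi> i \<pi>')"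
    by (rule garnir_base[OF \<pi>'_mono]) (use \<pi>'_cnt uv in simp_all)
  moreover have "higher (\<Phi> i (\<rho> K))" if K: "K \<in> Pow X - {{}}" for K
  proof (rule IH)
    have KX: "K \<subseteq> X" "K \<noteq> {}" using K by auto
    then have "0 < card K" "card K \<le> card X" using X(1) finite_subset card_mono card_gt_0_iff by blast+
    then show "cntw n (\<rho> K) (3 * i) < cntw n \<pi> (3 * i)"
      "cntw n (\<rho> K) (3 * i) + cntw n (\<rho> K) (3 * Suc i) < part la (Suc i)"
      using \<rho>_cnt[OF KX(1)] uv u X by simp_all
  qed
  ultimately show ?thesis
    unfolding eq by (intro higher_diff higher_sum higher_vsc)
qed

text \<open>The outer induction is on the number of fixed letters i. The inner one sorts the
  pattern, since at an ascent a generator carries the sum of one pattern to that of the interchanged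
  one.\<close>

lemma garnir:
  "cntw n \<pi> (3 * i) + cntw n \<pi> (3 * Suc i) < part la (Suc i) \<Longrightarrow> higher (\<Phi> i \<pi>)"
proof (induction "cntw n \<pi> (3 * i)" arbitrary: \<pi> rule: less_induct)
  case outer: less
  have "cntw n \<rho> (3 * i) = cntw n \<pi> (3 * i) \<Longrightarrow> cntw n \<rho> (3 * Suc i) = cntw n \<pi> (3 * Suc i) \<Longrightarrow>
    higher (\<Phi> i \<rho>)" for \<rho>
  proof (induction "ninv n \<rho>" arbitrary: \<rho> rule: less_induct)
    case less
    show ?case
    proof (cases "mono_on {1..n} \<rho>")
      case True
      show ?thesis
      proof (cases "cntw n \<rho> (3 * i) = 0")
        case u0: True
        show ?thesis by (rule garnir_base[OF True u0]) (use less.prems outer.prems in linarith)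
      next
        case False
        show ?thesis
          by (rule garnir_step[OF True _ _ False]) (use less.prems outer in auto)
      qed
    next
      case False
      then obtain j where j: "j \<in> {1..<n}" "\<rho> (Suc j) < \<rho> j" using mono_on_Suc[of n \<rho>] by force
      have "ninv n \<rho> = Suc (ninv n (\<rho> \<circ> adj j))" by (rule ninv_desc) fact+
      then have "higher (\<Phi> i (\<rho> \<circ> adj j))"
        using less.hyps[of "\<rho> \<circ> adj j"] less.prems cntw_adj[OF j(1), of \<rho>] by simp
      then have "higher (T q j \<triangleright> \<Phi> i (\<rho> \<circ> adj j))" using j(1) by (rule higher_T)
      moreover have "T q j \<triangleright> \<Phi> i (\<rho> \<circ> adj j) = \<Phi> i (\<rho> \<circ> adj j \<circ> adj j)"
        by (rule word_match.T_wsum_asc[OF word_match_fits j(1)]) (use j in simp)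
      ultimately show ?thesis by (simp del: o_apply)
    qed
  qed
  then show ?case by blast
qed

section \<open>Reduction of words to lattice words\<close>

abbreviation "Lat \<equiv> latw n la"

lemma finite_Lat: "finite Lat"
  by (simp add: latw_def finite_words)

definition reducible :: "'r vec \<Rightarrow> bool" where
  "reducible \<phi> \<longleftrightarrow> (\<exists>a. higher (\<phi> - (\<Sum>d\<in>Lat. vsc (a d) (de d))))"

lemma reducible_higher: "higher \<phi> \<Longrightarrow> reducible \<phi>"
proof -
  assume "higher \<phi>"
  moreover have "(\<Sum>d\<in>Lat. vsc 0 (de d)) = (0 :: 'r vec)"
    by (rule sum.neutral) (simp add: vsc_def fun_eq_iff)
  ultimately show ?thesis unfolding reducible_def by (intro exI[of _ "\<lambda>_. 0"]) simp
qed

lemma reducible_Lat: "d \<in> Lat \<Longrightarrow> reducible (de d)"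
proof -
  assume d: "d \<in> Lat"
  have "(\<Sum>x\<in>Lat. vsc (if x = d then 1 else 0) (de x)) = (\<Sum>x\<in>Lat. if x = d then de x else (0 :: 'r vec))"
    by (intro sum.cong refl) (simp add: vsc_def fun_eq_iff)
  also have "\<dots> = de d" using d finite_Lat by (simp only: sum.delta if_True)
  finally show ?thesis
    unfolding reducible_def by (intro exI[of _ "\<lambda>x. if x = d then 1 else 0"]) (simp add: higher_zero del: zero_fun_apply)
qed

lemma reducible_add: "reducible \<phi> \<Longrightarrow> reducible \<psi> \<Longrightarrow> reducible (\<phi> + \<psi>)"
proof -
  assume "reducible \<phi>" "reducible \<psi>"
  then obtain a b where "higher (\<phi> - (\<Sum>d\<in>Lat. vsc (a d) (de d)))" "higher (\<psi> - (\<Sum>d\<in>Lat. vsc (b d) (de d)))"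
    by (auto simp: reducible_def)
  from higher_add[OF this]
  have "higher ((\<phi> + \<psi>) - ((\<Sum>d\<in>Lat. vsc (a d) (de d)) + (\<Sum>d\<in>Lat. vsc (b d) (de d))))"
    by (simp only: add_diff_add)
  also have "(\<Sum>d\<in>Lat. vsc (a d) (de d)) + (\<Sum>d\<in>Lat. vsc (b d) (de d))
      = (\<Sum>d\<in>Lat. vsc (a d + b d) (de d))"
    unfolding sum.distrib[symmetric] by (intro sum.cong refl) (simp add: fun_eq_iff distrib_right)
  finally show ?thesis unfolding reducible_def by (rule exI[of _ "\<lambda>d. a d + b d"])
qed

lemma reducible_vsc: "reducible \<phi> \<Longrightarrow> reducible (vsc r \<phi>)"
proof -
  assume "reducible \<phi>"
  then obtain a where "higher (\<phi> - (\<Sum>d\<in>Lat. vsc (a d) (de d)))" by (auto simp: reducible_def)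
  then have "higher (vsc r (\<phi> - (\<Sum>d\<in>Lat. vsc (a d) (de d))))" by (rule higher_vsc)
  also have "vsc r (\<phi> - (\<Sum>d\<in>Lat. vsc (a d) (de d))) = vsc r \<phi> - (\<Sum>d\<in>Lat. vsc (r * a d) (de d))"
    by (simp add: fun_eq_iff sum_fun_apply sum_distrib_left right_diff_distrib mult.assoc)
  finally show ?thesis unfolding reducible_def by (rule exI[of _ "\<lambda>d. r * a d"])
qed

lemma reducible_sum: "(\<And>i. i \<in> A \<Longrightarrow> reducible (f i)) \<Longrightarrow> reducible (sum f A)"
proof (induction A rule: infinite_finite_induct)
  case (insert x F)
  then show ?case by (simp add: reducible_add del: plus_fun_apply)
qed (simp_all add: reducible_higher higher_zero del: zero_fun_apply)

lemma words_sum_eq: "c \<in> S0 \<Longrightarrow> d \<in> S0 \<Longrightarrow> (\<Sum>r\<in>{1..n}. c r) = (\<Sum>r\<in>{1..n}. d r)"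
proof -
  have "(\<Sum>r\<in>{1..n}. (row la \<circ> p) r) = (\<Sum>r\<in>{1..n}. row la r)" if "p permutes {1..n}" for p
    using sum.permute[OF that, of "row la"] by simp
  then show "c \<in> S0 \<Longrightarrow> d \<in> S0 \<Longrightarrow> (\<Sum>r\<in>{1..n}. c r) = (\<Sum>r\<in>{1..n}. d r)"
    unfolding words_def by fastforce
qed

lemma words_less: "c \<in> S0 \<Longrightarrow> r \<in> {1..n} \<Longrightarrow> c r < length la"
  using row_bounds(1)[of _ la] sum_list_Par[OF la] by (auto simp: words_def permutes_in_image simp del: atLeastAtMost_iff)

definition weight :: "(nat \<Rightarrow> nat) \<Rightarrow> nat" where
  "weight c = (\<Sum>r\<in>{1..n}. r * c r)"

lemma weight_bound: "c \<in> S0 \<Longrightarrow> weight c \<le> (\<Sum>r\<in>{1..n}. r * length la)"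
  unfolding weight_def by (intro sum_mono mult_left_mono) (auto dest: words_less)

text \<open>Both words have the same sum of letters, so the weights r may be replaced by r - m in
  the difference. All terms are then nonnegative, and one is positive as the words differ.\<close>

lemma weight_less:
  assumes c: "c \<in> S0" and c': "c' \<in> S0" and "c' \<noteq> c"
    and lo: "\<And>r. r \<in> {1..n} \<Longrightarrow> r \<le> m \<Longrightarrow> c' r \<le> c r"
    and hi: "\<And>r. r \<in> {1..n} \<Longrightarrow> m < r \<Longrightarrow> c r \<le> c' r"
  shows "weight c < weight c'"
proof -
  let ?f = "\<lambda>r. (int r - int m) * (int (c' r) - int (c r))"
  have nonneg: "0 \<le> ?f r" if "r \<in> {1..n}" for r
    using lo[OF that] hi[OF that] by (cases "r \<le> m") (auto intro: mult_nonpos_nonpos)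
  have ex: "\<exists>r\<in>{1..n}. m < r \<and> c' r \<noteq> c r"
  proof (rule ccontr)
    assume "\<not> ?thesis"
    then have eq: "c' r \<le> c r" if "r \<in> {1..n}" for r using lo[OF that] that by (cases "r \<le> m") auto
    have "\<forall>r\<in>{1..n}. c' r = c r"
    proof (rule ccontr)
      assume "\<not> (\<forall>r\<in>{1..n}. c' r = c r)"
      then obtain r where "r \<in> {1..n}" "c' r < c r" using eq le_neq_implies_less by blast
      then have "(\<Sum>r\<in>{1..n}. c' r) < (\<Sum>r\<in>{1..n}. c r)"
        using eq by (intro sum_strict_mono_ex1) auto
      then show False using words_sum_eq[OF c c'] by simp
    qed
    then have "c' r = c r" for r
      using c c' row_la(3) by (cases "r \<in> {1..n}") (auto simp: words_iff_cntw)
    then show False using \<open>c' \<noteq> c\<close> by auto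
  qed
  then obtain r where r: "r \<in> {1..n}" "m < r" "c' r \<noteq> c r" by blast
  then have "0 < ?f r" using hi[OF r(1,2)] by simp
  then have "0 < (\<Sum>r\<in>{1..n}. ?f r)"
    using nonneg r(1) by (intro sum_pos2[of _ r]) auto
  also have "(\<Sum>r\<in>{1..n}. ?f r) = int (weight c') - int (weight c)
      - int m * (int (\<Sum>r\<in>{1..n}. c' r) - int (\<Sum>r\<in>{1..n}. c r))"
    by (simp add: weight_def algebra_simps sum.distrib sum_subtractf sum_distrib_left)
  also have "\<dots> = int (weight c') - int (weight c)" using words_sum_eq[OF c c'] by simp
  finally show ?thesis by simp
qed

text \<open>
  At the first violation of the lattice condition a Garnir relation expresses the word by words
  with larger \<open>weight\<close>.
\<close>

lemma reducible_de: "c \<in> S0 \<Longrightarrow> reducible (de c)"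
proof (induction "(\<Sum>r\<in>{1..n}. r * length la) - weight c" arbitrary: c rule: less_induct)
  case less
  note c = less.prems
  show ?case
  proof (cases "lat n c")
    case True
    then show ?thesis using c by (intro reducible_Lat) (simp add: latw_def)
  next
    case False
    then obtain m i where m: "m \<le> n" and viol: "cntw m c i < cntw m c (Suc i)"
      by (auto simp: lat_def not_le)
    \<comment> \<open>Up to the violating place m the letters i stay fixed and the letters i + 1
      become free; beyond m the roles are exchanged. The violation says that fewer than
      \<lambda>_(i+1) letters i and i + 1 remain fixed. Another fitting word can only lower letters
      up to m and raise letters beyond m, so its weight is larger.\<close>
    define \<pi> where "\<pi> r = (if r \<le> m then if c r = Suc i then 3 * i + 1 else 3 * c r
      else if c r = i then 3 * i + 1 else 3 * c r)" for r
    have u: "cntw n \<pi> (3 * i) = cntw m c i"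
    proof -
      have "\<pi> r = 3 * i \<longleftrightarrow> r \<le> m \<and> c r = i" for r
        unfolding \<pi>_def by (auto split: if_splits)
      then have "{r \<in> {1..n}. \<pi> r = 3 * i} = {r \<in> {1..m}. c r = i}" using m by auto
      then show ?thesis by (simp only: cntw_def)
    qed
    have v: "cntw n \<pi> (3 * Suc i) + cntw m c (Suc i) = part la (Suc i)"
    proof -
      have *: "\<pi> r = 3 * Suc i \<longleftrightarrow> m < r \<and> c r = Suc i" for r
        unfolding \<pi>_def by (auto split: if_splits)
      have "{r \<in> {1..n}. c r = Suc i} = {r \<in> {1..n}. m < r \<and> c r = Suc i} \<union> {r \<in> {1..m}. c r = Suc i}"
        using m by auto
      then have "cntw n c (Suc i)
          = card ({r \<in> {1..n}. m < r \<and> c r = Suc i} \<union> {r \<in> {1..m}. c r = Suc i})"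
        by (simp only: cntw_def)
      also have "\<dots> = cntw n \<pi> (3 * Suc i) + cntw m c (Suc i)"
        unfolding cntw_def * by (intro card_Un_disjoint) auto
      finally show ?thesis using S0_cntw[OF c] by simp
    qed
    have high: "higher (\<Phi> i \<pi>)" by (rule garnir) (use u v viol in linarith)
    have mc: "c \<in> matched n (fits i) S0 \<pi>"
      using c by (auto simp: matched_def fits_def \<pi>_def)
    have red: "reducible (de c')" if c': "c' \<in> matched n (fits i) S0 \<pi>" "c' \<noteq> c" for c'
    proof (rule less.hyps)
      have S': "c' \<in> S0" and f: "fits i (\<pi> r) (c' r)" if "r \<in> {1..n}" for r
        using c' that by (auto simp: matched_def)
      show S'': "c' \<in> S0" using c' by (simp add: matched_def)
      have "weight c < weight c'"
      proof (rule weight_less[OF c S'' c'(2)])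
        show "c' r \<le> c r" if "r \<in> {1..n}" "r \<le> m" for r
          using f[OF that(1)] that(2) by (auto simp: fits_def \<pi>_def split: if_splits)
        show "c r \<le> c' r" if "r \<in> {1..n}" "m < r" for r
          using f[OF that(1)] that(2) by (auto simp: fits_def \<pi>_def split: if_splits)
      qed
      then show "(\<Sum>r\<in>{1..n}. r * length la) - weight c' < (\<Sum>r\<in>{1..n}. r * length la) - weight c"
        using weight_bound[OF S''] by simp
    qed
    obtain p where "q * p = 1" using unit by (metis dvd_def)
    then have pq: "p ^ k * q ^ k = 1" for k by (metis mult.commute power_mult_distrib power_one)
    let ?M = "matched n (fits i) S0 \<pi>" and ?e = "twist n \<pi> c"
    have finM: "finite ?M" using finite_words[of n "row la"] by (simp add: matched_def)
    have "\<Phi> i \<pi> = (\<Sum>d\<in>?M. vsc (q ^ twist n \<pi> d) (de d))"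
    proof
      fix d
      have "(\<Sum>x\<in>?M. vsc (q ^ twist n \<pi> x) (de x)) d = (\<Sum>x\<in>?M. if x = d then q ^ twist n \<pi> x else 0)"
        unfolding sum_fun_apply by (intro sum.cong refl) (auto simp: de_def)
      then show "\<Phi> i \<pi> d = (\<Sum>d\<in>?M. vsc (q ^ twist n \<pi> d) (de d)) d"
        using finM by (simp add: wsum_def)
    qed
    also have "\<dots> = vsc (q ^ ?e) (de c) + (\<Sum>d\<in>?M - {c}. vsc (q ^ twist n \<pi> d) (de d))"
      using finM mc by (rule sum.remove)
    finally have \<Phi>: "\<Phi> i \<pi> = vsc (q ^ ?e) (de c) + (\<Sum>d\<in>?M - {c}. vsc (q ^ twist n \<pi> d) (de d))" .
    \<comment> \<open>The coefficient of the given word in the Garnir sum is a power of q, hence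
      invertible.\<close>
    have "de c = vsc (p ^ ?e) (\<Phi> i \<pi> + vsc (- 1) (\<Sum>d\<in>?M - {c}. vsc (q ^ twist n \<pi> d) (de d)))"
    proof
      fix x
      have "p ^ ?e * (q ^ ?e * de c x) = de c x" by (simp only: mult.assoc[symmetric] pq mult_1)
      then show "de c x = vsc (p ^ ?e) (\<Phi> i \<pi> + vsc (- 1) (\<Sum>d\<in>?M - {c}. vsc (q ^ twist n \<pi> d) (de d))) x"
        unfolding \<Phi> by simp
    qed
    moreover have "reducible (vsc (p ^ ?e) (\<Phi> i \<pi> + vsc (- 1) (\<Sum>d\<in>?M - {c}. vsc (q ^ twist n \<pi> d) (de d))))"
      by (intro reducible_vsc reducible_add reducible_higher[OF high] reducible_sum red) auto
    ultimately show ?thesis by metis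
  qed
qed

text \<open>Any element that moves the row word to \<open>c\<close> will do, because only its
  product with the Young sum matters. For the word of a standard tableau s this product is the one
  formed with d(s), see \<open>tableau_lift\<close>.\<close>

definition lift :: "(nat \<Rightarrow> nat) \<Rightarrow> 'r endo" where
  "lift c = (SOME h. h \<in> H \<and> (h * Y (row la)) \<triangleright> de id = chi n (row la) c)"

lemma lift: "c \<in> S0 \<Longrightarrow> lift c \<in> H" "c \<in> S0 \<Longrightarrow> (lift c * Y (row la)) \<triangleright> de id = chi n (row la) c"
proof -
  assume "c \<in> S0"
  from someI_ex[OF chi_word[OF row_la(1) this, unfolded Bex_def]]
  show "lift c \<in> H" "(lift c * Y (row la)) \<triangleright> de id = chi n (row la) c" unfolding lift_def by blast+
qed

lemma pull_reducible: "reducible (de c) \<Longrightarrow> \<exists>a. \<exists>z\<in>yideal (above n la).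
  chi n (row la) c = (\<Sum>d\<in>Lat. vsc (a d) (chi n (row la) d)) + z \<triangleright> de id"
proof -
  assume "reducible (de c)"
  then obtain a z where z: "z \<in> yideal (above n la)"
    "z \<triangleright> de id = pull n (row la) (de c - (\<Sum>d\<in>Lat. vsc (a d) (de d)))"
    by (auto simp: reducible_def higher_def)
  have "pull n (row la) (de c - (\<Sum>d\<in>Lat. vsc (a d) (de d)))
      = chi n (row la) c - (\<Sum>d\<in>Lat. vsc (a d) (chi n (row la) d))"
    unfolding pull_de[symmetric] by (auto simp: pull_def fun_eq_iff sum_fun_apply)
  then have "chi n (row la) c = (\<Sum>d\<in>Lat. vsc (a d) (chi n (row la) d)) + z \<triangleright> de id"
    unfolding z(2) by simp
  then show ?thesis using z(1) by blast
qed

text \<open>Elements of the left ideal of the Young sum are functions of words of content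
  \<open>la\<close>. Each word is reduced by itself, and the functions called \<open>higher\<close>
  become elements of the ideal.\<close>

theorem straightening:
  assumes h: "h \<in> H"
  shows "\<exists>a. \<exists>z\<in>yideal (above n la). h * Y (row la) = (\<Sum>d\<in>Lat. smul (a d) (lift d * Y (row la))) + z"
proof -
  obtain a z where z: "\<And>c. c \<in> S0 \<Longrightarrow> z c \<in> yideal (above n la)"
    and a: "\<And>c. c \<in> S0 \<Longrightarrow> chi n (row la) c = (\<Sum>d\<in>Lat. vsc (a c d) (chi n (row la) d)) + z c \<triangleright> de id"
    using pull_reducible[OF reducible_de] by metis
  define f where "f = h \<triangleright> de (row la)"
  define b where "b d = (\<Sum>c\<in>S0. f c * a c d)" for d
  define z' where "z' = (\<Sum>c\<in>S0. smul (f c) (z c))"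
  have z': "z' \<in> yideal (above n la)" unfolding z'_def by (intro yideal_sum yideal_smul z)
  have Lat: "d \<in> S0" if "d \<in> Lat" for d using that by (simp add: latw_def)
  have "h * Y (row la) = (\<Sum>d\<in>Lat. smul (b d) (lift d * Y (row la))) + z'"
  proof (rule Hk_eqI[of _ n q])
    show "h * Y (row la) \<in> H" using h by (simp add: Hk_mult Y_Hk)
    show "(\<Sum>d\<in>Lat. smul (b d) (lift d * Y (row la))) + z' \<in> H"
      using yideal_Hk[OF z'] lift(1)[OF Lat] by (intro Hk_add Hk_sum Hk_smul Hk_mult Y_Hk)
    have "(h * Y (row la)) \<triangleright> de id = pull n (row la) f"
      using Hk_pull[OF row_la(1) h, of "de (row la)"] by (simp add: Y_app pull_de f_def)
    also have "\<dots> = (\<Sum>c\<in>S0. vsc (f c) (chi n (row la) c))" by (rule pull_expand)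
    also have "\<dots> = (\<Sum>c\<in>S0. vsc (f c) ((\<Sum>d\<in>Lat. vsc (a c d) (chi n (row la) d)) + z c \<triangleright> de id))"
      by (intro sum.cong refl arg_cong[of _ _ "vsc _"] a)
    also have "\<dots> = (\<Sum>d\<in>Lat. vsc (b d) (chi n (row la) d)) + z' \<triangleright> de id"
    proof
      fix x
      have "(\<Sum>c\<in>S0. \<Sum>d\<in>Lat. f c * (a c d * chi n (row la) d x)) = (\<Sum>d\<in>Lat. b d * chi n (row la) d x)"
        by (subst sum.swap) (simp add: b_def sum_distrib_right mult.assoc)
      then show "(\<Sum>c\<in>S0. vsc (f c) ((\<Sum>d\<in>Lat. vsc (a c d) (chi n (row la) d)) + z c \<triangleright> de id)) x
          = ((\<Sum>d\<in>Lat. vsc (b d) (chi n (row la) d)) + z' \<triangleright> de id) x"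
        by (simp add: sum_fun_apply z'_def sum_app distrib_left sum.distrib sum_distrib_left)
    qed
    also have "(\<Sum>d\<in>Lat. vsc (b d) (chi n (row la) d)) = (\<Sum>d\<in>Lat. smul (b d) (lift d * Y (row la))) \<triangleright> de id"
      unfolding sum_app smul_app by (intro sum.cong refl) (simp only: lift(2)[OF Lat])
    finally show "(h * Y (row la)) \<triangleright> de id = ((\<Sum>d\<in>Lat. smul (b d) (lift d * Y (row la))) + z') \<triangleright> de id"
      by (simp only: plus_app)
  qed
  then show ?thesis using z' by blast
qed

end

section \<open>Counting lattice words\<close>

text \<open>The content is a function with trailing zeros instead of a list of parts, so that adding
  and removing a box are function updates. The partitions of n take the form
  \<open>part_funs n\<close>.\<close>

definition lwords :: "nat \<Rightarrow> (nat \<Rightarrow> nat) \<Rightarrow> (nat \<Rightarrow> nat) set" where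
  "lwords n \<alpha> = {c. (\<forall>r. r \<notin> {1..n} \<longrightarrow> c r = 0) \<and> lat n c \<and> cntw n c = \<alpha>}"

definition part_funs :: "nat \<Rightarrow> (nat \<Rightarrow> nat) set" where
  "part_funs n = {\<alpha>. antimono \<alpha> \<and> (\<forall>l\<ge>n. \<alpha> l = 0) \<and> (\<Sum>l<n. \<alpha> l) = n}"

abbreviation up :: "(nat \<Rightarrow> nat) \<Rightarrow> nat \<Rightarrow> nat \<Rightarrow> nat" where
  "up \<alpha> i \<equiv> \<alpha>(i := Suc (\<alpha> i))"

abbreviation dn :: "(nat \<Rightarrow> nat) \<Rightarrow> nat \<Rightarrow> nat \<Rightarrow> nat" where
  "dn \<alpha> i \<equiv> \<alpha>(i := \<alpha> i - 1)"

lemma antimono_nat_iff: "antimono (\<alpha> :: nat \<Rightarrow> nat) \<longleftrightarrow> (\<forall>l. \<alpha> (Suc l) \<le> \<alpha> l)"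
  by (simp add: antimono_iff_le_Suc)

lemma up_antimono_iff:
  assumes "antimono \<alpha>"
  shows "antimono (up \<alpha> i) \<longleftrightarrow> i = 0 \<or> \<alpha> i < \<alpha> (i - 1)"
proof -
  have *: "\<alpha> (Suc l) \<le> \<alpha> l" for l using assms by (simp add: antimono_nat_iff)
  show ?thesis
    unfolding antimono_nat_iff
  proof
    assume **: "\<forall>l. up \<alpha> i (Suc l) \<le> up \<alpha> i l"
    show "i = 0 \<or> \<alpha> i < \<alpha> (i - 1)"
      using **[rule_format, of "i - 1"] by (cases i) auto
  next
    assume **: "i = 0 \<or> \<alpha> i < \<alpha> (i - 1)"
    show "\<forall>l. up \<alpha> i (Suc l) \<le> up \<alpha> i l"
    proof
      fix l show "up \<alpha> i (Suc l) \<le> up \<alpha> i l"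
        using *[of l] ** by (cases "i = Suc l") (auto simp: le_SucI)
    qed
  qed
qed

lemma dn_antimono_iff:
  "antimono \<alpha> \<Longrightarrow> 0 < \<alpha> j \<Longrightarrow> antimono (dn \<alpha> j) \<longleftrightarrow> \<alpha> (Suc j) < \<alpha> j"
  unfolding antimono_nat_iff
proof
  assume "\<forall>l. \<alpha> (Suc l) \<le> \<alpha> l" "0 < \<alpha> j" "\<forall>l. dn \<alpha> j (Suc l) \<le> dn \<alpha> j l"
  from this(3)[rule_format, of j] this(2) show "\<alpha> (Suc j) < \<alpha> j" by simp
next
  assume *: "\<forall>l. \<alpha> (Suc l) \<le> \<alpha> l" "0 < \<alpha> j" "\<alpha> (Suc j) < \<alpha> j"
  show "\<forall>l. dn \<alpha> j (Suc l) \<le> dn \<alpha> j l"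
  proof
    fix l show "dn \<alpha> j (Suc l) \<le> dn \<alpha> j l"
      using *(1)[rule_format, of l] *(3) by auto
  qed
qed

lemma cntw_Suc: "cntw (Suc m) c l = cntw m c l + (if c (Suc m) = l then 1 else 0)"
proof -
  have "{r \<in> {1..Suc m}. c r = l} = {r \<in> {1..m}. c r = l} \<union> (if c (Suc m) = l then {Suc m} else {})"
    by (auto simp: le_Suc_eq)
  then show ?thesis by (auto simp: cntw_def)
qed

lemma cntw_cong: "(\<And>r. r \<in> {1..m} \<Longrightarrow> c r = d r) \<Longrightarrow> cntw m c = cntw m d"
  unfolding cntw_def by (intro ext arg_cong[of _ _ card]) auto

lemma lat_antimono: "lat n c \<Longrightarrow> antimono (cntw n c)"
  by (auto simp: lat_def antimono_nat_iff)

lemma sum_cntw_le: "finite A \<Longrightarrow> (\<Sum>l\<in>A. cntw n c l) \<le> n"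
proof -
  assume A: "finite A"
  have "(\<Sum>l\<in>A. cntw n c l) = card (\<Union>l\<in>A. {r \<in> {1..n}. c r = l})"
    unfolding cntw_def using A by (intro card_UN_disjoint[symmetric]) auto
  also have "\<dots> \<le> card {1..n}" by (intro card_mono) auto
  finally show ?thesis by simp
qed

lemma lat_zero: "lat n c \<Longrightarrow> n \<le> l \<Longrightarrow> cntw n c l = 0"
proof (rule ccontr)
  assume c: "lat n c" "n \<le> l" "cntw n c l \<noteq> 0"
  have "(\<Sum>j\<le>l. 1) \<le> (\<Sum>j\<le>l. cntw n c j)"
    using antimonoD[OF lat_antimono[OF c(1)]] c(3) by (intro sum_mono) (fastforce simp: Suc_le_eq)
  then show False using sum_cntw_le[of "{..l}" n c] c(2) by simp
qed

lemma lwords_part_funs: "c \<in> lwords n \<alpha> \<Longrightarrow> \<alpha> \<in> part_funs n"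
proof -
  assume "c \<in> lwords n \<alpha>"
  then have c: "lat n c" "cntw n c = \<alpha>" by (auto simp: lwords_def)
  have lt: "c r < n" if "r \<in> {1..n}" for r
  proof (rule ccontr)
    assume "\<not> c r < n"
    then have "cntw n c (c r) = 0" using lat_zero[OF c(1)] by simp
    then show False using that by (auto simp: cntw_def)
  qed
  have "(\<Sum>l<n. cntw n c l) = card (\<Union>l\<in>{..<n}. {r \<in> {1..n}. c r = l})"
    unfolding cntw_def by (intro card_UN_disjoint[symmetric]) auto
  also have "(\<Union>l\<in>{..<n}. {r \<in> {1..n}. c r = l}) = {1..n}" using lt by auto
  finally have "(\<Sum>l<n. \<alpha> l) = n" using c(2) by simp
  then show ?thesis using lat_antimono[OF c(1)] lat_zero[OF c(1)] c(2) by (auto simp: part_funs_def)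
qed

text \<open>The branching rule, where the last letter is the row of the removed box. Rows from which
  no box can be removed contribute the empty set, since the content of a lattice word is weakly
  decreasing.\<close>

lemma lwords_Suc:
  assumes \<alpha>: "antimono \<alpha>"
  shows "lwords (Suc n) \<alpha> = (\<Union>i\<in>{i\<in>{..n}. 0 < \<alpha> i}. (\<lambda>c. c(Suc n := i)) ` lwords n (dn \<alpha> i))"
proof (intro equalityI subsetI)
  fix c assume c: "c \<in> lwords (Suc n) \<alpha>"
  let ?i = "c (Suc n)" and ?c = "c(Suc n := 0)"
  have c': "\<And>r. r \<notin> {1..Suc n} \<Longrightarrow> c r = 0" "lat (Suc n) c" "cntw (Suc n) c = \<alpha>"
    using c by (auto simp: lwords_def)
  have eq: "cntw m ?c = cntw m c" if "m \<le> n" for m using that by (intro cntw_cong) auto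
  have \<alpha>i: "\<alpha> l = cntw n c l + (if ?i = l then 1 else 0)" for l using c'(3) cntw_Suc[of n c l] by simp
  have "lat n ?c" using c'(2) eq by (auto simp: lat_def)
  moreover have "cntw n ?c = dn \<alpha> ?i" using \<alpha>i eq[of n] by (auto simp: fun_eq_iff)
  moreover have "?c r = 0" if "r \<notin> {1..n}" for r
    using c'(1)[of r] that by (cases "r = Suc n") auto
  ultimately have "?c \<in> lwords n (dn \<alpha> ?i)" by (auto simp: lwords_def)
  moreover have "c = ?c(Suc n := ?i)" by auto
  moreover have "?i \<le> n" using lat_zero[OF c'(2), of ?i] c'(3) \<alpha>i[of ?i] by (metis add_is_0 not_less_eq_eq one_neq_zero)
  moreover have "0 < \<alpha> ?i" using \<alpha>i[of ?i] by simp
  ultimately show "c \<in> (\<Union>i\<in>{i\<in>{..n}. 0 < \<alpha> i}. (\<lambda>c. c(Suc n := i)) ` lwords n (dn \<alpha> i))" by blast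
next
  fix d assume "d \<in> (\<Union>i\<in>{i\<in>{..n}. 0 < \<alpha> i}. (\<lambda>c. c(Suc n := i)) ` lwords n (dn \<alpha> i))"
  then obtain i c where i: "0 < \<alpha> i" and d: "d = c(Suc n := i)" and c: "c \<in> lwords n (dn \<alpha> i)" by auto
  have eq: "cntw m d = cntw m c" if "m \<le> n" for m unfolding d using that by (intro cntw_cong) auto
  have cd: "cntw (Suc n) d = \<alpha>"
    using c i cntw_Suc[of n d] eq[of n] by (auto simp: d lwords_def fun_eq_iff)
  have "lat (Suc n) d"
    unfolding lat_def
  proof (intro allI impI)
    fix m l assume "m \<le> Suc n"
    then consider "m \<le> n" | "m = Suc n" by linarith
    then show "cntw m d (Suc l) \<le> cntw m d l"
    proof cases
      case 1
      then show ?thesis using c eq by (simp add: lwords_def lat_def)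
    next
      case 2
      then show ?thesis using cd \<alpha> by (simp add: antimono_nat_iff)
    qed
  qed
  then show "d \<in> lwords (Suc n) \<alpha>"
    using c cd by (auto simp: lwords_def d)
qed

lemma finite_lwords: "finite (lwords n \<alpha>)"
proof (induction n arbitrary: \<alpha>)
  case 0
  have "lwords 0 \<alpha> \<subseteq> {\<lambda>_. 0}" by (auto simp: lwords_def)
  then show ?case using finite_subset by blast
next
  case (Suc n)
  show ?case
  proof (cases "antimono \<alpha>")
    case True
    then show ?thesis using Suc by (simp add: lwords_Suc)
  next
    case False
    then have "lwords (Suc n) \<alpha> = {}" using lwords_part_funs by (auto simp: part_funs_def)
    then show ?thesis by simp
  qed
qed

text \<open>For a partition this is the number of standard tableaux of its shape.\<close>

definition nlw :: "nat \<Rightarrow> (nat \<Rightarrow> nat) \<Rightarrow> nat" where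
  "nlw n \<alpha> = card (lwords n \<alpha>)"

lemma nlw_zero: "\<alpha> \<notin> part_funs n \<Longrightarrow> nlw n \<alpha> = 0"
  using lwords_part_funs[of _ n \<alpha>] by (auto simp: nlw_def card_eq_0_iff)

lemma nlw_nonanti: "\<not> antimono \<alpha> \<Longrightarrow> nlw n \<alpha> = 0"
  by (rule nlw_zero) (simp add: part_funs_def)

lemma nlw_Suc:
  assumes \<alpha>: "antimono \<alpha>"
  shows "nlw (Suc n) \<alpha> = (\<Sum>i\<in>{i\<in>{..n}. 0 < \<alpha> i}. nlw n (dn \<alpha> i))"
proof -
  have "nlw (Suc n) \<alpha> = (\<Sum>i\<in>{i\<in>{..n}. 0 < \<alpha> i}. card ((\<lambda>c. c(Suc n := i)) ` lwords n (dn \<alpha> i)))"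
    unfolding nlw_def lwords_Suc[OF \<alpha>]
  proof (rule card_UN_disjoint)
    show "\<forall>i\<in>{i\<in>{..n}. 0 < \<alpha> i}. \<forall>j\<in>{i\<in>{..n}. 0 < \<alpha> i}. i \<noteq> j \<longrightarrow>
        (\<lambda>c. c(Suc n := i)) ` lwords n (dn \<alpha> i) \<inter> (\<lambda>c. c(Suc n := j)) ` lwords n (dn \<alpha> j) = {}"
      by (auto dest: fun_upd_eqD)
  qed (auto simp: finite_lwords)
  also have "\<dots> = (\<Sum>i\<in>{i\<in>{..n}. 0 < \<alpha> i}. nlw n (dn \<alpha> i))"
  proof (intro sum.cong refl)
    fix i
    have "inj_on (\<lambda>c. c(Suc n := i)) (lwords n (dn \<alpha> i))"
    proof (rule inj_onI, rule ext)
      fix c d r assume "c \<in> lwords n (dn \<alpha> i)" "d \<in> lwords n (dn \<alpha> i)" "c(Suc n := i) = d(Suc n := i)"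
      then show "c r = d r"
        by (cases "r = Suc n") (auto simp: lwords_def dest: fun_cong[of _ _ r])
    qed
    then show "card ((\<lambda>c. c(Suc n := i)) ` lwords n (dn \<alpha> i)) = nlw n (dn \<alpha> i)"
      by (simp add: nlw_def card_image)
  qed
  finally show ?thesis .
qed

lemma part_funs_dn:
  assumes "\<alpha> \<in> part_funs (Suc n)" "0 < \<alpha> j" "antimono (dn \<alpha> j)"
  shows "dn \<alpha> j \<in> part_funs n"
proof -
  have j: "j < Suc n" using assms by (auto simp: part_funs_def intro: ccontr)
  have "(\<Sum>l<Suc n. \<alpha> l) = \<alpha> j + (\<Sum>l\<in>{..<Suc n} - {j}. \<alpha> l)"
    using j by (intro sum.remove) auto
  moreover have "(\<Sum>l<Suc n. dn \<alpha> j l) = \<alpha> j - 1 + (\<Sum>l\<in>{..<Suc n} - {j}. \<alpha> l)"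
    using j by (subst sum.remove[of _ j]) auto
  ultimately have s: "(\<Sum>l<Suc n. dn \<alpha> j l) = n" using assms by (simp add: part_funs_def)
  have n0: "dn \<alpha> j n = 0"
  proof (rule ccontr)
    assume *: "dn \<alpha> j n \<noteq> 0"
    have "1 \<le> dn \<alpha> j l" if "l < Suc n" for l
      using antimonoD[OF assms(3), of l n] * that by linarith
    then have "(\<Sum>l<Suc n. 1) \<le> (\<Sum>l<Suc n. dn \<alpha> j l)" by (intro sum_mono) simp
    then show False using s by simp
  qed
  have "dn \<alpha> j l = 0" if "n \<le> l" for l
    using antimonoD[OF assms(3) that] n0 by simp
  then show ?thesis using assms(3) s n0 by (simp add: part_funs_def)
qed

lemma part_funs_up:
  assumes "\<alpha> \<in> part_funs n" "antimono (up \<alpha> i)"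
  shows "up \<alpha> i \<in> part_funs (Suc n)" "i \<le> n"
proof -
  have \<alpha>: "antimono \<alpha>" "\<And>l. n \<le> l \<Longrightarrow> \<alpha> l = 0" "(\<Sum>l<n. \<alpha> l) = n" using assms by (auto simp: part_funs_def)
  show i: "i \<le> n"
    using up_antimono_iff[OF \<alpha>(1), of i] assms(2) \<alpha>(2)[of "i - 1"] by (cases i) (auto intro: ccontr)
  have "(\<Sum>l<Suc n. up \<alpha> i l) = Suc (\<alpha> i) + (\<Sum>l\<in>{..<Suc n} - {i}. \<alpha> l)"
    using i by (subst sum.remove[of _ i]) auto
  also have "\<dots> = Suc (\<Sum>l<Suc n. \<alpha> l)" using i by (subst sum.remove[of _ i]) auto
  also have "\<dots> = Suc n" using \<alpha>(2,3) by simp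
  finally show "up \<alpha> i \<in> part_funs (Suc n)" using assms(2) \<alpha>(2) i by (auto simp: part_funs_def)
qed

text \<open>Adding a box and then removing one agrees with removing and then adding, as long as the
  rows differ. The surplus comes from the same row: there is one more row to which a box can be
  added than there are rows from which one can be removed.\<close>

lemma nlw_up_sum: "\<alpha> \<in> part_funs n \<Longrightarrow> (\<Sum>i\<le>n. nlw (Suc n) (up \<alpha> i)) = Suc n * nlw n \<alpha>"
proof (induction n arbitrary: \<alpha>)
  case 0
  have "up \<alpha> 0 \<in> part_funs (Suc 0)"
    by (rule part_funs_up[OF 0]) (use 0 in \<open>auto simp: part_funs_def antimono_nat_iff\<close>)
  then have "nlw (Suc 0) (up \<alpha> 0) = (\<Sum>i\<in>{i\<in>{..0}. 0 < up \<alpha> 0 i}. nlw 0 (dn (up \<alpha> 0) i))"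
    by (intro nlw_Suc) (auto simp only: part_funs_def)
  also have "{i\<in>{..0}. 0 < up \<alpha> 0 i} = {0}" by auto
  finally have "nlw (Suc 0) (up \<alpha> 0) = nlw 0 (dn (up \<alpha> 0) 0)" by (simp del: fun_upd_apply)
  moreover have "dn (up \<alpha> 0) 0 = \<alpha>" by auto
  ultimately have "nlw (Suc 0) (up \<alpha> 0) = nlw 0 \<alpha>" by (simp only:)
  then show ?case by (simp del: fun_upd_apply)
next
  case (Suc n)
  let ?N = "Suc n"
  have \<alpha>: "antimono \<alpha>" "\<And>l. ?N \<le> l \<Longrightarrow> \<alpha> l = 0" using Suc.prems by (auto simp: part_funs_def)
  define add where "add = {i\<in>{..?N}. antimono (up \<alpha> i)}"
  define rem where "rem = {j\<in>{..?N}. 0 < \<alpha> j \<and> antimono (dn \<alpha> j)}"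
  have fin: "finite add" "finite rem" by (simp_all add: add_def rem_def)
  \<comment> \<open>A box can be added to row 0 and to each row directly below one from which a box
    can be removed.\<close>
  have add_rem: "add = insert 0 (Suc ` rem)"
  proof (intro equalityI subsetI)
    fix i assume i: "i \<in> add"
    show "i \<in> insert 0 (Suc ` rem)"
    proof (cases i)
      case (Suc j)
      then have "\<alpha> (Suc j) < \<alpha> j" using i up_antimono_iff[OF \<alpha>(1), of i] by (simp add: add_def)
      then show ?thesis using Suc i dn_antimono_iff[OF \<alpha>(1), of j] by (auto simp: add_def rem_def)
    qed simp
  next
    fix i assume "i \<in> insert 0 (Suc ` rem)"
    then consider "i = 0" | j where "i = Suc j" "j \<in> rem" by auto
    then show "i \<in> add"
    proof cases
      case 1
      then show ?thesis using up_antimono_iff[OF \<alpha>(1), of 0] by (simp add: add_def)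
    next
      case (2 j)
      then have "\<alpha> (Suc j) < \<alpha> j" "j < ?N"
        using dn_antimono_iff[OF \<alpha>(1), of j] \<alpha>(2)[of j] by (auto simp: rem_def intro: ccontr)
      then show ?thesis using 2 up_antimono_iff[OF \<alpha>(1), of i] by (simp add: add_def)
    qed
  qed
  have card_add: "card add = Suc (card rem)"
    unfolding add_rem using fin by (simp add: card_image)
  \<comment> \<open>The contribution of adding a box in row i and removing one in a different row j,
    in either order.\<close>
  define g where "g i j = (if i \<noteq> j \<and> 0 < \<alpha> j then nlw ?N ((up \<alpha> i)(j := \<alpha> j - 1)) else 0)" for i j
  have g_nonadd: "g i j = 0" if "i \<notin> add" "i \<le> ?N" for i j
  proof (cases "i \<noteq> j \<and> 0 < \<alpha> j \<and> antimono ((up \<alpha> i)(j := \<alpha> j - 1))")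
    case True
    have "antimono (up \<alpha> i)"
      unfolding up_antimono_iff[OF \<alpha>(1)]
    proof (cases i)
      case (Suc k)
      have "((up \<alpha> i)(j := \<alpha> j - 1)) (Suc k) \<le> ((up \<alpha> i)(j := \<alpha> j - 1)) k"
        using True by (auto simp: antimono_nat_iff simp del: fun_upd_apply)
      then show "i = 0 \<or> \<alpha> i < \<alpha> (i - 1)" using Suc True by (auto split: if_splits)
    qed simp
    then show ?thesis using that by (simp add: add_def)
  next
    case False
    then show ?thesis using nlw_zero[of "(up \<alpha> i)(j := \<alpha> j - 1)" ?N] by (auto simp: g_def part_funs_def)
  qed
  have g_nonrem: "g i j = 0" if "j \<notin> rem" "j \<le> ?N" for i j
  proof (cases "i \<noteq> j \<and> 0 < \<alpha> j \<and> antimono ((up \<alpha> i)(j := \<alpha> j - 1))")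
    case True
    have "((up \<alpha> i)(j := \<alpha> j - 1)) (Suc j) \<le> ((up \<alpha> i)(j := \<alpha> j - 1)) j"
      using True by (auto simp: antimono_nat_iff simp del: fun_upd_apply)
    then have "\<alpha> (Suc j) < \<alpha> j" using True by (auto split: if_splits)
    then have "antimono (dn \<alpha> j)" using dn_antimono_iff[OF \<alpha>(1), of j] by auto
    then show ?thesis using that True by (simp add: rem_def)
  next
    case False
    then show ?thesis using nlw_zero[of "(up \<alpha> i)(j := \<alpha> j - 1)" ?N] by (auto simp: g_def part_funs_def)
  qed
  have up_eq: "nlw (Suc ?N) (up \<alpha> i) = nlw ?N \<alpha> + (\<Sum>j\<le>?N. g i j)" if i: "i \<in> add" for i
  proof -
    have "nlw (Suc ?N) (up \<alpha> i) = (\<Sum>j\<in>{j\<in>{..?N}. 0 < up \<alpha> i j}. nlw ?N (dn (up \<alpha> i) j))"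
      using i by (intro nlw_Suc) (simp add: add_def)
    also have "\<dots> = (\<Sum>j\<le>?N. if 0 < up \<alpha> i j then nlw ?N (dn (up \<alpha> i) j) else 0)"
      by (rule sum.inter_filter) simp
    also have "\<dots> = (\<Sum>j\<le>?N. (if j = i then nlw ?N \<alpha> else 0) + g i j)"
    proof (intro sum.cong refl)
      fix j
      show "(if 0 < up \<alpha> i j then nlw ?N (dn (up \<alpha> i) j) else 0) = (if j = i then nlw ?N \<alpha> else 0) + g i j"
      proof (cases "j = i")
        case True
        then have "dn (up \<alpha> i) j = \<alpha>" "0 < up \<alpha> i j" by auto
        then show ?thesis using True by (simp only: if_True g_def) simp
      qed (auto simp: g_def)
    qed
    also have "\<dots> = nlw ?N \<alpha> + (\<Sum>j\<le>?N. g i j)"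
      using i by (simp add: sum.distrib add_def)
    finally show ?thesis .
  qed
  have dn_eq: "nlw ?N \<alpha> + (\<Sum>i\<le>?N. g i j) = ?N * nlw n (dn \<alpha> j)" if j: "j \<in> rem" for j
  proof -
    have dn: "dn \<alpha> j \<in> part_funs n" using part_funs_dn[OF Suc.prems] j by (simp add: rem_def)
    have jj: "0 < \<alpha> j" "j \<le> ?N" using j by (simp_all add: rem_def)
    \<comment> \<open>The induction hypothesis sums over rows up to n only; the further row cannot
      receive a box.\<close>
    have last: "nlw ?N (up (dn \<alpha> j) ?N) = 0"
    proof (rule nlw_zero)
      have "dn \<alpha> j n = 0" "dn \<alpha> j ?N = 0" using dn by (simp_all add: part_funs_def)
      then show "up (dn \<alpha> j) ?N \<notin> part_funs ?N" by (auto simp: part_funs_def)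
    qed
    have "(\<Sum>i\<le>?N. nlw ?N (up (dn \<alpha> j) i)) = ?N * nlw n (dn \<alpha> j)"
      by (simp only: sum.atMost_Suc Suc.IH[OF dn] last add_0_right)
    moreover have "(\<Sum>i\<le>?N. nlw ?N (up (dn \<alpha> j) i)) = (\<Sum>i\<le>?N. (if i = j then nlw ?N \<alpha> else 0) + g i j)"
    proof (intro sum.cong refl)
      fix i assume "i \<in> {..?N}"
      show "nlw ?N (up (dn \<alpha> j) i) = (if i = j then nlw ?N \<alpha> else 0) + g i j"
      proof (cases "i = j")
        case True
        then have "up (dn \<alpha> j) i = \<alpha>" using jj by auto
        then show ?thesis using True by (simp only: g_def) simp
      next
        case False
        then have "up (dn \<alpha> j) i = (up \<alpha> i)(j := \<alpha> j - 1)" by auto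
        then show ?thesis using False jj by (simp only: g_def) simp
      qed
    qed
    ultimately show ?thesis using jj by (simp add: sum.distrib)
  qed
  have "(\<Sum>i\<le>?N. nlw (Suc ?N) (up \<alpha> i)) = (\<Sum>i\<in>add. nlw (Suc ?N) (up \<alpha> i))"
    by (rule sum.mono_neutral_right) (auto simp: add_def intro!: nlw_nonanti simp del: fun_upd_apply)
  also have "\<dots> = card add * nlw ?N \<alpha> + (\<Sum>i\<in>add. \<Sum>j\<le>?N. g i j)"
  proof -
    have "(\<Sum>i\<in>add. nlw (Suc ?N) (up \<alpha> i)) = (\<Sum>i\<in>add. nlw ?N \<alpha> + (\<Sum>j\<le>?N. g i j))"
      by (intro sum.cong refl up_eq)
    then show ?thesis by (simp only: sum.distrib sum_constant of_nat_id)
  qed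
  also have "(\<Sum>i\<in>add. \<Sum>j\<le>?N. g i j) = (\<Sum>i\<le>?N. \<Sum>j\<le>?N. g i j)"
    by (rule sum.mono_neutral_left) (auto simp: add_def g_nonadd)
  also have "\<dots> = (\<Sum>j\<le>?N. \<Sum>i\<le>?N. g i j)" by (rule sum.swap)
  also have "\<dots> = (\<Sum>j\<in>rem. \<Sum>i\<le>?N. g i j)"
    by (rule sum.mono_neutral_right) (auto simp: rem_def g_nonrem)
  also have "card add * nlw ?N \<alpha> + (\<Sum>j\<in>rem. \<Sum>i\<le>?N. g i j)
      = nlw ?N \<alpha> + (\<Sum>j\<in>rem. nlw ?N \<alpha> + (\<Sum>i\<le>?N. g i j))"
    by (simp add: card_add sum.distrib)
  also have "\<dots> = nlw ?N \<alpha> + ?N * (\<Sum>j\<in>rem. nlw n (dn \<alpha> j))"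
  proof -
    have "(\<Sum>j\<in>rem. nlw ?N \<alpha> + (\<Sum>i\<le>?N. g i j)) = (\<Sum>j\<in>rem. ?N * nlw n (dn \<alpha> j))"
      by (intro sum.cong refl dn_eq)
    then show ?thesis by (simp only: sum_distrib_left)
  qed
  also have "(\<Sum>j\<in>rem. nlw n (dn \<alpha> j)) = nlw ?N \<alpha>"
  proof -
    have "nlw ?N \<alpha> = (\<Sum>j\<in>{j\<in>{..n}. 0 < \<alpha> j}. nlw n (dn \<alpha> j))" by (rule nlw_Suc[OF \<alpha>(1)])
    also have "\<dots> = (\<Sum>j\<in>rem. nlw n (dn \<alpha> j))"
    proof (rule sum.mono_neutral_right)
      show "rem \<subseteq> {j\<in>{..n}. 0 < \<alpha> j}"
        using \<alpha>(2)[of ?N] by (auto simp: rem_def le_Suc_eq)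
    qed (auto simp: rem_def intro!: nlw_nonanti simp del: fun_upd_apply)
    finally show ?thesis by simp
  qed
  finally show ?case by simp
qed

lemma finite_part_funs: "finite (part_funs n)"
proof (rule finite_subset)
  show "part_funs n \<subseteq> {f. \<forall>x. (x \<in> {..<n} \<longrightarrow> f x \<in> {..n}) \<and> (x \<notin> {..<n} \<longrightarrow> f x = 0)}"
  proof
    fix f assume f: "f \<in> part_funs n"
    have "f x \<le> n" if "x < n" for x
      using member_le_sum[of x "{..<n}" f] f that by (simp add: part_funs_def)
    then show "f \<in> {f. \<forall>x. (x \<in> {..<n} \<longrightarrow> f x \<in> {..n}) \<and> (x \<notin> {..<n} \<longrightarrow> f x = 0)}"
      using f by (simp add: part_funs_def)
  qed
  show "finite {f. \<forall>x. (x \<in> {..<n} \<longrightarrow> f x \<in> {..n}) \<and> (x \<notin> {..<n} \<longrightarrow> f x = (0::nat))}"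
    by (rule finite_set_of_finite_funs) auto
qed

text \<open>This is the relation \<open>D U - U D = 1\<close> of Young's lattice.\<close>

lemma sum_nlw_squares: "(\<Sum>\<alpha>\<in>part_funs n. nlw n \<alpha> ^ 2) = fact n"
proof (induction n)
  case 0
  have "part_funs 0 = {\<lambda>_. 0}" by (auto simp: part_funs_def antimono_nat_iff)
  moreover have "lwords 0 (\<lambda>_. 0) = {\<lambda>_. 0}" by (auto simp: lwords_def lat_def cntw_def)
  ultimately show ?case by (simp add: nlw_def)
next
  case (Suc n)
  let ?N = "Suc n"
  \<comment> \<open>\<open>A\<close> and \<open>B\<close> both list the edges of Young's lattice
    between two consecutive levels, from the upper and from the lower end.\<close>
  define A where "A = (SIGMA \<alpha>:part_funs ?N. {j\<in>{..n}. 0 < \<alpha> j \<and> antimono (dn \<alpha> j)})"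
  define B where "B = (SIGMA \<beta>:part_funs n. {i\<in>{..n}. antimono (up \<beta> i)})"
  have "(\<Sum>\<alpha>\<in>part_funs ?N. nlw ?N \<alpha> ^ 2)
      = (\<Sum>\<alpha>\<in>part_funs ?N. \<Sum>j\<in>{j\<in>{..n}. 0 < \<alpha> j \<and> antimono (dn \<alpha> j)}. nlw ?N \<alpha> * nlw n (dn \<alpha> j))"
  proof (intro sum.cong refl)
    fix \<alpha> assume "\<alpha> \<in> part_funs ?N"
    then have "nlw ?N \<alpha> = (\<Sum>j\<in>{j\<in>{..n}. 0 < \<alpha> j}. nlw n (dn \<alpha> j))"
      by (intro nlw_Suc) (simp add: part_funs_def)
    also have "\<dots> = (\<Sum>j\<in>{j\<in>{..n}. 0 < \<alpha> j \<and> antimono (dn \<alpha> j)}. nlw n (dn \<alpha> j))"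
      by (rule sum.mono_neutral_right) (auto intro!: nlw_nonanti simp del: fun_upd_apply)
    finally show "nlw ?N \<alpha> ^ 2
        = (\<Sum>j\<in>{j\<in>{..n}. 0 < \<alpha> j \<and> antimono (dn \<alpha> j)}. nlw ?N \<alpha> * nlw n (dn \<alpha> j))"
      by (simp add: power2_eq_square sum_distrib_left)
  qed
  also have "\<dots> = (\<Sum>(\<alpha>, j)\<in>A. nlw ?N \<alpha> * nlw n (dn \<alpha> j))"
    unfolding A_def using finite_part_funs by (subst sum.Sigma) auto
  also have "\<dots> = (\<Sum>(\<beta>, i)\<in>B. nlw ?N (up \<beta> i) * nlw n \<beta>)"
  proof (rule sum.reindex_bij_witness[where i = "\<lambda>(\<beta>, i). (up \<beta> i, i)" and j = "\<lambda>(\<alpha>, j). (dn \<alpha> j, j)"])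
    fix x assume "x \<in> A"
    then obtain \<alpha> j where x: "x = (\<alpha>, j)" "\<alpha> \<in> part_funs ?N" "j \<le> n" "0 < \<alpha> j" "antimono (dn \<alpha> j)"
      by (auto simp: A_def)
    have ud: "up (dn \<alpha> j) j = \<alpha>" using x(4) by auto
    then show "(case case x of (\<alpha>, j) \<Rightarrow> (dn \<alpha> j, j) of (\<beta>, i) \<Rightarrow> (up \<beta> i, i)) = x" using x(1) by simp
    show "(case x of (\<alpha>, j) \<Rightarrow> (dn \<alpha> j, j)) \<in> B"
      using x part_funs_dn[OF x(2,4,5)] ud by (simp add: B_def part_funs_def)
    show "(case case x of (\<alpha>, j) \<Rightarrow> (dn \<alpha> j, j) of (\<beta>, i) \<Rightarrow> nlw ?N (up \<beta> i) * nlw n \<beta>)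
        = (case x of (\<alpha>, j) \<Rightarrow> nlw ?N \<alpha> * nlw n (dn \<alpha> j))"
      using x(1) ud by simp
  next
    fix y assume "y \<in> B"
    then obtain \<beta> i where y: "y = (\<beta>, i)" "\<beta> \<in> part_funs n" "i \<le> n" "antimono (up \<beta> i)"
      by (auto simp: B_def)
    have du: "dn (up \<beta> i) i = \<beta>" by auto
    then show "(case case y of (\<beta>, i) \<Rightarrow> (up \<beta> i, i) of (\<alpha>, j) \<Rightarrow> (dn \<alpha> j, j)) = y" using y(1) by simp
    show "(case y of (\<beta>, i) \<Rightarrow> (up \<beta> i, i)) \<in> A"
      using y part_funs_up[OF y(2,4)] du by (simp add: A_def part_funs_def)
  qed
  also have "\<dots> = (\<Sum>\<beta>\<in>part_funs n. \<Sum>i\<in>{i\<in>{..n}. antimono (up \<beta> i)}. nlw ?N (up \<beta> i) * nlw n \<beta>)"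
    unfolding B_def using finite_part_funs by (subst sum.Sigma) auto
  also have "\<dots> = (\<Sum>\<beta>\<in>part_funs n. (\<Sum>i\<le>n. nlw ?N (up \<beta> i)) * nlw n \<beta>)"
  proof (intro sum.cong refl)
    fix \<beta>
    have "(\<Sum>i\<in>{i\<in>{..n}. antimono (up \<beta> i)}. nlw ?N (up \<beta> i)) = (\<Sum>i\<le>n. nlw ?N (up \<beta> i))"
      by (rule sum.mono_neutral_left) (auto intro!: nlw_nonanti simp del: fun_upd_apply)
    then show "(\<Sum>i\<in>{i\<in>{..n}. antimono (up \<beta> i)}. nlw ?N (up \<beta> i) * nlw n \<beta>)
        = (\<Sum>i\<le>n. nlw ?N (up \<beta> i)) * nlw n \<beta>"
      by (simp only: sum_distrib_right[symmetric])
  qed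
  also have "\<dots> = (\<Sum>\<beta>\<in>part_funs n. Suc n * nlw n \<beta> ^ 2)"
    by (intro sum.cong refl) (simp only: nlw_up_sum power2_eq_square mult.assoc)
  also have "\<dots> = Suc n * fact n" by (simp only: sum_distrib_left[symmetric] Suc.IH)
  finally show ?case by (simp add: fact_Suc)
qed

lemma part_Par: "la \<in> Par n \<Longrightarrow> part la \<in> part_funs n"
proof -
  assume la: "la \<in> Par n"
  have anti: "antimono (part la)" using Par_part_antimono[OF la] by (auto intro: antimonoI)
  have pos: "0 < part la l" if "l < length la" for l
    using la that nth_mem[OF that] by (auto simp: Par_def part_def)
  have "(\<Sum>l<length la. 1) \<le> (\<Sum>l<length la. part la l)"
    using pos by (intro sum_mono) (simp add: One_nat_def Suc_le_eq)
  then have len: "length la \<le> n" using sum_list_Par[OF la] by (simp add: sum_list_part)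
  have "(\<Sum>l<n. part la l) = (\<Sum>l<length la. part la l)"
    by (rule sum.mono_neutral_right) (use len in \<open>auto simp: part_def\<close>)
  then show ?thesis
    using anti len sum_list_Par[OF la] by (auto simp: part_funs_def sum_list_part part_def[of la])
qed

lemma part_inj: "inj_on part (Par n)"
proof (rule inj_onI)
  fix la mu assume la: "la \<in> Par n" and mu: "mu \<in> Par n" and eq: "part la = part mu"
  have len: "l < length nu \<longleftrightarrow> part nu l \<noteq> 0" if "nu \<in> Par n" for nu l
    using that nth_mem[of l nu] by (auto simp: Par_def part_def)
  have "length la = length mu"
    using len[OF la] len[OF mu] eq by (metis linorder_neqE_nat less_irrefl_nat)
  moreover have "la ! l = mu ! l" if "l < length la" for l
    using fun_cong[OF eq, of l] that calculation by (simp add: part_def)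
  ultimately show "la = mu" by (rule nth_equalityI)
qed

lemma finite_Par: "finite (Par n)"
  using finite_part_funs part_Par part_inj by (metis finite_imageD finite_subset image_subsetI)

lemma latw_lwords: "la \<in> Par n \<Longrightarrow> latw n la = lwords n (part la)"
proof -
  assume la: "la \<in> Par n"
  then have "row la r = 0" if "r \<notin> {1..n}" for r
    using row_outside[of r la] that sum_list_Par by blast
  moreover have "cntw n (row la) = part la"
    using cntw_row[of la] sum_list_Par[OF la] by auto
  ultimately show ?thesis
    by (auto simp: latw_def lwords_def words_iff_cntw fun_eq_iff)
qed

text \<open>The upper bound suffices: a spanning family of at most n! elements in a free module of
  rank n! is a basis.\<close>

lemma card_latw_pairs: "card (SIGMA la:Par n. latw n la \<times> latw n la) \<le> fact n"
proof -
  have "card (SIGMA la:Par n. latw n la \<times> latw n la) = (\<Sum>la\<in>Par n. nlw n (part la) ^ 2)"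
    using finite_Par finite_lwords
    by (subst card_SigmaI) (auto simp: latw_lwords card_cartesian_product nlw_def power2_eq_square)
  also have "\<dots> = (\<Sum>\<alpha>\<in>part ` Par n. nlw n \<alpha> ^ 2)"
    by (simp add: sum.reindex[OF part_inj])
  also have "\<dots> \<le> (\<Sum>\<alpha>\<in>part_funs n. nlw n \<alpha> ^ 2)"
    by (rule sum_mono2) (use finite_part_funs part_Par in auto)
  finally show ?thesis by (simp add: sum_nlw_squares)
qed

section \<open>Spanning families\<close>

text \<open>The adjugate divided by the determinant, a unit by multiplicativity, is a left inverse
  over any commutative ring, and it must coincide with the given right inverse.\<close>

lemma square_mat_right_inverse:
  fixes A B :: "'r::comm_ring_1 mat"
  assumes A: "A \<in> carrier_mat N N" and B: "B \<in> carrier_mat N N" and AB: "A * B = 1\<^sub>m N"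
  shows "B * A = 1\<^sub>m N"
proof -
  define C where "C = det B \<cdot>\<^sub>m adj_mat A"
  have adj: "adj_mat A \<in> carrier_mat N N" "adj_mat A * A = det A \<cdot>\<^sub>m 1\<^sub>m N" using adj_mat[OF A] by auto
  have "det A * det B = 1" using det_mult[OF A B] AB by simp
  moreover have "c \<cdot>\<^sub>m (d \<cdot>\<^sub>m M) = (c * d) \<cdot>\<^sub>m M" for c d :: 'r and M
    by (rule eq_matI) (auto simp: mult.assoc)
  moreover have "(1::'r) \<cdot>\<^sub>m M = M" for M by (rule eq_matI) auto
  ultimately have CA: "C * A = 1\<^sub>m N"
    using adj A by (simp add: C_def mult_smult_assoc_mat[OF adj(1) A] mult.commute)
  have C: "C \<in> carrier_mat N N" using adj by (simp add: C_def)
  have "B = (C * A) * B" using CA B by simp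
  also have "\<dots> = C * (A * B)" by (rule assoc_mult_mat[OF C A B])
  also have "\<dots> = C" using AB C by simp
  finally show ?thesis using CA by simp
qed

context hecke_unit
begin

text \<open>Expanding the T_w in the family and the family in the T_w gives matrices with product 1,
  so the product in the other order is 1 as well. This makes the coordinates well defined, and the
  perfect trace form represents them by elements.\<close>

lemma spanning_dual:
  fixes K :: "'k set" and m :: "'k \<Rightarrow> 'r endo"
  assumes K: "finite K" "card K \<le> fact n" and m: "\<And>k. k \<in> K \<Longrightarrow> m k \<in> H"
    and span: "\<And>y. y \<in> H \<Longrightarrow> \<exists>a. y = (\<Sum>k\<in>K. smul (a k) (m k))"
  shows "\<exists>dual. \<forall>k\<in>K. dual k \<in> H \<and> (\<forall>j\<in>K. tr (dual k * m j) = (if j = k then 1 else 0))"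
proof -
  have "\<forall>w\<in>P. \<exists>a. W w = (\<Sum>k\<in>K. smul (a k) (m k))"
    using span[OF Hk_Tw] by blast
  then obtain a where a: "\<And>w. w \<in> P \<Longrightarrow> W w = (\<Sum>k\<in>K. smul (a w k) (m k))"
    using bchoice[of P "\<lambda>w a. W w = (\<Sum>k\<in>K. smul (a k) (m k))"] by blast
  define b :: "'r endo \<Rightarrow> (nat \<Rightarrow> nat) \<Rightarrow> 'r" where "b y w = (y \<triangleright> de id) (pinv w)" for y w
  have b: "y = (\<Sum>w\<in>P. smul (b y w) (W w))" if "y \<in> H" for y
  proof -
    have "y = (\<Sum>c\<in>P. smul ((y \<triangleright> de id) c) (W (pinv c)))" using el_eq[OF that] by (simp add: el_def)
    also have "\<dots> = (\<Sum>w\<in>P. smul (b y w) (W w))"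
      unfolding b_def
      by (rule sum.reindex_bij_witness[of _ pinv pinv]) (auto simp: permutes_inv permutes_inv_inv)
    finally show ?thesis .
  qed
  have bW: "b (W w) w' = (if w' = w then 1 else 0)" if "w \<in> P" "w' \<in> P" for w w'
  proof -
    have "pinv w' = pinv w \<longleftrightarrow> w' = w" using that permutes_inv_inv by (metis mem_Collect_eq)
    moreover have "b (W w) w' = de (pinv w) (pinv w')" using that by (simp add: b_def Tw_de_id)
    ultimately show ?thesis by (simp add: de_def)
  qed
  have b_sum: "b (\<Sum>k\<in>K. smul (f k) (m k)) w = (\<Sum>k\<in>K. f k * b (m k) w)" for f w
    by (simp add: b_def sum_app sum_fun_apply)
  let ?N = "fact n :: nat"
  have cardP: "card P = ?N" using card_permutations[of "{1..n}" n] by simp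
  obtain e where e: "bij_betw e {..<?N} P"
    using ex_bij_betw_nat_finite[OF finite_perms[of n]] cardP by (auto simp: atLeast0LessThan)
  \<comment> \<open>The index set is embedded into n! positions; the positions left over receive
    zero columns and rows, which keeps the matrices square.\<close>
  obtain g where g: "inj_on g K" "g ` K \<subseteq> {..<?N}"
    using inj_on_iff_card_le[OF K(1), of "{..<?N}"] K(2) by auto
  define A where "A = mat ?N ?N (\<lambda>(i, j). if j \<in> g ` K then a (e i) (inv_into K g j) else 0)"
  define B where "B = mat ?N ?N (\<lambda>(j, i). if j \<in> g ` K then b (m (inv_into K g j)) (e i) else 0)"
  have AB: "A * B = 1\<^sub>m ?N"
  proof (rule eq_matI)
    fix i j assume "i < dim_row (1\<^sub>m ?N :: 'r mat)" "j < dim_col (1\<^sub>m ?N :: 'r mat)"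
    then have ij: "i < ?N" "j < ?N" by auto
    then have P: "e i \<in> P" "e j \<in> P" using bij_betwE[OF e] by auto
    have "(A * B) $$ (i, j) = (\<Sum>l\<in>{..<?N}. if l \<in> g ` K
        then a (e i) (inv_into K g l) * b (m (inv_into K g l)) (e j) else 0)"
      using ij by (simp add: A_def B_def scalar_prod_def atLeast0LessThan cong: sum.cong if_cong)
        (intro sum.cong refl, auto)
    also have "\<dots> = (\<Sum>l\<in>g ` K. a (e i) (inv_into K g l) * b (m (inv_into K g l)) (e j))"
      using g(2) by (simp add: sum.If_cases Int_absorb1)
    also have "\<dots> = (\<Sum>k\<in>K. a (e i) k * b (m k) (e j))"
      using g(1) by (simp add: sum.reindex)
    also have "\<dots> = b (W (e i)) (e j)" unfolding a[OF P(1)] b_sum ..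
    also have "\<dots> = (if i = j then 1 else 0)"
      using bW[OF P] bij_betw_imp_inj_on[OF e] ij by (auto dest: inj_onD)
    finally show "(A * B) $$ (i, j) = 1\<^sub>m ?N $$ (i, j)" using ij by simp
  qed (simp_all add: A_def B_def)
  have BA: "B * A = 1\<^sub>m ?N"
    by (rule square_mat_right_inverse[OF _ _ AB]) (simp_all add: A_def B_def)
  define \<phi> where "\<phi> k y = (\<Sum>w\<in>P. b y w * a w k)" for k y
  have \<phi>m: "\<phi> k (m j) = (if j = k then 1 else 0)" if "j \<in> K" "k \<in> K" for j k
  proof -
    have gg: "g j < ?N" "g k < ?N" using g(2) that by auto
    have "(B * A) $$ (g j, g k) = (\<Sum>l\<in>{..<?N}. b (m j) (e l) * a (e l) k)"
      using gg that g(1) by (simp add: A_def B_def scalar_prod_def atLeast0LessThan)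
    also have "\<dots> = \<phi> k (m j)"
      unfolding \<phi>_def by (rule sum.reindex_bij_betw[OF e, of "\<lambda>w. b (m j) w * a w k"])
    finally show ?thesis using BA gg inj_on_eq_iff[OF g(1) that] by simp
  qed
  have "\<exists>d\<in>H. \<forall>y\<in>H. \<phi> k y = tr (d * y)" for k
    by (rule functional_tr_left)
      (simp_all add: \<phi>_def b_def distrib_right sum.distrib sum_distrib_left mult.assoc)
  then have "\<forall>k. \<exists>d. d \<in> H \<and> (\<forall>y\<in>H. \<phi> k y = tr (d * y))" by blast
  from choice[OF this] obtain dual where dual: "\<And>k. dual k \<in> H" "\<And>k y. y \<in> H \<Longrightarrow> \<phi> k y = tr (dual k * y)"
    by blast
  show ?thesis
  proof (intro exI[of _ dual] ballI conjI)
    fix k j assume "k \<in> K" "j \<in> K"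
    then show "tr (dual k * m j) = (if j = k then 1 else 0)"
      using \<phi>m[of j k] dual(2)[OF m[of j], of k] by simp
  qed (rule dual(1))
qed

end

section \<open>Standard tableaux and lattice words\<close>

context
  fixes n :: nat and la :: "nat list"
  assumes la: "la \<in> Par n"
begin

lemma sum_la: "sum_list la = n"
  using la by (rule sum_list_Par)

lemma boxes_iff: "(i, j) \<in> boxes la \<longleftrightarrow> j < part la i"
  by (auto simp: boxes_def part_def)

lemma initial_tableau_eq:
  "(i, j) \<in> boxes la \<Longrightarrow> initial_tableau la (i, j) = (\<Sum>l<i. part la l) + j + 1"
  by (simp add: initial_tableau_def sum_list_take_part)

lemma part_sum_le: "(\<Sum>l<k. part la l) \<le> n"
proof -
  have "(\<Sum>l<k. part la l) \<le> (\<Sum>l<k + length la. part la l)" by (intro sum_mono2) auto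
  also have "\<dots> = sum_list (take (k + length la) la)" by (simp only: sum_list_take_part)
  finally show ?thesis by (simp add: sum_la)
qed

lemma initial_tableau_in:
  assumes "(i, j) \<in> boxes la"
  shows "initial_tableau la (i, j) \<in> {1..n}" "row la (initial_tableau la (i, j)) = i"
proof -
  have j: "j < part la i" using assms boxes_iff by simp
  have le: "(\<Sum>l<Suc i. part la l) \<le> n" by (rule part_sum_le)
  then show in_n: "initial_tableau la (i, j) \<in> {1..n}" using j by (simp add: initial_tableau_eq[OF assms])
  show "row la (initial_tableau la (i, j)) = i"
    using row_eq_iff[of "initial_tableau la (i, j)" la i] in_n j sum_la
    by (simp add: initial_tableau_eq[OF assms] lessThan_Suc_atMost[symmetric])
qed

lemma initial_tableau_surj:
  assumes "r \<in> {1..n}"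
  obtains j where "(row la r, j) \<in> boxes la" "initial_tableau la (row la r, j) = r"
proof -
  have r: "r \<in> {1..sum_list la}" using assms sum_la by simp
  let ?s = "\<Sum>l<row la r. part la l"
  have b: "?s < r" "r \<le> ?s + part la (row la r)"
    using row_bounds(2,3)[OF r] by (simp_all add: lessThan_Suc_atMost[symmetric])
  then have "(row la r, r - ?s - 1) \<in> boxes la" using boxes_iff by auto
  moreover from this have "initial_tableau la (row la r, r - ?s - 1) = r"
    using b by (simp add: initial_tableau_eq)
  ultimately show thesis using that by blast
qed

lemma initial_tableau_bij: "bij_betw (initial_tableau la) (boxes la) {1..n}"
proof (rule bij_betw_imageI)
  show "inj_on (initial_tableau la) (boxes la)"
  proof (rule inj_onI, clarify)
    fix i j i' j' assume *: "(i, j) \<in> boxes la" "(i', j') \<in> boxes la"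
      "initial_tableau la (i, j) = initial_tableau la (i', j')"
    then have "i = i'" using initial_tableau_in(2) by metis
    then show "i = i' \<and> j = j'" using * by (simp add: initial_tableau_eq)
  qed
  show "initial_tableau la ` boxes la = {1..n}"
  proof (intro equalityI subsetI)
    fix r assume "r \<in> {1..n}"
    then show "r \<in> initial_tableau la ` boxes la" by (metis initial_tableau_surj imageI)
  qed (use initial_tableau_in(1) in auto)
qed

lemma tableau_perm_eqI:
  assumes w: "w permutes {1..n}" and s: "\<And>b. b \<in> boxes la \<Longrightarrow> s b = w (initial_tableau la b)"
  shows "tableau_perm la s = w"
  unfolding tableau_perm_def sum_la
proof (rule the_equality)
  show "w permutes {1..n} \<and> (\<forall>b\<in>boxes la. s b = w (initial_tableau la b))" using assms by blast
  fix v assume v: "v permutes {1..n} \<and> (\<forall>b\<in>boxes la. s b = v (initial_tableau la b))"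
  show "v = w"
  proof
    fix r show "v r = w r"
    proof (cases "r \<in> {1..n}")
      case True
      then obtain b where "b \<in> boxes la" "initial_tableau la b = r"
        by (metis initial_tableau_surj)
      then show ?thesis using v s by metis
    next
      case False
      then show ?thesis using v w permutes_not_in by metis
    qed
  qed
qed

lemma tableau_perm:
  assumes s: "bij_betw s (boxes la) {1..n}"
  shows "tableau_perm la s permutes {1..n}"
    "b \<in> boxes la \<Longrightarrow> s b = tableau_perm la s (initial_tableau la b)"
proof -
  let ?t = "initial_tableau la"
  define w where "w r = (if r \<in> {1..n} then s (inv_into (boxes la) ?t r) else r)" for r
  have "bij_betw (s \<circ> inv_into (boxes la) ?t) {1..n} {1..n}"
    by (rule bij_betw_trans[OF bij_betw_inv_into[OF initial_tableau_bij] s])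
  then have "bij_betw w {1..n} {1..n}"
    by (rule bij_betw_cong[THEN iffD1, rotated]) (simp add: w_def)
  then have w: "w permutes {1..n}" by (rule bij_imp_permutes) (auto simp: w_def)
  have sw: "s b = w (?t b)" if "b \<in> boxes la" for b
    using that bij_betwE[OF initial_tableau_bij] bij_betw_inv_into_left[OF initial_tableau_bij that]
    by (simp add: w_def)
  have "tableau_perm la s = w" using w sw by (rule tableau_perm_eqI)
  then show "tableau_perm la s permutes {1..n}"
    "b \<in> boxes la \<Longrightarrow> s b = tableau_perm la s (initial_tableau la b)"
    using w sw by simp_all
qed

text \<open>Prefix counts of the row word count the entries up to m in a row. This turns the column
  condition on tableaux into the lattice condition.\<close>

lemma cntw_tableau:
  assumes d: "d permutes {1..n}" and s: "\<And>b. b \<in> boxes la \<Longrightarrow> s b = d (initial_tableau la b)"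
    and m: "m \<le> n"
  shows "cntw m (row la \<circ> pinv d) l = card {j. j < part la l \<and> s (l, j) \<le> m}"
proof -
  have sd: "s (i, j) \<in> {1..n}" "pinv d (s (i, j)) = initial_tableau la (i, j)" if "j < part la i" for i j
  proof -
    have b: "(i, j) \<in> boxes la" using that boxes_iff by simp
    show "s (i, j) \<in> {1..n}" using permutes_in_image[OF d] initial_tableau_in(1)[OF b] s[OF b] by metis
    show "pinv d (s (i, j)) = initial_tableau la (i, j)" using s[OF b] permutes_inverses[OF d] by simp
  qed
  have "bij_betw (\<lambda>j. s (l, j)) {j. j < part la l \<and> s (l, j) \<le> m} {r \<in> {1..m}. (row la \<circ> pinv d) r = l}"
  proof (rule bij_betw_imageI)
    show "inj_on (\<lambda>j. s (l, j)) {j. j < part la l \<and> s (l, j) \<le> m}"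
    proof (rule inj_onI)
      fix j k assume "j \<in> {j. j < part la l \<and> s (l, j) \<le> m}" "k \<in> {j. j < part la l \<and> s (l, j) \<le> m}"
        "s (l, j) = s (l, k)"
      then have "initial_tableau la (l, j) = initial_tableau la (l, k)" "(l, j) \<in> boxes la" "(l, k) \<in> boxes la"
        using sd(2)[of j l] sd(2)[of k l] boxes_iff by auto
      then show "j = k" by (simp add: initial_tableau_eq)
    qed
    show "(\<lambda>j. s (l, j)) ` {j. j < part la l \<and> s (l, j) \<le> m} = {r \<in> {1..m}. (row la \<circ> pinv d) r = l}"
    proof (intro equalityI subsetI)
      fix r assume "r \<in> (\<lambda>j. s (l, j)) ` {j. j < part la l \<and> s (l, j) \<le> m}"
      then obtain j where j: "j < part la l" "s (l, j) \<le> m" "r = s (l, j)" by blast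
      then show "r \<in> {r \<in> {1..m}. (row la \<circ> pinv d) r = l}"
        using sd[OF j(1)] initial_tableau_in(2)[of l j] boxes_iff by simp
    next
      fix r assume "r \<in> {r \<in> {1..m}. (row la \<circ> pinv d) r = l}"
      then have r: "r \<in> {1..m}" "row la (pinv d r) = l" by auto
      then have "pinv d r \<in> {1..n}" using permutes_in_image[OF permutes_inv[OF d], of r] m by auto
      then obtain j where j: "(l, j) \<in> boxes la" "initial_tableau la (l, j) = pinv d r"
        using initial_tableau_surj r(2) by metis
      then have "r = s (l, j)" using s[OF j(1)] permutes_inverses[OF d] by simp
      then show "r \<in> (\<lambda>j. s (l, j)) ` {j. j < part la l \<and> s (l, j) \<le> m}"
        using j(1) r(1) boxes_iff by auto
    qed
  qed
  then show ?thesis unfolding cntw_def by (rule bij_betw_same_card[symmetric])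
qed

lemma part_Suc_le: "part la (Suc l) \<le> part la l"
  using Par_part_antimono[OF la, of l "Suc l"] by simp

text \<open>The column condition yields a lattice word. The row condition confines the inversions of
  d(s) to different rows: d(s) is shortest in its coset of the Young subgroup, which is the form
  needed for \<open>Tw_asc_family\<close>.\<close>

lemma standard_tableau:
  assumes s: "s \<in> standard_tableaux la"
  defines "d \<equiv> tableau_perm la s"
  shows "d permutes {1..n}" "row la \<circ> pinv d \<in> latw n la"
    "\<And>a b. a \<in> {1..n} \<Longrightarrow> b \<in> {1..n} \<Longrightarrow> a < b \<Longrightarrow> d b < d a \<Longrightarrow> row la a < row la b"
proof -
  have bij: "bij_betw s (boxes la) {1..n}" using s sum_la by (simp add: standard_tableaux_def)
  note tp = tableau_perm[OF bij, folded d_def]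
  show d: "d permutes {1..n}" by (rule tp(1))
  have rows: "s (i, j) < s (i, k)" if "(i, j) \<in> boxes la" "(i, k) \<in> boxes la" "j < k" for i j k
    using s that unfolding standard_tableaux_def by blast
  have cols: "s (i, k) < s (j, k)" if "(i, k) \<in> boxes la" "(j, k) \<in> boxes la" "i < j" for i j k
    using s that unfolding standard_tableaux_def by blast
  have "lat n (row la \<circ> pinv d)"
    unfolding lat_def
  proof (intro allI impI)
    fix m l assume m: "m \<le> n"
    have "{j. j < part la (Suc l) \<and> s (Suc l, j) \<le> m} \<subseteq> {j. j < part la l \<and> s (l, j) \<le> m}"
    proof
      fix j assume "j \<in> {j. j < part la (Suc l) \<and> s (Suc l, j) \<le> m}"
      then show "j \<in> {j. j < part la l \<and> s (l, j) \<le> m}"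
        using cols[of l j "Suc l"] part_Suc_le[of l] boxes_iff by fastforce
    qed
    then have "card {j. j < part la (Suc l) \<and> s (Suc l, j) \<le> m} \<le> card {j. j < part la l \<and> s (l, j) \<le> m}"
      by (intro card_mono) auto
    moreover have "cntw m (row la \<circ> pinv d) k = card {j. j < part la k \<and> s (k, j) \<le> m}" for k
      by (rule cntw_tableau[OF d tp(2) m])
    ultimately show "cntw m (row la \<circ> pinv d) (Suc l) \<le> cntw m (row la \<circ> pinv d) l"
      by (simp only:)
  qed
  then show "row la \<circ> pinv d \<in> latw n la"
    using permutes_inv[OF d] by (auto simp: latw_def words_def)
  fix a b assume ab: "a \<in> {1..n}" "b \<in> {1..n}" "a < b" "d b < d a"
  have "row la a \<le> row la b" using mono_onD[OF row_mono[of la], of a b] ab sum_la by simp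
  moreover have "row la a \<noteq> row la b"
  proof
    assume eq: "row la a = row la b"
    obtain j where j: "(row la a, j) \<in> boxes la" "initial_tableau la (row la a, j) = a"
      using initial_tableau_surj[OF ab(1)] .
    obtain k where k: "(row la a, k) \<in> boxes la" "initial_tableau la (row la a, k) = b"
      using initial_tableau_surj[OF ab(2)] eq by metis
    have "j < k" using j k ab(3) by (simp add: initial_tableau_eq)
    then have "s (row la a, j) < s (row la a, k)" using rows j k by blast
    then show False using tp(2)[OF j(1)] tp(2)[OF k(1)] j k ab(4) by simp
  qed
  ultimately show "row la a < row la b" by simp
qed

text \<open>Of all permutations that produce the word, one with the fewest inversions increases
  along rows. Columns increase by counting: otherwise row i would have at most k entries up to the
  entry of row i + 1 in column k, while row i + 1 has at least k + 1.\<close>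

lemma lattice_word_tableau:
  assumes c: "c \<in> latw n la"
  obtains s where "s \<in> standard_tableaux la" "row la \<circ> pinv (tableau_perm la s) = c"
proof -
  obtain p where "p permutes {1..n}" "c = row la \<circ> p" using c by (auto simp: latw_def words_def)
  then have "pinv p permutes {1..n} \<and> row la \<circ> pinv (pinv p) = c"
    by (simp add: permutes_inv permutes_inv_inv)
  from ex_has_least_nat[of "\<lambda>d. d permutes {1..n} \<and> row la \<circ> pinv d = c", OF this, of "ninv n"]
  obtain d where d: "d permutes {1..n}" "row la \<circ> pinv d = c"
    and min: "\<And>d'. d' permutes {1..n} \<Longrightarrow> row la \<circ> pinv d' = c \<Longrightarrow> ninv n d \<le> ninv n d'" by blast
  have asc: "d i < d (Suc i)" if i: "i \<in> {1..<n}" "row la i = row la (Suc i)" for i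
  proof (rule ccontr)
    assume "\<not> d i < d (Suc i)"
    moreover have "d i \<noteq> d (Suc i)" using permutes_inj[OF d(1)] by (metis injD n_not_Suc_n)
    ultimately have less: "ninv n d = Suc (ninv n (d \<circ> adj i))" using ninv_desc[OF i(1)] by simp
    have "pinv (d \<circ> adj i) = adj i \<circ> pinv d"
      using o_inv_distrib[OF permutes_bij[OF d(1)] permutes_bij[OF adj_permutes[OF i(1)]]]
        permutes_inv_inv[OF adj_permutes[OF i(1)]] inv_unique_comp[of "adj i" "adj i"] by simp
    then have "row la \<circ> pinv (d \<circ> adj i) = row la \<circ> adj i \<circ> pinv d" by (simp only: comp_assoc)
    also have "\<dots> = c" using d(2) comp_adj_eq[of "row la" i] i(2) by simp
    finally show False
      using min[of "d \<circ> adj i"] comp_adj_permutes[OF i(1)] d(1) less by (simp del: o_apply)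
  qed
  have mono: "mono_on {1..n} (row la)" using row_mono[of la] sum_la by simp
  define s where "s = (\<lambda>b\<in>boxes la. d (initial_tableau la b))"
  have s: "s b = d (initial_tableau la b)" if "b \<in> boxes la" for b using that by (simp add: s_def)
  have bij: "bij_betw s (boxes la) {1..n}"
  proof -
    have "bij_betw (d \<circ> initial_tableau la) (boxes la) {1..n}"
      by (rule bij_betw_trans[OF initial_tableau_bij permutes_imp_bij[OF d(1)]])
    then show ?thesis by (rule bij_betw_cong[THEN iffD1, rotated]) (simp add: s)
  qed
  have rows: "s (i, j) < s (i, k)" if b: "(i, j) \<in> boxes la" "(i, k) \<in> boxes la" "j < k" for i j k
  proof -
    have "initial_tableau la (i, k) = Suc (initial_tableau la (i, j) + (k - j - 1))"
      using b by (simp add: initial_tableau_eq)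
    then show ?thesis
      using level_strict[where p = d and a = "initial_tableau la (i, j)" and k = "k - j - 1", OF mono asc]
        initial_tableau_in[OF b(1)] initial_tableau_in[OF b(2)] s b by simp
  qed
  have step: "s (i, k) < s (Suc i, k)" if b: "(Suc i, k) \<in> boxes la" for i k
  proof -
    have k: "k < part la (Suc i)" "k < part la i" using b boxes_iff part_Suc_le[of i] by auto
    have bi: "(i, k) \<in> boxes la" using k boxes_iff by simp
    let ?m = "s (Suc i, k)"
    have m: "?m \<le> n" using bij_betwE[OF bij] b by auto
    have cnt: "cntw ?m c l = card {j. j < part la l \<and> s (l, j) \<le> ?m}" for l
      using cntw_tableau[OF d(1) s m, of l] d(2) by simp
    have le: "s (Suc i, j) \<le> ?m" if "j \<le> k" for j
      using rows[of "Suc i" j k] that b k boxes_iff by (cases "j = k") auto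
    have "card {..k} \<le> card {j. j < part la (Suc i) \<and> s (Suc i, j) \<le> ?m}"
      by (intro card_mono) (use le k in auto)
    also have "\<dots> \<le> card {j. j < part la i \<and> s (i, j) \<le> ?m}"
    proof -
      have "cntw ?m c (Suc i) \<le> cntw ?m c i" using c m by (simp add: latw_def lat_def)
      then show ?thesis by (simp only: cnt)
    qed
    finally have card: "Suc k \<le> card {j. j < part la i \<and> s (i, j) \<le> ?m}" by simp
    have "s (i, k) \<le> ?m"
    proof (rule ccontr)
      assume *: "\<not> s (i, k) \<le> ?m"
      have "{j. j < part la i \<and> s (i, j) \<le> ?m} \<subseteq> {..<k}"
      proof
        fix j assume j: "j \<in> {j. j < part la i \<and> s (i, j) \<le> ?m}"
        show "j \<in> {..<k}"
        proof (rule ccontr)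
          assume "j \<notin> {..<k}"
          then have "k < j \<or> k = j" by auto
          then show False using rows[OF bi, of j] j * boxes_iff by auto
        qed
      qed
      then have "card {j. j < part la i \<and> s (i, j) \<le> ?m} \<le> k"
        using card_mono[of "{..<k}"] by fastforce
      then show False using card by simp
    qed
    moreover have "s (i, k) \<noteq> ?m"
      using bij_betw_imp_inj_on[OF bij] bi b by (auto dest: inj_onD)
    ultimately show ?thesis by simp
  qed
  have cols: "(j, k) \<in> boxes la \<Longrightarrow> i < j \<Longrightarrow> s (i, k) < s (j, k)" for i j k
  proof (induction j)
    case (Suc j)
    have bj: "(j, k) \<in> boxes la" using Suc.prems(1) part_Suc_le[of j] boxes_iff by simp
    show ?case
    proof (cases "i = j")
      case True
      then show ?thesis using step Suc.prems by simp
    next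
      case False
      then have "s (i, k) < s (j, k)" using Suc bj by simp
      also have "\<dots> < s (Suc j, k)" using step Suc.prems by simp
      finally show ?thesis .
    qed
  qed simp
  have "s \<in> extensional (boxes la)" by (simp add: s_def)
  then have "s \<in> standard_tableaux la"
    unfolding standard_tableaux_def sum_la using bij rows cols by blast
  moreover have "tableau_perm la s = d" using d(1) s by (rule tableau_perm_eqI)
  ultimately show thesis using that d(2) by blast
qed

end

section \<open>The Murphy basis\<close>

lemma dominated_by_trans: "dominated_by la mu \<Longrightarrow> dominated_by mu nu \<Longrightarrow> dominated_by la nu"
  unfolding dominated_by_def using le_trans by blast

lemma dominated_by_antisym:
  assumes "la \<in> Par n" "mu \<in> Par n" "dominated_by la mu" "dominated_by mu la"
  shows "la = mu"
proof -
  have eq: "(\<Sum>l<k. part la l) = (\<Sum>l<k. part mu l)" for k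
    using assms(3,4) by (simp add: dominated_by_part le_antisym)
  have "part la k = part mu k" for k
    using eq[of "Suc k"] eq[of k] by simp
  then show ?thesis using part_inj assms(1,2) by (metis ext inj_onD)
qed

lemma above_subset: "mu \<in> above n la \<Longrightarrow> la \<in> Par n \<Longrightarrow> insert mu (above n mu) \<subseteq> above n la"
  unfolding above_def using dominated_by_trans dominated_by_antisym by blast

lemma smul_family_span:
  fixes m :: "'k \<Rightarrow> 'r::comm_ring_1 endo"
  assumes "finite K"
  shows "endo_span (m ` K) = range (\<lambda>a. \<Sum>k\<in>K. smul (a k) (m k))"
proof
  show "range (\<lambda>a. \<Sum>k\<in>K. smul (a k) (m k)) \<subseteq> endo_span (m ` K)"
  proof clarify
    fix a show "(\<Sum>k\<in>K. smul (a k) (m k)) \<in> endo_span (m ` K)"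
      by (intro endo.span_sum endo.span_scale endo.span_base imageI)
  qed
  show "endo_span (m ` K) \<subseteq> range (\<lambda>a. \<Sum>k\<in>K. smul (a k) (m k))"
  proof (rule endo.span_minimal)
    show "m ` K \<subseteq> range (\<lambda>a. \<Sum>k\<in>K. smul (a k) (m k))"
    proof clarify
      fix x assume "x \<in> K"
      then have "m x = (\<Sum>k\<in>K. if k = x then m k else 0)" using assms by simp
      also have "\<dots> = (\<Sum>k\<in>K. smul (if k = x then 1 else 0) (m k))" by (intro sum.cong) auto
      finally show "m x \<in> range (\<lambda>a. \<Sum>k\<in>K. smul (a k) (m k))"
        by (rule range_eqI[of _ _ "\<lambda>k. if k = x then 1 else 0"])
    qed
    show "endo_subspace (range (\<lambda>a. \<Sum>k\<in>K. smul (a k) (m k)))"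
      unfolding endo.subspace_def
    proof (intro conjI ballI allI)
      have "0 = (\<Sum>k\<in>K. smul 0 (m k))" by simp
      then show "0 \<in> range (\<lambda>a. \<Sum>k\<in>K. smul (a k) (m k))" by (rule range_eqI[of _ _ "\<lambda>k. 0"])
      fix x y r
      assume "x \<in> range (\<lambda>a. \<Sum>k\<in>K. smul (a k) (m k))"
      then obtain a where x: "x = (\<Sum>k\<in>K. smul (a k) (m k))" by blast
      have "smul r x = (\<Sum>k\<in>K. smul (r * a k) (m k))"
        by (simp add: x endo.scale_sum_right)
      then show "smul r x \<in> range (\<lambda>a. \<Sum>k\<in>K. smul (a k) (m k))"
        by (rule range_eqI[of _ _ "\<lambda>k. r * a k"])
      assume "y \<in> range (\<lambda>a. \<Sum>k\<in>K. smul (a k) (m k))"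
      then obtain b where y: "y = (\<Sum>k\<in>K. smul (b k) (m k))" by blast
      have "x + y = (\<Sum>k\<in>K. smul (a k + b k) (m k))"
        by (simp add: x y endo.scale_left_distrib sum.distrib)
      then show "x + y \<in> range (\<lambda>a. \<Sum>k\<in>K. smul (a k) (m k))"
        by (rule range_eqI[of _ _ "\<lambda>k. a k + b k"])
    qed
  qed
qed

context hecke_unit
begin

definition mbase :: "nat list \<Rightarrow> (nat \<Rightarrow> nat) \<Rightarrow> (nat \<Rightarrow> nat) \<Rightarrow> 'r endo" where
  "mbase la c c' = straighten.lift n q la c * Y (row la) * star (straighten.lift n q la c')"

definition mset_span :: "nat list set \<Rightarrow> 'r endo set" where
  "mset_span S = endo_span {mbase la c c' | la c c'. la \<in> S \<and> c \<in> latw n la \<and> c' \<in> latw n la}"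

lemma straightenI: "la \<in> Par n \<Longrightarrow> straighten n q la"
  by unfold_locales

lemma latw_words: "c \<in> latw n la \<Longrightarrow> c \<in> words n (row la)"
  by (simp add: latw_def)

lemma lift_Hk: "la \<in> Par n \<Longrightarrow> c \<in> latw n la \<Longrightarrow> straighten.lift n q la c \<in> H"
  by (rule straighten.lift(1)[OF straightenI latw_words])

lemma mbase_yideal:
  "la \<in> S \<Longrightarrow> la \<in> Par n \<Longrightarrow> c \<in> latw n la \<Longrightarrow> c' \<in> latw n la \<Longrightarrow> mbase la c c' \<in> yideal S"
  unfolding mbase_def by (intro yideal_gen star_Hk lift_Hk)

lemma mset_span_mono: "S \<subseteq> S' \<Longrightarrow> mset_span S \<subseteq> mset_span S'"
  unfolding mset_span_def by (rule endo.span_mono) blast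

lemma mset_span_subspace: "endo_subspace (mset_span S)"
  unfolding mset_span_def by (rule endo.subspace_span)

lemma mset_span_base:
  "la \<in> S \<Longrightarrow> c \<in> latw n la \<Longrightarrow> c' \<in> latw n la \<Longrightarrow> mbase la c c' \<in> mset_span S"
  unfolding mset_span_def by (rule endo.span_base) blast

text \<open>Induction from the largest partitions downwards in the dominance order. The Young sum is
  straightened from the left, and from the right by applying \<open>star\<close>; both error terms
  lie in the ideal of larger partitions, already settled.\<close>

lemma gen_mset_span:
  "la \<in> Par n \<Longrightarrow> h \<in> H \<Longrightarrow> h' \<in> H \<Longrightarrow> h * Y (row la) * h' \<in> mset_span (insert la (above n la))"
proof (induction "card (above n la)" arbitrary: la h h' rule: less_induct)
  case less
  interpret straighten n q la by (rule straightenI[OF less.prems(1)])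
  have fin: "finite (above n la)" using finite_Par by (rule finite_subset[rotated]) (auto simp: above_def)
  have up: "yideal (above n la) \<subseteq> mset_span (above n la)"
    unfolding yideal_def
  proof (rule endo.span_minimal[OF _ mset_span_subspace], clarify)
    fix g mu g' assume g: "g \<in> H" "g' \<in> H" and mu: "mu \<in> above n la"
    have "mu \<notin> above n mu" by (simp add: above_def)
    then have "above n mu \<subset> above n la" using above_subset[OF mu less.prems(1)] mu by blast
    then have "card (above n mu) < card (above n la)" using fin by (rule psubset_card_mono[rotated])
    moreover have "mu \<in> Par n" using mu by (simp add: above_def)
    ultimately have "g * Y (row mu) * g' \<in> mset_span (insert mu (above n mu))"
      using less.hyps g by blast
    then show "g * Y (row mu) * g' \<in> mset_span (above n la)"
      using mset_span_mono[OF above_subset[OF mu less.prems(1)]] by blast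
  qed
  obtain a z where z: "z \<in> yideal (above n la)"
    and a: "h * Y (row la) = (\<Sum>d\<in>Lat. smul (a d) (lift d * Y (row la))) + z"
    using straightening[OF less.prems(2)] by blast
  obtain b z' where z': "z' \<in> yideal (above n la)"
    and b: "star h' * Y (row la) = (\<Sum>d\<in>Lat. smul (b d) (lift d * Y (row la))) + z'"
    using straightening[OF star_Hk[OF less.prems(3)]] by blast
  have liftH: "lift d \<in> H" if "d \<in> Lat" for d using that by (rule lift_Hk[OF less.prems(1)])
  have "Y (row la) * h' = star (star h' * Y (row la))"
    using less.prems(3) by (simp add: star_mult star_Hk Y_Hk star_Y star_star)
  also have "\<dots> = (\<Sum>e\<in>Lat. smul (b e) (Y (row la) * star (lift e))) + star z'"
    unfolding b using liftH yideal_Hk[OF z']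
    by (simp add: star_add star_sum star_smul star_mult star_Y Hk_sum Hk_smul Hk_mult Y_Hk)
  finally have Yh: "Y (row la) * h' = (\<Sum>e\<in>Lat. smul (b e) (Y (row la) * star (lift e))) + star z'" .
  have "h * Y (row la) * h' = (\<Sum>d\<in>Lat. smul (a d) (lift d * (Y (row la) * h'))) + z * h'"
    unfolding a by (simp add: distrib_right sum_distrib_right mult.assoc)
  also have "\<dots> = (\<Sum>d\<in>Lat. smul (a d) ((\<Sum>e\<in>Lat. smul (b e) (mbase la d e)) + lift d * star z')) + z * h'"
    unfolding Yh mbase_def by (simp add: distrib_left sum_distrib_left mult.assoc)
  also have "\<dots> \<in> mset_span (insert la (above n la))"
  proof (intro endo.subspace_add[OF mset_span_subspace] endo.subspace_sum[OF mset_span_subspace]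
      endo.subspace_scale[OF mset_span_subspace])
    have sub: "yideal (above n la) \<subseteq> mset_span (insert la (above n la))"
      using up mset_span_mono[of "above n la" "insert la (above n la)"] by blast
    show "mbase la d e \<in> mset_span (insert la (above n la))" if "d \<in> Lat" "e \<in> Lat" for d e
      using that by (intro mset_span_base) auto
    show "lift d * star z' \<in> mset_span (insert la (above n la))" if "d \<in> Lat" for d
      using yideal_left[OF liftH[OF that] star_yideal[OF z']] sub by blast
    show "z * h' \<in> mset_span (insert la (above n la))"
      using yideal_right[OF less.prems(3) z] sub by blast
  qed
  finally show ?case .
qed

definition upclosed :: "nat list set \<Rightarrow> bool" where
  "upclosed S \<longleftrightarrow> S \<subseteq> Par n \<and> (\<forall>la\<in>S. above n la \<subseteq> S)"

lemma yideal_mset_span: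
  assumes S: "upclosed S"
  shows "yideal S = mset_span S"
proof
  show "yideal S \<subseteq> mset_span S"
    unfolding yideal_def
  proof (rule endo.span_minimal[OF _ mset_span_subspace], clarify)
    fix h h' la assume "h \<in> H" "h' \<in> H" "la \<in> S"
    then have "h * Y (row la) * h' \<in> mset_span (insert la (above n la))" "insert la (above n la) \<subseteq> S"
      using gen_mset_span S by (auto simp: upclosed_def)
    then show "h * Y (row la) * h' \<in> mset_span S" using mset_span_mono by blast
  qed
  show "mset_span S \<subseteq> yideal S"
    unfolding mset_span_def
    by (rule endo.span_minimal[OF _ yideal_subspace])
      (use S mbase_yideal in \<open>auto simp: upclosed_def\<close>)
qed

text \<open>For the partition with all parts 1 the Young subgroup is trivial and the Young sum is
  1.\<close>

lemma yideal_Par: "yideal (Par n) = H"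
proof -
  let ?l = "replicate n 1"
  have l: "?l \<in> Par n" by (auto simp: Par_def sum_list_replicate sorted_wrt_iff_nth_less)
  have inj: "row ?l r = r - 1" if "r \<in> {1..n}" for r
  proof -
    have ps: "(\<Sum>j<k. part ?l j) = k" if "k \<le> n" for k
      using that by (simp add: part_def)
    have e1: "(\<Sum>j<r - 1. part ?l j) = r - 1" by (rule ps) (use that in auto)
    have r: "Suc (r - 1) = r" using that by simp
    have "(\<Sum>j<Suc (r - 1). part ?l j) = Suc (r - 1)" by (rule ps) (use that in auto)
    then have "(\<Sum>j\<le>r - 1. part ?l j) = Suc (r - 1)" unfolding lessThan_Suc_atMost .
    then have e2: "(\<Sum>j\<le>r - 1. part ?l j) = r" unfolding r .
    show ?thesis
      using row_eq_iff[of r ?l "r - 1"] that unfolding e1 e2 by (simp add: sum_list_replicate)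
  qed
  have "stab n (row ?l) = {id}"
  proof (intro equalityI subsetI)
    fix u assume "u \<in> stab n (row ?l)"
    then have u: "u permutes {1..n}" "\<And>r. row ?l (u r) = row ?l r" by (auto simp: stab_def fun_eq_iff)
    have "u r = r" for r
    proof (cases "r \<in> {1..n}")
      case True
      then have "u r \<in> {1..n}" using permutes_in_image[OF u(1)] by blast
      then have "u r - 1 = r - 1" using inj[OF True] inj[of "u r"] u(2)[of r] by simp
      moreover have "1 \<le> u r" "1 \<le> r" using \<open>u r \<in> {1..n}\<close> True by auto
      ultimately show ?thesis by linarith
    qed (rule permutes_not_in[OF u(1)])
    then show "u \<in> {id}" by auto
  qed (simp add: stab_def permutes_id)
  moreover have "W id = 1"
    using reduced_word(3)[OF permutes_id[of "{1..n}"]] by (simp add: Tw_def)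
  ultimately have "Y (row ?l) = 1" by (simp add: ys_def)
  then have "1 * 1 * h \<in> yideal (Par n)" if "h \<in> H" for h
    using yideal_gen[OF l Hk_one that] by simp
  then show ?thesis using yideal_Hk by auto
qed

definition mindex :: "(nat list \<times> (nat \<Rightarrow> nat) \<times> (nat \<Rightarrow> nat)) set" where
  "mindex = (SIGMA la:Par n. latw n la \<times> latw n la)"

lemma finite_mindex: "finite mindex"
  unfolding mindex_def using finite_Par finite_lwords by (auto simp: latw_lwords)

text \<open>One family of functionals describes the ideals of all upward closed S at once: each
  ideal is a coordinate subspace for Murphy's basis.\<close>

lemma murphy_dual:
  "\<exists>dual. (\<forall>k\<in>mindex. dual k \<in> H) \<and> (\<forall>S. upclosed S \<longrightarrow>
    yideal S = {y \<in> H. \<forall>k\<in>mindex. fst k \<notin> S \<longrightarrow> tr (dual k * y) = 0})"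
proof -
  define m where "m = (\<lambda>(la, c, c'). mbase la c c')"
  have mspan: "mset_span S = endo_span (m ` {k \<in> mindex. fst k \<in> S})" if "S \<subseteq> Par n" for S
    unfolding mset_span_def
    by (rule arg_cong[of _ _ endo_span]) (use that in \<open>force simp: m_def mindex_def\<close>)
  have upP: "upclosed (Par n)" by (auto simp: upclosed_def above_def)
  have all: "{k \<in> mindex. fst k \<in> Par n} = mindex" by (auto simp: mindex_def)
  have H: "H = range (\<lambda>a. \<Sum>k\<in>mindex. smul (a k) (m k))"
    using yideal_mset_span[OF upP] yideal_Par mspan[of "Par n"] all smul_family_span[OF finite_mindex, of m] by simp
  have mH: "m k \<in> H" if "k \<in> mindex" for k
    using that by (auto simp: m_def mindex_def intro!: yideal_Hk[OF mbase_yideal[of _ "Par n"]])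
  obtain dual where dual: "\<And>k. k \<in> mindex \<Longrightarrow> dual k \<in> H"
    "\<And>j k. j \<in> mindex \<Longrightarrow> k \<in> mindex \<Longrightarrow> tr (dual k * m j) = (if j = k then 1 else 0)"
  proof -
    have sp: "\<exists>a. h = (\<Sum>k\<in>mindex. smul (a k) (m k))" if "h \<in> H" for h using that H by blast
    from spanning_dual[OF finite_mindex card_latw_pairs[of n, folded mindex_def], of m, OF mH sp]
    show thesis using that by blast
  qed
  have coeff: "tr (dual k * (\<Sum>j\<in>J. smul (a j) (m j))) = (if k \<in> J then a k else 0)"
    if "k \<in> mindex" "J \<subseteq> mindex" for k a J
  proof -
    have J: "finite J" using that(2) finite_mindex finite_subset by blast
    have "tr (dual k * (\<Sum>j\<in>J. smul (a j) (m j))) = (\<Sum>j\<in>J. a j * tr (dual k * m j))"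
      by (simp add: sum_distrib_left tr_sum tr_smul)
    also have "\<dots> = (\<Sum>j\<in>J. if j = k then a j else 0)"
    proof (rule sum.cong)
      fix j assume "j \<in> J"
      then have "tr (dual k * m j) = (if j = k then 1 else 0)"
        by (intro dual(2)) (use that in auto)
      then show "a j * tr (dual k * m j) = (if j = k then a j else 0)" by simp
    qed simp
    finally show ?thesis using J by simp
  qed
  have "yideal S = {y \<in> H. \<forall>k\<in>mindex. fst k \<notin> S \<longrightarrow> tr (dual k * y) = 0}" if S: "upclosed S" for S
  proof -
    let ?J = "{k \<in> mindex. fst k \<in> S}"
    have "yideal S = range (\<lambda>a. \<Sum>k\<in>?J. smul (a k) (m k))"
      using yideal_mset_span[OF S] mspan[of S] S smul_family_span[of ?J m] finite_mindex
      by (simp add: upclosed_def)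
    also have "\<dots> = {y \<in> H. \<forall>k\<in>mindex. fst k \<notin> S \<longrightarrow> tr (dual k * y) = 0}"
    proof (intro equalityI subsetI)
      fix y assume "y \<in> range (\<lambda>a. \<Sum>k\<in>?J. smul (a k) (m k))"
      then obtain a where y: "y = (\<Sum>k\<in>?J. smul (a k) (m k))" by blast
      then show "y \<in> {y \<in> H. \<forall>k\<in>mindex. fst k \<notin> S \<longrightarrow> tr (dual k * y) = 0}"
        using mH coeff[of _ ?J a] by (auto intro!: Hk_sum Hk_smul)
    next
      fix y assume y: "y \<in> {y \<in> H. \<forall>k\<in>mindex. fst k \<notin> S \<longrightarrow> tr (dual k * y) = 0}"
      then obtain a where a: "y = (\<Sum>k\<in>mindex. smul (a k) (m k))" using H by blast
      have "a k = 0" if "k \<in> mindex" "fst k \<notin> S" for k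
        using coeff[of k mindex a] y that a by auto
      then have "y = (\<Sum>k\<in>?J. smul (a k) (m k))"
        unfolding a by (intro sum.mono_neutral_right) (auto simp: finite_mindex)
      then show "y \<in> range (\<lambda>a. \<Sum>k\<in>?J. smul (a k) (m k))" by blast
    qed
    finally show ?thesis .
  qed
  then show ?thesis using dual(1) by blast
qed

text \<open>For ideals given by generators only one inclusion is formal. Here both are coordinate
  subspaces for a common basis.\<close>

lemma yideal_Int:
  assumes "upclosed S" "upclosed S'"
  shows "yideal S \<inter> yideal S' = yideal (S \<inter> S')"
proof -
  have "upclosed (S \<inter> S')" using assms by (auto simp: upclosed_def)
  moreover obtain dual where "\<And>S. upclosed S \<Longrightarrow>
      yideal S = {y \<in> H. \<forall>k\<in>mindex. fst k \<notin> S \<longrightarrow> tr (dual k * y) = 0}"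
    using murphy_dual by blast
  ultimately show ?thesis using assms by auto
qed

end

section \<open>Cell ideals\<close>

text \<open>
  The family \<open>D\<close> is dual to the cell basis with respect to the trace form, and \<open>kill\<close> says that the
  cell modules are dual to Murphy's cell modules.
\<close>

locale hecke_cells = hecke_unit n q for n :: nat and q :: "'r::comm_ring_1" +
  fixes N :: "nat list \<Rightarrow> 'i set" and C :: "nat list \<Rightarrow> 'i \<Rightarrow> 'i \<Rightarrow> 'r endo" and sta :: "'r endo \<Rightarrow> 'r endo"
    and D :: "nat list \<Rightarrow> 'i \<Rightarrow> 'i \<Rightarrow> 'r endo" and A :: "nat list set \<Rightarrow> 'r endo set"
  defines "A \<tau> \<equiv> endo_span {C l u v | l u v. l \<in> \<tau> \<and> u \<in> N l \<and> v \<in> N l}"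
  assumes fin_N: "l \<in> Par n \<Longrightarrow> finite (N l)"
    and span: "A (Par n) = H"
    and D_Hk: "l \<in> Par n \<Longrightarrow> u \<in> N l \<Longrightarrow> v \<in> N l \<Longrightarrow> D l u v \<in> H"
    and C_D: "\<lbrakk>l \<in> Par n; u \<in> N l; v \<in> N l; l' \<in> Par n; u' \<in> N l'; v' \<in> N l'\<rbrakk>
      \<Longrightarrow> tr (C l' u' v' * D l u v) = (if l = l' \<and> u = u' \<and> v = v' then 1 else 0)"
    and sta_Hk: "a \<in> H \<Longrightarrow> sta a \<in> H"
    and sta_add: "a \<in> H \<Longrightarrow> b \<in> H \<Longrightarrow> sta (a + b) = sta a + sta b"
    and sta_smul: "a \<in> H \<Longrightarrow> sta (smul r a) = smul r (sta a)"
    and sta_mult: "a \<in> H \<Longrightarrow> b \<in> H \<Longrightarrow> sta (a * b) = sta b * sta a"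
    and sta_sta: "a \<in> H \<Longrightarrow> sta (sta a) = a"
    and sta_C: "l \<in> Par n \<Longrightarrow> u \<in> N l \<Longrightarrow> v \<in> N l \<Longrightarrow> sta (C l u v) = C l v u"
    and cell: "a \<in> H \<Longrightarrow> l \<in> Par n \<Longrightarrow> \<exists>r. \<forall>u\<in>N l. \<forall>v\<in>N l.
      a * C l u v - (\<Sum>u'\<in>N l. smul (r u' u) (C l u' v)) \<in> A {m \<in> Par n. dominated_by m l \<and> m \<noteq> l}"
    and kill: "\<lbrakk>a \<in> H; l \<in> Par n; \<And>y. y \<in> yideal (insert l (above n l)) \<Longrightarrow> star a * y \<in> yideal (above n l);
      u \<in> N l; v \<in> N l\<rbrakk> \<Longrightarrow> a * C l u v \<in> A {m \<in> Par n. dominated_by m l \<and> m \<noteq> l}"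
    and pos: "x \<in> H \<Longrightarrow> x * star x = 0 \<Longrightarrow> x = 0"
begin

abbreviation below :: "nat list \<Rightarrow> nat list set" where
  "below l \<equiv> {m \<in> Par n. dominated_by m l \<and> m \<noteq> l}"

lemma A_base: "l \<in> \<tau> \<Longrightarrow> u \<in> N l \<Longrightarrow> v \<in> N l \<Longrightarrow> C l u v \<in> A \<tau>"
  unfolding A_def by (rule endo.span_base) blast

lemma A_subspace: "endo_subspace (A \<tau>)"
  unfolding A_def by (rule endo.subspace_span)

lemma A_least:
  "endo_subspace Z \<Longrightarrow> (\<And>l u v. l \<in> \<tau> \<Longrightarrow> u \<in> N l \<Longrightarrow> v \<in> N l \<Longrightarrow> C l u v \<in> Z) \<Longrightarrow> x \<in> A \<tau> \<Longrightarrow> x \<in> Z"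
proof -
  assume "endo_subspace Z" "\<And>l u v. l \<in> \<tau> \<Longrightarrow> u \<in> N l \<Longrightarrow> v \<in> N l \<Longrightarrow> C l u v \<in> Z"
  then have "A \<tau> \<subseteq> Z" unfolding A_def by (intro endo.span_minimal) auto
  then show "x \<in> A \<tau> \<Longrightarrow> x \<in> Z" by blast
qed

lemma A_mono: "\<tau> \<subseteq> \<tau>' \<Longrightarrow> A \<tau> \<subseteq> A \<tau>'"
  unfolding A_def by (rule endo.span_mono) blast

lemma A_Hk: "\<tau> \<subseteq> Par n \<Longrightarrow> x \<in> A \<tau> \<Longrightarrow> x \<in> H"
  using A_mono span by blast

lemma C_Hk: "l \<in> Par n \<Longrightarrow> u \<in> N l \<Longrightarrow> v \<in> N l \<Longrightarrow> C l u v \<in> H"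
  using A_base span by blast

lemma subspace_left_mult: "endo_subspace Z \<Longrightarrow> endo_subspace {x. a * x \<in> Z}"
  unfolding endo.subspace_def by (simp add: distrib_left)

definition downclosed :: "nat list set \<Rightarrow> bool" where
  "downclosed \<tau> \<longleftrightarrow> \<tau> \<subseteq> Par n \<and> (\<forall>l\<in>\<tau>. below l \<subseteq> \<tau>)"

lemma A_left:
  assumes \<tau>: "downclosed \<tau>" and a: "a \<in> H" and x: "x \<in> A \<tau>"
  shows "a * x \<in> A \<tau>"
proof -
  have "x \<in> {x. a * x \<in> A \<tau>}"
  proof (rule A_least[OF subspace_left_mult[OF A_subspace] _ x], clarify)
    fix l u v assume l: "l \<in> \<tau>" "u \<in> N l" "v \<in> N l"
    then have lP: "l \<in> Par n" and b: "below l \<subseteq> \<tau>" using \<tau> by (auto simp: downclosed_def)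
    obtain r where "a * C l u v - (\<Sum>u'\<in>N l. smul (r u' u) (C l u' v)) \<in> A (below l)"
      using cell[OF a lP] l by blast
    then have "a * C l u v - (\<Sum>u'\<in>N l. smul (r u' u) (C l u' v)) \<in> A \<tau>"
      using A_mono[OF b] by blast
    moreover have "(\<Sum>u'\<in>N l. smul (r u' u) (C l u' v)) \<in> A \<tau>"
      using l by (intro endo.subspace_sum[OF A_subspace] endo.subspace_scale[OF A_subspace] A_base)
    ultimately have "a * C l u v - (\<Sum>u'\<in>N l. smul (r u' u) (C l u' v))
        + (\<Sum>u'\<in>N l. smul (r u' u) (C l u' v)) \<in> A \<tau>"
      by (rule endo.subspace_add[OF A_subspace])
    then show "a * C l u v \<in> A \<tau>" by simp
  qed
  then show ?thesis by simp
qed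

lemma sta_zero: "sta 0 = 0"
  using sta_smul[OF Hk_zero, of 0] by simp

lemma A_sta:
  assumes \<tau>: "\<tau> \<subseteq> Par n" and x: "x \<in> A \<tau>"
  shows "sta x \<in> A \<tau>"
proof -
  have "endo_subspace {x \<in> H. sta x \<in> A \<tau>}"
    unfolding endo.subspace_def
    using endo.subspace_0[OF A_subspace] endo.subspace_add[OF A_subspace] endo.subspace_scale[OF A_subspace]
    by (simp add: sta_zero Hk_zero sta_add Hk_add sta_smul Hk_smul)
  then have "x \<in> {x \<in> H. sta x \<in> A \<tau>}"
  proof (rule A_least[OF _ _ x], clarify)
    fix l u v assume l: "l \<in> \<tau>" "u \<in> N l" "v \<in> N l"
    then have "l \<in> Par n" using \<tau> by blast
    then show "C l u v \<in> H \<and> sta (C l u v) \<in> A \<tau>"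
      using l by (simp add: C_Hk sta_C A_base)
  qed
  then show ?thesis by simp
qed

text \<open>The cell axiom speaks of left multiplication only. The other side is reached through the
  involution of the datum, not through \<open>star\<close>.\<close>

lemma A_right:
  assumes \<tau>: "downclosed \<tau>" and a: "a \<in> H" and x: "x \<in> A \<tau>"
  shows "x * a \<in> A \<tau>"
proof -
  have P: "\<tau> \<subseteq> Par n" using \<tau> by (simp add: downclosed_def)
  have "sta (sta a * sta x) \<in> A \<tau>"
    by (intro A_sta[OF P] A_left[OF \<tau>] sta_Hk a x)
  then show ?thesis using a A_Hk[OF P x] by (simp add: sta_mult sta_Hk sta_sta)
qed

text \<open>An element that lowers the layers of the cell filtration is nilpotent modulo the others.\<close>

lemma layers_nilpotent:
  assumes a: "a \<in> H" and L: "downclosed L" and Z: "endo_subspace Z" and aZ: "\<And>z. z \<in> Z \<Longrightarrow> a * z \<in> Z"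
    and layer: "\<And>l. l \<in> L \<Longrightarrow> (\<forall>u\<in>N l. \<forall>v\<in>N l. a * C l u v \<in> A (below l)) \<or> (\<forall>u\<in>N l. \<forall>v\<in>N l. C l u v \<in> Z)"
  shows "\<exists>m. \<forall>x\<in>A L. a ^ m * x \<in> Z"
proof -
  have up: "a ^ m * z \<in> Z" if "z \<in> Z" for m z
    using that by (induction m) (simp_all add: aZ mult.assoc)
  have unif: "\<exists>m. \<forall>x\<in>A \<tau>. a ^ m * x \<in> Z"
    if \<tau>: "finite \<tau>" "\<And>l. l \<in> \<tau> \<Longrightarrow> \<exists>m. \<forall>u\<in>N l. \<forall>v\<in>N l. a ^ m * C l u v \<in> Z" for \<tau>
  proof -
    obtain m where m: "\<And>l u v. l \<in> \<tau> \<Longrightarrow> u \<in> N l \<Longrightarrow> v \<in> N l \<Longrightarrow> a ^ m l * C l u v \<in> Z"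
      using \<tau>(2) by metis
    \<comment> \<open>A common exponent for finitely many layers; the surplus powers do no harm
      because Z is stable under a.\<close>
    let ?M = "\<Sum>l\<in>\<tau>. m l"
    have "a ^ ?M * x \<in> Z" if x: "x \<in> A \<tau>" for x
    proof -
      have "x \<in> {x. a ^ ?M * x \<in> Z}"
      proof (rule A_least[OF subspace_left_mult[OF Z] _ x], clarify)
        fix l u v assume l: "l \<in> \<tau>" "u \<in> N l" "v \<in> N l"
        have "?M = (?M - m l) + m l" using member_le_sum[OF l(1), of m] \<tau>(1) by simp
        then have "a ^ ?M * C l u v = a ^ (?M - m l) * (a ^ m l * C l u v)"
          by (metis power_add mult.assoc)
        then show "a ^ ?M * C l u v \<in> Z" using up[OF m[OF l]] by simp
      qed
      then show ?thesis by simp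
    qed
    then show ?thesis by blast
  qed
  have finb: "finite (below l)" for l using finite_Par[of n] by simp
  have "l \<in> L \<Longrightarrow> \<exists>m. \<forall>u\<in>N l. \<forall>v\<in>N l. a ^ m * C l u v \<in> Z" for l
  proof (induction "card (below l)" arbitrary: l rule: less_induct)
    case less
    have lP: "l \<in> Par n" and bL: "below l \<subseteq> L" using L less.prems by (auto simp: downclosed_def)
    from layer[OF less.prems] show ?case
    proof
      assume "\<forall>u\<in>N l. \<forall>v\<in>N l. C l u v \<in> Z"
      then show ?thesis by (intro exI[of _ 0]) simp
    next
      assume low: "\<forall>u\<in>N l. \<forall>v\<in>N l. a * C l u v \<in> A (below l)"
      have "\<exists>m. \<forall>x\<in>A (below l). a ^ m * x \<in> Z"
      proof (rule unif[OF finb])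
        fix k assume k: "k \<in> below l"
        have "below k \<subseteq> below l"
          using k lP dominated_by_trans dominated_by_antisym by blast
        moreover have "k \<notin> below k" by simp
        ultimately have "below k \<subset> below l" using k by blast
        then have "card (below k) < card (below l)" using finb by (rule psubset_card_mono[rotated])
        then show "\<exists>m. \<forall>u\<in>N k. \<forall>v\<in>N k. a ^ m * C k u v \<in> Z"
          using less.hyps k bL by blast
      qed
      then obtain m where m: "\<And>x. x \<in> A (below l) \<Longrightarrow> a ^ m * x \<in> Z" by blast
      have "a ^ Suc m * C l u v \<in> Z" if "u \<in> N l" "v \<in> N l" for u v
        using m[of "a * C l u v"] low that by (simp add: power_Suc2 mult.assoc del: power_Suc)
      then show ?thesis by blast
    qed
  qed
  moreover have "finite L" using L finite_Par finite_subset by (auto simp: downclosed_def)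
  ultimately show ?thesis by (intro unif)
qed

lemma Hk_power: "a \<in> H \<Longrightarrow> a ^ m \<in> H"
  by (induction m) (auto intro: Hk_one Hk_mult)

lemma selfadjoint_nilpotent:
  assumes d: "d \<in> H" "star d = d"
  shows "d ^ m = 0 \<Longrightarrow> d = 0"
proof (induction m rule: less_induct)
  case (less m)
  have st: "star (d ^ k) = d ^ k" for k
    by (induction k) (simp_all add: star_mult d Hk_power power_commutes)
  consider "m = 0" | "m = 1" | "2 \<le> m" by linarith
  then show ?case
  proof cases
    case 1
    then have "(1::'r endo) = 0" using less.prems by simp
    then show ?thesis by (metis mult_1 mult_zero_left)
  next
    case 3
    \<comment> \<open>Half the exponent, rounded up: the square of this power contains d to the m
      and vanishes, so positivity kills the power itself. The exponent drops once m is at least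
      2.\<close>
    let ?k = "(m + 1) div 2"
    have "?k + ?k = m + (?k + ?k - m)" by simp
    then have "d ^ ?k * d ^ ?k = d ^ m * d ^ (?k + ?k - m)" by (metis power_add)
    then have "d ^ ?k * star (d ^ ?k) = 0" using less.prems st by simp
    then have "d ^ ?k = 0" by (rule pos[OF Hk_power[OF d(1)]])
    moreover have "?k < m" using 3 by simp
    ultimately show ?thesis using less.IH by blast
  qed (use less.prems in simp)
qed

section \<open>The annihilators of the ideal attached to an upward closed set\<close>

context
  fixes S :: "nat list set"
  assumes S: "upclosed S"
begin

abbreviation "I \<equiv> yideal S"
abbreviation "\<tau> \<equiv> Par n - S"

lemma \<tau>_downclosed: "downclosed \<tau>"
  unfolding downclosed_def
proof (intro conjI ballI subsetI)
  fix l m assume "l \<in> \<tau>" "m \<in> below l"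
  then have "l \<in> above n m" "m \<in> Par n" "l \<notin> S" by (auto simp: above_def)
  then show "m \<in> \<tau>" using S by (auto simp: upclosed_def)
qed simp

lemma A_H: "x \<in> A \<tau> \<Longrightarrow> x \<in> H"
  by (rule A_Hk) auto

text \<open>The element c \<open>star\<close> c lies in I, so it moves the ideal of the partitions
  at or above l into its intersection with I. By \<open>yideal_Int\<close> this is generated by
  shapes in S, and l itself is not in S; hence \<open>kill\<close> applies to every layer of the
  cell ideal.\<close>

lemma A_Int_yideal:
  assumes c: "c \<in> A \<tau>" "c \<in> I"
  shows "c = 0"
proof -
  have cH: "c \<in> H" using c(2) by (rule yideal_Hk)
  let ?d = "c * star c"
  have d: "?d \<in> H" "star ?d = ?d" "?d \<in> I" "?d \<in> A \<tau>"
    using cH c by (simp_all add: Hk_mult star_Hk star_mult star_star yideal_right A_right[OF \<tau>_downclosed])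
  have kl: "?d * C l u v \<in> A (below l)" if l: "l \<in> \<tau>" "u \<in> N l" "v \<in> N l" for l u v
  proof (rule kill[OF d(1)])
    fix y assume y: "y \<in> yideal (insert l (above n l))"
    have "upclosed (insert l (above n l))"
      using above_subset l by (auto simp: upclosed_def above_def)
    then have int: "I \<inter> yideal (insert l (above n l)) = yideal (S \<inter> insert l (above n l))"
      by (rule yideal_Int[OF S])
    have "star ?d * y \<in> I \<inter> yideal (insert l (above n l))"
      unfolding d(2) using d y by (auto intro: yideal_left yideal_right yideal_Hk)
    then have "star ?d * y \<in> yideal (S \<inter> insert l (above n l))" unfolding int .
    moreover have "S \<inter> insert l (above n l) \<subseteq> above n l" using l by blast
    ultimately show "star ?d * y \<in> yideal (above n l)" using yideal_mono by blast
  qed (use l in auto)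
  have "\<exists>m. \<forall>x\<in>A \<tau>. ?d ^ m * x \<in> {0}"
    by (rule layers_nilpotent[OF d(1) \<tau>_downclosed]) (use kl in \<open>auto simp: endo.subspace_def\<close>)
  then obtain m where "?d ^ m * ?d = 0" using d(4) by blast
  then have "?d ^ Suc m = 0" by (simp add: power_commutes)
  then have "?d = 0" by (rule selfadjoint_nilpotent[OF d(1,2)])
  then show "c = 0" by (rule pos[OF cH])
qed

lemma A_mult_yideal: "c \<in> A \<tau> \<Longrightarrow> i \<in> I \<Longrightarrow> c * i = 0"
  by (intro A_Int_yideal A_right[OF \<tau>_downclosed] yideal_left) (auto intro: yideal_Hk A_H)

text \<open>
  The elements of \<open>B\<close> lower the layers with index in \<open>S\<close>, and those of \<open>D'\<close> are killed by the other
  layers. Hence a self-adjoint element of both is nilpotent.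
\<close>

definition "B = {b \<in> H. \<forall>i\<in>I. b * i = 0}"
definition "D' = {d \<in> H. \<forall>c\<in>A \<tau>. c * d = 0}"

text \<open>Positivity turns left annihilators of I into right annihilators: i b times its star
  starts with i and continues with b times an element of I, which is 0.\<close>

lemma yideal_mult_B:
  assumes "b \<in> B" "i \<in> I"
  shows "i * b = 0"
proof (rule pos)
  have bH: "b \<in> H" and iH: "i \<in> H" using assms yideal_Hk by (auto simp: B_def)
  then show "i * b \<in> H" by (intro Hk_mult)
  have "star (i * b) \<in> I" using assms bH by (intro star_yideal yideal_right)
  then have "b * star (i * b) = 0" using assms(1) by (simp add: B_def)
  then show "i * b * star (i * b) = 0" by (simp add: mult.assoc)
qed

text \<open>The adjoint of b kills all of I, so the hypothesis of \<open>kill\<close> holds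
  trivially at each index in S.\<close>

lemma B_lowers:
  assumes b: "b \<in> B" and l: "l \<in> S" "u \<in> N l" "v \<in> N l"
  shows "b * C l u v \<in> A (below l)"
proof (rule kill)
  show bH: "b \<in> H" using b by (simp add: B_def)
  show "l \<in> Par n" using l(1) S by (auto simp: upclosed_def)
  fix y assume "y \<in> yideal (insert l (above n l))"
  moreover have "insert l (above n l) \<subseteq> S" using S l(1) by (auto simp: upclosed_def)
  ultimately have y: "y \<in> I" using yideal_mono by blast
  have "star y * b = 0" using b y by (intro yideal_mult_B star_yideal)
  then have "star (star y * b) = 0" by simp
  then have "star b * y = 0" using bH yideal_Hk[OF y] by (simp add: star_mult star_Hk star_star)
  then show "star b * y \<in> yideal (above n l)" by (simp add: yideal_zero)
qed (use l in auto)

lemma B_Int_D':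
  assumes x: "x \<in> B" "x \<in> D'"
  shows "x = 0"
proof -
  have xH: "x \<in> H" using x by (simp add: B_def)
  let ?e = "star x * x"
  have e: "?e \<in> H" "star ?e = ?e" using xH by (simp_all add: Hk_mult star_Hk star_mult star_star)
  have eB: "?e \<in> B" using e(1) x(1) by (auto simp: B_def mult.assoc)
  have eD: "c * ?e = 0" if "c \<in> A \<tau>" for c
    using A_right[OF \<tau>_downclosed star_Hk[OF xH] that] x(2) by (simp add: D'_def mult.assoc[symmetric])
  \<comment> \<open>The subspace Z is now the cell ideal itself: layers with index in S are lowered
    and the others already lie in it. Applied to 1, this puts a power of the self-adjoint element
    into the cell ideal, which annihilates that element.\<close>
  have "\<exists>m. \<forall>x\<in>A (Par n). ?e ^ m * x \<in> A \<tau>"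
  proof (rule layers_nilpotent[OF e(1) _ A_subspace])
    show "downclosed (Par n)" by (auto simp: downclosed_def)
    show "(\<forall>u\<in>N l. \<forall>v\<in>N l. ?e * C l u v \<in> A (below l)) \<or> (\<forall>u\<in>N l. \<forall>v\<in>N l. C l u v \<in> A \<tau>)"
      if "l \<in> Par n" for l
      using B_lowers[OF eB, of l] A_base[of l \<tau>] that by blast
  qed (rule A_left[OF \<tau>_downclosed e(1)])
  then obtain m where "?e ^ m * 1 \<in> A \<tau>" using span Hk_one by blast
  then have "?e ^ m * ?e = 0" using eD by simp
  then have "?e ^ Suc m = 0" by (simp add: power_commutes)
  then have "?e = 0" by (rule selfadjoint_nilpotent[OF e])
  then have "star x = 0" using pos[OF star_Hk[OF xH]] xH by (simp add: star_star)
  then have "star (star x) = 0" by simp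
  then show "x = 0" using xH by (simp add: star_star)
qed

lemma B_mult_D':
  assumes b: "b \<in> B" and d: "d \<in> D'"
  shows "b * d = 0"
proof (rule B_Int_D')
  have H: "b \<in> H" "d \<in> H" using b d by (auto simp: B_def D'_def)
  show "b * d \<in> B" using b H by (auto simp: B_def mult.assoc Hk_mult yideal_left)
  show "b * d \<in> D'" using d H A_right[OF \<tau>_downclosed H(1)] by (auto simp: D'_def mult.assoc[symmetric] Hk_mult)
qed

text \<open>I is cut out by the functionals tr(dual k y) with k outside S. By nondegeneracy these
  elements annihilate I from the left, so they belong to \<open>B\<close> and their products with
  \<open>D'\<close> vanish.\<close>

lemma D'_yideal:
  assumes d: "d \<in> D'"
  shows "d \<in> I"
proof -
  obtain dual where dual: "\<And>k. k \<in> mindex \<Longrightarrow> dual k \<in> H"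
    "I = {y \<in> H. \<forall>k\<in>mindex. fst k \<notin> S \<longrightarrow> tr (dual k * y) = 0}"
    using murphy_dual S by blast
  have "dual k \<in> B" if k: "k \<in> mindex" "fst k \<notin> S" for k
  proof -
    have "dual k * i = 0" if i: "i \<in> I" for i
    proof (rule tr_nondeg_left)
      show "dual k * i \<in> H" using dual(1)[OF k(1)] i by (intro Hk_mult yideal_Hk[OF i])
      fix h assume "h \<in> H"
      then have "i * h \<in> I" using i by (rule yideal_right)
      then show "tr (dual k * i * h) = 0" using dual(2) k by (simp add: mult.assoc)
    qed
    then show ?thesis using dual(1)[OF k(1)] by (simp add: B_def)
  qed
  then have "tr (dual k * d) = 0" if "k \<in> mindex" "fst k \<notin> S" for k
    using B_mult_D'[OF _ d] that by simp
  moreover have "d \<in> H" using d by (simp add: D'_def)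
  ultimately show ?thesis unfolding dual(2) by simp
qed

text \<open>Orthogonality to a two-sided ideal means being annihilated by it, because the trace form
  is nondegenerate.\<close>

lemma dual_yideal:
  assumes l: "l \<in> S" "u \<in> N l" "v \<in> N l"
  shows "D l u v \<in> I"
proof (rule D'_yideal)
  have lP: "l \<in> Par n" using l(1) S by (auto simp: upclosed_def)
  have DH: "D l u v \<in> H" using D_Hk lP l by blast
  have tr0: "tr (c * D l u v) = 0" if c: "c \<in> A \<tau>" for c
  proof -
    have "endo_subspace {c. tr (c * D l u v) = 0}"
      unfolding endo.subspace_def by (simp add: distrib_right tr_add tr_smul)
    then have "c \<in> {c. tr (c * D l u v) = 0}"
      by (rule A_least[OF _ _ c]) (use l lP C_D in auto)
    then show ?thesis by simp
  qed
  have "c * D l u v = 0" if c: "c \<in> A \<tau>" for c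
  proof (rule tr_nondeg_right)
    show "c * D l u v \<in> H" using A_H[OF c] DH by (rule Hk_mult)
    fix h assume "h \<in> H"
    then show "tr (h * (c * D l u v)) = 0"
      using tr0[OF A_left[OF \<tau>_downclosed _ c]] by (simp add: mult.assoc[symmetric])
  qed
  then show "D l u v \<in> D'" using DH by (simp add: D'_def)
qed

end

end

section \<open>From cosets to operators\<close>

lemma mem_hecke_class: "g \<in> hecke_class n q f \<longleftrightarrow> g - f \<in> hecke_ideal n q"
  unfolding hecke_class_def a_r_coset_def'
  by (auto intro!: bexI[of _ "g - f"] simp: algebra_simps)

text \<open>The relations act by zero, so the choice of the representative does not matter; see
  \<open>ev_class\<close>.\<close>

definition ev :: "'r::comm_ring_1 \<Rightarrow> 'r hecke \<Rightarrow> 'r endo" where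
  "ev q A = act q (SOME f. f \<in> A)"

lemma ev_class [simp]: "ev q (hecke_class n q f) = act q f"
proof -
  have "f \<in> hecke_class n q f" by (simp add: mem_hecke_class hecke_ideal_zero)
  then have "(SOME g. g \<in> hecke_class n q f) \<in> hecke_class n q f" by (rule someI)
  then have "act q ((SOME g. g \<in> hecke_class n q f) - f) = 0"
    by (simp only: mem_hecke_class act_hecke_ideal)
  then show ?thesis by (simp add: ev_def act_diff)
qed

lemma hecke_class_eqI:
  assumes "f \<in> carrier (free_alg n)" "g \<in> carrier (free_alg n)" "act q f = act q g"
  shows "hecke_class n q f = hecke_class n q g"
proof -
  have fg: "f - g \<in> hecke_ideal n q"
    using assms free_alg_diff by (simp add: hecke_ideal_iff act_diff)
  have "h - f \<in> hecke_ideal n q \<longleftrightarrow> h - g \<in> hecke_ideal n q" for h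
    using hecke_ideal_add[OF _ fg, of "h - f"] hecke_ideal_diff[OF _ fg, of "h - g"] by auto
  then show ?thesis by (auto simp: mem_hecke_class)
qed

lemma carrier_Hec: "carrier (Hec n q) = hecke_class n q ` carrier (free_alg n)"
  by (auto simp: Hec_def FactRing_def A_RCOSETS_def' hecke_class_def Let_def)

lemma hecke_class_carrier: "f \<in> carrier (free_alg n) \<Longrightarrow> hecke_class n q f \<in> carrier (Hec n q)"
  by (simp add: carrier_Hec)

lemma Hec_mult_class:
  assumes "f \<in> carrier (free_alg n)" "g \<in> carrier (free_alg n)"
  shows "hecke_class n q f \<otimes>\<^bsub>Hec n q\<^esub> hecke_class n q g = hecke_class n q (f * g)"
  using ideal.rcoset_mult_add[OF ideal_hecke assms, of q]
  by (simp add: Hec_def FactRing_def hecke_class_def Let_def)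

lemma Hec_add_class:
  assumes "f \<in> carrier (free_alg n)" "g \<in> carrier (free_alg n)"
  shows "hecke_class n q f \<oplus>\<^bsub>Hec n q\<^esub> hecke_class n q g = hecke_class n q (f + g)"
proof -
  interpret ideal "hecke_ideal n q" "free_alg n" by (rule ideal_hecke)
  show ?thesis using a_rcos_sum[OF assms] by (simp add: Hec_def FactRing_def hecke_class_def Let_def)
qed

lemma Hec_zero_class: "\<zero>\<^bsub>Hec n q\<^esub> = hecke_class n q 0"
  by (auto simp: Hec_def FactRing_def Let_def mem_hecke_class)

lemma Hec_one_class: "\<one>\<^bsub>Hec n q\<^esub> = hecke_class n q 1"
  by (simp add: Hec_def FactRing_def Let_def hecke_class_def)

lemma Hec_smult_class:
  "f \<in> carrier (free_alg n) \<Longrightarrow> r \<odot>\<^bsub>Hec n q\<^esub> hecke_class n q f = hecke_class n q (free_const r * f)"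
  using Hec_mult_class[OF free_alg_const, of f n q r] by (simp add: Hec_def Let_def)

lemma Hec_E:
  assumes "A \<in> carrier (Hec n q)"
  obtains f where "f \<in> carrier (free_alg n)" "A = hecke_class n q f"
  using assms by (auto simp: carrier_Hec)

lemma ev_Hk: "A \<in> carrier (Hec n q) \<Longrightarrow> ev q A \<in> Hk n q"
  by (auto elim: Hec_E simp: Hk_I)

lemma ev_inj: "A \<in> carrier (Hec n q) \<Longrightarrow> B \<in> carrier (Hec n q) \<Longrightarrow> ev q A = ev q B \<Longrightarrow> A = B"
proof -
  assume "A \<in> carrier (Hec n q)" "B \<in> carrier (Hec n q)" and eq: "ev q A = ev q B"
  then obtain f g where fg: "f \<in> carrier (free_alg n)" "g \<in> carrier (free_alg n)"
    "A = hecke_class n q f" "B = hecke_class n q g"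
    by (metis Hec_E)
  then show "A = B" using hecke_class_eqI[OF fg(1,2)] eq by simp
qed

lemma ev_mult:
  "A \<in> carrier (Hec n q) \<Longrightarrow> B \<in> carrier (Hec n q) \<Longrightarrow> ev q (A \<otimes>\<^bsub>Hec n q\<^esub> B) = ev q A * ev q B"
  by (auto elim!: Hec_E simp: Hec_mult_class act_mult)

lemma ev_add:
  "A \<in> carrier (Hec n q) \<Longrightarrow> B \<in> carrier (Hec n q) \<Longrightarrow> ev q (A \<oplus>\<^bsub>Hec n q\<^esub> B) = ev q A + ev q B"
  by (auto elim!: Hec_E simp: Hec_add_class act_add)

lemma ev_smult: "A \<in> carrier (Hec n q) \<Longrightarrow> ev q (r \<odot>\<^bsub>Hec n q\<^esub> A) = smul r (ev q A)"
  by (auto elim!: Hec_E simp: Hec_smult_class act_mult)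

lemma ev_zero: "ev q \<zero>\<^bsub>Hec n q\<^esub> = 0"
  by (simp add: Hec_zero_class)

lemma ev_one: "ev q \<one>\<^bsub>Hec n q\<^esub> = 1"
  by (simp add: Hec_one_class)

lemma Hec_closed:
  "A \<in> carrier (Hec n q) \<Longrightarrow> B \<in> carrier (Hec n q) \<Longrightarrow> A \<otimes>\<^bsub>Hec n q\<^esub> B \<in> carrier (Hec n q)"
  "A \<in> carrier (Hec n q) \<Longrightarrow> B \<in> carrier (Hec n q) \<Longrightarrow> A \<oplus>\<^bsub>Hec n q\<^esub> B \<in> carrier (Hec n q)"
  "A \<in> carrier (Hec n q) \<Longrightarrow> r \<odot>\<^bsub>Hec n q\<^esub> A \<in> carrier (Hec n q)"
  "\<zero>\<^bsub>Hec n q\<^esub> \<in> carrier (Hec n q)" "\<one>\<^bsub>Hec n q\<^esub> \<in> carrier (Hec n q)"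
  by (auto elim!: Hec_E simp: Hec_mult_class Hec_add_class Hec_smult_class Hec_zero_class Hec_one_class
      intro!: hecke_class_carrier free_alg_mult free_alg_add free_alg_const free_alg_zero free_alg_one)

lemmas ev_simps = ev_mult ev_add ev_smult ev_zero ev_one Hec_closed

text \<open>The axioms are pulled back along \<open>ev\<close>, which is injective and respects all
  operations.\<close>

lemma ring_Hec: "ring (Hec n q)"
proof (rule ringI)
  show "abelian_group (Hec n q)"
  proof (rule abelian_groupI)
    fix A assume A: "A \<in> carrier (Hec n q)"
    have "(- 1) \<odot>\<^bsub>Hec n q\<^esub> A \<oplus>\<^bsub>Hec n q\<^esub> A = \<zero>\<^bsub>Hec n q\<^esub>"
      by (rule ev_inj[of _ n q]) (simp_all add: ev_simps A)
    then show "\<exists>B\<in>carrier (Hec n q). B \<oplus>\<^bsub>Hec n q\<^esub> A = \<zero>\<^bsub>Hec n q\<^esub>"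
      using A Hec_closed(3) by blast
  qed (rule ev_inj[of _ n q]; simp add: ev_simps add_ac | simp add: Hec_closed)+
  show "Group.monoid (Hec n q)"
    by (rule monoidI) (rule ev_inj[of _ n q]; simp add: ev_simps mult.assoc | simp add: Hec_closed)+
qed (rule ev_inj[of _ n q]; simp add: ev_simps algebra_simps)+

lemma ev_minus:
  assumes A: "A \<in> carrier (Hec n q)" and B: "B \<in> carrier (Hec n q)"
  shows "A \<ominus>\<^bsub>Hec n q\<^esub> B \<in> carrier (Hec n q)" "ev q (A \<ominus>\<^bsub>Hec n q\<^esub> B) = ev q A - ev q B"
proof -
  interpret ring "Hec n q" by (rule ring_Hec)
  show c: "A \<ominus>\<^bsub>Hec n q\<^esub> B \<in> carrier (Hec n q)" using A B by simp
  have "(A \<ominus>\<^bsub>Hec n q\<^esub> B) \<oplus>\<^bsub>Hec n q\<^esub> B = A" using A B by algebra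
  then show "ev q (A \<ominus>\<^bsub>Hec n q\<^esub> B) = ev q A - ev q B"
    using ev_add[OF c B] by (simp add: algebra_simps)
qed

lemma ev_finsum:
  assumes "finite F" "\<And>i. i \<in> F \<Longrightarrow> f i \<in> carrier (Hec n q)"
  shows "finsum (Hec n q) f F \<in> carrier (Hec n q)" "ev q (finsum (Hec n q) f F) = (\<Sum>i\<in>F. ev q (f i))"
proof -
  interpret ring "Hec n q" by (rule ring_Hec)
  have "finsum (Hec n q) f F \<in> carrier (Hec n q) \<and> ev q (finsum (Hec n q) f F) = (\<Sum>i\<in>F. ev q (f i))"
    using assms by (induction F rule: finite_induct) (simp_all add: ev_zero ev_add Pi_def)
  then show "finsum (Hec n q) f F \<in> carrier (Hec n q)" "ev q (finsum (Hec n q) f F) = (\<Sum>i\<in>F. ev q (f i))"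
    by blast+
qed

lemma lin_span_carrier: "S \<subseteq> carrier (Hec n q) \<Longrightarrow> lin_span (Hec n q) S \<subseteq> carrier (Hec n q)"
  unfolding lin_span_def by (auto intro!: ev_finsum(1) Hec_closed(3))

lemma ev_lin_span:
  assumes S: "S \<subseteq> carrier (Hec n q)"
  shows "ev q ` lin_span (Hec n q) S = endo_span (ev q ` S)"
proof -
  have inj: "inj_on (ev q) S" using S by (intro inj_onI ev_inj[of _ n q]) auto
  have evF: "ev q (\<Oplus>\<^bsub>Hec n q\<^esub>b\<in>F. c b \<odot>\<^bsub>Hec n q\<^esub> b) = (\<Sum>b\<in>F. smul (c b) (ev q b))"
    if "finite F" "F \<subseteq> S" for F c
  proof -
    have F: "b \<in> carrier (Hec n q)" if "b \<in> F" for b using that \<open>F \<subseteq> S\<close> S by blast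
    then have "ev q (\<Oplus>\<^bsub>Hec n q\<^esub>b\<in>F. c b \<odot>\<^bsub>Hec n q\<^esub> b) = (\<Sum>b\<in>F. ev q (c b \<odot>\<^bsub>Hec n q\<^esub> b))"
      by (intro ev_finsum(2) \<open>finite F\<close> Hec_closed(3))
    then show ?thesis using F by (simp add: ev_smult)
  qed
  show ?thesis
  proof (intro equalityI subsetI)
    fix x assume "x \<in> ev q ` lin_span (Hec n q) S"
    then obtain F c where "finite F" "F \<subseteq> S" "x = ev q (\<Oplus>\<^bsub>Hec n q\<^esub>b\<in>F. c b \<odot>\<^bsub>Hec n q\<^esub> b)"
      unfolding lin_span_def by blast
    then show "x \<in> endo_span (ev q ` S)"
      by (simp add: evF) (intro endo.span_sum endo.span_scale endo.span_base imageI, blast)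
  next
    fix x assume "x \<in> endo_span (ev q ` S)"
    then obtain G c where G: "finite G" "G \<subseteq> ev q ` S" "x = (\<Sum>b\<in>G. smul (c b) b)"
      unfolding endo.span_explicit by blast
    obtain F where F: "F \<subseteq> S" "finite F" "G = ev q ` F"
      using finite_subset_image[OF G(1,2)] by blast
    have "ev q (\<Oplus>\<^bsub>Hec n q\<^esub>b\<in>F. c (ev q b) \<odot>\<^bsub>Hec n q\<^esub> b)
        = (\<Sum>b\<in>F. smul (c (ev q b)) (ev q b))"
      using evF[OF F(2,1), of "\<lambda>b. c (ev q b)"] .
    then have "x = ev q (\<Oplus>\<^bsub>Hec n q\<^esub>b\<in>F. c (ev q b) \<odot>\<^bsub>Hec n q\<^esub> b)"
      unfolding G(3) F(3) sum.reindex[OF inj_on_subset[OF inj F(1)]] o_def by (rule sym)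
    moreover have "(\<Oplus>\<^bsub>Hec n q\<^esub>b\<in>F. c (ev q b) \<odot>\<^bsub>Hec n q\<^esub> b) \<in> lin_span (Hec n q) S"
      unfolding lin_span_def mem_Collect_eq
      by (rule exI[of _ F], rule exI[of _ "\<lambda>b. c (ev q b)"]) (use F in auto)
    ultimately show "x \<in> ev q ` lin_span (Hec n q) S" by blast
  qed
qed

lemma mem_lin_span:
  assumes "S \<subseteq> carrier (Hec n q)"
  shows "A \<in> lin_span (Hec n q) S \<longleftrightarrow> A \<in> carrier (Hec n q) \<and> ev q A \<in> endo_span (ev q ` S)"
proof
  assume "A \<in> carrier (Hec n q) \<and> ev q A \<in> endo_span (ev q ` S)"
  then obtain B where "B \<in> lin_span (Hec n q) S" "ev q B = ev q A" "A \<in> carrier (Hec n q)"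
    unfolding ev_lin_span[OF assms, symmetric] by force
  then show "A \<in> lin_span (Hec n q) S"
    using ev_inj[of B n q A] lin_span_carrier[OF assms] by blast
qed (use lin_span_carrier[OF assms] ev_lin_span[OF assms] in blast)

definition unev :: "nat \<Rightarrow> 'r::comm_ring_1 \<Rightarrow> 'r endo \<Rightarrow> 'r hecke" where
  "unev n q a = inv_into (carrier (Hec n q)) (ev q) a"

lemma unev:
  assumes "a \<in> Hk n q"
  shows "unev n q a \<in> carrier (Hec n q)" "ev q (unev n q a) = a"
proof -
  obtain f where "f \<in> carrier (free_alg n)" "a = act q f" using assms by (rule Hk_E)
  then have "a \<in> ev q ` carrier (Hec n q)" by (auto simp: carrier_Hec image_image)
  then show "unev n q a \<in> carrier (Hec n q)" "ev q (unev n q a) = a"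
    unfolding unev_def by (rule inv_into_into, rule f_inv_into_f)
qed

lemma unev_ev: "A \<in> carrier (Hec n q) \<Longrightarrow> unev n q (ev q A) = A"
  by (rule ev_inj[of _ n q]) (simp_all add: unev ev_Hk)

lemma hecke_T_carrier: "w permutes {1..n} \<Longrightarrow> hecke_T n q w \<in> carrier (Hec n q)"
  and ev_hecke_T: "w permutes {1..n} \<Longrightarrow> ev q (hecke_T n q w) = Tw n q w"
  by (simp_all add: hecke_T_def hecke_class_carrier free_alg_single reduced_word act_single Tw_def)

lemma young_subgroup_stab:
  assumes la: "la \<in> Par n"
  shows "young_subgroup la = stab n (row la)"
proof -
  have sum: "sum_list la = n" using la by (rule sum_list_Par)
  have mem: "r \<in> {sum_list (take i la) + 1..sum_list (take (Suc i) la)} \<longleftrightarrow> r \<in> {1..n} \<and> row la r = i"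
    if "i < length la" for i r
  proof -
    have "sum_list (take (Suc i) la) \<le> n" using append_take_drop_id[of "Suc i" la] sum
      by (metis le_add1 sum_list.append)
    then show ?thesis
      using row_eq_iff[of r la i] sum by (auto simp: sum_list_take_part lessThan_Suc_atMost)
  qed
  have "(\<forall>i<length la. w ` {sum_list (take i la) + 1..sum_list (take (Suc i) la)}
      \<subseteq> {sum_list (take i la) + 1..sum_list (take (Suc i) la)}) \<longleftrightarrow> row la \<circ> w = row la"
    if w: "w permutes {1..n}" for w
  proof
    assume *: "\<forall>i<length la. w ` {sum_list (take i la) + 1..sum_list (take (Suc i) la)}
      \<subseteq> {sum_list (take i la) + 1..sum_list (take (Suc i) la)}"
    show "row la \<circ> w = row la"
    proof
      fix r show "(row la \<circ> w) r = row la r"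
      proof (cases "r \<in> {1..n}")
        case True
        then have l: "row la r < length la" using row_bounds(1)[of r la] sum by simp
        then have "w r \<in> {sum_list (take (row la r) la) + 1..sum_list (take (Suc (row la r)) la)}"
          using * mem[OF l, of r] True by blast
        then show ?thesis using mem[OF l, of "w r"] by simp
      qed (simp add: permutes_not_in[OF w])
    qed
  next
    assume *: "row la \<circ> w = row la"
    then have "row la (w r) = row la r" for r by (metis o_apply)
    then show "\<forall>i<length la. w ` {sum_list (take i la) + 1..sum_list (take (Suc i) la)}
      \<subseteq> {sum_list (take i la) + 1..sum_list (take (Suc i) la)}"
      using mem permutes_in_image[OF w] by (simp add: image_subset_iff)
  qed
  then show ?thesis unfolding young_subgroup_def stab_def sum Let_def by auto
qed

lemma young_sum_carrier: "la \<in> Par n \<Longrightarrow> young_sum n q la \<in> carrier (Hec n q)"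
  and ev_young_sum: "la \<in> Par n \<Longrightarrow> ev q (young_sum n q la) = ys n q (row la)"
  using finite_stab stab_permutes
  by (auto simp: young_sum_def young_subgroup_stab ys_def ev_hecke_T ev_finsum hecke_T_carrier
      intro!: sum.cong)

section \<open>The anti-automorphism on cosets and the adjoint of an operator\<close>

context hecke_unit
begin

definition frev :: "(fword \<Rightarrow>\<^sub>0 'r) \<Rightarrow> (fword \<Rightarrow>\<^sub>0 'r)" where
  "frev = Poly_Mapping.map_key (\<lambda>w. Word (rev (letters w)))"

lemma inj_rev_word: "inj (\<lambda>w. Word (rev (letters w)))"
  by (rule injI) (metis fword.expand fword.inject rev_rev_ident)

lemma lookup_frev: "Poly_Mapping.lookup (frev f) w = Poly_Mapping.lookup f (Word (rev (letters w)))"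
  unfolding frev_def by (simp add: map_key.rep_eq inj_rev_word)

lemma frev_frev: "frev (frev f) = f"
  by (rule poly_mapping_eqI) (simp add: lookup_frev)

lemma frev_diff: "frev (f - g) = frev f - frev g"
  by (rule poly_mapping_eqI) (simp add: lookup_frev lookup_minus)

lemma frev_add: "frev (f + g) = frev f + frev g"
  by (rule poly_mapping_eqI) (simp add: lookup_frev lookup_add)

lemma frev_single: "frev (Poly_Mapping.single (Word l) r) = Poly_Mapping.single (Word (rev l)) r"
  by (rule poly_mapping_eqI) (auto simp: lookup_frev lookup_single when_def)

lemma frev_carrier: "f \<in> carrier (free_alg n) \<Longrightarrow> frev f \<in> carrier (free_alg n)"
proof -
  assume f: "f \<in> carrier (free_alg n)"
  have "set (letters w) \<subseteq> {1..<n}" if "w \<in> Poly_Mapping.keys (frev f)" for w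
  proof -
    have "Word (rev (letters w)) \<in> Poly_Mapping.keys f" using that by (simp add: in_keys_iff lookup_frev)
    then have "set (letters (Word (rev (letters w)))) \<subseteq> {1..<n}"
      using f by (simp only: carrier_free_alg mem_Collect_eq)
    then show ?thesis by simp
  qed
  then show ?thesis by (simp add: carrier_free_alg)
qed

lemma act_frev: "f \<in> carrier (free_alg n) \<Longrightarrow> act q (frev f) = star (act q f)"
proof -
  assume f: "f \<in> carrier (free_alg n)"
  have fin: "finite (Poly_Mapping.keys f)" by simp
  have s: "frev (\<Sum>w\<in>K. g w) = (\<Sum>w\<in>K. frev (g w))" if "finite K" for K and g :: "fword \<Rightarrow> (fword \<Rightarrow>\<^sub>0 'r)"
    using that frev_diff[of 0 0] by (induction K rule: finite_induct) (simp_all add: frev_add)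
  have sp: "f = (\<Sum>w\<in>Poly_Mapping.keys f. Poly_Mapping.single w (Poly_Mapping.lookup f w))"
    by (rule poly_mapping_sum_single)
  have "act q (frev f) = (\<Sum>w\<in>Poly_Mapping.keys f. act q (frev (Poly_Mapping.single w (Poly_Mapping.lookup f w))))"
    by (subst sp) (simp add: s act_sum)
  also have "\<dots> = (\<Sum>w\<in>Poly_Mapping.keys f. star (smul (Poly_Mapping.lookup f w) (Tl q (letters w))))"
  proof (rule sum.cong)
    fix w assume "w \<in> Poly_Mapping.keys f"
    then have "set (letters w) \<subseteq> {1..<n}" using f by (simp add: carrier_free_alg)
    then show "act q (frev (Poly_Mapping.single w (Poly_Mapping.lookup f w)))
        = star (smul (Poly_Mapping.lookup f w) (Tl q (letters w)))"
      by (cases w) (simp add: frev_single act_single star_smul star_Tl Hk_Tl)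
  qed simp
  also have "\<dots> = star (act q f)"
    unfolding act_def
    by (rule star_sum[symmetric]) (use f in \<open>auto simp: carrier_free_alg intro!: Hk_smul Hk_Tl\<close>)
  finally show ?thesis .
qed

text \<open>Reversal of words corresponds to the adjoint, so it maps the ideal of relations, the
  kernel of the action, onto itself and cosets onto cosets.\<close>

lemma hecke_star_class:
  assumes f: "f \<in> carrier (free_alg n)"
  shows "hecke_star (hecke_class n q f) = hecke_class n q (frev f)"
proof -
  have I: "frev h \<in> hecke_ideal n q" if "h \<in> hecke_ideal n q" for h
  proof -
    have "h \<in> carrier (free_alg n)" "act q h = 0"
      using that hecke_ideal_carrier act_hecke_ideal by auto
    then show ?thesis by (simp add: hecke_ideal_iff frev_carrier act_frev)
  qed
  have "g \<in> frev ` hecke_class n q f \<longleftrightarrow> g \<in> hecke_class n q (frev f)" for g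
  proof
    assume "g \<in> hecke_class n q (frev f)"
    then have "frev (g - frev f) \<in> hecke_ideal n q" by (intro I) (simp add: mem_hecke_class)
    then have "frev g \<in> hecke_class n q f" by (simp add: mem_hecke_class frev_diff frev_frev)
    then show "g \<in> frev ` hecke_class n q f" using frev_frev[of g] by (metis imageI)
  qed (use I in \<open>auto simp: mem_hecke_class frev_diff[symmetric]\<close>)
  then show ?thesis unfolding hecke_star_def frev_def by blast
qed

lemma hecke_star_carrier: "A \<in> carrier (Hec n q) \<Longrightarrow> hecke_star A \<in> carrier (Hec n q)"
  and ev_hecke_star: "A \<in> carrier (Hec n q) \<Longrightarrow> ev q (hecke_star A) = star (ev q A)"
  by (auto elim!: Hec_E simp: hecke_star_class act_frev intro!: hecke_class_carrier frev_carrier)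

end

lemma mem_cell_span:
  assumes "\<And>l u v. l \<in> \<tau> \<Longrightarrow> u \<in> N l \<Longrightarrow> v \<in> N l \<Longrightarrow> C l u v \<in> carrier (Hec n q)"
  shows "A \<in> cell_span (Hec n q) N C \<tau> \<longleftrightarrow> A \<in> carrier (Hec n q) \<and>
    ev q A \<in> endo_span {ev q (C l u v) | l u v. l \<in> \<tau> \<and> u \<in> N l \<and> v \<in> N l}"
proof -
  have "{C l u v | l u v. l \<in> \<tau> \<and> u \<in> N l \<and> v \<in> N l} \<subseteq> carrier (Hec n q)"
    using assms by blast
  moreover have "ev q ` {C l u v | l u v. l \<in> \<tau> \<and> u \<in> N l \<and> v \<in> N l}
      = {ev q (C l u v) | l u v. l \<in> \<tau> \<and> u \<in> N l \<and> v \<in> N l}"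
    by blast
  ultimately show ?thesis unfolding cell_span_def by (simp add: mem_lin_span)
qed

context hecke_unit
begin

section \<open>Murphy's cell modules\<close>

lemma upclosed_above:
  assumes "la \<in> Par n"
  shows "upclosed (above n la)" "upclosed (insert la (above n la))"
  using above_subset[OF _ assms] assms by (auto simp: upclosed_def above_def)

definition tword :: "nat list \<Rightarrow> (nat \<times> nat \<Rightarrow> nat) \<Rightarrow> nat \<Rightarrow> nat" where
  "tword la s = row la \<circ> pinv (tableau_perm la s)"

text \<open>d(s) is shortest in its coset, so T_(d(s)) moves the indicator of the row word to that
  of the word of s, which is also how \<open>lift\<close> was chosen.\<close>

lemma tableau_lift:
  assumes la: "la \<in> Par n" and s: "s \<in> standard_tableaux la"
  shows "W (tableau_perm la s) * Y (row la) = straighten.lift n q la (tword la s) * Y (row la)"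
proof -
  interpret straighten n q la by (rule straightenI[OF la])
  note st = standard_tableau[OF la s]
  have asc: "asc_family n q (chi n (row la) :: _ \<Rightarrow> _ \<Rightarrow> 'r)"
    unfolding asc_family_def using T_chi_asc[OF row_la(1)] by blast
  have "(W (tableau_perm la s) * Y (row la)) \<triangleright> de id = W (tableau_perm la s) \<triangleright> chi n (row la) (row la)"
    by (simp add: Y_app)
  also have "\<dots> = chi n (row la) (tword la s)"
    unfolding tword_def by (rule Tw_asc_family[OF asc st(1,3)])
  also have "\<dots> = (lift (tword la s) * Y (row la)) \<triangleright> de id"
    using st(2) by (intro lift(2)[symmetric]) (simp add: latw_def tword_def)
  finally show ?thesis
    using st(1,2) lift_Hk[OF la] by (intro Hk_eqI[of _ n q]) (simp_all add: Hk_mult Hk_Tw Y_Hk tword_def)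
qed

lemma murphy_carrier_perm:
  assumes la: "la \<in> Par n" and s: "tableau_perm la s permutes {1..n}" "tableau_perm la t permutes {1..n}"
  shows "murphy n q la s t \<in> carrier (Hec n q)"
    "ev q (murphy n q la s t) = W (tableau_perm la s) * Y (row la) * star (W (tableau_perm la t))"
  using assms unfolding murphy_def
  by (simp_all add: hecke_T_carrier ev_hecke_T young_sum_carrier ev_young_sum hecke_star_carrier
      ev_hecke_star ev_mult Hec_closed)

lemma ev_murphy:
  assumes la: "la \<in> Par n" and s: "s \<in> standard_tableaux la" and t: "t \<in> standard_tableaux la"
  shows "murphy n q la s t \<in> carrier (Hec n q)" "ev q (murphy n q la s t) = mbase la (tword la s) (tword la t)"
proof -
  note ps = standard_tableau(1)[OF la s] and pt = standard_tableau(1)[OF la t]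
  have "tword la t \<in> latw n la" using standard_tableau(2)[OF la t] by (simp add: tword_def)
  then have l: "straighten.lift n q la (tword la t) \<in> H" by (rule lift_Hk[OF la])
  have "Y (row la) * star (W (tableau_perm la t)) = star (W (tableau_perm la t) * Y (row la))"
    by (simp add: star_mult Hk_Tw pt Y_Hk star_Y)
  also have "\<dots> = Y (row la) * star (straighten.lift n q la (tword la t))"
    unfolding tableau_lift[OF la t] by (simp add: star_mult l Y_Hk star_Y)
  finally have "W (tableau_perm la s) * Y (row la) * star (W (tableau_perm la t)) =
      W (tableau_perm la s) * Y (row la) * star (straighten.lift n q la (tword la t))"
    by (simp add: mult.assoc)
  then show "murphy n q la s t \<in> carrier (Hec n q)" "ev q (murphy n q la s t) = mbase la (tword la s) (tword la t)"
    using murphy_carrier_perm[OF la ps pt] by (simp_all add: mbase_def tableau_lift[OF la s])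
qed

text \<open>Standard tableaux and lattice words give the same Murphy elements, so the span modulo
  which Murphy's cell module is formed is a two-sided ideal.\<close>

lemma mem_murphy_above:
  assumes la: "la \<in> Par n"
  shows "A \<in> murphy_above n q la \<longleftrightarrow> A \<in> carrier (Hec n q) \<and> ev q A \<in> yideal (above n la)"
proof -
  let ?S = "{murphy n q mu u v | mu u v. mu \<in> Par n \<and> dominated_by la mu \<and> mu \<noteq> la \<and>
        u \<in> standard_tableaux mu \<and> v \<in> standard_tableaux mu}"
  have car: "?S \<subseteq> carrier (Hec n q)" using ev_murphy(1) by blast
  have "ev q ` ?S = {mbase mu c c' | mu c c'. mu \<in> above n la \<and> c \<in> latw n mu \<and> c' \<in> latw n mu}"
  proof (intro equalityI subsetI)
    fix x assume "x \<in> ev q ` ?S"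
    then obtain mu u v where mu: "mu \<in> Par n" "mu \<in> above n la" "u \<in> standard_tableaux mu"
      "v \<in> standard_tableaux mu" "x = mbase mu (tword mu u) (tword mu v)"
      using ev_murphy(2) by (auto simp: above_def)
    then have "tword mu u \<in> latw n mu" "tword mu v \<in> latw n mu"
      using standard_tableau(2) by (simp_all add: tword_def)
    then show "x \<in> {mbase mu c c' | mu c c'. mu \<in> above n la \<and> c \<in> latw n mu \<and> c' \<in> latw n mu}"
      using mu by blast
  next
    fix x assume "x \<in> {mbase mu c c' | mu c c'. mu \<in> above n la \<and> c \<in> latw n mu \<and> c' \<in> latw n mu}"
    then obtain mu c c' where mu: "mu \<in> Par n" "dominated_by la mu" "mu \<noteq> la" "c \<in> latw n mu" "c' \<in> latw n mu"
      "x = mbase mu c c'" by (auto simp: above_def)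
    obtain u where u: "u \<in> standard_tableaux mu" "tword mu u = c"
      using lattice_word_tableau[OF mu(1,4)] unfolding tword_def by blast
    obtain v where v: "v \<in> standard_tableaux mu" "tword mu v = c'"
      using lattice_word_tableau[OF mu(1,5)] unfolding tword_def by blast
    have "x = ev q (murphy n q mu u v)" using ev_murphy(2)[OF mu(1) u(1) v(1)] u(2) v(2) mu(6) by simp
    then show "x \<in> ev q ` ?S" using mu u v by blast
  qed
  then have "endo_span (ev q ` ?S) = yideal (above n la)"
    using yideal_mset_span[OF upclosed_above(1)[OF la]] by (simp add: mset_span_def)
  then show ?thesis unfolding murphy_above_def mem_lin_span[OF car] by simp
qed

lemma murphy_initial:
  assumes la: "la \<in> Par n" and A: "A \<in> lin_span (Hec n q) {murphy n q la u (initial_tableau la) | u. u \<in> standard_tableaux la}"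
  shows "A \<in> carrier (Hec n q)" "ev q A \<in> yideal (insert la (above n la))"
proof -
  have init: "tableau_perm la (initial_tableau la) permutes {1..n}"
    using tableau_perm_eqI[OF la permutes_id[of "{1..n}"], of "initial_tableau la"] by (simp add: permutes_id)
  note m = murphy_carrier_perm[OF la standard_tableau(1)[OF la] init]
  have car: "{murphy n q la u (initial_tableau la) | u. u \<in> standard_tableaux la} \<subseteq> carrier (Hec n q)"
    using m(1) by blast
  have "endo_span (ev q ` {murphy n q la u (initial_tableau la) | u. u \<in> standard_tableaux la})
      \<subseteq> yideal (insert la (above n la))"
  proof (rule endo.span_minimal[OF _ yideal_subspace], clarify)
    fix u assume "u \<in> standard_tableaux la"
    then show "ev q (murphy n q la u (initial_tableau la)) \<in> yideal (insert la (above n la))"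
      unfolding m(2)[OF \<open>u \<in> standard_tableaux la\<close>]
      using standard_tableau(1)[OF la] init by (intro yideal_gen star_Hk Hk_Tw) auto
  qed
  then show "A \<in> carrier (Hec n q)" "ev q A \<in> yideal (insert la (above n la))"
    using A unfolding mem_lin_span[OF car] by blast+
qed

lemma mem_Hec_coset: "x \<in> B +>\<^bsub>Hec n q\<^esub> y \<longleftrightarrow> (\<exists>b\<in>B. x = b \<oplus>\<^bsub>Hec n q\<^esub> y)"
  by (auto simp: a_r_coset_def')

text \<open>On the dual module a acts through the adjoint. If the adjoint sends the layer of
  \<open>la\<close> into the ideal above it, every coset of Murphy's cell module goes to the zero
  coset, where an additive functional vanishes.\<close>

lemma specht_module_kill:
  assumes la: "la \<in> Par n" and a: "a \<in> carrier (Hec n q)"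
    and st: "\<And>y. y \<in> yideal (insert la (above n la)) \<Longrightarrow> star (ev q a) * y \<in> yideal (above n la)"
    and \<alpha>: "\<alpha> \<in> carrier (specht_module n q la)"
  shows "a \<odot>\<^bsub>specht_module n q la\<^esub> \<alpha> = \<zero>\<^bsub>specht_module n q la\<^esub>"
proof -
  interpret Q: ring "Hec n q" by (rule ring_Hec)
  let ?M = "murphy_cell_module n q la" and ?B = "murphy_above n q la"
  let ?L = "lin_span (Hec n q) {murphy n q la u (initial_tableau la) | u. u \<in> standard_tableaux la}"
  note B = mem_murphy_above[OF la]
  have carM: "carrier ?M = (\<lambda>y. ?B +>\<^bsub>Hec n q\<^esub> y) ` ?L"
    by (simp add: murphy_cell_module_def mk_module_def Let_def)
  have addM: "V \<oplus>\<^bsub>?M\<^esub> V' = V <+>\<^bsub>Hec n q\<^esub> V'" for V V'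
    by (simp add: murphy_cell_module_def mk_module_def Let_def)
  have smM: "b \<odot>\<^bsub>?M\<^esub> V = (\<Union>y\<in>V. ?B +>\<^bsub>Hec n q\<^esub> (b \<otimes>\<^bsub>Hec n q\<^esub> y))" for b V
    by (simp add: murphy_cell_module_def mk_module_def Let_def)
  have zero: "\<zero>\<^bsub>Hec n q\<^esub> \<in> ?B" by (simp add: B ev_zero yideal_zero)
  have cos: "?B +>\<^bsub>Hec n q\<^esub> z = ?B" if z: "z \<in> ?B" for z
  proof (rule Set.set_eqI)
    fix x show "x \<in> ?B +>\<^bsub>Hec n q\<^esub> z \<longleftrightarrow> x \<in> ?B"
    proof
      assume "x \<in> ?B +>\<^bsub>Hec n q\<^esub> z"
      then show "x \<in> ?B" using z by (auto simp: mem_Hec_coset B ev_add intro: yideal_add)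
    next
      assume x: "x \<in> ?B"
      then have "x \<ominus>\<^bsub>Hec n q\<^esub> z \<in> ?B" using z by (auto simp: B ev_minus intro: yideal_diff)
      moreover have "x = (x \<ominus>\<^bsub>Hec n q\<^esub> z) \<oplus>\<^bsub>Hec n q\<^esub> z"
        using x z by (intro ev_inj[of _ n q]) (auto simp: B ev_add ev_minus)
      ultimately show "x \<in> ?B +>\<^bsub>Hec n q\<^esub> z" by (auto simp: mem_Hec_coset)
    qed
  qed
  have "\<zero>\<^bsub>Hec n q\<^esub> \<in> ?L"
    by (auto simp: lin_span_def intro!: exI[of _ "{}"])
  then have BM: "?B \<in> carrier ?M" unfolding carM using cos[OF zero] by (auto simp: image_iff intro!: bexI)
  have BB: "?B \<oplus>\<^bsub>?M\<^esub> ?B = ?B"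
  proof -
    have "?B <+>\<^bsub>Hec n q\<^esub> ?B = (\<Union>z\<in>?B. ?B +>\<^bsub>Hec n q\<^esub> z)"
      by (auto simp: set_add_def' a_r_coset_def')
    then show ?thesis unfolding addM using cos zero by auto
  qed
  have car\<alpha>: "carrier (specht_module n q la) = {\<alpha> \<in> extensional (carrier ?M).
        (\<forall>x\<in>carrier ?M. \<forall>y\<in>carrier ?M. \<alpha> (x \<oplus>\<^bsub>?M\<^esub> y) = \<alpha> x + \<alpha> y) \<and>
        (\<forall>r. \<forall>x\<in>carrier ?M. \<alpha> ((r \<odot>\<^bsub>Hec n q\<^esub> \<one>\<^bsub>Hec n q\<^esub>) \<odot>\<^bsub>?M\<^esub> x) = r * \<alpha> x)}"
    by (simp add: specht_module_def dual_module_def mk_module_def)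
  have "\<alpha> (?B \<oplus>\<^bsub>?M\<^esub> ?B) = \<alpha> ?B + \<alpha> ?B" using \<alpha> BM unfolding car\<alpha> by blast
  then have \<alpha>B: "\<alpha> ?B = 0" unfolding BB by simp
  have "\<alpha> (hecke_star a \<odot>\<^bsub>?M\<^esub> V) = 0" if V: "V \<in> carrier ?M" for V
  proof -
    obtain y where y: "y \<in> ?L" "V = ?B +>\<^bsub>Hec n q\<^esub> y" using V unfolding carM by blast
    note yc = murphy_initial[OF la y(1)]
    have "y = \<zero>\<^bsub>Hec n q\<^esub> \<oplus>\<^bsub>Hec n q\<^esub> y" using yc(1) by simp
    \<comment> \<open>The action on a coset is a union over its members, so it equals the zero coset
      only if there are members.\<close>
    then have ne: "V \<noteq> {}" using zero unfolding y(2) by (metis empty_iff mem_Hec_coset)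
    have "?B +>\<^bsub>Hec n q\<^esub> (hecke_star a \<otimes>\<^bsub>Hec n q\<^esub> y') = ?B" if yV: "y' \<in> V" for y'
    proof (rule cos)
      obtain b where b: "b \<in> ?B" "y' = b \<oplus>\<^bsub>Hec n q\<^esub> y" using yV unfolding y(2) mem_Hec_coset by blast
      have bc: "b \<in> carrier (Hec n q)" "ev q b \<in> yideal (insert la (above n la))"
        using b(1) yideal_mono[of "above n la" "insert la (above n la)"] by (auto simp: B)
      have y': "y' \<in> carrier (Hec n q)" "ev q y' \<in> yideal (insert la (above n la))"
        using bc yc unfolding b(2) by (auto simp: ev_add intro: yideal_add)
      show "hecke_star a \<otimes>\<^bsub>Hec n q\<^esub> y' \<in> ?B"
        unfolding B using y' a hecke_star_carrier[OF a] st by (simp add: ev_mult ev_hecke_star)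
    qed
    then have "hecke_star a \<odot>\<^bsub>?M\<^esub> V = ?B" unfolding smM using ne by simp
    then show ?thesis using \<alpha>B by simp
  qed
  then show ?thesis by (simp add: specht_module_def dual_module_def mk_module_def restrict_def fun_eq_iff)
qed

section \<open>Transport of cell data\<close>

lemma basis_dual:
  fixes m :: "'k \<Rightarrow> 'r endo"
  assumes K: "finite K" and m: "\<And>k. k \<in> K \<Longrightarrow> m k \<in> H" and span: "endo_span (m ` K) = H"
    and ind: "\<And>a. (\<Sum>k\<in>K. smul (a k) (m k)) = 0 \<Longrightarrow> \<forall>k\<in>K. a k = 0"
  shows "\<exists>D. \<forall>k\<in>K. D k \<in> H \<and> (\<forall>j\<in>K. tr (m j * D k) = (if j = k then 1 else 0))"
proof -
  define coef where "coef y = (SOME a. y = (\<Sum>k\<in>K. smul (a k) (m k)))" for y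
  have coef: "y = (\<Sum>k\<in>K. smul (coef y k) (m k))" if "y \<in> H" for y
  proof -
    have "\<exists>a. y = (\<Sum>k\<in>K. smul (a k) (m k))"
      using that span smul_family_span[OF K, of m] by blast
    then show ?thesis unfolding coef_def by (rule someI_ex)
  qed
  have uniq: "coef y k = a k" if "y = (\<Sum>k\<in>K. smul (a k) (m k))" "k \<in> K" for y a k
  proof -
    have "y \<in> H" unfolding that(1) using m by (intro Hk_sum Hk_smul)
    then have "(\<Sum>k\<in>K. smul (coef y k) (m k)) - (\<Sum>k\<in>K. smul (a k) (m k)) = 0"
      using coef that(1) by simp
    then have "(\<Sum>k\<in>K. smul (coef y k - a k) (m k)) = 0"
      by (simp add: endo.scale_left_diff_distrib sum_subtractf)
    from ind[OF this] show ?thesis using that(2) by simp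
  qed
  have "\<exists>b\<in>H. \<forall>y\<in>H. coef y k = tr (y * b)" if k: "k \<in> K" for k
  proof (rule functional_tr_right)
    fix a b assume "a \<in> H" "b \<in> H"
    then have "a + b = (\<Sum>k\<in>K. smul (coef a k) (m k)) + (\<Sum>k\<in>K. smul (coef b k) (m k))"
      using coef by simp
    then have "a + b = (\<Sum>k\<in>K. smul (coef a k + coef b k) (m k))"
      by (simp add: endo.scale_left_distrib sum.distrib)
    then show "coef (a + b) k = coef a k + coef b k" using k by (rule uniq)
  next
    fix r a assume "a \<in> H"
    then have "smul r a = smul r (\<Sum>k\<in>K. smul (coef a k) (m k))" using coef by simp
    then have "smul r a = (\<Sum>k\<in>K. smul (r * coef a k) (m k))" by (simp add: endo.scale_sum_right)
    then show "coef (smul r a) k = r * coef a k" using k by (rule uniq)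
  qed
  then obtain D where D: "\<And>k. k \<in> K \<Longrightarrow> D k \<in> H" "\<And>k y. k \<in> K \<Longrightarrow> y \<in> H \<Longrightarrow> coef y k = tr (y * D k)"
    by metis
  have "tr (m j * D k) = (if j = k then 1 else 0)" if "k \<in> K" "j \<in> K" for j k
  proof -
    have "m j = (\<Sum>i\<in>K. if i = j then m i else 0)" using K that(2) by simp
    also have "\<dots> = (\<Sum>i\<in>K. smul (if i = j then 1 else 0) (m i))" by (intro sum.cong) auto
    finally have "coef (m j) k = (if k = j then 1 else 0)" using that(1) by (rule uniq)
    then show ?thesis using D(2)[OF that(1) m[OF that(2)]] by auto
  qed
  then show ?thesis using D(1) by blast
qed

lemma Hec_image: "ev q ` carrier (Hec n q) = H"
  using ev_Hk unev[of _ n q] by (metis (no_types, lifting) image_iff subsetI image_subsetI subset_antisym)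

text \<open>An element that annihilates the Specht module annihilates the isomorphic cell module.
  Evaluated at the basis symbols, this says that the matrix chosen in \<open>cell_module\<close>
  vanishes on \<open>N l\<close>.\<close>

lemma cell_module_kill:
  assumes l: "l \<in> Par n" and fin: "finite (N l)"
    and ex: "\<exists>r. is_cell_action (Hec n q) (Par n) dominated_by N C l a r"
    and iso: "module_iso (Hec n q) (cell_module (Hec n q) (Par n) dominated_by N C l) (specht_module n q l)"
    and a: "a \<in> carrier (Hec n q)"
    and st: "\<And>y. y \<in> yideal (insert l (above n l)) \<Longrightarrow> star (ev q a) * y \<in> yideal (above n l)"
  shows "\<exists>r. is_cell_action (Hec n q) (Par n) dominated_by N C l a r \<and> (\<forall>u\<in>N l. \<forall>u'\<in>N l. r u' u = 0)"
proof -
  let ?W = "cell_module (Hec n q) (Par n) dominated_by N C l" and ?S = "specht_module n q l"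
  define r where "r = (SOME r. is_cell_action (Hec n q) (Par n) dominated_by N C l a r)"
  have r: "is_cell_action (Hec n q) (Par n) dominated_by N C l a r"
    unfolding r_def using ex by (rule someI_ex)
  have carW: "carrier ?W = extensional (N l)" by (simp add: cell_module_def mk_module_def)
  have smW: "a \<odot>\<^bsub>?W\<^esub> f = (\<lambda>u'\<in>N l. \<Sum>u\<in>N l. r u' u * f u)" for f
    by (simp add: cell_module_def mk_module_def r_def)
  obtain f where f: "bij_betw f (carrier ?W) (carrier ?S)"
    "\<And>b x. b \<in> carrier (Hec n q) \<Longrightarrow> x \<in> carrier ?W \<Longrightarrow> f (b \<odot>\<^bsub>?W\<^esub> x) = b \<odot>\<^bsub>?S\<^esub> f x"
    using iso unfolding module_iso_def by blast
  have zero: "f (a \<odot>\<^bsub>?W\<^esub> x) = \<zero>\<^bsub>?S\<^esub>" if "x \<in> carrier ?W" for x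
    unfolding f(2)[OF a that]
    using f(1) that by (intro specht_module_kill[OF l a st]) (auto simp: bij_betw_def)
  \<comment> \<open>Two images are compared with each other rather than with zero, so injectivity of
    the isomorphism is enough.\<close>
  have same: "a \<odot>\<^bsub>?W\<^esub> x = a \<odot>\<^bsub>?W\<^esub> y" if "x \<in> carrier ?W" "y \<in> carrier ?W" for x y
  proof (rule inj_onD[OF bij_betw_imp_inj_on[OF f(1)]])
    show "f (a \<odot>\<^bsub>?W\<^esub> x) = f (a \<odot>\<^bsub>?W\<^esub> y)" using zero that by simp
  qed (simp_all add: smW carW)
  have "r u' u = 0" if u: "u \<in> N l" "u' \<in> N l" for u u'
  proof -
    have "a \<odot>\<^bsub>?W\<^esub> (\<lambda>w\<in>N l. if w = u then 1 else 0) = a \<odot>\<^bsub>?W\<^esub> (\<lambda>w\<in>N l. 0)"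
      by (rule same) (simp_all add: carW)
    then have "(a \<odot>\<^bsub>?W\<^esub> (\<lambda>w\<in>N l. if w = u then 1 else 0)) u' = (a \<odot>\<^bsub>?W\<^esub> (\<lambda>w\<in>N l. 0)) u'"
      by (rule arg_cong)
    then have z: "(\<Sum>w\<in>N l. r u' w * (\<lambda>w\<in>N l. if w = u then 1 else 0) w) = 0"
      unfolding smW restrict_apply'[OF u(2)] by simp
    have "(\<Sum>w\<in>N l. r u' w * (\<lambda>w\<in>N l. if w = u then 1 else 0) w) = (\<Sum>w\<in>N l. if w = u then r u' w else 0)"
      by (intro sum.cong) auto
    then show ?thesis using fin u z by simp
  qed
  then show ?thesis using r by blast
qed

lemma hecke_cells_of_datum:
  assumes cd: "cell_datum (Hec n q) (Par n) dominated_by N C st"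
    and iso: "\<And>l. l \<in> Par n \<Longrightarrow> module_iso (Hec n q) (cell_module (Hec n q) (Par n) dominated_by N C l) (specht_module n q l)"
    and pos: "\<And>x. x \<in> H \<Longrightarrow> x * star x = 0 \<Longrightarrow> x = 0"
  shows "\<exists>D. hecke_cells n q N (\<lambda>l u v. ev q (C l u v)) (\<lambda>a. ev q (st (unev n q a))) D"
proof -
  let ?K = "SIGMA l:Par n. N l \<times> N l"
  let ?P = "\<lambda>(l, u, v). C l u v"
  let ?below = "\<lambda>l. {m \<in> Par n. dominated_by m l \<and> m \<noteq> l}"
  let ?A = "\<lambda>\<tau>. endo_span {ev q (C l u v) | l u v. l \<in> \<tau> \<and> u \<in> N l \<and> v \<in> N l}"
  have finN: "\<And>l. l \<in> Par n \<Longrightarrow> finite (N l)" and inj: "inj_on ?P ?K"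
    and basis: "is_basis (Hec n q) (?P ` ?K)" and anti: "is_involutory_antiaut (Hec n q) st"
    and stC: "\<And>l u v. l \<in> Par n \<Longrightarrow> u \<in> N l \<Longrightarrow> v \<in> N l \<Longrightarrow> st (C l u v) = C l v u"
    and act: "\<And>a l. a \<in> carrier (Hec n q) \<Longrightarrow> l \<in> Par n \<Longrightarrow>
      \<exists>r. is_cell_action (Hec n q) (Par n) dominated_by N C l a r"
    using cd unfolding cell_datum_def by blast+
  note bas = basis[unfolded is_basis_def]
  have carK: "?P ` ?K \<subseteq> carrier (Hec n q)" by (rule conjunct1[OF bas])
  have car: "C l u v \<in> carrier (Hec n q)" if "l \<in> Par n" "u \<in> N l" "v \<in> N l" for l u v
    by (rule subsetD[OF carK], rule image_eqI[of _ _ "(l, u, v)"]) (use that in auto)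
  have finK: "finite ?K" using finite_Par finN by auto
  have img: "(\<lambda>k. ev q (?P k)) ` ?K = {ev q (C l u v) | l u v. l \<in> Par n \<and> u \<in> N l \<and> v \<in> N l}"
    by force
  have "lin_span (Hec n q) (?P ` ?K) = carrier (Hec n q)"
    by (rule conjunct1[OF conjunct2[OF bas]])
  then have span: "endo_span ((\<lambda>k. ev q (?P k)) ` ?K) = H"
    using ev_lin_span[OF carK] Hec_image by (simp add: image_image)
  have ind: "\<forall>k\<in>?K. a k = 0" if a: "(\<Sum>k\<in>?K. smul (a k) (ev q (?P k))) = 0" for a
  proof
    fix k assume k: "k \<in> ?K"
    \<comment> \<open>The notion of basis concerns a set of elements; injectivity of the indexing
      turns coefficients of indices into coefficients of elements.\<close>
    let ?F = "?P ` ?K" and ?c = "\<lambda>b. a (inv_into ?K ?P b)"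
    have cF: "b \<in> carrier (Hec n q)" if "b \<in> ?F" for b using carK that by blast
    have "ev q (\<Oplus>\<^bsub>Hec n q\<^esub>b\<in>?F. ?c b \<odot>\<^bsub>Hec n q\<^esub> b) = (\<Sum>b\<in>?F. ev q (?c b \<odot>\<^bsub>Hec n q\<^esub> b))"
      by (rule ev_finsum(2)[OF finite_imageI[OF finK] Hec_closed(3)[OF cF]])
    also have "\<dots> = (\<Sum>b\<in>?F. smul (?c b) (ev q b))"
      by (intro sum.cong refl ev_smult cF)
    also have "\<dots> = (\<Sum>k\<in>?K. smul (?c (?P k)) (ev q (?P k)))"
      by (simp add: sum.reindex[OF inj])
    also have "\<dots> = (\<Sum>k\<in>?K. smul (a k) (ev q (?P k)))"
      by (intro sum.cong refl) (simp add: inv_into_f_f[OF inj])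
    finally have "ev q (\<Oplus>\<^bsub>Hec n q\<^esub>b\<in>?F. ?c b \<odot>\<^bsub>Hec n q\<^esub> b) = ev q \<zero>\<^bsub>Hec n q\<^esub>"
      using a by (simp add: ev_zero)
    then have "(\<Oplus>\<^bsub>Hec n q\<^esub>b\<in>?F. ?c b \<odot>\<^bsub>Hec n q\<^esub> b) = \<zero>\<^bsub>Hec n q\<^esub>"
      by (rule ev_inj[of _ n q, rotated 2])
        (rule ev_finsum(1)[OF finite_imageI[OF finK]], rule Hec_closed(3), erule cF, rule Hec_closed(4))
    then have "\<forall>b\<in>?F. ?c b = 0"
      using conjunct2[OF conjunct2[OF bas], rule_format, of ?F ?c] finite_imageI[OF finK] by blast
    then have "?c (?P k) = 0" using k by blast
    then show "a k = 0" using inv_into_f_f[OF inj k] by simp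
  qed
  have mH: "ev q (?P k) \<in> H" if "k \<in> ?K" for k
    by (rule ev_Hk, rule subsetD[OF carK], rule imageI[OF that])
  obtain D0 where D: "\<forall>k\<in>?K. D0 k \<in> H \<and> (\<forall>j\<in>?K. tr (ev q (?P j) * D0 k) = (if j = k then 1 else 0))"
    by (rule exE[OF basis_dual[OF finK mH span ind]])
  have D0: "D0 k \<in> H" "j \<in> ?K \<Longrightarrow> tr (ev q (?P j) * D0 k) = (if j = k then 1 else 0)" if "k \<in> ?K" for j k
    by (rule conjunct1[OF bspec[OF D that]], rule bspec[OF conjunct2[OF bspec[OF D that]]])
  have st: "\<And>a. a \<in> carrier (Hec n q) \<Longrightarrow> st a \<in> carrier (Hec n q)"
    "\<And>a b. a \<in> carrier (Hec n q) \<Longrightarrow> b \<in> carrier (Hec n q) \<Longrightarrow> st (a \<oplus>\<^bsub>Hec n q\<^esub> b) = st a \<oplus>\<^bsub>Hec n q\<^esub> st b"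
    "\<And>a r. a \<in> carrier (Hec n q) \<Longrightarrow> st (r \<odot>\<^bsub>Hec n q\<^esub> a) = r \<odot>\<^bsub>Hec n q\<^esub> st a"
    "\<And>a b. a \<in> carrier (Hec n q) \<Longrightarrow> b \<in> carrier (Hec n q) \<Longrightarrow> st (a \<otimes>\<^bsub>Hec n q\<^esub> b) = st b \<otimes>\<^bsub>Hec n q\<^esub> st a"
    "\<And>a. a \<in> carrier (Hec n q) \<Longrightarrow> st (st a) = a"
    using anti unfolding is_involutory_antiaut_def is_linear_endo_def by (auto simp: Pi_def)
  have ue: "unev n q (a + b) = unev n q a \<oplus>\<^bsub>Hec n q\<^esub> unev n q b"
    "unev n q (a * b) = unev n q a \<otimes>\<^bsub>Hec n q\<^esub> unev n q b"
    "unev n q (smul r a) = r \<odot>\<^bsub>Hec n q\<^esub> unev n q a" if "a \<in> H" "b \<in> H" for a b r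
    by (rule ev_inj[of _ n q]; simp add: ev_simps unev that Hk_add Hk_mult Hk_smul)+
  have mA: "X \<in> cell_span (Hec n q) N C (?below l) \<Longrightarrow> ev q X \<in> ?A (?below l)" for X l
    using mem_cell_span[of "?below l" N C n q X] car by simp
  have cellE: "ev q a * ev q (C l u v) - (\<Sum>u'\<in>N l. smul (r u' u) (ev q (C l u' v))) \<in> ?A (?below l)"
    if "is_cell_action (Hec n q) (Par n) dominated_by N C l a r" "a \<in> carrier (Hec n q)"
      "l \<in> Par n" "u \<in> N l" "v \<in> N l" for a l u v r
  proof -
    have f: "(\<Oplus>\<^bsub>Hec n q\<^esub>u'\<in>N l. r u' u \<odot>\<^bsub>Hec n q\<^esub> C l u' v) \<in> carrier (Hec n q)"
      "ev q (\<Oplus>\<^bsub>Hec n q\<^esub>u'\<in>N l. r u' u \<odot>\<^bsub>Hec n q\<^esub> C l u' v) = (\<Sum>u'\<in>N l. ev q (r u' u \<odot>\<^bsub>Hec n q\<^esub> C l u' v))"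
      using that finN car by (auto intro!: ev_finsum Hec_closed(3))
    have "ev q ((a \<otimes>\<^bsub>Hec n q\<^esub> C l u v) \<ominus>\<^bsub>Hec n q\<^esub> (\<Oplus>\<^bsub>Hec n q\<^esub>u'\<in>N l. r u' u \<odot>\<^bsub>Hec n q\<^esub> C l u' v)) \<in> ?A (?below l)"
      using that by (intro mA) (simp add: is_cell_action_def)
    moreover have "(\<Sum>u'\<in>N l. ev q (r u' u \<odot>\<^bsub>Hec n q\<^esub> C l u' v)) = (\<Sum>u'\<in>N l. smul (r u' u) (ev q (C l u' v)))"
      using that car by (intro sum.cong refl ev_smult) blast
    ultimately show ?thesis
      using that car f by (simp add: ev_minus ev_mult Hec_closed)
  qed
  have "hecke_cells n q N (\<lambda>l u v. ev q (C l u v)) (\<lambda>a. ev q (st (unev n q a))) (\<lambda>l u v. D0 (l, u, v))"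
  proof (intro hecke_cells.intro hecke_unit_axioms hecke_cells_axioms.intro)
    show "?A (Par n) = H" using span unfolding img .
    show "D0 (l, u, v) \<in> H" if "l \<in> Par n" "u \<in> N l" "v \<in> N l" for l u v
      by (rule D0(1)) (use that in auto)
    show "tr (ev q (C l' u' v') * D0 (l, u, v)) = (if l = l' \<and> u = u' \<and> v = v' then 1 else 0)"
      if "l \<in> Par n" "u \<in> N l" "v \<in> N l" "l' \<in> Par n" "u' \<in> N l'" "v' \<in> N l'" for l u v l' u' v'
      using D0(2)[of "(l, u, v)" "(l', u', v')"] that by auto
    show "ev q (st (unev n q a)) \<in> H" if "a \<in> H" for a
      using that by (intro ev_Hk st unev)
    show "ev q (st (unev n q (a + b))) = ev q (st (unev n q a)) + ev q (st (unev n q b))"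
      if "a \<in> H" "b \<in> H" for a b
      using that by (simp add: ue st unev ev_add)
    show "ev q (st (unev n q (smul r a))) = smul r (ev q (st (unev n q a)))" if "a \<in> H" for a r
      using that by (simp add: ue(3)[OF that that] st unev ev_smult)
    show "ev q (st (unev n q (a * b))) = ev q (st (unev n q b)) * ev q (st (unev n q a))"
      if "a \<in> H" "b \<in> H" for a b
      using that by (simp add: ue st unev ev_mult)
    show "ev q (st (unev n q (ev q (st (unev n q a))))) = a" if "a \<in> H" for a
      using that by (simp add: unev_ev st unev)
    show "ev q (st (unev n q (ev q (C l u v)))) = ev q (C l v u)"
      if "l \<in> Par n" "u \<in> N l" "v \<in> N l" for l u v
      using that by (simp add: unev_ev stC car)
    show "\<exists>r. \<forall>u\<in>N l. \<forall>v\<in>N l.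
        a * ev q (C l u v) - (\<Sum>u'\<in>N l. smul (r u' u) (ev q (C l u' v))) \<in> ?A (?below l)"
      if "a \<in> H" "l \<in> Par n" for a l
    proof -
      note ua = unev[OF that(1)]
      from act[OF ua(1) that(2)] obtain r
        where r: "is_cell_action (Hec n q) (Par n) dominated_by N C l (unev n q a) r" ..
      show ?thesis
        by (rule exI[of _ r], intro ballI) (rule cellE[OF r ua(1) that(2), unfolded ua(2)])
    qed
    show "a * ev q (C l u v) \<in> ?A (?below l)"
      if a: "a \<in> H" and l: "l \<in> Par n" and u: "u \<in> N l" "v \<in> N l"
        and st: "\<And>y. y \<in> yideal (insert l (above n l)) \<Longrightarrow> star a * y \<in> yideal (above n l)" for a l u v
    proof -
      note ua = unev[OF a]
      obtain r where r: "is_cell_action (Hec n q) (Par n) dominated_by N C l (unev n q a) r"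
        "\<And>u u'. u \<in> N l \<Longrightarrow> u' \<in> N l \<Longrightarrow> r u' u = 0"
        using cell_module_kill[OF l finN[OF l] act[OF ua(1) l] iso[OF l] ua(1)] st unfolding ua(2) by blast
      have "(\<Sum>u'\<in>N l. smul (r u' u) (ev q (C l u' v))) = 0" using r(2) u by (intro sum.neutral) simp
      then show ?thesis using cellE[OF r(1) ua(1) l u] ua(2) by simp
    qed
  qed (use finN pos in auto)
  then show ?thesis by blast
qed

end

section \<open>Coarsenings\<close>

lemma image_mset_eq_mset:
  "image_mset f P = mset xs \<Longrightarrow> \<exists>ps. mset ps = P \<and> map f ps = xs"
proof (induction xs arbitrary: P)
  case (Cons x xs)
  then obtain P' p where P: "P = add_mset p P'" "f p = x" "image_mset f P' = mset xs"
    by (metis mset.simps(2) msed_map_invR)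
  from Cons.IH[OF P(3)] obtain ps where "mset ps = P'" "map f ps = xs" by blast
  then show ?case using P by (intro exI[of _ "p # ps"]) simp
qed simp

text \<open>Multisets are replaced by lists whose order follows the parts of \<open>mu\<close>: the
  concatenation rearranges \<open>la\<close> and is a composition refining
  \<open>mu\<close>.\<close>

lemma coarsening_concat:
  assumes "is_coarsening mu la"
  obtains L where "mset (concat L) = mset la" "map sum_list L = mu"
proof -
  obtain P where P: "sum_mset P = mset la" "image_mset sum_mset P = mset mu"
    using assms by (auto simp: is_coarsening_def)
  obtain ps where ps: "mset ps = P" "map sum_mset ps = mu" using image_mset_eq_mset[OF P(2)] by blast
  define g :: "nat multiset \<Rightarrow> nat list" where "g p = (SOME l. mset l = p)" for p
  have g: "mset (g p) = p" for p unfolding g_def using ex_mset by (rule someI_ex)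
  have "mset (concat (map g ps)) = mset la"
    using P(1) ps(1) g by (simp add: mset_concat sum_mset_sum_list[symmetric] o_def)
  moreover have "map sum_list (map g ps) = mu"
    using ps(2) g by (simp add: o_def sum_mset_sum_list[symmetric])
  ultimately show thesis using that by blast
qed

lemma is_coarsening_refl: "is_coarsening la la"
  unfolding is_coarsening_def
  by (rule exI[of _ "image_mset (\<lambda>x. {#x#}) (mset la)"]) (simp add: image_mset.compositionality o_def)

text \<open>Each partial sum of the coarse composition is a partial sum of the fine one, so a block
  of the fine one is never cut.\<close>

lemma row_concat:
  assumes rs: "r \<in> {1..sum_list (concat L)}" "s \<in> {1..sum_list (concat L)}"
    and eq: "row (concat L) r = row (concat L) s"
  shows "row (map sum_list L) r = row (map sum_list L) s"
proof -
  let ?\<kappa> = "concat L" and ?\<mu> = "map sum_list L"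
  have sc: "sum_list (map sum_list M) = sum_list (concat M)" for M :: "nat list list"
    by (induction M) simp_all
  have mono: "(\<Sum>j<a. part la j) \<le> (\<Sum>j<b. part la j)" if "a \<le> b" for a b la
    using that by (intro sum_mono2) auto
  have cut: "\<exists>k. (\<Sum>j<b. part ?\<mu> j) = (\<Sum>j<k. part ?\<kappa> j)" for b
  proof (rule exI)
    have "(\<Sum>j<b. part ?\<mu> j) = sum_list (take b ?\<mu>)" by (simp add: sum_list_take_part)
    also have "\<dots> = sum_list (concat (take b L))" by (simp only: take_map sc)
    also have "concat (take b L) = take (length (concat (take b L))) ?\<kappa>"
      using concat_append[of "take b L" "drop b L"] by (metis append_take_drop_id append_eq_conv_conj)
    finally show "(\<Sum>j<b. part ?\<mu> j) = (\<Sum>j<length (concat (take b L)). part ?\<kappa> j)"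
      by (simp only: sum_list_take_part)
  qed
  have "\<not> row ?\<mu> r < row ?\<mu> s"
    if rs: "r \<in> {1..sum_list ?\<kappa>}" "s \<in> {1..sum_list ?\<kappa>}" "row ?\<kappa> r = row ?\<kappa> s" for r s
  proof
    assume less: "row ?\<mu> r < row ?\<mu> s"
    obtain k where k: "(\<Sum>j<row ?\<mu> s. part ?\<mu> j) = (\<Sum>j<k. part ?\<kappa> j)" using cut by blast
    have "r \<le> (\<Sum>j<Suc (row ?\<mu> r). part ?\<mu> j)"
      using row_bounds(3)[of r ?\<mu>] rs(1) sc[of L] by (simp add: lessThan_Suc_atMost)
    also have "\<dots> \<le> (\<Sum>j<row ?\<mu> s. part ?\<mu> j)" using less by (intro mono) simp
    finally have "r \<le> (\<Sum>j<k. part ?\<kappa> j)" unfolding k .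
    moreover have "(\<Sum>j<row ?\<kappa> r. part ?\<kappa> j) < r" using row_bounds(2) rs(1) .
    ultimately have "row ?\<kappa> r < k" using mono[of k "row ?\<kappa> r" ?\<kappa>] by (meson leD leI less_le_trans)
    then have "(\<Sum>j<Suc (row ?\<kappa> r). part ?\<kappa> j) \<le> (\<Sum>j<k. part ?\<kappa> j)" by (intro mono) simp
    moreover have "s \<le> (\<Sum>j<Suc (row ?\<kappa> r). part ?\<kappa> j)"
      unfolding rs(3) lessThan_Suc_atMost by (rule row_bounds(3)[OF rs(2)])
    moreover have "(\<Sum>j<k. part ?\<kappa> j) < s"
      using row_bounds(2)[of s ?\<mu>] rs(2) sc[of L] unfolding k by simp
    ultimately show False by simp
  qed
  from this[OF rs eq] this[OF rs(2,1) eq[symmetric]] show ?thesis by simp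
qed

lemma rearranged_word:
  assumes la: "sum_list la = n" and ms: "mset \<kappa> = mset la"
  obtains c where "c \<in> words n (row la)"
    "\<And>r s. r \<in> {1..n} \<Longrightarrow> s \<in> {1..n} \<Longrightarrow> c r = c s \<longleftrightarrow> row \<kappa> r = row \<kappa> s"
proof -
  obtain p where p: "p permutes {..<length la}" "permute_list p la = \<kappa>"
    using mset_eq_permutation[OF ms] by blast
  have len: "length \<kappa> = length la" using ms by (metis size_mset)
  have n: "sum_list \<kappa> = n" using ms la by (metis sum_mset_sum_list)
  have part: "part la (p i) = part \<kappa> i" for i
  proof (cases "i < length la")
    case True
    then have "p i < length la" using permutes_in_image[OF p(1)] by simp
    then show ?thesis using True p len permute_list_nth[OF p(1) True] by (simp add: part_def)
  next
    case False
    then show ?thesis using permutes_not_in[OF p(1)] len by (simp add: part_def)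
  qed
  have pinj: "p x = p y \<longleftrightarrow> x = y" for x y using permutes_inj[OF p(1)] by (auto dest: injD)
  define c where "c r = (if r \<in> {1..n} then p (row \<kappa> r) else row la r)" for r
  have "cntw n c l = cntw n (row la) l" for l
  proof -
    obtain i where i: "l = p i" using permutes_surj[OF p(1)] by (metis surjD)
    have "cntw n c l = cntw n (row \<kappa>) i"
      unfolding cntw_def i by (rule arg_cong[of _ _ card]) (auto simp: c_def pinj)
    also have "\<dots> = cntw n (row la) l" using cntw_row[of \<kappa> i] cntw_row[of la l] n la part[of i] i by simp
    finally show ?thesis .
  qed
  then have "c \<in> words n (row la)" unfolding words_iff_cntw by (simp add: c_def)
  moreover have "c r = c s \<longleftrightarrow> row \<kappa> r = row \<kappa> s" if "r \<in> {1..n}" "s \<in> {1..n}" for r s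
    using that by (simp add: c_def pinj)
  ultimately show thesis using that by blast
qed

context hecke_unit
begin

text \<open>The Young subgroup of \<open>mu\<close> contains that of the refining composition, so
  its Young sum is a left multiple of the finer one. The latter differs from that of
  \<open>la\<close> only by the order of the parts, which is a conjugation.\<close>

lemma Y_coarsening:
  assumes la: "la \<in> Par n" and co: "is_coarsening mu la"
  shows "\<exists>h\<in>H. \<exists>h'\<in>H. Y (row mu) = h * Y (row la) * h'"
proof -
  obtain L where L: "mset (concat L) = mset la" "map sum_list L = mu"
    using coarsening_concat[OF co] by blast
  let ?\<kappa> = "concat L"
  have n: "sum_list la = n" "sum_list ?\<kappa> = n"
    using sum_list_Par[OF la] L(1) by (simp, metis sum_mset_sum_list)
  have mono: "mono_on {1..n} (row ?\<kappa>)" "mono_on {1..n} (row la)"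
    using row_mono[of ?\<kappa>] row_mono[of la] n by simp_all
  have "\<exists>h\<in>H. Y (row mu) = h * Y (row ?\<kappa>)"
  proof (rule right_invariant[OF mono(1) Y_Hk])
    fix i assume i: "i \<in> {1..<n}" "row ?\<kappa> i = row ?\<kappa> (Suc i)"
    then have "row mu i = row mu (Suc i)"
      using row_concat[of i L "Suc i"] n L(2) by simp
    with i(1) show "Y (row mu) * T q i = smul q (Y (row mu))" by (rule Y_T)
  qed
  then obtain h where h: "h \<in> H" "Y (row mu) = h * Y (row ?\<kappa>)" by blast
  obtain c where c: "c \<in> words n (row la)"
    "\<And>r s. r \<in> {1..n} \<Longrightarrow> s \<in> {1..n} \<Longrightarrow> c r = c s \<longleftrightarrow> row ?\<kappa> r = row ?\<kappa> s"
    using rearranged_word[OF n(1) L(1)] by blast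
  obtain g g' where "g \<in> H" "g' \<in> H" "Y (row ?\<kappa>) = g * Y (row la) * g'"
    using Y_conjugate[OF mono c] by blast
  then show ?thesis using h by (intro bexI[of _ "h * g"] bexI[of _ g']) (simp_all add: Hk_mult mult.assoc)
qed

lemma annihilates_coarsenings:
  assumes \<sigma>: "\<sigma> \<subseteq> Par n"
  shows "(\<forall>la\<in>\<sigma>. \<forall>h\<in>H. a * (h * Y (row la)) = 0) \<longleftrightarrow> (\<forall>y\<in>yideal (coarsenings n \<sigma>). a * y = 0)"
proof
  assume *: "\<forall>la\<in>\<sigma>. \<forall>h\<in>H. a * (h * Y (row la)) = 0"
  have "yideal (coarsenings n \<sigma>) \<subseteq> {y. a * y = 0}"
    unfolding yideal_def
  proof (rule endo.span_minimal, clarify)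
    fix h h' mu assume h: "h \<in> H" "h' \<in> H" and "mu \<in> coarsenings n \<sigma>"
    then obtain la where la: "la \<in> \<sigma>" "is_coarsening mu la" by (auto simp: coarsenings_def)
    then obtain g g' where g: "g \<in> H" "g' \<in> H" "Y (row mu) = g * Y (row la) * g'"
      using Y_coarsening \<sigma> by blast
    have "a * (h * Y (row mu) * h') = a * ((h * g) * Y (row la)) * (g' * h')"
      by (simp add: g(3) mult.assoc)
    also have "\<dots> = 0" using * la(1) Hk_mult[OF h(1) g(1)] by simp
    finally show "a * (h * Y (row mu) * h') = 0" .
  qed (simp add: endo.subspace_def distrib_left)
  then show "\<forall>y\<in>yideal (coarsenings n \<sigma>). a * y = 0" by blast
next
  assume *: "\<forall>y\<in>yideal (coarsenings n \<sigma>). a * y = 0"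
  show "\<forall>la\<in>\<sigma>. \<forall>h\<in>H. a * (h * Y (row la)) = 0"
  proof (intro ballI)
    fix la h assume la: "la \<in> \<sigma>" and h: "h \<in> H"
    have "la \<in> coarsenings n \<sigma>" using la \<sigma> is_coarsening_refl by (auto simp: coarsenings_def)
    then have "h * Y (row la) * 1 \<in> yideal (coarsenings n \<sigma>)" using h by (intro yideal_gen) simp_all
    then show "a * (h * Y (row la)) = 0" using * by simp
  qed
qed

lemma upclosed_coarsenings: "co_saturated n (coarsenings n \<sigma>) \<Longrightarrow> upclosed (coarsenings n \<sigma>)"
  by (auto simp: upclosed_def co_saturated_def above_def coarsenings_def)

end

section \<open>Laurent polynomials\<close>

lemma laurent_x_power: "laurent_x ^ k = Poly_Mapping.single (int k) 1"
  by (induction k) (simp_all add: laurent_x_def mult_single)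

lemma laurent_x_unit: "laurent_x dvd 1"
proof
  show "1 = laurent_x * Poly_Mapping.single (- 1) 1" by (simp add: laurent_x_def mult_single)
qed

text \<open>The degree M is at least twice the top degree of f plus the shift k, so only the square
  of the top coefficient can contribute.\<close>

lemma lookup_square_top:
  fixes f :: laurent
  assumes d: "\<And>a. a \<in> Poly_Mapping.keys f \<Longrightarrow> a \<le> d" and M: "k + 2 * d \<le> M"
  shows "Poly_Mapping.lookup (Poly_Mapping.single k 1 * f * f) M
    = (if k + 2 * d = M then (Poly_Mapping.lookup f d)\<^sup>2 else 0)"
proof -
  let ?K = "Poly_Mapping.keys f" and ?l = "Poly_Mapping.lookup f"
  have f: "f = (\<Sum>a\<in>?K. Poly_Mapping.single a (?l a))" by (rule poly_mapping_sum_single)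
  have "Poly_Mapping.single k 1 * f * f
      = Poly_Mapping.single k 1 * (\<Sum>a\<in>?K. Poly_Mapping.single a (?l a)) * (\<Sum>a\<in>?K. Poly_Mapping.single a (?l a))"
    by (simp only: f[symmetric])
  also have "\<dots> = (\<Sum>a\<in>?K. \<Sum>b\<in>?K. Poly_Mapping.single (k + a + b) (?l a * ?l b))"
    by (simp only: sum_distrib_left[of "Poly_Mapping.single k 1"] mult_single mult_1 sum_product)
  finally have "Poly_Mapping.lookup (Poly_Mapping.single k 1 * f * f) M
      = (\<Sum>a\<in>?K. \<Sum>b\<in>?K. if k + a + b = M then ?l a * ?l b else 0)"
    by (simp add: lookup_sum lookup_single when_def)
  also have "\<dots> = (\<Sum>a\<in>?K. \<Sum>b\<in>?K. if b = d then (if a = d then (if k + 2 * d = M then ?l d * ?l d else 0) else 0) else 0)"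
  proof (intro sum.cong refl)
    fix a b assume "a \<in> ?K" "b \<in> ?K"
    then have "a \<le> d" "b \<le> d" using d by blast+
    then have "k + a + b = M \<longleftrightarrow> b = d \<and> a = d \<and> k + 2 * d = M" using M by auto
    then show "(if k + a + b = M then ?l a * ?l b else 0)
        = (if b = d then (if a = d then (if k + 2 * d = M then ?l d * ?l d else 0) else 0) else 0)"
      by auto
  qed
  also have "\<dots> = (if d \<in> ?K then (if k + 2 * d = M then ?l d * ?l d else 0) else 0)"
    by simp
  finally show ?thesis by (simp add: power2_eq_square in_keys_iff)
qed

text \<open>The top coefficients of the terms are squares, so that they cannot cancel.\<close>

lemma laurent_squares_zero:
  fixes u :: "'c \<Rightarrow> laurent"
  assumes F: "finite F" and zero: "(\<Sum>c\<in>F. laurent_x ^ k c * u c * u c) = 0"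
  shows "\<forall>c\<in>F. u c = 0"
proof (rule ccontr)
  assume "\<not> (\<forall>c\<in>F. u c = 0)"
  then have ne: "{c \<in> F. u c \<noteq> 0} \<noteq> {}" by blast
  let ?G = "{c \<in> F. u c \<noteq> 0}"
  define d where "d c = Max (Poly_Mapping.keys (u c))" for c
  define M where "M = Max ((\<lambda>c. int (k c) + 2 * d c) ` ?G)"
  have top: "Poly_Mapping.lookup (laurent_x ^ k c * u c * u c) M
      = (if int (k c) + 2 * d c = M then (Poly_Mapping.lookup (u c) (d c))\<^sup>2 else 0)" if "c \<in> ?G" for c
    unfolding laurent_x_power
  proof (rule lookup_square_top)
    show "a \<le> d c" if "a \<in> Poly_Mapping.keys (u c)" for a unfolding d_def using that by simp
    show "int (k c) + 2 * d c \<le> M" unfolding M_def using that F by (intro Max_ge) auto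
  qed
  have "M \<in> (\<lambda>c. int (k c) + 2 * d c) ` ?G" unfolding M_def using ne F by (intro Max_in) auto
  then obtain c0 where c0: "c0 \<in> ?G" "int (k c0) + 2 * d c0 = M" by blast
  have "d c0 \<in> Poly_Mapping.keys (u c0)" unfolding d_def using c0(1) by (intro Max_in) auto
  then have "0 < Poly_Mapping.lookup (laurent_x ^ k c0 * u c0 * u c0) M"
    using top[OF c0(1)] c0(2) by (simp add: in_keys_iff)
  moreover have "Poly_Mapping.lookup (laurent_x ^ k c * u c * u c) M \<ge> 0" if "c \<in> F" for c
    using top[of c] that by (cases "u c = 0") simp_all
  ultimately have "0 < (\<Sum>c\<in>F. Poly_Mapping.lookup (laurent_x ^ k c * u c * u c) M)"
    using F c0(1) by (intro sum_pos2[of F c0]) auto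
  also have "\<dots> = 0" using zero by (simp add: lookup_sum[symmetric])
  finally show False by simp
qed

text \<open>tr(x \<open>star\<close> x) is the form \<open>bf\<close> at a vector paired with
  itself: squares of its coordinates weighted by powers of the variable.\<close>

lemma laurent_star_pos:
  assumes x: "x \<in> Hk n laurent_x" and zero: "x * hecke_unit.star n laurent_x x = 0"
  shows "x = 0"
proof -
  interpret hecke_unit n laurent_x by (unfold_locales) (rule laurent_x_unit)
  let ?v = "star x \<triangleright> de id"
  have "(\<Sum>c\<in>P. laurent_x ^ ninv n c * ?v c * ?v c) = tr (x * star x)"
    unfolding tr_mult[OF x] bf_def ..
  also have "\<dots> = 0" unfolding zero by (rule tr_zero)
  finally have v: "\<forall>c\<in>P. ?v c = 0" by (rule laurent_squares_zero[OF finite_perms])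
  have "star x = 0"
  proof (rule Hk_eqI[of _ n laurent_x])
    show "?v = 0 \<triangleright> de id"
    proof
      fix c show "?v c = (0 \<triangleright> de id) c"
        using v supp_Hk[OF star_Hk[OF x] supp_de[OF permutes_id[of "{1..n}"]]]
        by (cases "c permutes {1..n}") (auto simp: supp_def)
    qed
  qed (simp_all add: x star_Hk)
  then have "star (star x) = 0" by simp
  then show ?thesis by (simp add: star_star x)
qed

locale coeff_hom =
  fixes \<phi> :: "'a::comm_ring_1 \<Rightarrow> 'b::comm_ring_1"
  assumes add: "\<phi> (a + b) = \<phi> a + \<phi> b" and mult: "\<phi> (a * b) = \<phi> a * \<phi> b" and one: "\<phi> 1 = 1"
begin

lemma zero [simp]: "\<phi> 0 = 0"
  using add[of 0 0] by simp

lemma sum: "\<phi> (sum f A) = (\<Sum>i\<in>A. \<phi> (f i))"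
  by (induction A rule: infinite_finite_induct) (simp_all add: add)

lemma diff: "\<phi> (a - b) = \<phi> a - \<phi> b"
  using add[of "a - b" b] by (simp add: algebra_simps)

end

text \<open>Truncation by \<open>nat\<close> leaves one of the two exponents 0, so a single formula
  covers both signs.\<close>

lemma unit_power_eq:
  assumes "q * i = 1"
  shows "unit_power q k = q ^ nat k * i ^ nat (- k)"
proof -
  have "(THE r. q * r = 1) = i"
  proof (rule the_equality)
    show "q * i = 1" by (rule assms)
    fix r assume "q * r = 1"
    then have "i * (q * r) = i" by simp
    then show "r = i" using assms by (simp add: mult.assoc[symmetric] mult.commute[of i])
  qed
  then show ?thesis by (simp add: unit_power_def)
qed

lemma unit_power_add:
  assumes "q dvd 1"
  shows "unit_power q (k + l) = unit_power q k * unit_power q l"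
proof -
  obtain i where i: "q * i = 1" using assms by (metis dvdE)
  have shift: "q ^ a * i ^ b = q ^ a' * i ^ b'" if "a + b' = a' + b" for a b a' b'
  proof -
    have qi: "q ^ m * i ^ m = 1" for m by (simp add: power_mult_distrib[symmetric] i)
    have "q ^ a * i ^ b = q ^ a * i ^ b * (q ^ b' * i ^ b')" by (simp add: qi)
    also have "\<dots> = q ^ (a + b') * i ^ (b + b')" by (simp add: power_add mult_ac)
    also have "\<dots> = q ^ a' * i ^ b' * (q ^ b * i ^ b)" unfolding that by (simp add: power_add mult_ac)
    finally show ?thesis by (simp add: qi)
  qed
  have "unit_power q k * unit_power q l = q ^ (nat k + nat l) * i ^ (nat (- k) + nat (- l))"
    by (simp add: unit_power_eq[OF i] power_add mult_ac)
  also have "\<dots> = unit_power q (k + l)" unfolding unit_power_eq[OF i] by (rule shift) linarith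
  finally show ?thesis by simp
qed

lemma laurent_eval_superset:
  "finite S \<Longrightarrow> Poly_Mapping.keys f \<subseteq> S \<Longrightarrow>
    laurent_eval q f = (\<Sum>k\<in>S. of_int (Poly_Mapping.lookup f k) * unit_power q k)"
  unfolding laurent_eval_def by (rule sum.mono_neutral_left) (auto simp: in_keys_iff)

lemma laurent_eval_single: "laurent_eval q (Poly_Mapping.single k c) = of_int c * unit_power q k"
  using laurent_eval_superset[of "{k}" "Poly_Mapping.single k c" q] by simp

lemma laurent_eval_add: "laurent_eval q (f + g) = laurent_eval q f + laurent_eval q g"
proof -
  let ?S = "Poly_Mapping.keys f \<union> Poly_Mapping.keys g"
  have "Poly_Mapping.keys (f + g) \<subseteq> ?S" by (rule Poly_Mapping.keys_add)
  then show ?thesis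
    using laurent_eval_superset[of ?S f q] laurent_eval_superset[of ?S g q] laurent_eval_superset[of ?S "f + g" q]
    by (simp add: lookup_add distrib_right sum.distrib)
qed

lemma laurent_eval_hom:
  assumes q: "q dvd 1"
  shows "coeff_hom (laurent_eval q)"
proof
  have z: "laurent_eval q 0 = 0" by (simp add: laurent_eval_def)
  have s: "laurent_eval q (sum f A) = (\<Sum>i\<in>A. laurent_eval q (f i))" for f :: "'z \<Rightarrow> laurent" and A
    by (induction A rule: infinite_finite_induct) (simp_all add: z laurent_eval_add)
  fix f g :: laurent
  show "laurent_eval q (f + g) = laurent_eval q f + laurent_eval q g" by (rule laurent_eval_add)
  show "laurent_eval q 1 = 1"
    using laurent_eval_single[of q 0 1] by (simp add: unit_power_def)
  have "f * g = (\<Sum>a\<in>Poly_Mapping.keys f. Poly_Mapping.single a (Poly_Mapping.lookup f a))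
      * (\<Sum>b\<in>Poly_Mapping.keys g. Poly_Mapping.single b (Poly_Mapping.lookup g b))"
    by (simp only: poly_mapping_sum_single[symmetric])
  also have "\<dots> = (\<Sum>a\<in>Poly_Mapping.keys f. \<Sum>b\<in>Poly_Mapping.keys g.
      Poly_Mapping.single (a + b) (Poly_Mapping.lookup f a * Poly_Mapping.lookup g b))"
    unfolding sum_product mult_single ..
  finally have "laurent_eval q (f * g) = (\<Sum>a\<in>Poly_Mapping.keys f. \<Sum>b\<in>Poly_Mapping.keys g.
      of_int (Poly_Mapping.lookup f a * Poly_Mapping.lookup g b) * unit_power q (a + b))"
    by (simp only: s laurent_eval_single)
  also have "\<dots> = laurent_eval q f * laurent_eval q g"
    unfolding laurent_eval_def sum_product by (intro sum.cong refl) (simp add: unit_power_add[OF q] mult_ac)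
  finally show "laurent_eval q (f * g) = laurent_eval q f * laurent_eval q g" .
qed

lemma laurent_eval_x: "laurent_eval q laurent_x = q"
  by (simp add: laurent_x_def laurent_eval_single unit_power_def)

section \<open>Base change\<close>

text \<open>The parameter of the target is the image of \<open>x\<close>; it is identified with the
  given q only at the end, by \<open>laurent_eval_x\<close>.\<close>

locale base_change = coeff_hom \<phi> + src: hecke_unit n x for n and x :: "'a::comm_ring_1" and \<phi> :: "'a \<Rightarrow> 'b::comm_ring_1"
begin

sublocale tgt: hecke_unit n "\<phi> x"
proof
  show "\<phi> x dvd 1" using src.unit one mult by (metis dvd_def)
qed

lemma lookup_map_hom: "Poly_Mapping.lookup (Poly_Mapping.map \<phi> f) w = \<phi> (Poly_Mapping.lookup f w)"
  by (simp add: Poly_Mapping.map.rep_eq when_def)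

text \<open>The operator is given by polynomial formulas in its parameter, so it commutes with
  applying a ring homomorphism to all values.\<close>

lemma T_base_change: "T (\<phi> x) i \<triangleright> (\<phi> \<circ> v) = \<phi> \<circ> (T x i \<triangleright> v)"
  by (rule ext) (simp add: T_app add mult diff one)

lemma Tl_base_change: "Tl (\<phi> x) l \<triangleright> (\<phi> \<circ> v) = \<phi> \<circ> (Tl x l \<triangleright> v)"
  by (induction l) (simp_all add: T_base_change del: o_apply)

lemma act_base_change: "act (\<phi> x) (Poly_Mapping.map \<phi> f) \<triangleright> (\<phi> \<circ> v) = \<phi> \<circ> (act x f \<triangleright> v)"
proof
  fix c
  let ?K = "Poly_Mapping.keys f"
  have "Poly_Mapping.keys (Poly_Mapping.map \<phi> f) \<subseteq> ?K"
    by (auto simp: in_keys_iff lookup_map_hom)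
  then have "(act (\<phi> x) (Poly_Mapping.map \<phi> f) \<triangleright> (\<phi> \<circ> v)) c
      = (\<Sum>w\<in>?K. \<phi> (Poly_Mapping.lookup f w) * (Tl (\<phi> x) (letters w) \<triangleright> (\<phi> \<circ> v)) c)"
    by (simp add: act_superset[of ?K] sum_app sum_fun_apply lookup_map_hom)
  also have "\<dots> = \<phi> ((act x f \<triangleright> v) c)"
    unfolding Tl_base_change by (simp add: act_superset[of ?K f x] sum_app sum_fun_apply sum mult)
  finally show "(act (\<phi> x) (Poly_Mapping.map \<phi> f) \<triangleright> (\<phi> \<circ> v)) c = (\<phi> \<circ> (act x f \<triangleright> v)) c" by simp
qed

lemma map_carrier: "f \<in> carrier (free_alg n) \<Longrightarrow> Poly_Mapping.map \<phi> f \<in> carrier (free_alg n)"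
  by (auto simp: carrier_free_alg in_keys_iff lookup_map_hom)

text \<open>Coefficients of some representing element of the free algebra are mapped. The result
  depends on the operator alone, as its value at \<open>de id\<close> is determined
  (\<open>bc_eqI\<close>).\<close>

definition bc :: "'a endo \<Rightarrow> 'b endo" where
  "bc a = act (\<phi> x) (Poly_Mapping.map \<phi> (SOME f. f \<in> carrier (free_alg n) \<and> act x f = a))"

lemma bc:
  assumes "a \<in> Hk n x"
  shows "bc a \<in> Hk n (\<phi> x)" "bc a \<triangleright> (\<phi> \<circ> v) = \<phi> \<circ> (a \<triangleright> v)"
proof -
  have "\<exists>f. f \<in> carrier (free_alg n) \<and> act x f = a" using assms by (blast elim: Hk_E)
  from someI_ex[OF this] have f: "(SOME f. f \<in> carrier (free_alg n) \<and> act x f = a) \<in> carrier (free_alg n)"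
    "act x (SOME f. f \<in> carrier (free_alg n) \<and> act x f = a) = a"
    by blast+
  show "bc a \<in> Hk n (\<phi> x)" unfolding bc_def by (intro Hk_I map_carrier f)
  show "bc a \<triangleright> (\<phi> \<circ> v) = \<phi> \<circ> (a \<triangleright> v)" unfolding bc_def act_base_change f(2) ..
qed

lemma comp_de: "\<phi> \<circ> de c = de c"
  by (rule ext) (simp add: de_def one)

lemma bc_de: "a \<in> Hk n x \<Longrightarrow> bc a \<triangleright> de c = \<phi> \<circ> (a \<triangleright> de c)"
  using bc(2)[of a "de c"] by (simp add: comp_de)

lemma bc_eqI: "a \<in> Hk n x \<Longrightarrow> b \<in> Hk n (\<phi> x) \<Longrightarrow> b \<triangleright> de id = \<phi> \<circ> (a \<triangleright> de id) \<Longrightarrow> bc a = b"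
  by (rule Hk_eqI[of _ n "\<phi> x"]) (simp_all add: bc(1) bc_de)

lemma bc_add: "a \<in> Hk n x \<Longrightarrow> b \<in> Hk n x \<Longrightarrow> bc (a + b) = bc a + bc b"
  by (rule bc_eqI) (auto simp: Hk_add bc(1) bc_de add fun_eq_iff)

lemma bc_smul: "a \<in> Hk n x \<Longrightarrow> bc (smul r a) = smul (\<phi> r) (bc a)"
  by (rule bc_eqI) (auto simp: Hk_smul bc(1) bc_de mult fun_eq_iff)

lemma bc_mult: "a \<in> Hk n x \<Longrightarrow> b \<in> Hk n x \<Longrightarrow> bc (a * b) = bc a * bc b"
  by (rule bc_eqI) (simp_all add: Hk_mult bc(1) bc_de bc(2) del: o_apply)

lemma bc_zero: "bc 0 = 0"
  by (rule bc_eqI) (auto simp: fun_eq_iff)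

lemma bc_Tw: "w permutes {1..n} \<Longrightarrow> bc (Tw n x w) = Tw n (\<phi> x) w"
  by (rule bc_eqI) (simp_all add: Hk_Tw Tw_de_id comp_de)

lemma bc_ys: "bc (ys n x \<pi>) = ys n (\<phi> x) \<pi>"
proof (rule bc_eqI[OF src.Y_Hk tgt.Y_Hk])
  have "\<phi> \<circ> chi n \<pi> \<pi> = chi n \<pi> \<pi>" by (rule ext) (simp add: chi_def one)
  then show "ys n (\<phi> x) \<pi> \<triangleright> de id = \<phi> \<circ> (ys n x \<pi> \<triangleright> de id)"
    by (simp add: src.Y_app tgt.Y_app)
qed

lemma tr_bc: "a \<in> Hk n x \<Longrightarrow> tgt.tr (bc a) = \<phi> (src.tr a)"
  by (simp add: src.tr_def tgt.tr_def bc_de)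

lemma bc_span:
  assumes Z: "endo_subspace Z" and X: "X \<subseteq> Hk n x" and XZ: "\<And>y. y \<in> X \<Longrightarrow> bc y \<in> Z" and a: "a \<in> endo_span X"
  shows "bc a \<in> Z"
proof -
  have "endo_span X \<subseteq> {a \<in> Hk n x. bc a \<in> Z}"
  proof (rule endo.span_minimal)
    show "endo_subspace {a \<in> Hk n x. bc a \<in> Z}"
      using endo.subspace_0[OF Z] endo.subspace_add[OF Z] endo.subspace_scale[OF Z]
      by (simp add: endo.subspace_def bc_zero bc_add bc_smul Hk_add Hk_smul)
  qed (use X XZ in auto)
  then show ?thesis using a by blast
qed

lemma hecke_map_ev:
  assumes A: "A \<in> carrier (Hec n x)"
  shows "hecke_map n (\<phi> x) \<phi> A \<in> carrier (Hec n (\<phi> x))" "ev (\<phi> x) (hecke_map n (\<phi> x) \<phi> A) = bc (ev x A)"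
proof -
  obtain f where f: "f \<in> carrier (free_alg n)" "A = hecke_class n x f" using A by (rule Hec_E)
  have bcf: "act (\<phi> x) (Poly_Mapping.map \<phi> g) = bc (act x f)" if "g \<in> A" for g
  proof -
    have d: "g - f \<in> hecke_ideal n x" using that f by (simp add: mem_hecke_class)
    have "act x g = act x f" using act_hecke_ideal[OF d] by (simp add: act_diff)
    moreover have "g \<in> carrier (free_alg n)"
      using free_alg_add[OF hecke_ideal_carrier[OF d] f(1)] by simp
    ultimately show ?thesis
      using f(1) act_base_change[of g "de id"]
      by (intro bc_eqI[symmetric]) (simp_all add: Hk_I map_carrier comp_de)
  qed
  have car: "g \<in> carrier (free_alg n)" if "g \<in> A" for g
    using free_alg_add[OF hecke_ideal_carrier f(1), of "g - f" x] that f by (simp add: mem_hecke_class)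
  have fA: "f \<in> A" using f by (simp add: mem_hecke_class hecke_ideal_zero)
  have "hecke_class n (\<phi> x) (Poly_Mapping.map \<phi> g) = hecke_class n (\<phi> x) (Poly_Mapping.map \<phi> f)" if "g \<in> A" for g
    using that fA bcf by (intro hecke_class_eqI map_carrier car) auto
  then have "hecke_map n (\<phi> x) \<phi> A = hecke_class n (\<phi> x) (Poly_Mapping.map \<phi> f)"
    using fA unfolding hecke_map_def by blast
  then show "hecke_map n (\<phi> x) \<phi> A \<in> carrier (Hec n (\<phi> x))" "ev (\<phi> x) (hecke_map n (\<phi> x) \<phi> A) = bc (ev x A)"
    using f bcf[OF fA] by (simp_all add: hecke_class_carrier map_carrier)
qed

text \<open>The mapped cell basis still spans, and the mapped dual family still reads off its
  coefficients by the trace form. Therefore both inclusions only use that the generic products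
  vanish and that the generic \<open>D\<close> with index in S lie in the generic ideal.\<close>

lemma cell_annihilator:
  assumes cells: "hecke_cells n x N C sta D" and S: "src.upclosed S" and a: "a \<in> Hk n (\<phi> x)"
  shows "(\<forall>y\<in>tgt.yideal S. a * y = 0) \<longleftrightarrow>
    a \<in> endo_span {bc (C l u v) | l u v. l \<in> Par n - S \<and> u \<in> N l \<and> v \<in> N l}"
    (is "_ \<longleftrightarrow> a \<in> endo_span ?G")
proof
  interpret hecke_cells n x N C sta D "\<lambda>\<tau>. endo_span {C l u v | l u v. l \<in> \<tau> \<and> u \<in> N l \<and> v \<in> N l}"
    by (rule cells) (rule reflexive)
  let ?K = "SIGMA l:Par n. N l \<times> N l"
  let ?c = "\<lambda>(l, u, v). bc (C l u v)"
  have SP: "S \<subseteq> Par n" using S by (simp add: src.upclosed_def)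
  {
    assume ann: "\<forall>y\<in>tgt.yideal S. a * y = 0"
    have "Tw n (\<phi> x) w \<in> endo_span (?c ` ?K)" if w: "w permutes {1..n}" for w
    proof -
      have "Tw n x w \<in> endo_span {C l u v | l u v. l \<in> Par n \<and> u \<in> N l \<and> v \<in> N l}"
        using span Hk_Tw[OF w] by simp
      then have "bc (Tw n x w) \<in> endo_span (?c ` ?K)"
        by (rule bc_span[OF endo.subspace_span, rotated 2])
          (use C_Hk in \<open>auto intro!: endo.span_base image_eqI[of _ ?c "(_, _, _)"]\<close>)
      then show ?thesis by (simp add: bc_Tw w)
    qed
    then have "Hk n (\<phi> x) \<subseteq> endo_span (?c ` ?K)"
      unfolding Hk_span_Tw by (intro endo.span_minimal endo.subspace_span) auto
    moreover have fK: "finite ?K" using finite_Par fin_N by auto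
    ultimately obtain b where b: "a = (\<Sum>k\<in>?K. smul (b k) (?c k))"
      using a smul_family_span[OF fK, of ?c] by blast
    have b0: "b k = 0" if k: "k \<in> ?K" "fst k \<in> S" for k
    proof -
      obtain l u v where luv: "k = (l, u, v)" "l \<in> Par n" "u \<in> N l" "v \<in> N l" "l \<in> S"
        using k by auto
      \<comment> \<open>The mapped element lies in the ideal over the target ring, so
        \<open>a\<close> annihilates it; the trace of the product is the coefficient at k.\<close>
      have "D l u v \<in> src.yideal S" using dual_yideal[OF S luv(5,3,4)] .
      then have "bc (D l u v) \<in> tgt.yideal S"
        unfolding src.yideal_def
      proof (rule bc_span[OF tgt.yideal_subspace, rotated 2])
        fix y assume "y \<in> {h * ys n x (row mu) * h' | h h' mu. mu \<in> S \<and> h \<in> Hk n x \<and> h' \<in> Hk n x}"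
        then show "bc y \<in> tgt.yideal S"
          by (auto simp: bc_mult Hk_mult src.Y_Hk bc_ys bc(1) intro!: tgt.yideal_gen)
      qed (auto intro!: Hk_mult src.Y_Hk)
      then have "0 = tgt.tr (a * bc (D l u v))" using ann by simp
      also have "\<dots> = (\<Sum>j\<in>?K. b j * tgt.tr (?c j * bc (D l u v)))"
        unfolding b by (simp add: sum_distrib_right tgt.tr_sum tgt.tr_smul)
      also have "\<dots> = (\<Sum>j\<in>?K. if j = k then b j else 0)"
      proof (rule sum.cong)
        fix j assume "j \<in> ?K"
        then obtain l' u' v' where j: "j = (l', u', v')" "l' \<in> Par n" "u' \<in> N l'" "v' \<in> N l'" by auto
        have "tgt.tr (?c j * bc (D l u v)) = \<phi> (src.tr (C l' u' v' * D l u v))"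
          using j luv by (simp add: bc_mult[symmetric] C_Hk D_Hk tr_bc Hk_mult)
        then show "b j * tgt.tr (?c j * bc (D l u v)) = (if j = k then b j else 0)"
          using C_D[OF luv(2-4) j(2-4)] j(1) luv(1) one by auto
      qed simp
      finally show ?thesis using fK k(1) by simp
    qed
    show "a \<in> endo_span ?G"
      unfolding b
    proof (rule endo.span_sum)
      fix k assume k: "k \<in> ?K"
      then obtain l u v where luv: "k = (l, u, v)" "l \<in> Par n" "u \<in> N l" "v \<in> N l" by auto
      show "smul (b k) (?c k) \<in> endo_span ?G"
      proof (cases "l \<in> S")
        case True
        then show ?thesis using b0[OF k] luv(1) by (simp add: endo.span_zero)
      next
        case False
        then have "?c k \<in> ?G" using luv by auto
        then show ?thesis by (intro endo.span_scale endo.span_base)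
      qed
    qed
  }
  assume "a \<in> endo_span ?G"
  moreover have "endo_span ?G \<subseteq> {a. \<forall>y\<in>tgt.yideal S. a * y = 0}"
  proof (rule endo.span_minimal, clarify)
    fix l u v y assume l: "l \<in> Par n" "l \<notin> S" "u \<in> N l" "v \<in> N l" and y: "y \<in> tgt.yideal S"
    have CA: "C l u v \<in> endo_span {C l u v | l u v. l \<in> Par n - S \<and> u \<in> N l \<and> v \<in> N l}"
      using l by (intro endo.span_base) blast
    have CH: "C l u v \<in> Hk n x" using l C_Hk by blast
    \<comment> \<open>The map \<open>bc\<close> need not be surjective, so an arbitrary h is reached
      by linearity from the T_w, which are images of generic elements.\<close>
    have hY: "bc (C l u v) * (h * ys n (\<phi> x) (row mu)) = 0" if h: "h \<in> Hk n (\<phi> x)" and mu: "mu \<in> S" for h mu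
    proof -
      have "Tw n (\<phi> x) ` perms n \<subseteq> {h. bc (C l u v) * (h * ys n (\<phi> x) (row mu)) = 0}"
      proof clarify
        fix w assume w: "w permutes {1..n}"
        have "Tw n x w * ys n x (row mu) * 1 \<in> src.yideal S"
          using mu w by (intro src.yideal_gen Hk_Tw Hk_one)
        then have "C l u v * (Tw n x w * ys n x (row mu)) = 0"
          using A_mult_yideal[OF S CA] by simp
        then have "bc (C l u v * (Tw n x w * ys n x (row mu))) = 0" by (simp add: bc_zero)
        then show "bc (C l u v) * (Tw n (\<phi> x) w * ys n (\<phi> x) (row mu)) = 0"
          using w by (simp add: bc_mult CH Hk_mult Hk_Tw src.Y_Hk bc_Tw bc_ys)
      qed
      moreover have "endo_subspace {h. bc (C l u v) * (h * ys n (\<phi> x) (row mu)) = 0}"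
        by (simp add: endo.subspace_def distrib_left distrib_right)
      ultimately have "Hk n (\<phi> x) \<subseteq> {h. bc (C l u v) * (h * ys n (\<phi> x) (row mu)) = 0}"
        unfolding Hk_span_Tw by (rule endo.span_minimal)
      then show ?thesis using h by blast
    qed
    have "tgt.yideal S \<subseteq> {y. bc (C l u v) * y = 0}"
      unfolding tgt.yideal_def
    proof (rule endo.span_minimal, clarify)
      fix h h' mu assume "h \<in> Hk n (\<phi> x)" "mu \<in> S"
      then have "bc (C l u v) * (h * ys n (\<phi> x) (row mu)) * h' = 0" using hY by simp
      then show "bc (C l u v) * (h * ys n (\<phi> x) (row mu) * h') = 0" by (simp add: mult.assoc)
    qed (simp add: endo.subspace_def distrib_left)
    then show "bc (C l u v) * y = 0" using y by blast
  qed (simp add: endo.subspace_def distrib_right)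
  ultimately show "\<forall>y\<in>tgt.yideal S. a * y = 0" by blast
qed

end

section \<open>Young permutation modules\<close>

context hecke_unit
begin

lemma annihilator_young_permutation_module:
  assumes X: "young_permutation_module n q d X"
  shows "A \<in> annihilator (Hec n q) X \<longleftrightarrow>
    A \<in> carrier (Hec n q) \<and> (\<forall>la\<in>zeta n d. \<forall>h\<in>H. ev q A * (h * Y (row la)) = 0)"
proof (cases "A \<in> carrier (Hec n q)")
  case A: True
  let ?I = "SIGMA la:Par n. {..<d la}"
  let ?S = "direct_sum_module ?I (\<lambda>(la, k). perm_module n q la)"
  have lm: "left_module (Hec n q) X" and iso: "module_iso (Hec n q) X ?S"
    using X unfolding young_permutation_module_def by blast+
  interpret X: left_module "Hec n q" X by (rule lm)
  obtain f where f: "bij_betw f (carrier X) (carrier ?S)"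
    "\<And>x y. x \<in> carrier X \<Longrightarrow> y \<in> carrier X \<Longrightarrow> f (x \<oplus>\<^bsub>X\<^esub> y) = f x \<oplus>\<^bsub>?S\<^esub> f y"
    "\<And>a x. a \<in> carrier (Hec n q) \<Longrightarrow> x \<in> carrier X \<Longrightarrow> f (a \<odot>\<^bsub>X\<^esub> x) = a \<odot>\<^bsub>?S\<^esub> f x"
    using iso unfolding module_iso_def by blast
  have perm_sel: "carrier (perm_module n q la) = (\<lambda>a. a \<otimes>\<^bsub>Hec n q\<^esub> young_sum n q la) ` carrier (Hec n q)"
    "\<zero>\<^bsub>perm_module n q la\<^esub> = \<zero>\<^bsub>Hec n q\<^esub>" "y \<oplus>\<^bsub>perm_module n q la\<^esub> z = y \<oplus>\<^bsub>Hec n q\<^esub> z"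
    "y \<odot>\<^bsub>perm_module n q la\<^esub> z = y \<otimes>\<^bsub>Hec n q\<^esub> z" for la y z
    by (simp_all add: perm_module_def left_ideal_module_def mk_module_def)
  have S_car: "carrier ?S = {g \<in> (\<Pi>\<^sub>E i\<in>?I. carrier (perm_module n q (fst i))). finite {i \<in> ?I. g i \<noteq> \<zero>\<^bsub>Hec n q\<^esub>}}"
    by (simp add: direct_sum_module_def mk_module_def split_def perm_sel)
  have S_zero: "\<zero>\<^bsub>?S\<^esub> = (\<lambda>i\<in>?I. \<zero>\<^bsub>Hec n q\<^esub>)"
    by (simp add: direct_sum_module_def mk_module_def split_def perm_sel)
  have S_add: "g \<oplus>\<^bsub>?S\<^esub> g' = (\<lambda>i\<in>?I. g i \<oplus>\<^bsub>Hec n q\<^esub> g' i)" for g g'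
    by (simp add: direct_sum_module_def mk_module_def split_def perm_sel)
  have S_smult: "b \<odot>\<^bsub>?S\<^esub> g = (\<lambda>i\<in>?I. b \<otimes>\<^bsub>Hec n q\<^esub> g i)" for b g
    by (simp add: direct_sum_module_def mk_module_def split_def perm_sel)
  have perm_car: "carrier (perm_module n q la) \<subseteq> carrier (Hec n q)" if "la \<in> Par n" for la
    using young_sum_carrier[OF that] Hec_closed(1) by (auto simp: perm_sel)
  \<comment> \<open>An isomorphism is assumed to respect sums and scalars only; that zero goes to
    zero follows in each component from g = g + g.\<close>
  have fz: "f \<zero>\<^bsub>X\<^esub> = \<zero>\<^bsub>?S\<^esub>"
  proof -
    let ?g = "f \<zero>\<^bsub>X\<^esub>"
    have g: "?g \<in> carrier ?S" using f(1) by (auto simp: bij_betw_def)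
    have "?g = ?g \<oplus>\<^bsub>?S\<^esub> ?g" using f(2)[of "\<zero>\<^bsub>X\<^esub>" "\<zero>\<^bsub>X\<^esub>"] by simp
    then have gg: "?g = (\<lambda>i\<in>?I. ?g i \<oplus>\<^bsub>Hec n q\<^esub> ?g i)" unfolding S_add .
    have "?g i = \<zero>\<^bsub>Hec n q\<^esub>" if i: "i \<in> ?I" for i
    proof -
      have c: "?g i \<in> carrier (Hec n q)" using g i perm_car unfolding S_car by fastforce
      have "?g i = ?g i \<oplus>\<^bsub>Hec n q\<^esub> ?g i" using fun_cong[OF gg, of i] i by (simp only: restrict_apply')
      from arg_cong[OF this, of "ev q"] show ?thesis
        using c by (intro ev_inj[of _ n q]) (simp_all add: ev_simps)
    qed
    moreover have "?g \<in> extensional ?I" using g unfolding S_car by (simp add: PiE_def)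
    ultimately show ?thesis
      unfolding S_zero by (intro extensionalityI[OF _ restrict_extensional]) simp_all
  qed
  have X_ann: "(\<forall>x\<in>carrier X. A \<odot>\<^bsub>X\<^esub> x = \<zero>\<^bsub>X\<^esub>) \<longleftrightarrow> (\<forall>g\<in>carrier ?S. A \<odot>\<^bsub>?S\<^esub> g = \<zero>\<^bsub>?S\<^esub>)"
  proof
    assume X0: "\<forall>x\<in>carrier X. A \<odot>\<^bsub>X\<^esub> x = \<zero>\<^bsub>X\<^esub>"
    show "\<forall>g\<in>carrier ?S. A \<odot>\<^bsub>?S\<^esub> g = \<zero>\<^bsub>?S\<^esub>"
    proof
      fix g assume "g \<in> carrier ?S"
      then obtain x where "x \<in> carrier X" "g = f x" using f(1) by (auto simp: bij_betw_def)
      then show "A \<odot>\<^bsub>?S\<^esub> g = \<zero>\<^bsub>?S\<^esub>" using f(3)[OF A, of x] X0 fz by simp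
    qed
  next
    assume S0: "\<forall>g\<in>carrier ?S. A \<odot>\<^bsub>?S\<^esub> g = \<zero>\<^bsub>?S\<^esub>"
    show "\<forall>x\<in>carrier X. A \<odot>\<^bsub>X\<^esub> x = \<zero>\<^bsub>X\<^esub>"
    proof
      fix x assume x: "x \<in> carrier X"
      then have "f x \<in> carrier ?S" using f(1) by (auto simp: bij_betw_def)
      then have "f (A \<odot>\<^bsub>X\<^esub> x) = f \<zero>\<^bsub>X\<^esub>" using f(3)[OF A x] S0 fz by simp
      then show "A \<odot>\<^bsub>X\<^esub> x = \<zero>\<^bsub>X\<^esub>"
        using X.smult_closed[OF A x] by (intro inj_onD[OF bij_betw_imp_inj_on[OF f(1)]]) simp_all
    qed
  qed
  also have "\<dots> \<longleftrightarrow> (\<forall>la\<in>zeta n d. \<forall>h\<in>H. ev q A * (h * Y (row la)) = 0)"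
  proof
    assume S0: "\<forall>g\<in>carrier ?S. A \<odot>\<^bsub>?S\<^esub> g = \<zero>\<^bsub>?S\<^esub>"
    show "\<forall>la\<in>zeta n d. \<forall>h\<in>H. ev q A * (h * Y (row la)) = 0"
    proof (intro ballI)
      fix la h assume la: "la \<in> zeta n d" and h: "h \<in> H"
      then have laP: "la \<in> Par n" and i: "(la, 0) \<in> ?I" by (auto simp: zeta_def)
      let ?m = "unev n q h \<otimes>\<^bsub>Hec n q\<^esub> young_sum n q la"
      \<comment> \<open>A vector supported in the copy number 0 of M(\<lambda>), which exists
        because the multiplicity is not zero.\<close>
      let ?g = "\<lambda>i\<in>?I. if i = (la, 0) then ?m else \<zero>\<^bsub>Hec n q\<^esub>"
      have z: "\<zero>\<^bsub>Hec n q\<^esub> \<in> carrier (perm_module n q mu)" if "mu \<in> Par n" for mu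
        unfolding perm_sel
        by (rule image_eqI[of _ _ "\<zero>\<^bsub>Hec n q\<^esub>"], rule ev_inj[of _ n q])
          (simp_all add: ev_simps young_sum_carrier that)
      have "?m \<in> carrier (perm_module n q la)" unfolding perm_sel using unev(1)[OF h] by blast
      moreover have "finite {i \<in> ?I. ?g i \<noteq> \<zero>\<^bsub>Hec n q\<^esub>}"
        by (rule finite_subset[of _ "{(la, 0)}"]) (auto split: if_splits)
      ultimately have "?g \<in> carrier ?S" unfolding S_car using z by auto
      then have "A \<odot>\<^bsub>?S\<^esub> ?g = \<zero>\<^bsub>?S\<^esub>" using S0 by blast
      then have "A \<otimes>\<^bsub>Hec n q\<^esub> ?g (la, 0) = \<zero>\<^bsub>Hec n q\<^esub>"
        using fun_cong[of "A \<odot>\<^bsub>?S\<^esub> ?g" "\<zero>\<^bsub>?S\<^esub>" "(la, 0)"] i unfolding S_smult S_zero restrict_apply'[OF i] by simp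
      then have "ev q (A \<otimes>\<^bsub>Hec n q\<^esub> ?m) = 0" using i by (simp add: ev_zero)
      then show "ev q A * (h * Y (row la)) = 0"
        using A unev[OF h] young_sum_carrier[OF laP, of q] ev_young_sum[OF laP, of q] by (simp add: ev_mult Hec_closed)
    qed
  next
    assume Y0: "\<forall>la\<in>zeta n d. \<forall>h\<in>H. ev q A * (h * Y (row la)) = 0"
    show "\<forall>g\<in>carrier ?S. A \<odot>\<^bsub>?S\<^esub> g = \<zero>\<^bsub>?S\<^esub>"
    proof
      fix g assume g: "g \<in> carrier ?S"
      have "A \<otimes>\<^bsub>Hec n q\<^esub> g i = \<zero>\<^bsub>Hec n q\<^esub>" if i: "i \<in> ?I" for i
      proof -
        have la: "fst i \<in> zeta n d" "fst i \<in> Par n" using i by (auto simp: zeta_def)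
        have "g i \<in> carrier (perm_module n q (fst i))" using g i unfolding S_car by auto
        then obtain b where b: "b \<in> carrier (Hec n q)" "g i = b \<otimes>\<^bsub>Hec n q\<^esub> young_sum n q (fst i)"
          unfolding perm_sel by blast
        have "ev q A * (ev q b * Y (row (fst i))) = 0" using Y0 la(1) ev_Hk[OF b(1)] by blast
        then show ?thesis
          using A b young_sum_carrier[OF la(2), of q] ev_young_sum[OF la(2), of q]
          by (intro ev_inj[of _ n q]) (simp_all add: ev_simps)
      qed
      then show "A \<odot>\<^bsub>?S\<^esub> g = \<zero>\<^bsub>?S\<^esub>" unfolding S_smult S_zero by (intro restrict_ext)
    qed
  qed
  finally show ?thesis using A by (simp add: annihilator_def)
qed (simp add: annihilator_def)

end

theorem proposition8p8:
  fixes n :: nat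
    and q :: "'r::comm_ring_1"
    and N :: "nat list \<Rightarrow> 'i set"
    and C :: "nat list \<Rightarrow> 'i \<Rightarrow> 'i \<Rightarrow> 'r hecke"
    and st :: "'r hecke \<Rightarrow> 'r hecke"
    and X :: "('r hecke, 'm) module"
    and d :: "nat list \<Rightarrow> nat"
    and \<sigma> \<tau> :: "nat list set"
  assumes "q dvd 1"
    and "regular_cell_datum n q N C st"
    and "young_permutation_module n q d X"
    and "\<sigma> = zeta n d"
    and "\<tau> = Par n - coarsenings n \<sigma>"
    and "co_saturated n (coarsenings n \<sigma>)"
  shows "annihilator (Hec n q) X = cell_span (Hec n q) N C \<tau>"
proof -
  obtain C' st' where gen: "regular_cell_datum_generic n N C' st'"
    and C: "\<And>la u v. la \<in> Par n \<Longrightarrow> u \<in> N la \<Longrightarrow> v \<in> N la \<Longrightarrow> C la u v = hecke_map n q (laurent_eval q) (C' la u v)"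
    using assms(2) unfolding regular_cell_datum_def by blast
  interpret hecke_unit n q by unfold_locales (rule assms(1))
  interpret hom: coeff_hom "laurent_eval q" by (rule laurent_eval_hom[OF assms(1)])
  interpret b: base_change n laurent_x "laurent_eval q" by unfold_locales (rule laurent_x_unit)
  \<comment> \<open>Identifies the parameter of the base-changed algebra with \<open>q\<close>, so
    that facts from both interpretations combine.\<close>
  note ex = laurent_eval_x[of q]
  have cd: "cell_datum (Hec n laurent_x) (Par n) dominated_by N C' st'"
    and iso: "\<And>la. la \<in> Par n \<Longrightarrow> module_iso (Hec n laurent_x)
        (cell_module (Hec n laurent_x) (Par n) dominated_by N C' la) (specht_module n laurent_x la)"
    using gen unfolding regular_cell_datum_generic_def by blast+
  have "is_basis (Hec n laurent_x) ((\<lambda>(l, u, v). C' l u v) ` (SIGMA l:Par n. N l \<times> N l))"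
    using cd unfolding cell_datum_def by blast
  then have carK: "(\<lambda>(l, u, v). C' l u v) ` (SIGMA l:Par n. N l \<times> N l) \<subseteq> carrier (Hec n laurent_x)"
    unfolding is_basis_def by (rule conjunct1)
  have C': "C' l u v \<in> carrier (Hec n laurent_x)" if "l \<in> Par n" "u \<in> N l" "v \<in> N l" for l u v
    by (rule subsetD[OF carK], rule image_eqI[of _ _ "(l, u, v)"]) (use that in auto)
  have Cev: "C l u v \<in> carrier (Hec n q)" "ev q (C l u v) = b.bc (ev laurent_x (C' l u v))"
    if "l \<in> Par n" "u \<in> N l" "v \<in> N l" for l u v
    using b.hecke_map_ev[OF C'[OF that]] C[OF that] by (simp_all add: ex)
  obtain D where cells: "hecke_cells n laurent_x N (\<lambda>l u v. ev laurent_x (C' l u v))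
      (\<lambda>a. ev laurent_x (st' (unev n laurent_x a))) D"
    using b.src.hecke_cells_of_datum[OF cd iso laurent_star_pos[where n = n]] by blast
  let ?S = "coarsenings n \<sigma>"
  have up: "b.src.upclosed ?S" using assms(6) by (rule b.src.upclosed_coarsenings)
  have \<sigma>: "\<sigma> \<subseteq> Par n" using assms(4) by (auto simp: zeta_def)
  have "A \<in> annihilator (Hec n q) X \<longleftrightarrow> A \<in> cell_span (Hec n q) N C \<tau>" for A
  proof -
    have "A \<in> annihilator (Hec n q) X \<longleftrightarrow> A \<in> carrier (Hec n q) \<and> (\<forall>y\<in>yideal ?S. ev q A * y = 0)"
      unfolding annihilator_young_permutation_module[OF assms(3)] assms(4)[symmetric]
        annihilates_coarsenings[OF \<sigma>] ..
    also have "\<dots> \<longleftrightarrow> A \<in> carrier (Hec n q) \<and> ev q A \<in> endo_span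
        {b.bc (ev laurent_x (C' l u v)) | l u v. l \<in> Par n - ?S \<and> u \<in> N l \<and> v \<in> N l}"
      using b.cell_annihilator[OF cells up, of "ev q A"] ev_Hk[of A n q] by (auto simp: ex)
    also have "{b.bc (ev laurent_x (C' l u v)) | l u v. l \<in> Par n - ?S \<and> u \<in> N l \<and> v \<in> N l}
        = {ev q (C l u v) | l u v. l \<in> \<tau> \<and> u \<in> N l \<and> v \<in> N l}"
      unfolding assms(5) using Cev(2) by (metis (lifting) Diff_iff)
    also have "A \<in> carrier (Hec n q) \<and> ev q A \<in> endo_span \<dots> \<longleftrightarrow> A \<in> cell_span (Hec n q) N C \<tau>"
      by (rule mem_cell_span[symmetric]) (use Cev(1) assms(5) in auto)
    finally show ?thesis .
  qed
  then show ?thesis by (rule Set.set_eqI)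
qed

end
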